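(* Let $S$ be a non-abelian simple group with $p$ dividing $|S|$ that satisfies the inductive Galois--McKay condition for $p$, and let $X$, $R$, $\Gamma=\mathrm{Aut}(X)_R$, $N$ and $\Omega$ be as in that condition. Let $n$ be a positive integer. Then the map $\tilde\Omega:\mathrm{Irr}_{p'}(X^n)\to\mathrm{Irr}_{p'}(N^n)$ given by $\tilde\Omega(\theta_1\times\cdots\times\theta_n)=\Omega(\theta_1)\times\cdots\times\Omega(\theta_n)$ is a bijection. Writing $\tilde\Gamma=\Gamma\wr\mathsf S_n$, $\tilde\Omega$ is $\tilde\Gamma\times\mathcal H$-equivariant, and for every $\tilde\theta\in\mathrm{Irr}_{p'}(X^n)$, $$(X^n\rtimes\tilde\Gamma_{\tilde\theta^{\mathcal H}},X^n,\tilde\theta)_{\mathcal H}\ge_c(N^n\rtimes\tilde\Gamma_{\tilde\theta^{\mathcal H}},N^n,\tilde\Omega(\tilde\theta))_{\mathcal H}.$$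
   Context: All groups are finite; $p$ is a fixed prime. $\mathrm{Irr}_{p'}(Y)$ denotes irreducible characters of $p'$-degree. $\mathbb Q^{\mathrm{ab}}\subseteq\mathbb C$ is generated by all roots of unity, $\mathcal G=\mathrm{Gal}(\mathbb Q^{\mathrm{ab}}/\mathbb Q)$, $\mathcal H\le\mathcal G$ consists of those $\sigma$ for which there is an integer $f$ with $\sigma(\xi)=\xi^{p^f}$ for all roots of unity $\xi$ of order prime to $p$. For $N\trianglelefteq G$, $\theta\in\mathrm{Irr}(N)$, $g\in G$, $\sigma\in\mathcal G$: $\theta^{g\sigma}(n)=\sigma(\theta(gng^{-1}))$; $A_\theta$ the stabilizer in $A\le G\times\mathcal G$; $\theta^{\mathcal H}$ the $\mathcal H$-orbit; $G_{\theta^{\mathcal H}}=\{g:\theta^g\in\theta^{\mathcal H}\}$ (similarly for a group of automorphisms). $(G,N,\theta)_{\mathcal H}$ is an $\mathcal H$-triple if $N\trianglelefteq G$, $\theta\in\mathrm{Irr}(N)$, $G_{\theta^{\mathcal H}}=G$. $\mathsf S_n$ permutes the factors of $X^n$ and $\Gamma\wr\mathsf S_n=\Gamma^n\rtimes\mathsf S_n$ acts on $X^n$ (it equals $\mathrm{Aut}(X^n)_{R^n}$). Projective representation $\mathcal P$ with factor set $\alpha$: $\mathcal P(x)\mathcal P(y)=\alpha(x,y)\mathcal P(xy)$. For $G$-invariant $\theta$, $\mathcal P$ is associated with $\theta$ if $\mathcal P_N$ affords $\theta$ and $\mathcal P(ng)=\mathcal P(n)\mathcal P(g)$, $\mathcal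 P(gn)=\mathcal P(g)\mathcal P(n)$. $\mathcal Q\sim\mu\mathcal P$ means $\mathcal Q(x)=\mu(x)M^{-1}\mathcal P(x)M$ for fixed invertible $M$. For $\mathcal P$ associated with $\theta$ on $G_\theta$ with entries in $\mathbb Q^{\mathrm{ab}}$ and $\theta^{x\sigma}=\theta$: $\mathcal P^{x\sigma}(y)=\sigma(\mathcal P(xyx^{-1}))$, and $\mu_{x\sigma}$ is the unique function $G_\theta\to\mathbb C^\times$, constant on $N$-cosets, $\mu_{x\sigma}(1)=1$, with $\mathcal P^{x\sigma}\sim\mu_{x\sigma}\mathcal P$. $(G,N,\theta)_{\mathcal H}\ge_c(H,M,\varphi)_{\mathcal H}$ (both $\mathcal H$-triples, $H\le G$) means: (i) $G=NH$, $N\cap H=M$, $\mathbf C_G(N)\subseteq H$; (ii) $(H\times\mathcal H)_\theta=(H\times\mathcal H)_\varphi$; (iii) there are projective representations $\mathcal P$ of $G_\theta$ associated with $\theta$ and $\mathcal P'$ of $H_\varphi$ associated with $\varphi$, entries in $\mathbb Q^{\mathrm{ab}}$, factor sets with root-of-unity values agreeing on $H_\theta\times H_\theta$, and $\mathcal P(c),\mathcal P'(c)$ the same scalar for all $c\in\mathbf C_G(N)$; (iv) $\mu_a=\mu'_a$ on $H_\theta$ for all $a\in(H\times\mathcal H)_\theta$. Inductive Galois--McKay condition for $S$ (non-abelian simple, $p\mid|S|$): with $X$ a universal covering group of $S$, $R\in\mathrm{Syl}_p(X)$, $\Gamma=\mathrm{Aut}(X)_R$, there exist a $\Gamma$-stable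 proper subgroup $N<X$ with $\mathbf N_X(R)\subseteq N$ and a $\Gamma\times\mathcal H$-equivariant bijection $\Omega:\mathrm{Irr}_{p'}(X)\to\mathrm{Irr}_{p'}(N)$ such that $(X\rtimes\Gamma_{\theta^{\mathcal H}},X,\theta)_{\mathcal H}\ge_c(N\rtimes\Gamma_{\theta^{\mathcal H}},N,\Omega(\theta))_{\mathcal H}$ for every $\theta\in\mathrm{Irr}_{p'}(X)$. *)

theory Defs
  imports "HOL-Algebra.Algebra" "HOL-Number_Theory.Number_Theory" "Jordan_Normal_Form.Matrix"
begin

definition grp_center :: "('a, 'b) monoid_scheme \<Rightarrow> 'a set" where
  "grp_center G = {z \<in> carrier G. \<forall>g \<in> carrier G. z \<otimes>\<^bsub>G\<^esub> g = g \<otimes>\<^bsub>G\<^esub> z}"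

definition centralizer_of :: "('a, 'b) monoid_scheme \<Rightarrow> 'a set \<Rightarrow> 'a set" where
  "centralizer_of G N = {g \<in> carrier G. \<forall>n \<in> N. g \<otimes>\<^bsub>G\<^esub> n = n \<otimes>\<^bsub>G\<^esub> g}"

definition central_ext :: "('e, 'c) monoid_scheme \<Rightarrow> ('s, 'd) monoid_scheme \<Rightarrow> ('e \<Rightarrow> 's) \<Rightarrow> bool" where
  "central_ext E S \<pi> \<longleftrightarrow> group E \<and> \<pi> \<in> hom E S \<and> \<pi> ` carrier E = carrier S
      \<and> kernel E S \<pi> \<subseteq> grp_center E"

text \<open>Universal covering group (universal central extension) of a finite perfect group S:
  a perfect central extension mapping (compatibly) into every central extension of S.
  It suffices to test finite central extensions (whose carriers may be taken inside nat).\<close>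
definition universal_cover :: "('a, 'c) monoid_scheme \<Rightarrow> ('s, 'd) monoid_scheme \<Rightarrow> bool" where
  "universal_cover Xc S \<longleftrightarrow> (\<exists>\<pi>. central_ext Xc S \<pi> \<and> derived Xc (carrier Xc) = carrier Xc \<and>
     (\<forall>(Y :: nat monoid) \<pi>'. finite (carrier Y) \<and> central_ext Y S \<pi>' \<longrightarrow>
        (\<exists>\<psi> \<in> hom Xc Y. \<forall>x \<in> carrier Xc. \<pi>' (\<psi> x) = \<pi> x)))"

definition sylow_p :: "nat \<Rightarrow> ('a, 'c) monoid_scheme \<Rightarrow> 'a set \<Rightarrow> bool" where
  "sylow_p p Xc R \<longleftrightarrow> subgroup R Xc \<and> card R = p ^ multiplicity p (order Xc)"

definition Aut_stab :: "('a, 'c) monoid_scheme \<Rightarrow> 'a set \<Rightarrow> ('a \<Rightarrow> 'a) set" where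
  "Aut_stab Xc R = {f. f \<in> iso Xc Xc \<and> f ` R = R \<and> (\<forall>x. x \<notin> carrier Xc \<longrightarrow> f x = x)}"

definition sdp :: "('a, 'c) monoid_scheme \<Rightarrow> ('a \<Rightarrow> 'a) set \<Rightarrow> ('a \<times> ('a \<Rightarrow> 'a)) monoid" where
  "sdp K A = \<lparr>carrier = carrier K \<times> A,
     monoid.mult = (\<lambda>(k, a) (k', a'). (k \<otimes>\<^bsub>K\<^esub> a k', a \<circ> a')),
     one = (\<one>\<^bsub>K\<^esub>, id)\<rparr>"

definition dpow :: "('a, 'c) monoid_scheme \<Rightarrow> nat \<Rightarrow> (nat \<Rightarrow> 'a) monoid" where
  "dpow Xc n = product_group {..<n} (\<lambda>_. Xc)"

definition wreath_aut :: "('a, 'c) monoid_scheme \<Rightarrow> ('a \<Rightarrow> 'a) set \<Rightarrow> nat \<Rightarrow> ((nat \<Rightarrow> 'a) \<Rightarrow> (nat \<Rightarrow> 'a)) set" where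
  "wreath_aut Xc \<Gamma> n = {(\<lambda>v. if v \<in> carrier (dpow Xc n)
        then (\<lambda>i. if i < n then \<gamma> i (v (\<pi> i)) else undefined) else v) | \<gamma> \<pi>.
      (\<forall>i<n. \<gamma> i \<in> \<Gamma>) \<and> \<pi> permutes {..<n}}"

definition mat_trace :: "complex mat \<Rightarrow> complex" where
  "mat_trace A = (\<Sum>i<dim_row A. A $$ (i, i))"

definition is_rep :: "('a, 'c) monoid_scheme \<Rightarrow> nat \<Rightarrow> ('a \<Rightarrow> complex mat) \<Rightarrow> bool" where
  "is_rep G d \<rho> \<longleftrightarrow> (\<forall>g \<in> carrier G. \<rho> g \<in> carrier_mat d d) \<and>
     (\<forall>g \<in> carrier G. \<forall>h \<in> carrier G. \<rho> (g \<otimes>\<^bsub>G\<^esub> h) = \<rho> g * \<rho> h) \<and> \<rho> \<one>\<^bsub>G\<^esub> = 1\<^sub>m d"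

text \<open>Irreducible: nonzero degree and no proper nonzero invariant subspace (spanned by the
  first k columns of an invertible matrix P).\<close>
definition irred_rep :: "('a, 'c) monoid_scheme \<Rightarrow> nat \<Rightarrow> ('a \<Rightarrow> complex mat) \<Rightarrow> bool" where
  "irred_rep G d \<rho> \<longleftrightarrow> is_rep G d \<rho> \<and> 0 < d \<and>
     \<not> (\<exists>k P Pi. 0 < k \<and> k < d \<and> P \<in> carrier_mat d d \<and> Pi \<in> carrier_mat d d \<and>
          P * Pi = 1\<^sub>m d \<and> Pi * P = 1\<^sub>m d \<and>
          (\<forall>g \<in> carrier G. \<forall>i j. k \<le> i \<and> i < d \<and> j < k \<longrightarrow> (Pi * \<rho> g * P) $$ (i, j) = 0))"

definition Irr :: "('a, 'c) monoid_scheme \<Rightarrow> ('a \<Rightarrow> complex) set" where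
  "Irr G = {\<chi>. \<exists>d \<rho>. irred_rep G d \<rho> \<and>
       (\<forall>g. \<chi> g = (if g \<in> carrier G then mat_trace (\<rho> g) else 0))}"

definition Irr_p' :: "nat \<Rightarrow> ('a, 'c) monoid_scheme \<Rightarrow> ('a \<Rightarrow> complex) set" where
  "Irr_p' p G = {\<chi> \<in> Irr G. \<not> (\<exists>k::nat. \<chi> \<one>\<^bsub>G\<^esub> = of_nat (p * k))}"

definition root_of_unity :: "complex \<Rightarrow> bool" where
  "root_of_unity z \<longleftrightarrow> (\<exists>m::nat. 0 < m \<and> z ^ m = 1)"

inductive_set Qab :: "complex set" where
  root: "root_of_unity z \<Longrightarrow> z \<in> Qab"
| add: "x \<in> Qab \<Longrightarrow> y \<in> Qab \<Longrightarrow> x + y \<in> Qab"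
| neg: "x \<in> Qab \<Longrightarrow> - x \<in> Qab"
| mul: "x \<in> Qab \<Longrightarrow> y \<in> Qab \<Longrightarrow> x * y \<in> Qab"
| inv: "x \<in> Qab \<Longrightarrow> x \<noteq> 0 \<Longrightarrow> inverse x \<in> Qab"

definition galois_ab :: "(complex \<Rightarrow> complex) \<Rightarrow> bool" where
  "galois_ab \<sigma> \<longleftrightarrow> bij_betw \<sigma> Qab Qab \<and>
     (\<forall>x \<in> Qab. \<forall>y \<in> Qab. \<sigma> (x + y) = \<sigma> x + \<sigma> y \<and> \<sigma> (x * y) = \<sigma> x * \<sigma> y) \<and>
     (\<forall>z. z \<notin> Qab \<longrightarrow> \<sigma> z = z)"

text \<open>\<open>\<H>\<close>: there is an integer f with \<open>\<sigma>(\<xi>) = \<xi>^{p^f}\<close> for all roots of unity \<open>\<xi>\<close> of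
  order prime to p (for negative f, \<open>p^f\<close> is read modulo the order of \<open>\<xi>\<close>).\<close>
definition Hgal :: "nat \<Rightarrow> (complex \<Rightarrow> complex) \<Rightarrow> bool" where
  "Hgal p \<sigma> \<longleftrightarrow> galois_ab \<sigma> \<and> (\<exists>f::int. \<forall>\<xi> (m::nat) (k::nat).
      0 < m \<and> coprime m p \<and> \<xi> ^ m = 1 \<and> [k * p ^ nat (- f) = p ^ nat f] (mod m) \<longrightarrow> \<sigma> \<xi> = \<xi> ^ k)"

definition char_act :: "('a, 'c) monoid_scheme \<Rightarrow> 'a set \<Rightarrow> ('a \<Rightarrow> complex) \<Rightarrow> 'a \<Rightarrow> (complex \<Rightarrow> complex) \<Rightarrow> ('a \<Rightarrow> complex)" where
  "char_act G N \<theta> g \<sigma> = (\<lambda>n. if n \<in> N then \<sigma> (\<theta> (g \<otimes>\<^bsub>G\<^esub> n \<otimes>\<^bsub>G\<^esub> inv\<^bsub>G\<^esub> g)) else 0)"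

definition H_orbit :: "nat \<Rightarrow> 'a set \<Rightarrow> ('a \<Rightarrow> complex) \<Rightarrow> ('a \<Rightarrow> complex) set" where
  "H_orbit p N \<theta> = {(\<lambda>n. if n \<in> N then \<sigma> (\<theta> n) else 0) | \<sigma>. Hgal p \<sigma>}"

definition stab :: "('a, 'c) monoid_scheme \<Rightarrow> 'a set \<Rightarrow> ('a \<Rightarrow> complex) \<Rightarrow> 'a set \<Rightarrow> 'a set" where
  "stab G N \<theta> K = {g \<in> K. char_act G N \<theta> g id = \<theta>}"

definition stabH :: "nat \<Rightarrow> ('a, 'c) monoid_scheme \<Rightarrow> 'a set \<Rightarrow> ('a \<Rightarrow> complex) \<Rightarrow> 'a set \<Rightarrow> ('a \<times> (complex \<Rightarrow> complex)) set" where
  "stabH p G N \<theta> K = {(h, \<sigma>). h \<in> K \<and> Hgal p \<sigma> \<and> char_act G N \<theta> h \<sigma> = \<theta>}"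

definition H_triple :: "nat \<Rightarrow> ('a, 'c) monoid_scheme \<Rightarrow> 'a set \<Rightarrow> ('a \<Rightarrow> complex) \<Rightarrow> bool" where
  "H_triple p G N \<theta> \<longleftrightarrow> group G \<and> N \<lhd> G \<and> \<theta> \<in> Irr (G\<lparr>carrier := N\<rparr>) \<and>
     {g \<in> carrier G. char_act G N \<theta> g id \<in> H_orbit p N \<theta>} = carrier G"

definition proj_rep :: "('a, 'c) monoid_scheme \<Rightarrow> 'a set \<Rightarrow> nat \<Rightarrow> ('a \<Rightarrow> complex mat) \<Rightarrow> ('a \<Rightarrow> 'a \<Rightarrow> complex) \<Rightarrow> bool" where
  "proj_rep G K d P \<alpha> \<longleftrightarrow> (\<forall>x \<in> K. P x \<in> carrier_mat d d \<and> invertible_mat (P x)) \<and>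
     (\<forall>x \<in> K. \<forall>y \<in> K. P x * P y = \<alpha> x y \<cdot>\<^sub>m P (x \<otimes>\<^bsub>G\<^esub> y))"

definition assoc_with :: "('a, 'c) monoid_scheme \<Rightarrow> 'a set \<Rightarrow> ('a \<Rightarrow> complex) \<Rightarrow> 'a set \<Rightarrow> ('a \<Rightarrow> complex mat) \<Rightarrow> bool" where
  "assoc_with G N \<theta> K P \<longleftrightarrow>
     (\<forall>n \<in> N. \<forall>m \<in> N. P (n \<otimes>\<^bsub>G\<^esub> m) = P n * P m) \<and> (\<forall>n \<in> N. mat_trace (P n) = \<theta> n) \<and>
     (\<forall>n \<in> N. \<forall>g \<in> K. P (n \<otimes>\<^bsub>G\<^esub> g) = P n * P g \<and> P (g \<otimes>\<^bsub>G\<^esub> n) = P g * P n)"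

definition entries_Qab :: "'a set \<Rightarrow> nat \<Rightarrow> ('a \<Rightarrow> complex mat) \<Rightarrow> bool" where
  "entries_Qab K d P \<longleftrightarrow> (\<forall>x \<in> K. \<forall>i<d. \<forall>j<d. P x $$ (i, j) \<in> Qab)"

definition proj_twist :: "('a, 'c) monoid_scheme \<Rightarrow> ('a \<Rightarrow> complex mat) \<Rightarrow> 'a \<Rightarrow> (complex \<Rightarrow> complex) \<Rightarrow> ('a \<Rightarrow> complex mat)" where
  "proj_twist G P x \<sigma> = (\<lambda>y. map_mat \<sigma> (P (x \<otimes>\<^bsub>G\<^esub> y \<otimes>\<^bsub>G\<^esub> inv\<^bsub>G\<^esub> x)))"

definition sim_scaled :: "'a set \<Rightarrow> nat \<Rightarrow> ('a \<Rightarrow> complex mat) \<Rightarrow> ('a \<Rightarrow> complex) \<Rightarrow> ('a \<Rightarrow> complex mat) \<Rightarrow> bool" where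
  "sim_scaled K d Q \<mu> P \<longleftrightarrow> (\<exists>M Mi. M \<in> carrier_mat d d \<and> Mi \<in> carrier_mat d d \<and>
     M * Mi = 1\<^sub>m d \<and> Mi * M = 1\<^sub>m d \<and> (\<forall>y \<in> K. Q y = \<mu> y \<cdot>\<^sub>m (Mi * P y * M)))"

definition is_mu :: "('a, 'c) monoid_scheme \<Rightarrow> 'a set \<Rightarrow> 'a set \<Rightarrow> nat \<Rightarrow> ('a \<Rightarrow> complex mat) \<Rightarrow> 'a \<Rightarrow> (complex \<Rightarrow> complex) \<Rightarrow> ('a \<Rightarrow> complex) \<Rightarrow> bool" where
  "is_mu G N K d P x \<sigma> \<mu> \<longleftrightarrow> (\<forall>y \<in> K. \<mu> y \<noteq> 0) \<and> (\<forall>n \<in> N. \<forall>y \<in> K. \<mu> (n \<otimes>\<^bsub>G\<^esub> y) = \<mu> y) \<and>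
     \<mu> \<one>\<^bsub>G\<^esub> = 1 \<and> sim_scaled K d (proj_twist G P x \<sigma>) \<mu> P"

definition central_ge :: "nat \<Rightarrow> ('a, 'c) monoid_scheme \<Rightarrow> 'a set \<Rightarrow> ('a \<Rightarrow> complex)
    \<Rightarrow> 'a set \<Rightarrow> 'a set \<Rightarrow> ('a \<Rightarrow> complex) \<Rightarrow> bool" where
  "central_ge p G N \<theta> H M \<phi> \<longleftrightarrow>
     H_triple p G N \<theta> \<and> subgroup H G \<and> H_triple p (G\<lparr>carrier := H\<rparr>) M \<phi> \<and>
     carrier G = N <#>\<^bsub>G\<^esub> H \<and> N \<inter> H = M \<and> centralizer_of G N \<subseteq> H \<and>
     stabH p G N \<theta> H = stabH p G M \<phi> H \<and>
     (let G\<theta> = stab G N \<theta> (carrier G); H\<phi> = stab G M \<phi> H; H\<theta> = stab G N \<theta> H in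
      \<exists>d P \<alpha> d' P' \<alpha>'.
        proj_rep G G\<theta> d P \<alpha> \<and> assoc_with G N \<theta> G\<theta> P \<and> entries_Qab G\<theta> d P \<and>
        proj_rep G H\<phi> d' P' \<alpha>' \<and> assoc_with G M \<phi> H\<phi> P' \<and> entries_Qab H\<phi> d' P' \<and>
        (\<forall>x \<in> G\<theta>. \<forall>y \<in> G\<theta>. root_of_unity (\<alpha> x y)) \<and>
        (\<forall>x \<in> H\<phi>. \<forall>y \<in> H\<phi>. root_of_unity (\<alpha>' x y)) \<and>
        (\<forall>x \<in> H\<theta>. \<forall>y \<in> H\<theta>. \<alpha> x y = \<alpha>' x y) \<and>
        (\<forall>c \<in> centralizer_of G N. \<exists>lam. P c = lam \<cdot>\<^sub>m 1\<^sub>m d \<and> P' c = lam \<cdot>\<^sub>m 1\<^sub>m d') \<and>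
        (\<forall>x \<sigma> \<mu> \<mu>'. (x, \<sigma>) \<in> stabH p G N \<theta> H \<and>
             is_mu G N G\<theta> d P x \<sigma> \<mu> \<and> is_mu G M H\<phi> d' P' x \<sigma> \<mu>' \<longrightarrow>
             (\<forall>h \<in> H\<theta>. \<mu> h = \<mu>' h)))"

text \<open>\<open>\<theta>^{\<gamma>\<sigma>}\<close> for an automorphism \<gamma> (= conjugation by \<gamma> in \<open>K \<rtimes> A\<close>).\<close>
definition aut_twist :: "'a set \<Rightarrow> ('a \<Rightarrow> complex) \<Rightarrow> ('a \<Rightarrow> 'a) \<Rightarrow> (complex \<Rightarrow> complex) \<Rightarrow> ('a \<Rightarrow> complex)" where
  "aut_twist K \<theta> \<gamma> \<sigma> = (\<lambda>x. if x \<in> K then \<sigma> (\<theta> (\<gamma> x)) else 0)"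

definition aut_stab_orbit :: "nat \<Rightarrow> 'a set \<Rightarrow> ('a \<Rightarrow> 'a) set \<Rightarrow> ('a \<Rightarrow> complex) \<Rightarrow> ('a \<Rightarrow> 'a) set" where
  "aut_stab_orbit p K A \<theta> = {\<gamma> \<in> A. aut_twist K \<theta> \<gamma> id \<in> H_orbit p K \<theta>}"

definition lift_char :: "('a \<Rightarrow> complex) \<Rightarrow> ('a \<times> ('a \<Rightarrow> 'a) \<Rightarrow> complex)" where
  "lift_char \<theta> = (\<lambda>(x, a). if a = id then \<theta> x else 0)"

definition sdp_central_ge :: "nat \<Rightarrow> ('a, 'c) monoid_scheme \<Rightarrow> ('a \<Rightarrow> 'a) set \<Rightarrow> 'a set
    \<Rightarrow> ('a \<Rightarrow> complex) \<Rightarrow> ('a \<Rightarrow> complex) \<Rightarrow> bool" where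
  "sdp_central_ge p K A N \<theta> \<phi> \<longleftrightarrow>
     (let A' = aut_stab_orbit p (carrier K) A \<theta> in
      central_ge p (sdp K A') (carrier K \<times> {id}) (lift_char \<theta>) (N \<times> A') (N \<times> {id}) (lift_char \<phi>))"

definition equivariant_map :: "nat \<Rightarrow> 'a set \<Rightarrow> 'a set \<Rightarrow> ('a \<Rightarrow> 'a) set \<Rightarrow> ('a \<Rightarrow> complex) set
    \<Rightarrow> (('a \<Rightarrow> complex) \<Rightarrow> ('a \<Rightarrow> complex)) \<Rightarrow> bool" where
  "equivariant_map p K N A D \<Omega> \<longleftrightarrow> (\<forall>\<theta> \<in> D. \<forall>\<gamma> \<in> A. \<forall>\<sigma>. Hgal p \<sigma> \<longrightarrow>
       \<Omega> (aut_twist K \<theta> \<gamma> \<sigma>) = aut_twist N (\<Omega> \<theta>) \<gamma> \<sigma>)"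

definition igm_data :: "nat \<Rightarrow> ('a, 'c) monoid_scheme \<Rightarrow> 'a set \<Rightarrow> 'a set
    \<Rightarrow> (('a \<Rightarrow> complex) \<Rightarrow> ('a \<Rightarrow> complex)) \<Rightarrow> bool" where
  "igm_data p Xc R N \<Omega> \<longleftrightarrow>
     (let \<Gamma> = Aut_stab Xc R in
       subgroup N Xc \<and> N \<subset> carrier Xc \<and> (\<forall>\<gamma> \<in> \<Gamma>. \<gamma> ` N = N) \<and> normalizer Xc R \<subseteq> N \<and>
       bij_betw \<Omega> (Irr_p' p Xc) (Irr_p' p (Xc\<lparr>carrier := N\<rparr>)) \<and>
       equivariant_map p (carrier Xc) N \<Gamma> (Irr_p' p Xc) \<Omega> \<and>
       (\<forall>\<theta> \<in> Irr_p' p Xc. sdp_central_ge p Xc \<Gamma> N \<theta> (\<Omega> \<theta>)))"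

definition prod_char :: "'a set \<Rightarrow> nat \<Rightarrow> (nat \<Rightarrow> 'a \<Rightarrow> complex) \<Rightarrow> ((nat \<Rightarrow> 'a) \<Rightarrow> complex)" where
  "prod_char K n \<theta>s = (\<lambda>v. if v \<in> (\<Pi>\<^sub>E i\<in>{..<n}. K) then (\<Prod>i<n. \<theta>s i (v i)) else 0)"

end

theory Submission
  imports Defs "Jordan_Normal_Form.Spectral_Radius"
begin

text \<open>A central isomorphism of triples is carried by projective representations \<open>P\<close>, \<open>P'\<close> of the stabilisers
  of \<open>\<theta>\<close> and \<open>\<Omega> \<theta>\<close> with the same factor set, the same scalars on the centraliser and the same Galois
  multipliers. Choosing such a pair for one character in each orbit of \<open>\<Gamma> \<times> \<H>\<close> and transporting it along
  the orbit yields matrices \<open>Q \<theta> (x, a)\<close> also for those automorphisms \<open>a\<close> that move \<open>\<theta>\<close>, again with equal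
  factor sets and multipliers for \<open>X\<close> and \<open>N\<close>. An element of \<open>X\<^sup>n \<rtimes> (\<Gamma> \<wr> S\<^sub>n)\<close> that stabilises a product
  character permutes the tensor factors and acts in each of them by some \<open>Q \<theta>\<^sub>i (x, a)\<close>. The tensor products
  twisted by these permutations are the required projective representations: factor sets, central scalars and
  Galois multipliers are the products of those of the factors, hence they agree for \<open>X\<^sup>n\<close> and \<open>N\<^sup>n\<close>.\<close>

section \<open>Matrices and Schur's lemma\<close>

text \<open>The obstacle is that an element stabilising \<open>\<theta>_1 x ... x \<theta>_n\<close>
  need not stabilise any factor: it leads from slot i to a slot whose character is only a
  \<Gamma>-conjugate of \<open>\<theta>_i\<close>, or a \<Gamma> x H-conjugate if a Galois
  automorphism is involved. Equality of multipliers, known for single stabilisers, is thus needed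
  along arrows between distinct characters. Two facts provide it. The Galois part of the path from
  the orbit representative to \<theta> can be chosen to depend only on the \<Gamma>-orbit of
  \<theta>; an automorphism moving \<theta> then becomes an element that stabilises the
  representative exactly, where the given projective representation is defined. And the
  automorphisms that fix the representative together with a given Galois automorphism form one coset
  of its stabiliser, so all multipliers along arrows reduce to one of them and to values of the
  factor set, which are common to X and N. Irreducibility is handled through orthogonality of matrix
  coefficients, an identity that passes to tensor products and Galois twists. Base changes are kept
  over \<open>Qab\<close> because Galois automorphisms are applied to them again.\<close>

lemma mat_mult_entry:
  assumes "A \<in> carrier_mat a b" "B \<in> carrier_mat b c" "i < a" "j < c"
  shows "(A * B) $$ (i, j) = (\<Sum>k<b. A $$ (i, k) * B $$ (k, j))"
  using assms by (auto simp: scalar_prod_def atLeast0LessThan intro!: sum.cong)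

lemma mult_vec_entry:
  assumes "A \<in> carrier_mat a b" "v \<in> carrier_vec b" "i < a"
  shows "(A *\<^sub>v v) $ i = (\<Sum>k<b. A $$ (i, k) * v $ k)"
  using assms by (auto simp: scalar_prod_def atLeast0LessThan intro!: sum.cong)

lemma mat3_entry:
  assumes "A \<in> carrier_mat a b" "B \<in> carrier_mat b c" "C \<in> carrier_mat c d" "i < a" "j < d"
  shows "(A * B * C) $$ (i, j) = (\<Sum>k<b. \<Sum>l<c. A $$ (i, k) * B $$ (k, l) * C $$ (l, j))"
proof -
  have "(A * B * C) $$ (i, j) = (\<Sum>l<c. (\<Sum>k<b. A $$ (i, k) * B $$ (k, l)) * C $$ (l, j))"
    using assms by (subst mat_mult_entry[of _ a c _ d]) (auto simp del: index_mult_mat intro!: sum.cong simp: mat_mult_entry[of A a b B c])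
  then show ?thesis
    by (simp add: sum_distrib_right sum.swap[of _ "{..<c}"])
qed

text \<open>The exchange step of linear algebra as a matrix: since \<open>y $ k\<close> is nonzero,
  \<open>y\<close> can take the place of the k-th unit vector in a basis. It lets an adapted basis
  absorb one more vector.\<close>

lemma column_replacement:
  fixes y :: "complex vec"
  assumes y: "y \<in> carrier_vec d" and k: "k < d" "y $ k \<noteq> 0"
  shows "\<exists>E E'. E \<in> carrier_mat d d \<and> E' \<in> carrier_mat d d \<and> E * E' = 1\<^sub>m d \<and> E' * E = 1\<^sub>m d \<and>
    col E k = y \<and> (\<forall>j<d. j \<noteq> k \<longrightarrow> col E j = unit_vec d j)"
proof -
  define E where "E = mat d d (\<lambda>(i, j). if j = k then y $ i else if i = j then 1 else 0)"
  \<comment> \<open>\<open>y\<close> is the sum of the unit vectors weighted by its entries; solving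
    this for the k-th unit vector gives column k of the inverse.\<close>
  define E' where "E' = mat d d (\<lambda>(i, j). if j = k then (if i = k then 1 / y $ k else - y $ i / y $ k)
     else if i = j then 1 else 0)"
  have c: "E \<in> carrier_mat d d" "E' \<in> carrier_mat d d" by (auto simp: E_def E'_def)
  have 1: "E * E' = 1\<^sub>m d"
  proof (rule eq_matI)
    fix i j assume ij: "i < dim_row (1\<^sub>m d :: complex mat)" "j < dim_col (1\<^sub>m d :: complex mat)"
    then have "(E * E') $$ (i, j) = (\<Sum>l<d. E $$ (i, l) * E' $$ (l, j))"
      by (intro mat_mult_entry[OF c]) auto
    also have "\<dots> = (\<Sum>l\<in>{..<d} - {k}. E $$ (i, l) * E' $$ (l, j)) + E $$ (i, k) * E' $$ (k, j)"
      using k by (subst sum.remove[of _ k]) (auto simp: add.commute)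
    also have "(\<Sum>l\<in>{..<d} - {k}. E $$ (i, l) * E' $$ (l, j)) = (\<Sum>l\<in>{..<d} - {k}. if l = i then E' $$ (i, j) else 0)"
      using ij by (intro sum.cong) (auto simp: E_def)
    also have "\<dots> = (if i = k then 0 else E' $$ (i, j))" using ij by (auto simp: sum.delta)
    finally show "(E * E') $$ (i, j) = 1\<^sub>m d $$ (i, j)"
      using ij k by (auto simp: E_def E'_def field_simps)
  qed (auto simp: E_def E'_def)
  have "E' * E = 1\<^sub>m d" using mat_mult_left_right_inverse[OF c 1] .
  moreover have "col E k = y" using y k by (intro eq_vecI) (auto simp: E_def)
  moreover have "\<forall>j<d. j \<noteq> k \<longrightarrow> col E j = unit_vec d j" by (auto simp: E_def unit_vec_def intro!: eq_vecI)
  ultimately show ?thesis using c 1 by blast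
qed

lemma mult_unit_vec:
  fixes P :: "complex mat"
  assumes "P \<in> carrier_mat e d" "j < d"
  shows "P *\<^sub>v unit_vec d j = col P j"
  using assms by (intro eq_vecI) auto

text \<open>Take an invertible matrix with as many leading columns as possible in \<open>W\<close>.\<close>
lemma adapted_basis:
  fixes W :: "complex vec set"
  assumes W: "W \<subseteq> carrier_vec d" "0\<^sub>v d \<in> W" "\<And>v w. v \<in> W \<Longrightarrow> w \<in> W \<Longrightarrow> v + w \<in> W"
    "\<And>c v. v \<in> W \<Longrightarrow> c \<cdot>\<^sub>v v \<in> W"
  shows "\<exists>k P Pi. k \<le> d \<and> P \<in> carrier_mat d d \<and> Pi \<in> carrier_mat d d \<and> P * Pi = 1\<^sub>m d \<and> Pi * P = 1\<^sub>m d \<and>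
     (\<forall>x\<in>carrier_vec d. x \<in> W \<longleftrightarrow> (\<forall>i. k \<le> i \<and> i < d \<longrightarrow> (Pi *\<^sub>v x) $ i = 0))"
proof -
  define Q where "Q k P Pi \<longleftrightarrow> k \<le> d \<and> P \<in> carrier_mat d d \<and> Pi \<in> carrier_mat d d \<and> P * Pi = 1\<^sub>m d \<and>
     Pi * P = 1\<^sub>m d \<and> (\<forall>j<k. col P j \<in> W)" for k and P Pi :: "complex mat"
  define K where "K = {k. \<exists>P Pi. Q k P Pi}"
  have "0 \<in> K" unfolding K_def Q_def by (auto intro!: exI[of _ "1\<^sub>m d"])
  moreover have fin: "finite K" by (rule finite_subset[of _ "{..d}"]) (auto simp: K_def Q_def)
  ultimately have MK: "Max K \<in> K" by (intro Max_in) auto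
  define k where "k = Max K"
  have k: "\<exists>P Pi. Q k P Pi" using MK by (simp add: k_def K_def)
  have kmax: "k' \<le> k" if "\<exists>P Pi. Q k' P Pi" for k'
    using that fin unfolding k_def by (intro Max_ge) (auto simp: K_def)
  from k obtain P Pi where "Q k P Pi" by blast
  then have P: "k \<le> d" "P \<in> carrier_mat d d" "Pi \<in> carrier_mat d d" "P * Pi = 1\<^sub>m d" "Pi * P = 1\<^sub>m d"
    and PW: "\<And>j. j < k \<Longrightarrow> col P j \<in> W" by (auto simp: Q_def)
  have "x \<in> W" if x: "x \<in> carrier_vec d" and z: "\<forall>i. k \<le> i \<and> i < d \<longrightarrow> (Pi *\<^sub>v x) $ i = 0" for x
  proof -
    define y where "y = Pi *\<^sub>v x"
    have y: "y \<in> carrier_vec d" using P x by (auto simp: y_def)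
    have W': "vec d (\<lambda>i. \<Sum>j<l. P $$ (i, j) * y $ j) \<in> W" if "l \<le> k" for l using that
    proof (induction l)
      case 0 have "vec d (\<lambda>i. \<Sum>j<0. P $$ (i, j) * y $ j) = 0\<^sub>v d" by (intro eq_vecI) auto
      then show ?case using W(2) by simp
    next
      case (Suc l)
      have "vec d (\<lambda>i. \<Sum>j<Suc l. P $$ (i, j) * y $ j) = vec d (\<lambda>i. \<Sum>j<l. P $$ (i, j) * y $ j) + y $ l \<cdot>\<^sub>v col P l"
        using Suc.prems P(1,2) by (intro eq_vecI) (auto simp: mult.commute)
      then show ?case using Suc W(3) W(4) PW by simp
    qed
    have "x = P *\<^sub>v y" using P x by (simp add: y_def flip: assoc_mult_mat_vec)
    also have "\<dots> = vec d (\<lambda>i. \<Sum>j<k. P $$ (i, j) * y $ j)"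
    proof (rule eq_vecI)
      fix i assume "i < dim_vec (vec d (\<lambda>i. \<Sum>j<k. P $$ (i, j) * y $ j))"
      then have i: "i < d" by simp
      have "(P *\<^sub>v y) $ i = (\<Sum>j<d. P $$ (i, j) * y $ j)" using P(2) y i by (rule mult_vec_entry)
      also have "\<dots> = (\<Sum>j<k. P $$ (i, j) * y $ j)" using P(1) z by (intro sum.mono_neutral_right) (auto simp: y_def)
      finally show "(P *\<^sub>v y) $ i = vec d (\<lambda>i. \<Sum>j<k. P $$ (i, j) * y $ j) $ i" using i by simp
    qed (use P in auto)
    finally show ?thesis using W' by simp
  qed
  moreover have "(Pi *\<^sub>v x) $ i = 0" if x: "x \<in> carrier_vec d" "x \<in> W" and i: "k \<le> i" "i < d" for x i
  proof (rule ccontr)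
    assume nz: "(Pi *\<^sub>v x) $ i \<noteq> 0"
    \<comment> \<open>A nonzero coordinate beyond the first k means that \<open>x\<close> is
      independent of the first k columns. Swapping coordinates i and k and then exchanging column k
      for \<open>x\<close> yields k+1 leading columns in \<open>W\<close>, against the maximality of
      k.\<close>
    define S where "S = (swaprows_mat d k i :: complex mat)"
    have kd: "k < d" using i by simp
    have S: "S \<in> carrier_mat d d" "S * S = 1\<^sub>m d" using kd i by (auto simp: S_def intro: swaprows_mat_inv)
    have colS: "col S j = unit_vec d j" if "j < k" for j
      using that kd i by (auto simp: S_def swaprows_mat_def intro!: eq_vecI)
    define y where "y = S *\<^sub>v (Pi *\<^sub>v x)"
    have y: "y \<in> carrier_vec d" using S P x by (auto simp: y_def)
    have yk: "y $ k \<noteq> 0"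
    proof -
      have "y $ k = (\<Sum>l<d. S $$ (k, l) * (Pi *\<^sub>v x) $ l)" unfolding y_def using S P x kd by (intro mult_vec_entry) auto
      also have "\<dots> = (\<Sum>l<d. if l = i then (Pi *\<^sub>v x) $ l else 0)" using kd i by (intro sum.cong) (auto simp: S_def swaprows_mat_def)
      also have "\<dots> = (Pi *\<^sub>v x) $ i" using i by simp
      finally show ?thesis using nz by simp
    qed
    obtain E E' where E: "E \<in> carrier_mat d d" "E' \<in> carrier_mat d d" "E * E' = 1\<^sub>m d" "E' * E = 1\<^sub>m d"
      "col E k = y" "\<forall>j<d. j \<noteq> k \<longrightarrow> col E j = unit_vec d j" using column_replacement[OF y kd yk] by blast
    define P' where "P' = P * (S * E)"
    define Pi' where "Pi' = (E' * S) * Pi"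
    have car: "P' \<in> carrier_mat d d" "Pi' \<in> carrier_mat d d" using P S E by (auto simp: P'_def Pi'_def)
    have SE: "(S * E) * (E' * S) = 1\<^sub>m d"
    proof -
      have "(S * E) * (E' * S) = S * (E * (E' * S))" using S E by (intro assoc_mult_mat) auto
      also have "E * (E' * S) = (E * E') * S" using S E by (intro assoc_mult_mat[symmetric]) auto
      finally show ?thesis using S E by simp
    qed
    have inv: "P' * Pi' = 1\<^sub>m d"
    proof -
      have "P' * Pi' = P * ((S * E) * ((E' * S) * Pi))" unfolding P'_def Pi'_def using P S E by (intro assoc_mult_mat) auto
      also have "(S * E) * ((E' * S) * Pi) = ((S * E) * (E' * S)) * Pi" using P S E by (intro assoc_mult_mat[symmetric]) auto
      finally show ?thesis using P SE by simp
    qed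
    have colP': "col P' j = P *\<^sub>v (S *\<^sub>v col E j)" if "j < d" for j
      unfolding P'_def using that P S E col_mult2[of P d d "S * E" d j] col_mult2[of S d d E d j] by simp
    have "col P' j \<in> W" if j: "j < Suc k" for j
    proof (cases "j = k")
      case True
      then have "col P' j = P *\<^sub>v (S *\<^sub>v y)" using colP' kd E by simp
      also have "S *\<^sub>v y = (S * S) *\<^sub>v (Pi *\<^sub>v x)" unfolding y_def
        using S(1) P x by (intro assoc_mult_mat_vec[symmetric, of S d d S d]) auto
      also have "\<dots> = Pi *\<^sub>v x" using S P x by (auto simp del: assoc_mult_mat_vec)
      finally have "col P' j = P *\<^sub>v (Pi *\<^sub>v x)" .
      also have "P *\<^sub>v (Pi *\<^sub>v x) = x" using P x by (simp flip: assoc_mult_mat_vec)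
      finally show ?thesis using x by simp
    next
      case False
      then have jk: "j < k" "j < d" using j kd by auto
      then have "col P' j = P *\<^sub>v (S *\<^sub>v unit_vec d j)" using colP' E by simp
      also have "S *\<^sub>v unit_vec d j = unit_vec d j" using S colS jk by (simp add: mult_unit_vec)
      also have "P *\<^sub>v unit_vec d j = col P j" using P jk by (simp add: mult_unit_vec)
      finally show ?thesis using PW jk by simp
    qed
    then have "Q (Suc k) P' Pi'"
      using car inv mat_mult_left_right_inverse[OF car inv] kd by (auto simp: Q_def)
    then show False using kmax by fastforce
  qed
  ultimately show ?thesis using P by blast
qed

section \<open>Invariant subspaces, intertwiners and Schur's lemma\<close>

lemma rep_mat: "is_rep G d \<rho> \<Longrightarrow> g \<in> carrier G \<Longrightarrow> \<rho> g \<in> carrier_mat d d"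
  by (simp add: is_rep_def)

lemma rep_mult: "is_rep G d \<rho> \<Longrightarrow> g \<in> carrier G \<Longrightarrow> h \<in> carrier G \<Longrightarrow> \<rho> (g \<otimes>\<^bsub>G\<^esub> h) = \<rho> g * \<rho> h"
  by (simp add: is_rep_def)

lemma rep_one: "is_rep G d \<rho> \<Longrightarrow> \<rho> \<one>\<^bsub>G\<^esub> = 1\<^sub>m d"
  by (simp add: is_rep_def)

text \<open>Irreducibility is defined by the absence of a zero block in the lower left corner. In a
  basis adapted to \<open>W\<close>, invariance of \<open>W\<close> produces such a block of width
  k, which forces k = 0 or k = d.\<close>

lemma irred_invariant_subspace:
  assumes irr: "irred_rep G d \<rho>"
    and W: "W \<subseteq> carrier_vec d" "0\<^sub>v d \<in> W" "\<And>v w. v \<in> W \<Longrightarrow> w \<in> W \<Longrightarrow> v + w \<in> W"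
      "\<And>c v. v \<in> W \<Longrightarrow> c \<cdot>\<^sub>v v \<in> W"
    and inv: "\<And>g w. g \<in> carrier G \<Longrightarrow> w \<in> W \<Longrightarrow> \<rho> g *\<^sub>v w \<in> W"
  shows "W = {0\<^sub>v d} \<or> W = carrier_vec d"
proof -
  have rep: "is_rep G d \<rho>" using irr by (simp add: irred_rep_def)
  obtain k P Pi where P: "k \<le> d" "P \<in> carrier_mat d d" "Pi \<in> carrier_mat d d" "P * Pi = 1\<^sub>m d" "Pi * P = 1\<^sub>m d"
    and PW: "\<forall>x\<in>carrier_vec d. x \<in> W \<longleftrightarrow> (\<forall>i. k \<le> i \<and> i < d \<longrightarrow> (Pi *\<^sub>v x) $ i = 0)"
    using adapted_basis[OF W] by blast
  have Picol: "Pi *\<^sub>v col P j = unit_vec d j" if "j < d" for j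
  proof -
    have "Pi *\<^sub>v col P j = col (Pi * P) j" using that P by (intro col_mult2[symmetric]) auto
    then show ?thesis using P(5) that by simp
  qed
  have z: "(Pi * \<rho> g * P) $$ (i, j) = 0" if g: "g \<in> carrier G" and ij: "k \<le> i" "i < d" "j < k" for g i j
  proof -
    have jd: "j < d" using ij by simp
    have c: "col P j \<in> carrier_vec d" using P by auto
    have "col P j \<in> W" using PW c Picol[OF jd] ij by (auto simp: unit_vec_def)
    then have w: "\<rho> g *\<^sub>v col P j \<in> W" using inv g by blast
    have rg: "\<rho> g \<in> carrier_mat d d" using rep g by (rule rep_mat)
    have "(Pi * \<rho> g * P) $$ (i, j) = (Pi * (\<rho> g * P)) $$ (i, j)" using P rg by simp
    also have "\<dots> = (Pi *\<^sub>v (\<rho> g *\<^sub>v col P j)) $ i"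
    proof -
      have "(Pi * (\<rho> g * P)) $$ (i, j) = col (Pi * (\<rho> g * P)) j $ i" using P rg ij jd by simp
      also have "col (Pi * (\<rho> g * P)) j = Pi *\<^sub>v col (\<rho> g * P) j" using P rg jd by (intro col_mult2[of _ d d _ d]) auto
      also have "col (\<rho> g * P) j = \<rho> g *\<^sub>v col P j" using P rg jd by (intro col_mult2[of _ d d _ d]) auto
      finally show ?thesis .
    qed
    also have "\<dots> = 0" using w W(1) PW ij by blast
    finally show ?thesis .
  qed
  have kk: "\<not> (0 < k \<and> k < d)" using irr z P unfolding irred_rep_def by blast
  show ?thesis
  proof (cases "k = 0")
    case True
    have "w = 0\<^sub>v d" if "w \<in> W" for w
    proof -
      have w: "w \<in> carrier_vec d" using that W by auto
      have "Pi *\<^sub>v w = 0\<^sub>v d" using that PW w True P by (intro eq_vecI) auto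
      then have "P *\<^sub>v (Pi *\<^sub>v w) = 0\<^sub>v d" using P by (auto intro!: eq_vecI)
      then show ?thesis using P w by (simp flip: assoc_mult_mat_vec)
    qed
    then show ?thesis using W(2) by blast
  next
    case False
    then have "k = d" using kk P by auto
    then show ?thesis using PW W(1) by auto
  qed
qed

text \<open>The kernel of \<open>C\<close> is invariant under \<rho> and is not the whole space.
  Irreducibility is asked of the source alone, which admits targets that are known only through
  their character.\<close>

lemma intertwiner_injective:
  fixes C :: "complex mat"
  assumes irr: "irred_rep G d \<rho>" and C: "C \<in> carrier_mat e d" "C \<noteq> 0\<^sub>m e d"
    and \<rho>': "\<And>g. g \<in> carrier G \<Longrightarrow> \<rho>' g \<in> carrier_mat e e" "\<And>g. g \<in> carrier G \<Longrightarrow> \<rho>' g * C = C * \<rho> g"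
    and x: "x \<in> carrier_vec d" "C *\<^sub>v x = 0\<^sub>v e"
  shows "x = 0\<^sub>v d"
proof -
  have rep: "is_rep G d \<rho>" using irr by (simp add: irred_rep_def)
  define W where "W = {v \<in> carrier_vec d. C *\<^sub>v v = 0\<^sub>v e}"
  have "W = {0\<^sub>v d} \<or> W = carrier_vec d"
  proof (rule irred_invariant_subspace[OF irr])
    fix g w assume g: "g \<in> carrier G" and w: "w \<in> W"
    have "C *\<^sub>v (\<rho> g *\<^sub>v w) = (C * \<rho> g) *\<^sub>v w" using C w rep_mat[OF rep g] by (simp add: W_def)
    also have "\<dots> = \<rho>' g *\<^sub>v (C *\<^sub>v w)" using C w \<rho>'(1)[OF g] by (simp add: W_def \<rho>'(2)[OF g, symmetric])
    also have "\<dots> = 0\<^sub>v e" using w \<rho>'(1)[OF g] by (auto simp: W_def)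
    finally show "\<rho> g *\<^sub>v w \<in> W" using w rep_mat[OF rep g] by (auto simp: W_def)
  qed (use C in \<open>auto simp: W_def mult_add_distrib_mat_vec mult_mat_vec\<close>)
  moreover have "W \<noteq> carrier_vec d"
  proof
    assume a: "W = carrier_vec d"
    have "C = 0\<^sub>m e d"
    proof (rule eq_matI)
      fix i j assume ij: "i < dim_row (0\<^sub>m e d :: complex mat)" "j < dim_col (0\<^sub>m e d :: complex mat)"
      have "unit_vec d j \<in> W" unfolding a by simp
      then have "C *\<^sub>v unit_vec d j = 0\<^sub>v e" unfolding W_def by blast
      then have "col C j = 0\<^sub>v e" using C ij by (simp add: mult_unit_vec)
      then have "col C j $ i = 0" using ij by simp
      then show "C $$ (i, j) = 0\<^sub>m e d $$ (i, j)" using C ij by simp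
    qed (use C in auto)
    then show False using C by simp
  qed
  ultimately show ?thesis using x by (auto simp: W_def)
qed

text \<open>Subtracting an eigenvalue from \<open>A\<close> gives an intertwiner with nontrivial
  kernel, which therefore vanishes.\<close>

lemma schur_commutant:
  assumes irr: "irred_rep G d \<rho>" and A: "A \<in> carrier_mat d d"
    and comm: "\<And>g. g \<in> carrier G \<Longrightarrow> \<rho> g * A = A * \<rho> g"
  shows "\<exists>c. A = c \<cdot>\<^sub>m 1\<^sub>m d"
proof -
  have rep: "is_rep G d \<rho>" and d: "0 < d" using irr by (auto simp: irred_rep_def)
  obtain c where "c \<in> spectrum A" using spectrum_non_empty[OF A d] by auto
  then obtain v where v: "v \<in> carrier_vec d" "v \<noteq> 0\<^sub>v d" "A *\<^sub>v v = c \<cdot>\<^sub>v v"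
    using A by (auto simp: spectrum_def eigenvalue_def eigenvector_def)
  define B where "B = A - c \<cdot>\<^sub>m 1\<^sub>m d"
  have B: "B \<in> carrier_mat d d" using A by (auto simp: B_def)
  have Bv: "B *\<^sub>v v = 0\<^sub>v d"
  proof -
    have "B *\<^sub>v v = A *\<^sub>v v - (c \<cdot>\<^sub>m 1\<^sub>m d) *\<^sub>v v" unfolding B_def using A v by (intro minus_mult_distrib_mat_vec) auto
    also have "(c \<cdot>\<^sub>m 1\<^sub>m d) *\<^sub>v v = c \<cdot>\<^sub>v v" using v by (auto intro!: eq_vecI)
    finally show ?thesis using v by auto
  qed
  have "B = 0\<^sub>m d d"
  proof (rule ccontr)
    assume nz: "B \<noteq> 0\<^sub>m d d"
    have "\<rho> g * B = B * \<rho> g" if g: "g \<in> carrier G" for g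
    proof -
      have r: "\<rho> g \<in> carrier_mat d d" using rep g by (rule rep_mat)
      have "\<rho> g * B = \<rho> g * A - \<rho> g * (c \<cdot>\<^sub>m 1\<^sub>m d)" unfolding B_def using A r by (intro mult_minus_distrib_mat) auto
      moreover have "B * \<rho> g = A * \<rho> g - (c \<cdot>\<^sub>m 1\<^sub>m d) * \<rho> g" unfolding B_def using A r by (intro minus_mult_distrib_mat) auto
      moreover have "\<rho> g * (c \<cdot>\<^sub>m 1\<^sub>m d) = (c \<cdot>\<^sub>m 1\<^sub>m d) * \<rho> g" using r mult_smult_distrib[of "\<rho> g" d d "1\<^sub>m d" d c] mult_smult_assoc_mat[of "1\<^sub>m d" d d "\<rho> g" d c]
        by simp
      ultimately show ?thesis using comm[OF g] by simp
    qed
    then show False using intertwiner_injective[OF irr B nz _ _ v(1) Bv, of \<rho>] rep_mat[OF rep] v by blast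
  qed
  have "A = c \<cdot>\<^sub>m 1\<^sub>m d"
  proof (rule eq_matI)
    fix i j assume ij: "i < dim_row (c \<cdot>\<^sub>m 1\<^sub>m d)" "j < dim_col (c \<cdot>\<^sub>m 1\<^sub>m d)"
    then have "B $$ (i, j) = 0" using \<open>B = 0\<^sub>m d d\<close> by simp
    then show "A $$ (i, j) = (c \<cdot>\<^sub>m 1\<^sub>m d) $$ (i, j)" using ij A by (simp add: B_def)
  qed (use A in auto)
  then show ?thesis by blast
qed

section \<open>Orthogonality relations\<close>

text \<open>Schur's orthogonality relations for the coefficients of a single representation. Taking
  the inverse element rather than a complex conjugate keeps the relation algebraic, so that it can
  be multiplied over tensor factors and subjected to Galois automorphisms. For representations of
  positive degree of a finite group it is equivalent to irreducibility.\<close>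

definition schur_orth :: "('a, 'c) monoid_scheme \<Rightarrow> nat \<Rightarrow> ('a \<Rightarrow> complex mat) \<Rightarrow> bool" where
  "schur_orth G d \<rho> \<longleftrightarrow> (\<forall>i<d. \<forall>a<d. \<forall>b<d. \<forall>j<d.
     (\<Sum>g\<in>carrier G. \<rho> g $$ (i, a) * \<rho> (inv\<^bsub>G\<^esub> g) $$ (b, j)) =
       (if i = j \<and> a = b then of_nat (card (carrier G)) / of_nat d else 0))"

lemma schur_orthD:
  assumes "schur_orth G d \<rho>" "i < d" "a < d" "b < d" "j < d"
  shows "(\<Sum>g\<in>carrier G. \<rho> g $$ (i, a) * \<rho> (inv\<^bsub>G\<^esub> g) $$ (b, j)) =
       (if i = j \<and> a = b then of_nat (card (carrier G)) / of_nat d else 0)"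
  using assms unfolding schur_orth_def by blast

lemma mat_trace_eq: "A \<in> carrier_mat d d \<Longrightarrow> mat_trace A = (\<Sum>i<d. A $$ (i, i))"
  by (auto simp: mat_trace_def)

section \<open>Averaging over the group; irreducibility and orthogonality\<close>

context group
begin

lemma sum_shift:
  assumes "h \<in> carrier G"
  shows "(\<Sum>g\<in>carrier G. f g) = (\<Sum>g\<in>carrier G. f (h \<otimes> g))"
proof -
  have "bij_betw (\<lambda>g. h \<otimes> g) (carrier G) (carrier G)"
    by (rule bij_betw_byWitness[where f' = "\<lambda>g. inv h \<otimes> g"]) (use assms in \<open>auto simp flip: m_assoc\<close>)
  then show ?thesis by (rule sum.reindex_bij_betw[symmetric])
qed

lemma sum_inv: "(\<Sum>g\<in>carrier G. f g) = (\<Sum>g\<in>carrier G. f (inv g))"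
proof -
  have "bij_betw (\<lambda>g. inv g) (carrier G) (carrier G)"
    by (rule bij_betw_byWitness[where f' = "\<lambda>g. inv g"]) auto
  then show ?thesis by (rule sum.reindex_bij_betw[symmetric])
qed

lemma rep_entry_mult:
  assumes "is_rep G d \<rho>" "g \<in> carrier G" "h \<in> carrier G" "i < d" "j < d"
  shows "\<rho> (g \<otimes> h) $$ (i, j) = (\<Sum>k<d. \<rho> g $$ (i, k) * \<rho> h $$ (k, j))"
  unfolding rep_mult[OF assms(1-3)]
  by (rule mat_mult_entry[OF rep_mat[OF assms(1,2)] rep_mat[OF assms(1,3)] assms(4,5)])

lemma rep_inverse:
  assumes "is_rep G d \<rho>" "g \<in> carrier G"
  shows "\<rho> g * \<rho> (inv g) = 1\<^sub>m d" "\<rho> (inv g) * \<rho> g = 1\<^sub>m d"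
  using assms by (simp_all add: rep_one flip: rep_mult)

text \<open>\<open>C\<close> is the sum of \<open>\<rho>' g * E * \<rho> (inv g)\<close> over the
  group for the matrix unit \<open>E\<close> at position (a, b), and left translation by h permutes
  the summands.\<close>

lemma average_intertwines:
  assumes r: "is_rep G d \<rho>" and r': "is_rep G e \<rho>'" and ab: "a < e" "b < d" and h: "h \<in> carrier G"
  defines "C \<equiv> mat e d (\<lambda>(i, j). \<Sum>g\<in>carrier G. \<rho>' g $$ (i, a) * \<rho> (inv g) $$ (b, j))"
  shows "\<rho>' h * C = C * \<rho> h"
proof (rule eq_matI)
  have C: "C \<in> carrier_mat e d" by (simp add: C_def)
  note hr = rep_mat[OF r h] and hr' = rep_mat[OF r' h]
  fix i j assume "i < dim_row (C * \<rho> h)" "j < dim_col (C * \<rho> h)"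
  then have ij: "i < e" "j < d" using C hr by auto
  have "(\<rho>' h * C) $$ (i, j) = (\<Sum>k<e. \<rho>' h $$ (i, k) * C $$ (k, j))"
    using hr' C ij by (intro mat_mult_entry[of _ e e _ d])
  also have "\<dots> = (\<Sum>k<e. \<Sum>g\<in>carrier G. \<rho>' h $$ (i, k) * \<rho>' g $$ (k, a) * \<rho> (inv g) $$ (b, j))"
    using ij by (intro sum.cong) (auto simp: C_def sum_distrib_left mult.assoc)
  also have "\<dots> = (\<Sum>g\<in>carrier G. (\<Sum>k<e. \<rho>' h $$ (i, k) * \<rho>' g $$ (k, a)) * \<rho> (inv g) $$ (b, j))"
    by (subst sum.swap) (simp add: sum_distrib_right)
  also have "\<dots> = (\<Sum>g\<in>carrier G. \<rho>' (h \<otimes> g) $$ (i, a) * \<rho> (inv g) $$ (b, j))"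
    using rep_entry_mult[OF r' h] ij ab by (intro sum.cong) auto
  finally have 1: "(\<rho>' h * C) $$ (i, j) = \<dots>" .
  have "(C * \<rho> h) $$ (i, j) = (\<Sum>k<d. C $$ (i, k) * \<rho> h $$ (k, j))"
    using hr C ij by (intro mat_mult_entry[of _ e d _ d])
  also have "\<dots> = (\<Sum>k<d. \<Sum>g\<in>carrier G. \<rho>' g $$ (i, a) * (\<rho> (inv g) $$ (b, k) * \<rho> h $$ (k, j)))"
    using ij by (intro sum.cong) (auto simp: C_def sum_distrib_right mult.assoc)
  also have "\<dots> = (\<Sum>g\<in>carrier G. \<rho>' g $$ (i, a) * (\<Sum>k<d. \<rho> (inv g) $$ (b, k) * \<rho> h $$ (k, j)))"
    by (subst sum.swap) (simp add: sum_distrib_left)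
  also have "\<dots> = (\<Sum>g\<in>carrier G. \<rho>' g $$ (i, a) * \<rho> (inv g \<otimes> h) $$ (b, j))"
    using rep_entry_mult[OF r _ h] ij ab by (intro sum.cong) auto
  also have "\<dots> = (\<Sum>g\<in>carrier G. \<rho>' (h \<otimes> g) $$ (i, a) * \<rho> (inv (h \<otimes> g) \<otimes> h) $$ (b, j))"
    by (rule sum_shift[OF h])
  also have "\<dots> = (\<Sum>g\<in>carrier G. \<rho>' (h \<otimes> g) $$ (i, a) * \<rho> (inv g) $$ (b, j))"
    using h by (intro sum.cong) (auto simp: inv_mult_group m_assoc)
  finally show "(\<rho>' h * C) $$ (i, j) = (C * \<rho> h) $$ (i, j)" using 1 by simp
qed (use rep_mat[OF r h] rep_mat[OF r' h] in \<open>auto simp: C_def\<close>)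

text \<open>The averaged matrix unit is a scalar by Schur's lemma. Its trace, computed with the two
  factors interchanged, is the group order if a = b and 0 otherwise, and this determines the
  scalar.\<close>

lemma irred_imp_schur_orth:
  assumes irr: "irred_rep G d \<rho>"
  shows "schur_orth G d \<rho>"
  unfolding schur_orth_def
proof (intro allI impI)
  fix i a b j assume ij: "i < d" "a < d" "b < d" "j < d"
  have r: "is_rep G d \<rho>" and d: "0 < d" using irr by (auto simp: irred_rep_def)
  define C where "C = mat d d (\<lambda>(i, j). \<Sum>g\<in>carrier G. \<rho> g $$ (i, a) * \<rho> (inv g) $$ (b, j))"
  obtain c where c: "C = c \<cdot>\<^sub>m 1\<^sub>m d"
    using schur_commutant[OF irr, of C] average_intertwines[OF r r, of a b] ij by (auto simp: C_def)
  have "c * of_nat d = (\<Sum>i<d. C $$ (i, i))" unfolding c by simp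
  also have "\<dots> = (\<Sum>g\<in>carrier G. \<Sum>i<d. \<rho> (inv g) $$ (b, i) * \<rho> g $$ (i, a))"
    by (subst sum.swap) (auto simp: C_def mult.commute intro!: sum.cong)
  also have "\<dots> = (\<Sum>g\<in>carrier G. if a = b then 1 else 0)"
    using ij by (intro sum.cong) (auto simp: rep_one[OF r] simp flip: rep_entry_mult[OF r])
  finally have "c = (if a = b then of_nat (card (carrier G)) / of_nat d else 0)"
    using d by (auto simp: field_simps)
  moreover have "(\<Sum>g\<in>carrier G. \<rho> g $$ (i, a) * \<rho> (inv g) $$ (b, j)) = C $$ (i, j)"
    using ij by (simp add: C_def)
  ultimately show "(\<Sum>g\<in>carrier G. \<rho> g $$ (i, a) * \<rho> (inv g) $$ (b, j)) =
       (if i = j \<and> a = b then of_nat (card (carrier G)) / of_nat d else 0)"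
    using ij by (simp add: c)
qed

lemma conj_rep:
  assumes r: "is_rep G d \<rho>" and P: "P \<in> carrier_mat d d" "Q \<in> carrier_mat d d" "P * Q = 1\<^sub>m d" "Q * P = 1\<^sub>m d"
  shows "is_rep G d (\<lambda>g. Q * \<rho> g * P)"
proof -
  have "Q * (\<rho> g * \<rho> h) * P = Q * \<rho> g * P * (Q * \<rho> h * P)" if gh: "g \<in> carrier G" "h \<in> carrier G" for g h
  proof -
    note R = rep_mat[OF r gh(1)] rep_mat[OF r gh(2)]
    have "Q * \<rho> g * P * (Q * \<rho> h * P) = Q * \<rho> g * (P * (Q * \<rho> h * P))"
      using R P by (intro assoc_mult_mat[of _ d d _ d _ d]) auto
    also have "Q * \<rho> h * P = Q * (\<rho> h * P)" using R P by (intro assoc_mult_mat[of _ d d _ d _ d])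
    also have "P * (Q * (\<rho> h * P)) = (P * Q) * (\<rho> h * P)" using R P by (intro assoc_mult_mat[symmetric]) auto
    finally have "Q * \<rho> g * P * (Q * \<rho> h * P) = Q * \<rho> g * (\<rho> h * P)" using R P by simp
    then show ?thesis using R P by (simp add: assoc_mult_mat[of _ d d _ d _ d])
  qed
  then show ?thesis using P rep_mat[OF r] rep_mult[OF r] rep_one[OF r] by (auto simp: is_rep_def)
qed

text \<open>The relation is bilinear in the coefficients, and after inserting it for \<rho> the
  matrices \<open>P\<close> and \<open>Q\<close> meet only in entries of
  \<open>Q * P\<close>.\<close>

lemma schur_orth_conj:
  assumes r: "is_rep G d \<rho>" and so: "schur_orth G d \<rho>"
    and P: "P \<in> carrier_mat d d" "Q \<in> carrier_mat d d" "P * Q = 1\<^sub>m d" "Q * P = 1\<^sub>m d"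
  shows "schur_orth G d (\<lambda>g. Q * \<rho> g * P)"
  unfolding schur_orth_def
proof (intro allI impI)
  fix i a b j assume ij: "i < d" "a < d" "b < d" "j < d"
  let ?N = "of_nat (card (carrier G)) / of_nat d :: complex"
  have "(\<Sum>g\<in>carrier G. (Q * \<rho> g * P) $$ (i, a) * (Q * \<rho> (inv g) * P) $$ (b, j))
    = (\<Sum>g\<in>carrier G. (\<Sum>s<d. \<Sum>t<d. Q $$ (i, s) * \<rho> g $$ (s, t) * P $$ (t, a)) *
         (\<Sum>u<d. \<Sum>v<d. Q $$ (b, u) * \<rho> (inv g) $$ (u, v) * P $$ (v, j)))"
    using ij P rep_mat[OF r] by (intro sum.cong refl arg_cong2[where f = "(*)"] mat3_entry[of _ d d _ d _ d]) auto
  also have "\<dots> = (\<Sum>g\<in>carrier G. \<Sum>s<d. \<Sum>t<d. \<Sum>u<d. \<Sum>v<d. Q $$ (i, s) * P $$ (t, a) * Q $$ (b, u) * P $$ (v, j) *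
        (\<rho> g $$ (s, t) * \<rho> (inv g) $$ (u, v)))"
    by (simp only: sum_distrib_right, simp only: sum_distrib_left) (simp only: mult_ac)
  also have "\<dots> = (\<Sum>s<d. \<Sum>t<d. \<Sum>u<d. \<Sum>v<d. Q $$ (i, s) * P $$ (t, a) * Q $$ (b, u) * P $$ (v, j) *
        (\<Sum>g\<in>carrier G. \<rho> g $$ (s, t) * \<rho> (inv g) $$ (u, v)))"
    by (simp add: sum.swap[of _ _ "carrier G"] sum_distrib_left)
  also have "\<dots> = (\<Sum>s<d. \<Sum>t<d. \<Sum>u<d. \<Sum>v<d. Q $$ (i, s) * P $$ (t, a) * Q $$ (b, u) * P $$ (v, j) *
        (if s = v \<and> t = u then ?N else 0))"
    using so by (intro sum.cong refl) (auto simp: schur_orth_def)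
  also have "\<dots> = (\<Sum>s<d. \<Sum>t<d. \<Sum>u<d. if t = u then Q $$ (i, s) * P $$ (t, a) * Q $$ (b, u) * P $$ (s, j) * ?N else 0)"
    by (intro sum.cong refl) (auto simp: if_distrib sum.delta cong: if_cong)
  also have "\<dots> = (\<Sum>s<d. \<Sum>t<d. Q $$ (i, s) * P $$ (t, a) * Q $$ (b, t) * P $$ (s, j) * ?N)"
    by (intro sum.cong refl) (auto simp: sum.delta)
  also have "\<dots> = (\<Sum>s<d. Q $$ (i, s) * P $$ (s, j)) * (\<Sum>t<d. Q $$ (b, t) * P $$ (t, a)) * ?N"
    by (simp add: sum_product sum_distrib_right sum_distrib_left mult_ac)
  also have "\<dots> = (if i = j then 1 else 0) * (if b = a then 1 else 0) * ?N"
    using mat_mult_entry[OF P(2,1)] ij P(4) by simp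
  finally show "(\<Sum>g\<in>carrier G. (Q * \<rho> g * P) $$ (i, a) * (Q * \<rho> (inv g) * P) $$ (b, j)) =
     (if i = j \<and> a = b then ?N else 0)" by simp
qed

text \<open>Suppose the first k coordinates span an invariant subspace. Because of the vanishing
  block, the sum of \<open>B g $$ (0, l) * B (inv g) $$ (l, 0)\<close> over l < k is already the
  full diagonal entry of \<open>B g * B (inv g)\<close>, that is 1. Summed over the group this gives
  |G|, whereas orthogonality gives k |G| / d; so k = d.\<close>

lemma schur_orth_imp_irred:
  assumes r: "is_rep G d \<rho>" and so: "schur_orth G d \<rho>" and d: "0 < d" and fin: "finite (carrier G)"
  shows "irred_rep G d \<rho>"
  unfolding irred_rep_def
proof (intro conjI notI)
  assume "\<exists>k P Q. 0 < k \<and> k < d \<and> P \<in> carrier_mat d d \<and> Q \<in> carrier_mat d d \<and>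
          P * Q = 1\<^sub>m d \<and> Q * P = 1\<^sub>m d \<and>
          (\<forall>g \<in> carrier G. \<forall>i j. k \<le> i \<and> i < d \<and> j < k \<longrightarrow> (Q * \<rho> g * P) $$ (i, j) = 0)"
  then obtain k P Q where k: "0 < k" "k < d" and P: "P \<in> carrier_mat d d" "Q \<in> carrier_mat d d" "P * Q = 1\<^sub>m d" "Q * P = 1\<^sub>m d"
    and z: "\<And>g i j. g \<in> carrier G \<Longrightarrow> k \<le> i \<Longrightarrow> i < d \<Longrightarrow> j < k \<Longrightarrow> (Q * \<rho> g * P) $$ (i, j) = 0" by metis
  define B where "B g = Q * \<rho> g * P" for g
  have so': "schur_orth G d B" unfolding B_def using schur_orth_conj[OF r so P] .
  have r': "is_rep G d B" unfolding B_def using conj_rep[OF r P] .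
  let ?N = "of_nat (card (carrier G)) :: complex"
  have "(\<Sum>l<k. \<Sum>g\<in>carrier G. B g $$ (0, l) * B (inv g) $$ (l, 0)) = (\<Sum>l<k. ?N / of_nat d)"
    using so' k by (intro sum.cong) (auto simp: schur_orth_def)
  then have 1: "(\<Sum>l<k. \<Sum>g\<in>carrier G. B g $$ (0, l) * B (inv g) $$ (l, 0)) = of_nat k * (?N / of_nat d)" by simp
  have "(\<Sum>l<k. \<Sum>g\<in>carrier G. B g $$ (0, l) * B (inv g) $$ (l, 0)) = (\<Sum>g\<in>carrier G. \<Sum>l<k. B g $$ (0, l) * B (inv g) $$ (l, 0))"
    by (rule sum.swap)
  also have "\<dots> = (\<Sum>g\<in>carrier G. \<Sum>l<d. B g $$ (0, l) * B (inv g) $$ (l, 0))"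
    using k z by (intro sum.cong refl sum.mono_neutral_left) (auto simp: B_def)
  also have "\<dots> = (\<Sum>g\<in>carrier G. 1)"
    using d by (intro sum.cong) (auto simp: rep_one[OF r'] simp flip: rep_entry_mult[OF r'])
  finally have "of_nat k * (?N / of_nat d) = ?N" using 1 by simp
  moreover have "?N \<noteq> 0" using fin one_closed by auto
  ultimately have "(of_nat k :: complex) = of_nat d" using d by (simp add: field_simps)
  then show False using k by simp
qed (use r d in auto)

text \<open>Of the pairs of diagonal coefficients only the d equal ones contribute, each of them |G|
  / d.\<close>

lemma orth_char_sum:
  assumes so: "schur_orth G d \<rho>" and d: "0 < d" and r: "is_rep G d \<rho>"
  shows "(\<Sum>g\<in>carrier G. mat_trace (\<rho> g) * mat_trace (\<rho> (inv g))) = of_nat (card (carrier G))"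
proof -
  have "(\<Sum>g\<in>carrier G. mat_trace (\<rho> g) * mat_trace (\<rho> (inv g))) =
     (\<Sum>g\<in>carrier G. \<Sum>i<d. \<Sum>j<d. \<rho> g $$ (i, i) * \<rho> (inv g) $$ (j, j))"
    using rep_mat[OF r] by (intro sum.cong refl) (simp add: mat_trace_eq[of _ d] sum_product)
  also have "\<dots> = (\<Sum>i<d. \<Sum>j<d. \<Sum>g\<in>carrier G. \<rho> g $$ (i, i) * \<rho> (inv g) $$ (j, j))"
    by (simp add: sum.swap[of _ _ "carrier G"])
  also have "\<dots> = (\<Sum>i<d. \<Sum>j<d. if i = j then of_nat (card (carrier G)) / of_nat d else 0)"
    using so by (intro sum.cong refl) (auto simp: schur_orth_def)
  also have "\<dots> = of_nat (card (carrier G))" using d by (simp add: sum.delta)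
  finally show ?thesis .
qed

text \<open>Maschke's averaging argument at the level of coefficients: up to the factor |G|, the
  upper right block of a block triangular representation is a coboundary formed from the diagonal
  blocks and the constant matrix \<open>Z\<close>. Hence its coefficients are linear combinations of
  theirs.\<close>

lemma off_diagonal_coboundary:
  assumes r: "is_rep G d B" and k: "k \<le> d" and fin: "finite (carrier G)"
    and z: "\<And>g i j. g \<in> carrier G \<Longrightarrow> k \<le> i \<Longrightarrow> i < d \<Longrightarrow> j < k \<Longrightarrow> B g $$ (i, j) = 0"
    and x: "x \<in> carrier G" and ij: "i < k" "k \<le> j" "j < d"
  defines "Z \<equiv> \<lambda>i j. \<Sum>w\<in>carrier G. \<Sum>l\<in>{k..<d}. B w $$ (i, l) * B (inv w) $$ (l, j)"
  shows "of_nat (card (carrier G)) * B x $$ (i, j) =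
    (\<Sum>m\<in>{k..<d}. Z i m * B x $$ (m, j)) - (\<Sum>m<k. B x $$ (i, m) * Z m j)"
proof -
  let ?U = "{k..<d}"
  have split: "{..<d} = {..<k} \<union> ?U" using k by auto
  have low: "B (g \<otimes> h) $$ (l, j) = (\<Sum>m\<in>?U. B g $$ (l, m) * B h $$ (m, j))"
    if "g \<in> carrier G" "h \<in> carrier G" "l \<in> ?U" "j < d" for g h l j
    using that z by (subst rep_entry_mult[OF r]) (auto intro!: sum.mono_neutral_right)
  have "(\<Sum>m\<in>?U. Z i m * B x $$ (m, j)) =
     (\<Sum>m\<in>?U. \<Sum>w\<in>carrier G. \<Sum>l\<in>?U. B w $$ (i, l) * (B (inv w) $$ (l, m) * B x $$ (m, j)))"
    by (simp add: Z_def sum_distrib_right mult.assoc)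
  also have "\<dots> = (\<Sum>w\<in>carrier G. \<Sum>l\<in>?U. \<Sum>m\<in>?U. B w $$ (i, l) * (B (inv w) $$ (l, m) * B x $$ (m, j)))"
    by (subst sum.swap, rule sum.cong[OF refl], rule sum.swap)
  also have "\<dots> = (\<Sum>w\<in>carrier G. \<Sum>l\<in>?U. B w $$ (i, l) * B (inv w \<otimes> x) $$ (l, j))"
    using x ij by (intro sum.cong refl) (simp add: low sum_distrib_left)
  \<comment> \<open>Replacing w by x w turns \<open>inv w \<otimes> x\<close> into
    \<open>inv w\<close> and releases a factor \<open>B x\<close> on the left.\<close>
  also have "\<dots> = (\<Sum>w\<in>carrier G. \<Sum>l\<in>?U. B (x \<otimes> w) $$ (i, l) * B (inv (x \<otimes> w) \<otimes> x) $$ (l, j))"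
    by (rule sum_shift[OF x])
  also have "\<dots> = (\<Sum>w\<in>carrier G. \<Sum>l\<in>?U. (\<Sum>m<d. B x $$ (i, m) * B w $$ (m, l)) * B (inv w) $$ (l, j))"
    using x ij k by (intro sum.cong refl) (auto simp: inv_mult_group m_assoc rep_entry_mult[OF r])
  also have "\<dots> = (\<Sum>w\<in>carrier G. \<Sum>m<d. \<Sum>l\<in>?U. B x $$ (i, m) * (B w $$ (m, l) * B (inv w) $$ (l, j)))"
    by (rule sum.cong[OF refl], simp only: sum_distrib_right mult.assoc, rule sum.swap)
  also have "\<dots> = (\<Sum>m<d. B x $$ (i, m) * Z m j)"
    by (subst sum.swap) (simp add: Z_def sum_distrib_left)
  also have "\<dots> = (\<Sum>m<k. B x $$ (i, m) * Z m j) + (\<Sum>m\<in>?U. B x $$ (i, m) * Z m j)"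
    unfolding split by (intro sum.union_disjoint) auto
  also have "(\<Sum>m\<in>?U. B x $$ (i, m) * Z m j) = (\<Sum>m\<in>?U. if m = j then B x $$ (i, m) * of_nat (card (carrier G)) else 0)"
  proof (intro sum.cong refl)
    fix m assume m: "m \<in> ?U"
    have "Z m j = (\<Sum>w\<in>carrier G. if m = j then 1 else 0)"
      unfolding Z_def using m ij by (intro sum.cong) (auto simp: rep_one[OF r] simp flip: low)
    then show "B x $$ (i, m) * Z m j = (if m = j then B x $$ (i, m) * of_nat (card (carrier G)) else 0)" by simp
  qed
  also have "\<dots> = of_nat (card (carrier G)) * B x $$ (i, j)" using ij by (simp add: sum.delta')
  finally show ?thesis by simp
qed

text \<open>Induction on the degree. A reducible representation is conjugate to a block triangular
  one; its diagonal blocks have smaller degree, one block is zero, and the coefficients of the last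
  one are combinations of those of the diagonal blocks.\<close>

lemma annihilates_all_reps:
  assumes fin: "finite (carrier G)"
    and f: "\<And>d \<rho> i j. irred_rep G d \<rho> \<Longrightarrow> i < d \<Longrightarrow> j < d \<Longrightarrow> (\<Sum>g\<in>carrier G. f g * \<rho> g $$ (i, j)) = 0"
    and r: "is_rep G d \<rho>" and ij: "i < d" "j < d"
  shows "(\<Sum>g\<in>carrier G. f g * \<rho> g $$ (i, j)) = 0"
  using r ij
proof (induction d arbitrary: \<rho> i j rule: less_induct)
  case (less d)
  note r = less.prems(1)
  show ?case
  proof (cases "irred_rep G d \<rho>")
    case True then show ?thesis using f less.prems by blast
  next
    case False
    then obtain k P Q where k: "0 < k" "k < d" and P: "P \<in> carrier_mat d d" "Q \<in> carrier_mat d d" "P * Q = 1\<^sub>m d" "Q * P = 1\<^sub>m d"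
      and z: "\<And>g i j. g \<in> carrier G \<Longrightarrow> k \<le> i \<Longrightarrow> i < d \<Longrightarrow> j < k \<Longrightarrow> (Q * \<rho> g * P) $$ (i, j) = 0"
      using less.prems unfolding irred_rep_def by (metis gr_zeroI not_less_zero)
    define B where "B g = Q * \<rho> g * P" for g
    have r': "is_rep G d B" unfolding B_def using conj_rep[OF r P] .
    have zB: "\<And>g i j. g \<in> carrier G \<Longrightarrow> k \<le> i \<Longrightarrow> i < d \<Longrightarrow> j < k \<Longrightarrow> B g $$ (i, j) = 0"
      using z by (simp add: B_def)
    let ?U = "{k..<d}"
    have split: "{..<d} = {..<k} \<union> ?U" using k by auto
    have rA: "is_rep G k (\<lambda>g. mat k k (\<lambda>(i, j). B g $$ (i, j)))"
      unfolding is_rep_def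
    proof (intro conjI ballI)
      fix g h assume gh: "g \<in> carrier G" "h \<in> carrier G"
      show "mat k k (\<lambda>(i, j). B (g \<otimes> h) $$ (i, j)) = mat k k (\<lambda>(i, j). B g $$ (i, j)) * mat k k (\<lambda>(i, j). B h $$ (i, j))"
      proof (rule eq_matI, goal_cases)
        case (1 i j)
        then have "B (g \<otimes> h) $$ (i, j) = (\<Sum>l<d. B g $$ (i, l) * B h $$ (l, j))"
          using gh k by (intro rep_entry_mult[OF r']) auto
        also have "\<dots> = (\<Sum>l<k. B g $$ (i, l) * B h $$ (l, j))"
          using gh zB k 1 by (intro sum.mono_neutral_right) auto
        finally show ?case using 1 by (subst mat_mult_entry[of _ k k _ k]) auto
      qed auto
    qed (use k rep_one[OF r'] in \<open>auto intro!: eq_matI\<close>)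
    have rD: "is_rep G (d - k) (\<lambda>g. mat (d - k) (d - k) (\<lambda>(i, j). B g $$ (i + k, j + k)))"
      unfolding is_rep_def
    proof (intro conjI ballI)
      fix g h assume gh: "g \<in> carrier G" "h \<in> carrier G"
      show "mat (d - k) (d - k) (\<lambda>(i, j). B (g \<otimes> h) $$ (i + k, j + k)) =
        mat (d - k) (d - k) (\<lambda>(i, j). B g $$ (i + k, j + k)) * mat (d - k) (d - k) (\<lambda>(i, j). B h $$ (i + k, j + k))"
      proof (rule eq_matI, goal_cases)
        case (1 i j)
        then have "B (g \<otimes> h) $$ (i + k, j + k) = (\<Sum>l<d. B g $$ (i + k, l) * B h $$ (l, j + k))"
          using gh k by (intro rep_entry_mult[OF r']) auto
        also have "\<dots> = (\<Sum>l\<in>?U. B g $$ (i + k, l) * B h $$ (l, j + k))"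
          using gh zB k 1 by (intro sum.mono_neutral_right) auto
        also have "\<dots> = (\<Sum>l<d - k. B g $$ (i + k, l + k) * B h $$ (l + k, j + k))"
          using k by (intro sum.reindex_bij_witness[of _ "\<lambda>l. l + k" "\<lambda>l. l - k"]) auto
        finally show ?case using 1 by (subst mat_mult_entry[of _ "d - k" "d - k" _ "d - k"]) auto
      qed auto
    qed (use k rep_one[OF r'] in \<open>auto intro!: eq_matI\<close>)
    have A0: "(\<Sum>g\<in>carrier G. f g * B g $$ (i, j)) = 0" if "i < k" "j < k" for i j
      using less.IH[OF k(2) rA that] that by simp
    have D0: "(\<Sum>g\<in>carrier G. f g * B g $$ (i, j)) = 0" if "i \<in> ?U" "j \<in> ?U" for i j
      using less.IH[of "d - k", OF _ rD, of "i - k" "j - k"] that k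
        diff_less_mono[of i d k] diff_less_mono[of j d k] by simp
    have B0: "(\<Sum>g\<in>carrier G. f g * B g $$ (i, j)) = 0" if ij: "i < k" "k \<le> j" "j < d" for i j
    proof -
      define Z where "Z = (\<lambda>i j. \<Sum>w\<in>carrier G. \<Sum>l\<in>?U. B w $$ (i, l) * B (inv w) $$ (l, j))"
      let ?N = "of_nat (card (carrier G)) :: complex"
      have "?N * (\<Sum>g\<in>carrier G. f g * B g $$ (i, j)) = (\<Sum>g\<in>carrier G. f g * (?N * B g $$ (i, j)))"
        by (simp add: sum_distrib_left mult_ac)
      also have "\<dots> = (\<Sum>g\<in>carrier G. f g * ((\<Sum>m\<in>?U. Z i m * B g $$ (m, j)) - (\<Sum>m<k. B g $$ (i, m) * Z m j)))"
        unfolding Z_def using k by (intro sum.cong refl arg_cong2[where f = "(*)"] off_diagonal_coboundary[OF r' _ fin zB _ ij]) auto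
      also have "\<dots> = (\<Sum>g\<in>carrier G. \<Sum>m\<in>?U. Z i m * (f g * B g $$ (m, j))) - (\<Sum>g\<in>carrier G. \<Sum>m<k. Z m j * (f g * B g $$ (i, m)))"
        by (simp add: right_diff_distrib sum_subtractf sum_distrib_left mult_ac)
      also have "\<dots> = (\<Sum>m\<in>?U. Z i m * (\<Sum>g\<in>carrier G. f g * B g $$ (m, j))) - (\<Sum>m<k. Z m j * (\<Sum>g\<in>carrier G. f g * B g $$ (i, m)))"
        by (simp add: sum.swap[of _ _ "carrier G"] sum_distrib_left)
      also have "\<dots> = 0" using A0 D0 ij by simp
      finally show ?thesis using fin one_closed by auto
    qed
    have all0: "(\<Sum>g\<in>carrier G. f g * B g $$ (i, j)) = 0" if "i < d" "j < d" for i j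
      using that A0 B0 D0 zB by (cases "i < k"; cases "j < k") auto
    have "(\<Sum>g\<in>carrier G. f g * \<rho> g $$ (i, j)) = (\<Sum>g\<in>carrier G. \<Sum>s<d. \<Sum>t<d. P $$ (i, s) * Q $$ (t, j) * (f g * B g $$ (s, t)))"
    proof (intro sum.cong refl)
      fix g assume g: "g \<in> carrier G"
      note R = rep_mat[OF r g]
      have "\<rho> g = P * B g * Q"
      proof -
        have "P * B g * Q = (P * Q) * (\<rho> g * (P * Q))" unfolding B_def using R P(1,2)
          by (simp add: assoc_mult_mat[of _ d d _ d _ d])
        then show ?thesis using R P by simp
      qed
      then have "\<rho> g $$ (i, j) = (\<Sum>s<d. \<Sum>t<d. P $$ (i, s) * B g $$ (s, t) * Q $$ (t, j))"
        using mat3_entry[OF P(1) rep_mat[OF r' g] P(2)] less.prems by simp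
      then show "f g * \<rho> g $$ (i, j) = (\<Sum>s<d. \<Sum>t<d. P $$ (i, s) * Q $$ (t, j) * (f g * B g $$ (s, t)))"
        by (simp add: sum_distrib_left mult_ac)
    qed
    also have "\<dots> = (\<Sum>s<d. \<Sum>t<d. P $$ (i, s) * Q $$ (t, j) * (\<Sum>g\<in>carrier G. f g * B g $$ (s, t)))"
      by (simp add: sum.swap[of _ _ "carrier G"] sum_distrib_left)
    finally show ?thesis using all0 by simp
  qed
qed

text \<open>In the regular representation, the coefficient in row g and in the column of the unit
  element is the indicator function of g.\<close>

lemma irreps_separate:
  assumes fin: "finite (carrier G)"
    and f: "\<And>d \<rho> i j. irred_rep G d \<rho> \<Longrightarrow> i < d \<Longrightarrow> j < d \<Longrightarrow> (\<Sum>g\<in>carrier G. f g * \<rho> g $$ (i, j)) = 0"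
    and g: "g \<in> carrier G"
  shows "f g = (0 :: complex)"
proof -
  let ?N = "card (carrier G)"
  obtain e where e: "bij_betw e {..<?N} (carrier G)"
    using ex_bij_betw_nat_finite[OF fin] by (auto simp: atLeast0LessThan)
  have eG: "i < ?N \<Longrightarrow> e i \<in> carrier G" for i using e by (auto dest: bij_betwE)
  have einj: "i < ?N \<Longrightarrow> j < ?N \<Longrightarrow> e i = e j \<longleftrightarrow> i = j" for i j
    using e unfolding bij_betw_def inj_on_def by auto
  define \<rho> where "\<rho> x = (mat ?N ?N (\<lambda>(i, j). if e i = x \<otimes> e j then 1 else 0) :: complex mat)" for x
  have "is_rep G ?N \<rho>"
    unfolding is_rep_def
  proof (intro conjI ballI)
    fix x y assume xy: "x \<in> carrier G" "y \<in> carrier G"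
    show "\<rho> (x \<otimes> y) = \<rho> x * \<rho> y"
    proof (rule eq_matI, goal_cases)
      case (1 i j)
      then have ij: "i < ?N" "j < ?N" by (auto simp: \<rho>_def)
      have "(\<rho> x * \<rho> y) $$ (i, j) = (\<Sum>k<?N. \<rho> x $$ (i, k) * \<rho> y $$ (k, j))"
        using ij by (intro mat_mult_entry[of _ ?N ?N _ ?N]) (auto simp: \<rho>_def)
      also have "\<dots> = (\<Sum>k<?N. (if e i = x \<otimes> e k then 1 else 0) * (if e k = y \<otimes> e j then 1 else 0))"
        using ij by (intro sum.cong) (auto simp: \<rho>_def)
      also have "\<dots> = (\<Sum>z\<in>carrier G. (if e i = x \<otimes> z then 1 else 0) * (if z = y \<otimes> e j then 1 else 0))"
        by (rule sum.reindex_bij_betw[OF e])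
      also have "\<dots> = (\<Sum>z\<in>carrier G. if z = y \<otimes> e j then if e i = x \<otimes> z then 1 else 0 else 0)"
        by (intro sum.cong) auto
      also have "\<dots> = (if e i = x \<otimes> (y \<otimes> e j) then 1 else 0)"
        using fin xy eG ij by (simp add: sum.delta')
      finally show ?case using ij xy eG by (simp add: \<rho>_def m_assoc)
    qed (auto simp: \<rho>_def)
  qed (use einj eG in \<open>auto simp: \<rho>_def intro!: eq_matI\<close>)
  then have rep: "is_rep G ?N \<rho>" .
  have im: "e ` {..<?N} = carrier G" using e by (simp add: bij_betw_def)
  have "g \<in> e ` {..<?N}" "\<one> \<in> e ` {..<?N}" unfolding im using g by simp_all
  then obtain i j where "i < ?N" "g = e i" "j < ?N" "\<one> = e j" by (elim imageE) simp
  then have ij: "i < ?N" "j < ?N" "e i = g" "e j = \<one>" by simp_all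
  have "(\<Sum>x\<in>carrier G. f x * \<rho> x $$ (i, j)) = 0"
    by (rule annihilates_all_reps[OF fin _ rep ij(1,2)]) (rule f)
  moreover have "(\<Sum>x\<in>carrier G. f x * \<rho> x $$ (i, j)) = (\<Sum>x\<in>carrier G. if x = g then f x else 0)"
    using ij by (intro sum.cong) (auto simp: \<rho>_def)
  ultimately show ?thesis using fin g by (simp add: sum.delta')
qed

end

section \<open>Abelian numbers and Galois twists\<close>

lemma Qab_1 [simp]: "1 \<in> Qab"
  by (rule Qab.root) (auto simp: root_of_unity_def intro: exI[of _ 1])

lemma Qab_0 [simp]: "0 \<in> Qab"
  using Qab.add[OF Qab_1 Qab.neg[OF Qab_1]] by simp

lemma Qab_sum: "(\<And>x. x \<in> A \<Longrightarrow> f x \<in> Qab) \<Longrightarrow> sum f A \<in> Qab"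
  by (induction A rule: infinite_finite_induct) (auto intro: Qab.add)

lemma Qab_prod: "(\<And>x. x \<in> A \<Longrightarrow> f x \<in> Qab) \<Longrightarrow> prod f A \<in> Qab"
  by (induction A rule: infinite_finite_induct) (auto intro: Qab.mul)

lemma Qab_of_nat [simp]: "of_nat n \<in> Qab"
  by (induction n) (auto intro: Qab.add)

lemma Qab_divide: "x \<in> Qab \<Longrightarrow> y \<in> Qab \<Longrightarrow> x / y \<in> Qab"
  by (cases "y = 0") (auto simp: divide_inverse intro: Qab.mul Qab.inv)

lemma root_of_unity_1 [simp]: "root_of_unity 1"
  by (auto simp: root_of_unity_def intro: exI[of _ 1])

lemma root_of_unity_nonzero: "root_of_unity z \<Longrightarrow> z \<noteq> 0"
  by (auto simp: root_of_unity_def power_0_left)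

lemma root_of_unity_mult:
  assumes "root_of_unity x" "root_of_unity y" shows "root_of_unity (x * y)"
proof -
  obtain m n where "0 < m" "x ^ m = 1" "0 < n" "y ^ n = 1" using assms by (auto simp: root_of_unity_def)
  then have "(x * y) ^ (m * n) = 1" by (simp add: power_mult_distrib power_mult) (metis power_commutes power_mult power_one mult.commute)
  then show ?thesis using \<open>0 < m\<close> \<open>0 < n\<close> unfolding root_of_unity_def by (intro exI[of _ "m * n"]) simp
qed

lemma root_of_unity_prod: "(\<And>x. x \<in> A \<Longrightarrow> root_of_unity (f x)) \<Longrightarrow> root_of_unity (prod f A)"
  by (induction A rule: infinite_finite_induct) (auto intro: root_of_unity_mult)

section \<open>Matrices over \<open>Qab\<close>, traces and injective matrices\<close>

definition mat_Qab :: "complex mat \<Rightarrow> bool" where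
  "mat_Qab A \<longleftrightarrow> (\<forall>i<dim_row A. \<forall>j<dim_col A. A $$ (i, j) \<in> Qab)"

lemma mat_Qab_mult:
  assumes "A \<in> carrier_mat a b" "B \<in> carrier_mat b c" "mat_Qab A" "mat_Qab B"
  shows "mat_Qab (A * B)"
  unfolding mat_Qab_def
proof (intro allI impI)
  fix i j assume "i < dim_row (A * B)" "j < dim_col (A * B)"
  then have "i < a" "j < c" using assms by auto
  then show "(A * B) $$ (i, j) \<in> Qab"
    unfolding mat_mult_entry[OF assms(1,2) \<open>i < a\<close> \<open>j < c\<close>]
    using assms by (intro Qab_sum Qab.mul) (auto simp: mat_Qab_def)
qed

lemma mat_Qab_smult: "c \<in> Qab \<Longrightarrow> mat_Qab A \<Longrightarrow> mat_Qab (c \<cdot>\<^sub>m A)"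
  by (simp add: mat_Qab_def Qab.mul)

lemma det_Qab:
  assumes "A \<in> carrier_mat n n" "mat_Qab A" shows "det A \<in> Qab"
  unfolding det_def'[OF assms(1)]
proof (intro Qab_sum Qab.mul Qab_prod)
  fix p i assume p: "p \<in> {p. p permutes {0..<n}}" and "i \<in> {0..<n}"
  then have "p i < n" by (metis atLeastLessThan_iff mem_Collect_eq permutes_in_image)
  then show "A $$ (i, p i) \<in> Qab" using assms \<open>i \<in> {0..<n}\<close> by (auto simp: mat_Qab_def)
next
  fix p show "(signof p :: complex) \<in> Qab" by (cases "evenperm p") (auto simp: sign_def intro: Qab.neg)
qed

text \<open>By Cramer's rule the inverse is the adjugate divided by the determinant, and both of
  these are polynomials in the entries.\<close>

lemma mat_Qab_inverse:
  assumes A: "A \<in> carrier_mat n n" "mat_Qab A" and B: "B \<in> carrier_mat n n" "A * B = 1\<^sub>m n" "B * A = 1\<^sub>m n"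
  shows "mat_Qab B"
proof -
  have adj: "adj_mat A \<in> carrier_mat n n" "A * adj_mat A = det A \<cdot>\<^sub>m 1\<^sub>m n" using adj_mat[OF A(1)] by auto
  have "det A * det B = 1" using det_mult[OF A(1) B(1)] B by simp
  then have nz: "det A \<noteq> 0" by auto
  have "mat_Qab (adj_mat A)"
    unfolding mat_Qab_def
  proof (intro allI impI)
    fix i j assume ij: "i < dim_row (adj_mat A)" "j < dim_col (adj_mat A)"
    have "mat_delete A j i \<in> carrier_mat (n - 1) (n - 1)" using A by (intro mat_delete_carrier)
    moreover have "mat_Qab (mat_delete A j i)" using A ij adj by (auto simp: mat_Qab_def mat_delete_def)
    ultimately have "det (mat_delete A j i) \<in> Qab" by (rule det_Qab)
    moreover have "(- 1) ^ k \<in> Qab" for k by (induction k) (auto intro: Qab.neg)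
    ultimately show "adj_mat A $$ (i, j) \<in> Qab"
      using ij adj A by (auto simp: adj_mat_def cofactor_def intro: Qab.mul)
  qed
  moreover have "adj_mat A = det A \<cdot>\<^sub>m B"
  proof -
    have "adj_mat A = (B * A) * adj_mat A" using B adj by simp
    also have "\<dots> = B * (A * adj_mat A)" using A B adj by (intro assoc_mult_mat)
    also have "\<dots> = det A \<cdot>\<^sub>m B" unfolding adj(2) using B mult_smult_distrib[OF B(1), of "1\<^sub>m n" n "det A"] by simp
    finally show ?thesis .
  qed
  ultimately have "mat_Qab (det A \<cdot>\<^sub>m B)" by simp
  then have "mat_Qab (inverse (det A) \<cdot>\<^sub>m (det A \<cdot>\<^sub>m B))"
    by (rule mat_Qab_smult[OF Qab.inv[OF det_Qab[OF A] nz]])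
  moreover have "inverse (det A) \<cdot>\<^sub>m (det A \<cdot>\<^sub>m B) = B" using nz by (intro eq_matI) auto
  ultimately show ?thesis by (simp only:)
qed

lemma mat_trace_comm:
  assumes "A \<in> carrier_mat a b" "B \<in> carrier_mat b a"
  shows "mat_trace (A * B) = mat_trace (B * A)"
proof -
  have "mat_trace (A * B) = (\<Sum>i<a. \<Sum>k<b. A $$ (i, k) * B $$ (k, i))"
    using assms mat_mult_entry[OF assms] by (subst mat_trace_eq[of _ a]) auto
  also have "\<dots> = (\<Sum>k<b. \<Sum>i<a. B $$ (k, i) * A $$ (i, k))"
    by (subst sum.swap) (simp add: mult.commute)
  also have "\<dots> = mat_trace (B * A)"
    using assms mat_mult_entry[OF assms(2,1)] by (subst mat_trace_eq[of _ b]) auto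
  finally show ?thesis .
qed

lemma mat_trace_conj:
  assumes "A \<in> carrier_mat d d" "M \<in> carrier_mat d d" "M' \<in> carrier_mat d d" "M' * M = 1\<^sub>m d"
  shows "mat_trace (M * A * M') = mat_trace A"
proof -
  have "mat_trace (M * A * M') = mat_trace (M' * (M * A))" using assms by (intro mat_trace_comm[of _ d d]) auto
  also have "M' * (M * A) = (M' * M) * A" using assms by (intro assoc_mult_mat[symmetric]) auto
  finally show ?thesis using assms by simp
qed

lemma mat_trace_one [simp]: "mat_trace (1\<^sub>m d) = of_nat d"
  by (simp add: mat_trace_def)

lemma injective_square_invertible:
  fixes C :: "complex mat"
  assumes C: "C \<in> carrier_mat d d" and inj: "\<And>x. x \<in> carrier_vec d \<Longrightarrow> C *\<^sub>v x = 0\<^sub>v d \<Longrightarrow> x = 0\<^sub>v d"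
  shows "\<exists>C'. C' \<in> carrier_mat d d \<and> C * C' = 1\<^sub>m d \<and> C' * C = 1\<^sub>m d"
proof -
  have nz: "det C \<noteq> 0" using det_0_iff_vec_prod_zero[OF C] inj by blast
  define D where "D = inverse (det C) \<cdot>\<^sub>m adj_mat C"
  have D: "D \<in> carrier_mat d d" using adj_mat[OF C] by (simp add: D_def)
  have "C * D = inverse (det C) \<cdot>\<^sub>m (C * adj_mat C)" unfolding D_def using C adj_mat[OF C] by (intro mult_smult_distrib) auto
  also have "\<dots> = 1\<^sub>m d" using adj_mat[OF C] nz by (intro eq_matI) auto
  finally show ?thesis using D mat_mult_left_right_inverse[OF C D] by blast
qed

text \<open>With fewer rows than columns, \<open>C\<close> could be filled up with zero rows to a
  singular square matrix, whose kernel vectors are killed by \<open>C\<close>.\<close>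

lemma injective_imp_le:
  fixes C :: "complex mat"
  assumes C: "C \<in> carrier_mat e d" and inj: "\<And>x. x \<in> carrier_vec d \<Longrightarrow> C *\<^sub>v x = 0\<^sub>v e \<Longrightarrow> x = 0\<^sub>v d"
  shows "d \<le> e"
proof (rule ccontr)
  assume "\<not> d \<le> e"
  then have e: "e < d" by simp
  define B where "B = mat d d (\<lambda>(i, j). if i < e then C $$ (i, j) else 0)"
  have B: "B \<in> carrier_mat d d" by (simp add: B_def)
  have "det B = 0"
    unfolding det_def'[OF B]
  proof (intro sum.neutral ballI)
    fix q assume "q \<in> {q. q permutes {0..<d}}"
    then have "q e < d" using e by (metis atLeastLessThan_iff mem_Collect_eq permutes_in_image zero_le)
    then have "B $$ (e, q e) = 0" using e by (simp add: B_def)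
    then have "(\<Prod>i = 0..<d. B $$ (i, q i)) = 0" using e by (intro prod_zero) auto
    then show "signof q * (\<Prod>i = 0..<d. B $$ (i, q i)) = 0" by simp
  qed
  then obtain v where v: "v \<in> carrier_vec d" "v \<noteq> 0\<^sub>v d" "B *\<^sub>v v = 0\<^sub>v d"
    using det_0_iff_vec_prod_zero[OF B] by blast
  have "C *\<^sub>v v = 0\<^sub>v e"
  proof (rule eq_vecI)
    fix i assume "i < dim_vec (0\<^sub>v e :: complex vec)"
    then have i: "i < e" by simp
    have "(C *\<^sub>v v) $ i = (\<Sum>k<d. C $$ (i, k) * v $ k)" using C v i by (intro mult_vec_entry)
    also have "\<dots> = (B *\<^sub>v v) $ i" using B v i e by (subst mult_vec_entry[of _ d d]) (auto simp: B_def)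
    finally show "(C *\<^sub>v v) $ i = 0\<^sub>v e $ i" using v i e by simp
  qed (use C in auto)
  then show False using inj v by blast
qed

section \<open>Similarity of representations from their characters and coefficients\<close>

context group
begin

text \<open>The averaged matrix unit has a nonzero entry by assumption, so it is injective. Its
  entries are sums of products of coefficients, which is why base changes exist over
  \<open>Qab\<close> as soon as both representations are given over \<open>Qab\<close>.\<close>

lemma nonzero_intertwiner:
  assumes irr: "irred_rep G d \<rho>" and r': "is_rep G e \<rho>'"
    and nz: "(\<Sum>g\<in>carrier G. \<rho>' g $$ (i, a) * \<rho> (inv g) $$ (b, j)) \<noteq> 0"
    and ij: "i < e" "a < e" "b < d" "j < d"
  obtains C where "C \<in> carrier_mat e d" "\<forall>g\<in>carrier G. \<rho>' g * C = C * \<rho> g"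
    "\<forall>x\<in>carrier_vec d. C *\<^sub>v x = 0\<^sub>v e \<longrightarrow> x = 0\<^sub>v d"
    "(\<forall>g\<in>carrier G. mat_Qab (\<rho> g) \<and> mat_Qab (\<rho>' g)) \<longrightarrow> mat_Qab C"
proof -
  have r: "is_rep G d \<rho>" using irr by (simp add: irred_rep_def)
  define C where "C = mat e d (\<lambda>(i, j). \<Sum>g\<in>carrier G. \<rho>' g $$ (i, a) * \<rho> (inv g) $$ (b, j))"
  have C: "C \<in> carrier_mat e d" by (simp add: C_def)
  have int: "\<rho>' g * C = C * \<rho> g" if "g \<in> carrier G" for g
    unfolding C_def by (rule average_intertwines[OF r r' ij(2,3) that])
  have "C $$ (i, j) \<noteq> 0" using nz ij by (simp add: C_def)
  then have Cnz: "C \<noteq> 0\<^sub>m e d" using ij by auto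
  have inj: "x = 0\<^sub>v d" if "x \<in> carrier_vec d" "C *\<^sub>v x = 0\<^sub>v e" for x
    by (rule intertwiner_injective[OF irr C Cnz rep_mat[OF r'] int that])
  have "mat_Qab C" if Q: "\<forall>g\<in>carrier G. mat_Qab (\<rho> g) \<and> mat_Qab (\<rho>' g)"
    unfolding mat_Qab_def
  proof (intro allI impI)
    fix s t assume "s < dim_row C" "t < dim_col C"
    then have st: "s < e" "t < d" by (auto simp: C_def)
    have "\<rho>' g $$ (s, a) \<in> Qab" "\<rho> (inv g) $$ (b, t) \<in> Qab" if "g \<in> carrier G" for g
    proof -
      have "mat_Qab (\<rho>' g)" "mat_Qab (\<rho> (inv g))" using Q that by auto
      then show "\<rho>' g $$ (s, a) \<in> Qab" "\<rho> (inv g) $$ (b, t) \<in> Qab"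
        unfolding mat_Qab_def using ij st carrier_matD[OF rep_mat[OF r inv_closed[OF that]]] carrier_matD[OF rep_mat[OF r' that]]
        by simp_all
    qed
    then show "C $$ (s, t) \<in> Qab" using st by (auto simp: C_def intro!: Qab_sum Qab.mul)
  qed
  then show thesis using int inj by (intro that[OF C]) blast+
qed

text \<open>Equality of the characters makes the sum of
  \<open>mat_trace (\<rho>' g) * mat_trace (\<rho> (inv g))\<close> equal to |G|. So one of the
  coefficient sums it consists of is nonzero and yields an injective intertwiner, which is square
  and hence invertible.\<close>

lemma equal_char_similar:
  assumes fin: "finite (carrier G)" and irr: "irred_rep G d \<rho>" and r': "is_rep G d \<rho>'"
    and tr: "\<And>g. g \<in> carrier G \<Longrightarrow> mat_trace (\<rho>' g) = mat_trace (\<rho> g)"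
  shows "\<exists>M M'. M \<in> carrier_mat d d \<and> M' \<in> carrier_mat d d \<and> M * M' = 1\<^sub>m d \<and> M' * M = 1\<^sub>m d \<and>
    (\<forall>g\<in>carrier G. \<rho>' g = M' * \<rho> g * M) \<and>
    ((\<forall>g\<in>carrier G. mat_Qab (\<rho> g) \<and> mat_Qab (\<rho>' g)) \<longrightarrow> mat_Qab M \<and> mat_Qab M')"
proof -
  have r: "is_rep G d \<rho>" and d: "0 < d" using irr by (auto simp: irred_rep_def)
  have so: "schur_orth G d \<rho>" by (rule irred_imp_schur_orth[OF irr])
  have "\<exists>i<d. \<exists>a<d. (\<Sum>g\<in>carrier G. \<rho>' g $$ (i, i) * \<rho> (inv g) $$ (a, a)) \<noteq> 0"
  proof (rule ccontr)
    assume "\<not> ?thesis"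
    then have "(\<Sum>i<d. \<Sum>a<d. \<Sum>g\<in>carrier G. \<rho>' g $$ (i, i) * \<rho> (inv g) $$ (a, a)) = 0" by (intro sum.neutral) auto
    moreover have "(\<Sum>i<d. \<Sum>a<d. \<Sum>g\<in>carrier G. \<rho>' g $$ (i, i) * \<rho> (inv g) $$ (a, a)) =
       (\<Sum>g\<in>carrier G. mat_trace (\<rho>' g) * mat_trace (\<rho> (inv g)))"
    proof -
      have "(\<Sum>g\<in>carrier G. mat_trace (\<rho>' g) * mat_trace (\<rho> (inv g))) =
         (\<Sum>g\<in>carrier G. \<Sum>i<d. \<Sum>a<d. \<rho>' g $$ (i, i) * \<rho> (inv g) $$ (a, a))"
        using rep_mat[OF r] rep_mat[OF r'] by (intro sum.cong refl) (simp add: mat_trace_eq[of _ d] sum_product)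
      then show ?thesis by (simp add: sum.swap[of _ _ "carrier G"])
    qed
    moreover have "\<dots> = of_nat (card (carrier G))" using orth_char_sum[OF so d r] tr by simp
    ultimately show False using fin one_closed by auto
  qed
  then obtain i a where ia: "i < d" "a < d" "(\<Sum>g\<in>carrier G. \<rho>' g $$ (i, i) * \<rho> (inv g) $$ (a, a)) \<noteq> 0" by blast
  obtain C where C0: "C \<in> carrier_mat d d" "\<forall>g\<in>carrier G. \<rho>' g * C = C * \<rho> g"
    "\<forall>x\<in>carrier_vec d. C *\<^sub>v x = 0\<^sub>v d \<longrightarrow> x = 0\<^sub>v d"
    and CQ: "(\<forall>g\<in>carrier G. mat_Qab (\<rho> g) \<and> mat_Qab (\<rho>' g)) \<longrightarrow> mat_Qab C"
    by (rule nonzero_intertwiner[OF irr r' ia(3,1,1,2,2)])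
  note C = C0(1) C0(2)[rule_format] C0(3)[rule_format]
  obtain C' where C': "C' \<in> carrier_mat d d" "C * C' = 1\<^sub>m d" "C' * C = 1\<^sub>m d"
    using injective_square_invertible[OF C(1,3)] by blast
  have "\<rho>' g = C * \<rho> g * C'" if g: "g \<in> carrier G" for g
  proof -
    note R = rep_mat[OF r g] rep_mat[OF r' g]
    have "C * \<rho> g * C' = \<rho>' g * C * C'" using C(2)[OF g] by simp
    also have "\<dots> = \<rho>' g * (C * C')" using R C C' by (intro assoc_mult_mat)
    finally show ?thesis using R C' by simp
  qed
  moreover have "mat_Qab C \<and> mat_Qab C'" if "\<forall>g\<in>carrier G. mat_Qab (\<rho> g) \<and> mat_Qab (\<rho>' g)"
    using CQ that mat_Qab_inverse[OF C(1) _ C'] by simp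
  ultimately show ?thesis using C(1) C' by (intro exI[of _ C'] exI[of _ C]) simp
qed

text \<open>The degree is the value at the unit element, and similarity then carries the
  orthogonality relations from \<rho> to \<rho>'. This is how a projective representation associated
  with an irreducible character is recognised as irreducible on the normal subgroup.\<close>

lemma irred_of_equal_char:
  assumes fin: "finite (carrier G)" and irr: "irred_rep G d \<rho>" and r': "is_rep G e \<rho>'"
    and tr: "\<And>g. g \<in> carrier G \<Longrightarrow> mat_trace (\<rho>' g) = mat_trace (\<rho> g)"
  shows "e = d \<and> irred_rep G e \<rho>'"
proof -
  have r: "is_rep G d \<rho>" and d: "0 < d" using irr by (auto simp: irred_rep_def)
  have "(of_nat e :: complex) = of_nat d" using tr[OF one_closed] rep_one[OF r] rep_one[OF r'] by simp
  then have ed: "e = d" by simp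
  obtain M M' where M: "M \<in> carrier_mat d d" "M' \<in> carrier_mat d d" "M * M' = 1\<^sub>m d" "M' * M = 1\<^sub>m d"
    "\<And>g. g\<in>carrier G \<Longrightarrow> \<rho>' g = M' * \<rho> g * M"
    using equal_char_similar[OF fin irr r'[unfolded ed] tr] by blast
  have "schur_orth G d (\<lambda>g. M' * \<rho> g * M)"
    by (rule schur_orth_conj[OF r irred_imp_schur_orth[OF irr] M(1-4)])
  then have "schur_orth G d \<rho>'" using M(5) by (simp add: schur_orth_def)
  then show ?thesis using schur_orth_imp_irred[OF r'[unfolded ed] _ d fin] ed by simp
qed

text \<open>Inverting the summation variable exchanges the two representations, so a nonzero pairing
  gives injective intertwiners in both directions; the degrees agree and the representations are
  similar.\<close>

lemma irreps_equal_char: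
  assumes irr: "irred_rep G d \<rho>" and irr': "irred_rep G e \<rho>'"
    and nz: "(\<Sum>g\<in>carrier G. \<rho>' g $$ (i, a) * \<rho> (inv g) $$ (b, j)) \<noteq> 0"
    and ij: "i < e" "a < e" "b < d" "j < d"
    and g: "g \<in> carrier G"
  shows "mat_trace (\<rho>' g) = mat_trace (\<rho> g)"
proof -
  have r: "is_rep G d \<rho>" and r': "is_rep G e \<rho>'" using irr irr' by (auto simp: irred_rep_def)
  obtain C where C0: "C \<in> carrier_mat e d" "\<forall>g\<in>carrier G. \<rho>' g * C = C * \<rho> g"
    "\<forall>x\<in>carrier_vec d. C *\<^sub>v x = 0\<^sub>v e \<longrightarrow> x = 0\<^sub>v d"
    "(\<forall>g\<in>carrier G. mat_Qab (\<rho> g) \<and> mat_Qab (\<rho>' g)) \<longrightarrow> mat_Qab C"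
    by (rule nonzero_intertwiner[OF irr r' nz ij])
  note C = C0(1) C0(2)[rule_format] C0(3)[rule_format]
  have nz': "(\<Sum>g\<in>carrier G. \<rho> g $$ (b, j) * \<rho>' (inv g) $$ (i, a)) \<noteq> 0"
    using nz by (subst sum_inv) (simp add: mult.commute)
  obtain C' where C'0: "C' \<in> carrier_mat d e" "\<forall>g\<in>carrier G. \<rho> g * C' = C' * \<rho>' g"
    "\<forall>x\<in>carrier_vec e. C' *\<^sub>v x = 0\<^sub>v d \<longrightarrow> x = 0\<^sub>v e"
    "(\<forall>g\<in>carrier G. mat_Qab (\<rho>' g) \<and> mat_Qab (\<rho> g)) \<longrightarrow> mat_Qab C'"
    by (rule nonzero_intertwiner[OF irr' r nz' ij(3,4,1,2)])
  note C' = C'0(1) C'0(3)[rule_format]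
  have ed: "e = d" using injective_imp_le[OF C(1,3)] injective_imp_le[OF C'] by simp
  obtain B where B: "B \<in> carrier_mat d d" "C * B = 1\<^sub>m d" "B * C = 1\<^sub>m d"
    using injective_square_invertible[OF C(1,3)[unfolded ed]] by blast
  note R = rep_mat[OF r g] rep_mat[OF r' g, unfolded ed] C(1)[unfolded ed]
  have "C * \<rho> g * B = \<rho>' g * C * B" using C(2)[OF g] by simp
  also have "\<dots> = \<rho>' g * (C * B)" using R B by (intro assoc_mult_mat)
  finally have "\<rho>' g = C * \<rho> g * B" using R B by simp
  then show ?thesis using mat_trace_conj[OF R(1) R(3) B(1,3)] by simp
qed

end

section \<open>Galois automorphisms of \<open>Qab\<close> acting on numbers and matrices\<close>

lemma galois_abD:
  assumes "galois_ab \<sigma>"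
  shows "x \<in> Qab \<Longrightarrow> \<sigma> x \<in> Qab" "x \<in> Qab \<Longrightarrow> y \<in> Qab \<Longrightarrow> \<sigma> (x + y) = \<sigma> x + \<sigma> y"
    "x \<in> Qab \<Longrightarrow> y \<in> Qab \<Longrightarrow> \<sigma> (x * y) = \<sigma> x * \<sigma> y" "x \<in> Qab \<Longrightarrow> y \<in> Qab \<Longrightarrow> \<sigma> x = \<sigma> y \<longleftrightarrow> x = y"
    "z \<notin> Qab \<Longrightarrow> \<sigma> z = z" "x \<in> Qab \<Longrightarrow> \<exists>y\<in>Qab. \<sigma> y = x"
proof -
  show "x \<in> Qab \<Longrightarrow> \<sigma> x \<in> Qab" using assms by (auto simp: galois_ab_def dest: bij_betwE)
  show "x \<in> Qab \<Longrightarrow> y \<in> Qab \<Longrightarrow> \<sigma> (x + y) = \<sigma> x + \<sigma> y" using assms by (auto simp: galois_ab_def)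
  show "x \<in> Qab \<Longrightarrow> y \<in> Qab \<Longrightarrow> \<sigma> (x * y) = \<sigma> x * \<sigma> y" using assms by (auto simp: galois_ab_def)
  show "x \<in> Qab \<Longrightarrow> y \<in> Qab \<Longrightarrow> \<sigma> x = \<sigma> y \<longleftrightarrow> x = y"
    using assms by (auto simp: galois_ab_def bij_betw_def inj_on_def)
  show "z \<notin> Qab \<Longrightarrow> \<sigma> z = z" using assms by (auto simp: galois_ab_def)
  have "\<sigma> ` Qab = Qab" using assms by (simp add: galois_ab_def bij_betw_def)
  then have "x \<in> \<sigma> ` Qab \<Longrightarrow> \<exists>y\<in>Qab. \<sigma> y = x" "x \<in> Qab \<Longrightarrow> x \<in> \<sigma> ` Qab" by blast+
  then show "x \<in> Qab \<Longrightarrow> \<exists>y\<in>Qab. \<sigma> y = x" by simp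
qed

lemma galois_ab_0: "galois_ab \<sigma> \<Longrightarrow> \<sigma> 0 = 0"
  using galois_abD(2)[of \<sigma> 0 0] by simp

lemma galois_ab_eq_0: "galois_ab \<sigma> \<Longrightarrow> \<sigma> x = 0 \<longleftrightarrow> x = 0"
  using galois_abD(4)[of \<sigma> x 0] galois_abD(5)[of \<sigma> x] galois_ab_0[of \<sigma>] by (cases "x \<in> Qab") auto

lemma galois_ab_1: "galois_ab \<sigma> \<Longrightarrow> \<sigma> 1 = 1"
  using galois_abD(3)[of \<sigma> 1 1] galois_ab_eq_0[of \<sigma> 1] by simp

lemma galois_ab_sum:
  assumes "galois_ab \<sigma>" "\<And>x. x \<in> A \<Longrightarrow> f x \<in> Qab" shows "\<sigma> (sum f A) = (\<Sum>x\<in>A. \<sigma> (f x))"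
  using assms(2)
  by (induction A rule: infinite_finite_induct) (auto simp: galois_ab_0 assms(1) galois_abD(2)[OF assms(1)] Qab_sum)

lemma galois_ab_prod:
  assumes "galois_ab \<sigma>" "\<And>x. x \<in> A \<Longrightarrow> f x \<in> Qab" shows "\<sigma> (prod f A) = (\<Prod>x\<in>A. \<sigma> (f x))"
  using assms(2)
  by (induction A rule: infinite_finite_induct) (auto simp: galois_ab_1 assms(1) galois_abD(3)[OF assms(1)] Qab_prod)

lemma galois_ab_of_nat: "galois_ab \<sigma> \<Longrightarrow> \<sigma> (of_nat n) = of_nat n"
  by (induction n) (auto simp: galois_ab_0 galois_ab_1 galois_abD(2))

lemma galois_ab_inverse:
  assumes "galois_ab \<sigma>" "x \<in> Qab" shows "\<sigma> (inverse x) = inverse (\<sigma> x)"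
proof (cases "x = 0")
  case False
  then have "\<sigma> x * \<sigma> (inverse x) = 1" using galois_abD(3)[OF assms(1,2), of "inverse x"] assms Qab.inv by (simp add: galois_ab_1)
  then show ?thesis by (metis inverse_unique)
qed (simp add: galois_ab_0 assms)

lemma galois_ab_power: "galois_ab \<sigma> \<Longrightarrow> x \<in> Qab \<Longrightarrow> \<sigma> (x ^ n) = \<sigma> x ^ n"
  using galois_ab_prod[of \<sigma> "{..<n}" "\<lambda>_. x"] by simp

lemma galois_ab_root_of_unity: "galois_ab \<sigma> \<Longrightarrow> root_of_unity z \<Longrightarrow> root_of_unity (\<sigma> z)"
  unfolding root_of_unity_def
  by (metis Qab.root galois_ab_1 galois_ab_power root_of_unity_def)

lemma map_mat_galois_mult:
  assumes "galois_ab \<sigma>" "A \<in> carrier_mat a b" "B \<in> carrier_mat b c" "mat_Qab A" "mat_Qab B"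
  shows "map_mat \<sigma> (A * B) = map_mat \<sigma> A * map_mat \<sigma> B"
proof (rule eq_matI, goal_cases)
  case (1 i j)
  then have ij: "i < a" "j < c" using assms by auto
  have "\<sigma> ((A * B) $$ (i, j)) = \<sigma> (\<Sum>k<b. A $$ (i, k) * B $$ (k, j))"
    by (simp add: mat_mult_entry[OF assms(2,3) ij] del: index_mult_mat)
  also have "\<dots> = (\<Sum>k<b. \<sigma> (A $$ (i, k)) * \<sigma> (B $$ (k, j)))"
    using assms ij by (subst galois_ab_sum) (auto simp: mat_Qab_def galois_abD(3) intro!: Qab.mul)
  also have "\<dots> = (map_mat \<sigma> A * map_mat \<sigma> B) $$ (i, j)"
    using assms ij by (subst mat_mult_entry[of _ a b _ c]) auto
  finally show ?case using ij assms by (simp del: index_mult_mat(1))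
qed (use assms in auto)

lemma map_mat_galois_smult:
  assumes "galois_ab \<sigma>" "c \<in> Qab" "mat_Qab A"
  shows "map_mat \<sigma> (c \<cdot>\<^sub>m A) = \<sigma> c \<cdot>\<^sub>m map_mat \<sigma> A"
  using assms by (intro eq_matI) (auto simp: galois_abD(3) mat_Qab_def)

lemma map_mat_galois_one: "galois_ab \<sigma> \<Longrightarrow> map_mat \<sigma> (1\<^sub>m d) = 1\<^sub>m d"
  by (intro eq_matI) (auto simp: galois_ab_0 galois_ab_1)

lemma mat_Qab_map_galois: "galois_ab \<sigma> \<Longrightarrow> mat_Qab A \<Longrightarrow> mat_Qab (map_mat \<sigma> A)"
  by (auto simp: mat_Qab_def galois_abD)

lemma mat_trace_map_galois: "galois_ab \<sigma> \<Longrightarrow> mat_Qab A \<Longrightarrow> dim_row A = dim_col A \<Longrightarrow> mat_trace (map_mat \<sigma> A) = \<sigma> (mat_trace A)"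
  unfolding mat_trace_def by (subst galois_ab_sum) (auto simp: mat_Qab_def)

lemma map_mat_comp: "map_mat \<tau> (map_mat \<sigma> A) = map_mat (\<tau> \<circ> \<sigma>) A"
  by (intro eq_matI) auto

lemma galois_ab_id: "galois_ab id"
  by (auto simp: galois_ab_def)

lemma galois_ab_comp:
  assumes "galois_ab \<sigma>" "galois_ab \<tau>" shows "galois_ab (\<sigma> \<circ> \<tau>)"
  unfolding galois_ab_def
proof (intro conjI ballI allI impI)
  show "bij_betw (\<sigma> \<circ> \<tau>) Qab Qab" using assms by (auto simp: galois_ab_def intro: bij_betw_trans)
  fix x y assume "x \<in> Qab" "y \<in> Qab"
  then show "(\<sigma> \<circ> \<tau>) (x + y) = (\<sigma> \<circ> \<tau>) x + (\<sigma> \<circ> \<tau>) y" "(\<sigma> \<circ> \<tau>) (x * y) = (\<sigma> \<circ> \<tau>) x * (\<sigma> \<circ> \<tau>) y"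
    by (simp_all add: galois_abD(1-3)[OF assms(1)] galois_abD(1-3)[OF assms(2)])
qed (simp add: galois_abD(5)[OF assms(1)] galois_abD(5)[OF assms(2)])

section \<open>The group H\<close>

lemma Hgal_galois: "Hgal p \<sigma> \<Longrightarrow> galois_ab \<sigma>"
  by (simp add: Hgal_def)

lemma power_cong_root:
  fixes \<xi> :: complex
  assumes "\<xi> ^ m = 1" "[a = b] (mod m)" shows "\<xi> ^ a = \<xi> ^ b"
proof -
  have *: "\<xi> ^ c = \<xi> ^ (c mod m)" for c
  proof -
    have "\<xi> ^ c = \<xi> ^ (m * (c div m) + c mod m)" by simp
    also have "\<dots> = \<xi> ^ (c mod m)" unfolding power_add power_mult assms(1) by simp
    finally show ?thesis .
  qed
  show ?thesis using *[of a] *[of b] assms(2) by (simp add: cong_def)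
qed

text \<open>The exponent by which an element of H acts on a root of unity is described only through
  a congruence; a solution has to be exhibited before that description can be applied.\<close>

lemma solve_cong_power:
  fixes m p :: nat
  assumes "coprime m p" shows "\<exists>k. [k * p ^ a = p ^ b] (mod m)"
proof -
  have "coprime (p ^ a) m" using assms by (simp add: coprime_commute)
  from cong_solve_coprime_nat[OF this] obtain x where "[p ^ a * x = 1] (mod m)" by (auto simp only: One_nat_def)
  then have "[p ^ b * (p ^ a * x) = p ^ b * 1] (mod m)" by (rule cong_scalar_left)
  then show ?thesis by (intro exI[of _ "p ^ b * x"]) (simp add: mult_ac)
qed

lemma Hgal_id: "Hgal p id"
  unfolding Hgal_def
proof (intro conjI exI[of _ 0] allI impI galois_ab_id)
  fix \<xi> :: complex and m k :: nat
  assume "0 < m \<and> coprime m p \<and> \<xi> ^ m = 1 \<and> [k * p ^ nat (- 0) = p ^ nat 0] (mod m)"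
  then show "id \<xi> = \<xi> ^ k" using power_cong_root[of \<xi> m k 1] by simp
qed

text \<open>The integers f add up. As they may be negative, powers of p occur on both sides of the
  defining congruences; these are combined after multiplication by a common power of p, which is
  cancelled again modulo m.\<close>

lemma Hgal_comp:
  assumes "Hgal p \<sigma>" "Hgal p \<tau>" shows "Hgal p (\<sigma> \<circ> \<tau>)"
proof -
  obtain f where f: "\<And>\<xi> m k. 0 < m \<Longrightarrow> coprime m p \<Longrightarrow> \<xi> ^ m = 1 \<Longrightarrow> [k * p ^ nat (- f) = p ^ nat f] (mod m) \<Longrightarrow> \<sigma> \<xi> = \<xi> ^ k"
    using assms(1) unfolding Hgal_def by blast
  obtain f' where f': "\<And>\<xi> m k. 0 < m \<Longrightarrow> coprime m p \<Longrightarrow> \<xi> ^ m = 1 \<Longrightarrow> [k * p ^ nat (- f') = p ^ nat f'] (mod m) \<Longrightarrow> \<tau> \<xi> = \<xi> ^ k"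
    using assms(2) unfolding Hgal_def by blast
  have "(\<sigma> \<circ> \<tau>) \<xi> = \<xi> ^ k"
    if m: "0 < m" "coprime m p" "\<xi> ^ m = 1" and k: "[k * p ^ nat (- (f + f')) = p ^ nat (f + f')] (mod m)" for \<xi> m k
  proof -
    obtain k1 where k1: "[k1 * p ^ nat (- f') = p ^ nat f'] (mod m)" using solve_cong_power[OF m(2)] by blast
    obtain k2 where k2: "[k2 * p ^ nat (- f) = p ^ nat f] (mod m)" using solve_cong_power[OF m(2)] by blast
    have "(\<xi> ^ k1) ^ m = 1" using m(3) by (metis power_mult mult.commute power_one)
    then have eq: "(\<sigma> \<circ> \<tau>) \<xi> = \<xi> ^ (k1 * k2)" using f'[OF m k1] f[OF m(1,2) _ k2] by (simp add: power_mult)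
    let ?P = "p ^ (nat (- f) + nat (- f') + nat (- (f + f')))"
    have "[(k1 * k2) * ?P = k * ?P] (mod m)"
    proof -
      have "[(k1 * p ^ nat (- f')) * (k2 * p ^ nat (- f)) * p ^ nat (- (f + f')) = p ^ nat f' * p ^ nat f * p ^ nat (- (f + f'))] (mod m)"
        using k1 k2 by (intro cong_mult cong_refl)
      also have "p ^ nat f' * p ^ nat f * p ^ nat (- (f + f')) = p ^ nat (f + f') * p ^ (nat (- f) + nat (- f'))"
      proof -
        have "nat f' + nat f + nat (- (f + f')) = nat (f + f') + (nat (- f) + nat (- f'))" by linarith
        then show ?thesis by (simp flip: power_add)
      qed
      also have "[p ^ nat (f + f') * p ^ (nat (- f) + nat (- f')) = k * p ^ nat (- (f + f')) * p ^ (nat (- f) + nat (- f'))] (mod m)"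
        using k by (intro cong_mult cong_refl) (rule cong_sym)
      finally show ?thesis by (simp add: power_add mult_ac)
    qed
    moreover have "coprime ?P m" using m(2) by (simp add: coprime_commute)
    ultimately have "[k1 * k2 = k] (mod m)" using cong_mult_rcancel_nat by blast
    then show ?thesis using eq power_cong_root[OF m(3)] by simp
  qed
  then show ?thesis using galois_ab_comp[of \<sigma> \<tau>] assms unfolding Hgal_def by blast
qed

text \<open>The inverse on \<open>Qab\<close> is extended by the identity and belongs to the integer
  -f: the exponents k and k1 that go with -f and f are inverse to each other modulo m.\<close>

lemma Hgal_inverse:
  assumes "Hgal p \<sigma>" shows "\<exists>\<tau>. Hgal p \<tau> \<and> \<tau> \<circ> \<sigma> = id \<and> \<sigma> \<circ> \<tau> = id"
proof -
  have s: "galois_ab \<sigma>" using assms by (rule Hgal_galois)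
  define \<tau> where "\<tau> z = (if z \<in> Qab then inv_into Qab \<sigma> z else z)" for z
  have b: "bij_betw \<sigma> Qab Qab" using s by (simp add: galois_ab_def)
  have ts: "\<tau> (\<sigma> z) = z" for z
    using b galois_abD[OF s] by (cases "z \<in> Qab") (auto simp: \<tau>_def bij_betw_def)
  have st: "\<sigma> (\<tau> z) = z" for z
    using b galois_abD[OF s] by (cases "z \<in> Qab") (auto simp: \<tau>_def bij_betw_def f_inv_into_f)
  have tQ: "z \<in> Qab \<Longrightarrow> \<tau> z \<in> Qab" for z using b by (auto simp: \<tau>_def bij_betw_def inv_into_into)
  have g: "galois_ab \<tau>"
    unfolding galois_ab_def
  proof (intro conjI ballI allI impI)
    show "bij_betw \<tau> Qab Qab" by (rule bij_betw_byWitness[where f' = \<sigma>]) (auto simp: ts st tQ galois_abD[OF s])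
    fix x y assume "x \<in> Qab" "y \<in> Qab"
    then show "\<tau> (x + y) = \<tau> x + \<tau> y" "\<tau> (x * y) = \<tau> x * \<tau> y"
      using galois_abD(2,3)[OF s tQ tQ] by (metis st ts)+
  qed (simp add: \<tau>_def)
  obtain f where f: "\<And>\<xi> m k. 0 < m \<Longrightarrow> coprime m p \<Longrightarrow> \<xi> ^ m = 1 \<Longrightarrow> [k * p ^ nat (- f) = p ^ nat f] (mod m) \<Longrightarrow> \<sigma> \<xi> = \<xi> ^ k"
    using assms unfolding Hgal_def by blast
  have "\<tau> \<xi> = \<xi> ^ k" if m: "0 < m" "coprime m p" "\<xi> ^ m = 1" and k: "[k * p ^ nat (- (- f)) = p ^ nat (- f)] (mod m)" for \<xi> m k
  proof -
    obtain k1 where k1: "[k1 * p ^ nat (- f) = p ^ nat f] (mod m)" using solve_cong_power[OF m(2)] by blast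
    have "(\<xi> ^ k) ^ m = 1" using m(3) by (metis power_mult mult.commute power_one)
    then have eq: "\<sigma> (\<xi> ^ k) = \<xi> ^ (k * k1)" using f[OF m(1,2) _ k1] by (simp add: power_mult)
    let ?P = "p ^ (nat f + nat (- f))"
    have "[(k1 * p ^ nat (- f)) * (k * p ^ nat (- (- f))) = p ^ nat f * p ^ nat (- f)] (mod m)"
      using k1 k by (intro cong_mult)
    then have "[(k * k1) * ?P = 1 * ?P] (mod m)" by (simp add: power_add mult_ac)
    moreover have "coprime ?P m" using m(2) by (simp add: coprime_commute)
    ultimately have "[k * k1 = 1] (mod m)" using cong_mult_rcancel_nat by blast
    then have "\<sigma> (\<xi> ^ k) = \<xi>" using eq power_cong_root[OF m(3), of "k * k1" 1] by simp
    then show ?thesis using ts by metis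
  qed
  then have "Hgal p \<tau>" unfolding Hgal_def using g by blast
  then show ?thesis using ts st by (auto simp: fun_eq_iff)
qed

section \<open>Characters of direct powers\<close>

text \<open>An arbitrary enumeration of the multi-indices serves as the basis of a tensor product.
  Sums over basis indices thereby become sums over \<open>PiE\<close>, to which the rule for
  products of sums applies directly.\<close>

definition tens_index :: "nat \<Rightarrow> (nat \<Rightarrow> nat) \<Rightarrow> nat \<Rightarrow> nat \<Rightarrow> nat" where
  "tens_index n d = (SOME e. bij_betw e {..<\<Prod>i<n. d i} (\<Pi>\<^sub>E i\<in>{..<n}. {..<d i}))"

lemma tens_index_bij: "bij_betw (tens_index n d) {..<\<Prod>i<n. d i} (\<Pi>\<^sub>E i\<in>{..<n}. {..<d i})"
proof -
  have "\<exists>e. bij_betw e {..<\<Prod>i<n. d i} (\<Pi>\<^sub>E i\<in>{..<n}. {..<d i})"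
    by (rule finite_same_card_bij) (auto simp: card_PiE intro!: finite_PiE)
  then show ?thesis unfolding tens_index_def by (rule someI_ex)
qed

lemma tens_index_less: "a < (\<Prod>i<n. d i) \<Longrightarrow> i < n \<Longrightarrow> tens_index n d a i < d i"
  using bij_betwE[OF tens_index_bij] by (auto simp: PiE_def Pi_def)

lemma tens_index_eq_iff:
  assumes "a < (\<Prod>i<n. d i)" "b < (\<Prod>i<n. d i)"
  shows "a = b \<longleftrightarrow> (\<forall>i<n. tens_index n d a i = tens_index n d b i)"
proof -
  have "tens_index n d a \<in> (\<Pi>\<^sub>E i\<in>{..<n}. {..<d i})" "tens_index n d b \<in> (\<Pi>\<^sub>E i\<in>{..<n}. {..<d i})"
    using assms bij_betwE[OF tens_index_bij] by auto
  then have "tens_index n d a = tens_index n d b \<longleftrightarrow> (\<forall>i<n. tens_index n d a i = tens_index n d b i)"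
    using PiE_ext[of "tens_index n d a" "{..<n}" _ "tens_index n d b"] by (metis lessThan_iff)
  moreover have "inj_on (tens_index n d) {..<\<Prod>i<n. d i}" using tens_index_bij by (rule bij_betw_imp_inj_on)
  ultimately show ?thesis using inj_on_eq_iff[of "tens_index n d" "{..<\<Prod>i<n. d i}" a b] assms by simp
qed

lemma tens_index_surj:
  assumes "\<And>i. i < n \<Longrightarrow> y i < d i"
  obtains a where "a < (\<Prod>i<n. d i)" "\<And>i. i < n \<Longrightarrow> tens_index n d a i = y i"
proof -
  have "restrict y {..<n} \<in> (\<Pi>\<^sub>E i\<in>{..<n}. {..<d i})" using assms by auto
  then have "restrict y {..<n} \<in> tens_index n d ` {..<\<Prod>i<n. d i}" using tens_index_bij[of n d] by (simp add: bij_betw_def)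
  then obtain a where "a < (\<Prod>i<n. d i)" "tens_index n d a = restrict y {..<n}" by auto
  then show thesis by (intro that[of a]) auto
qed

text \<open>The \<open>i\<close>-th factor maps the \<open>\<pi> i\<close>-th tensor slot to the \<open>i\<close>-th one, so that a permutation
  of the slots is built into the tensor product.\<close>
definition tens :: "nat \<Rightarrow> (nat \<Rightarrow> nat) \<Rightarrow> (nat \<Rightarrow> complex mat) \<Rightarrow> (nat \<Rightarrow> nat) \<Rightarrow> complex mat" where
  "tens n d A \<pi> = mat (\<Prod>i<n. d i) (\<Prod>i<n. d i)
     (\<lambda>(a, b). \<Prod>i<n. A i $$ (tens_index n d a i, tens_index n d b (\<pi> i)))"

lemma tens_carrier [simp]: "tens n d A \<pi> \<in> carrier_mat (\<Prod>i<n. d i) (\<Prod>i<n. d i)"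
  by (simp add: tens_def)

lemma tens_cong: "(\<And>i. i < n \<Longrightarrow> A i = B i) \<Longrightarrow> (\<And>i. i < n \<Longrightarrow> \<pi> i = \<rho> i) \<Longrightarrow> tens n d A \<pi> = tens n d B \<rho>"
  by (auto simp: tens_def intro!: eq_matI)

lemma permutes_less: "\<pi> permutes {..<n} \<Longrightarrow> i < n \<Longrightarrow> \<pi> i < n"
  by (metis lessThan_iff permutes_in_image)

text \<open>The intermediate basis index runs over all multi-indices y, and slot j of y occurs in
  exactly one factor of either product, in \<open>B j\<close> and in \<open>A i\<close> for \<pi> i
  = j. So the sum factorises over the slots. Following slot i through both factors leads to \<rho>
  (\<pi> i), which explains the order of composition.\<close>

lemma tens_mult:
  assumes pi: "\<pi> permutes {..<n}" and rho: "\<rho> permutes {..<n}"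
    and A: "\<And>i. i < n \<Longrightarrow> A i \<in> carrier_mat (d i) (d (\<pi> i))"
    and B: "\<And>i. i < n \<Longrightarrow> B i \<in> carrier_mat (d i) (d (\<rho> i))"
  shows "tens n d A \<pi> * tens n d B \<rho> = tens n d (\<lambda>i. A i * B (\<pi> i)) (\<rho> \<circ> \<pi>)"
proof (rule eq_matI)
  let ?D = "\<Prod>i<n. d i" and ?e = "tens_index n d" and ?p = "inv_into UNIV \<pi>"
  fix a c assume "a < dim_row (tens n d (\<lambda>i. A i * B (\<pi> i)) (\<rho> \<circ> \<pi>))" "c < dim_col (tens n d (\<lambda>i. A i * B (\<pi> i)) (\<rho> \<circ> \<pi>))"
  then have ac: "a < ?D" "c < ?D" by (auto simp: tens_def)
  have p: "?p permutes {..<n}" using pi by (rule permutes_inv)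
  define F where "F j x = A (?p j) $$ (?e a (?p j), x) * B j $$ (x, ?e c (\<rho> j))" for j x
  have "(tens n d A \<pi> * tens n d B \<rho>) $$ (a, c) =
     (\<Sum>b<?D. (\<Prod>i<n. A i $$ (?e a i, ?e b (\<pi> i))) * (\<Prod>i<n. B i $$ (?e b i, ?e c (\<rho> i))))"
    using ac by (subst mat_mult_entry[of _ ?D ?D _ ?D]) (auto simp: tens_def)
  also have "\<dots> = (\<Sum>y\<in>(\<Pi>\<^sub>E i\<in>{..<n}. {..<d i}). (\<Prod>i<n. A i $$ (?e a i, y (\<pi> i))) * (\<Prod>i<n. B i $$ (y i, ?e c (\<rho> i))))"
    by (rule sum.reindex_bij_betw[OF tens_index_bij])
  also have "\<dots> = (\<Sum>y\<in>(\<Pi>\<^sub>E i\<in>{..<n}. {..<d i}). \<Prod>j<n. F j (y j))"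
  proof (intro sum.cong refl)
    fix y
    have "(\<Prod>i<n. A i $$ (?e a i, y (\<pi> i))) = (\<Prod>j<n. A (?p j) $$ (?e a (?p j), y j))"
      by (subst prod.permute[OF p]) (simp add: comp_def permutes_inverses[OF pi])
    then show "(\<Prod>i<n. A i $$ (?e a i, y (\<pi> i))) * (\<Prod>i<n. B i $$ (y i, ?e c (\<rho> i))) = (\<Prod>j<n. F j (y j))"
      by (simp add: F_def prod.distrib)
  qed
  also have "\<dots> = (\<Prod>j<n. \<Sum>x<d j. F j x)"
    by (rule prod_sum_PiE[symmetric]) auto
  also have "\<dots> = (\<Prod>i<n. \<Sum>x<d (\<pi> i). F (\<pi> i) x)"
    by (subst prod.permute[OF pi]) (simp add: comp_def)
  also have "\<dots> = (\<Prod>i<n. (A i * B (\<pi> i)) $$ (?e a i, ?e c (\<rho> (\<pi> i))))"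
  proof (intro prod.cong refl)
    fix i assume "i \<in> {..<n}"
    then have i: "i < n" "\<pi> i < n" "\<rho> (\<pi> i) < n" using permutes_less[OF pi] permutes_less[OF rho] by auto
    show "(\<Sum>x<d (\<pi> i). F (\<pi> i) x) = (A i * B (\<pi> i)) $$ (?e a i, ?e c (\<rho> (\<pi> i)))"
      using i ac by (subst mat_mult_entry[OF A[of i] B[of "\<pi> i"]]) (auto simp: F_def permutes_inverses[OF pi] tens_index_less)
  qed
  finally show "(tens n d A \<pi> * tens n d B \<rho>) $$ (a, c) = tens n d (\<lambda>i. A i * B (\<pi> i)) (\<rho> \<circ> \<pi>) $$ (a, c)"
    using ac by (simp add: tens_def)
qed (auto simp: tens_def)

lemma tens_one: "tens n d (\<lambda>i. 1\<^sub>m (d i)) id = 1\<^sub>m (\<Prod>i<n. d i)"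
proof (rule eq_matI, goal_cases)
  case (1 a b)
  then have ab: "a < (\<Prod>i<n. d i)" "b < (\<Prod>i<n. d i)" by auto
  have "(\<Prod>i<n. (1\<^sub>m (d i) :: complex mat) $$ (tens_index n d a i, tens_index n d b i)) =
     (\<Prod>i<n. if tens_index n d a i = tens_index n d b i then 1 else 0)"
    using ab by (intro prod.cong) (auto simp: tens_index_less)
  also have "\<dots> = (if \<forall>i<n. tens_index n d a i = tens_index n d b i then 1 else 0)"
    by auto
  finally show ?case using ab tens_index_eq_iff[OF ab] by (simp add: tens_def)
qed (auto simp: tens_def)

lemma tens_smult:
  assumes "\<pi> permutes {..<n}" "\<And>i. i < n \<Longrightarrow> A i \<in> carrier_mat (d i) (d (\<pi> i))"
  shows "tens n d (\<lambda>i. c i \<cdot>\<^sub>m A i) \<pi> = (\<Prod>i<n. c i) \<cdot>\<^sub>m tens n d A \<pi>"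
proof (rule eq_matI, goal_cases)
  case (1 a b)
  then have ab: "a < (\<Prod>i<n. d i)" "b < (\<Prod>i<n. d i)" by (auto simp: tens_def)
  have "(\<Prod>i<n. (c i \<cdot>\<^sub>m A i) $$ (tens_index n d a i, tens_index n d b (\<pi> i))) =
     (\<Prod>i<n. c i * A i $$ (tens_index n d a i, tens_index n d b (\<pi> i)))"
  proof (intro prod.cong refl)
    fix i assume "i \<in> {..<n}"
    then have "tens_index n d a i < d i" "tens_index n d b (\<pi> i) < d (\<pi> i)"
      using ab permutes_less[OF assms(1)] by (auto simp: tens_index_less)
    then show "(c i \<cdot>\<^sub>m A i) $$ (tens_index n d a i, tens_index n d b (\<pi> i)) = c i * A i $$ (tens_index n d a i, tens_index n d b (\<pi> i))"
      using assms(2)[of i] \<open>i \<in> {..<n}\<close> by auto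
  qed
  then show ?case using ab by (simp add: tens_def prod.distrib)
qed (auto simp: tens_def)

lemma tens_scalar:
  assumes "\<And>i. i < n \<Longrightarrow> A i = c i \<cdot>\<^sub>m 1\<^sub>m (d i)"
  shows "tens n d A id = (\<Prod>i<n. c i) \<cdot>\<^sub>m 1\<^sub>m (\<Prod>i<n. d i)"
proof -
  have "tens n d A id = tens n d (\<lambda>i. c i \<cdot>\<^sub>m 1\<^sub>m (d i)) id" using assms by (intro tens_cong) auto
  also have "\<dots> = (\<Prod>i<n. c i) \<cdot>\<^sub>m tens n d (\<lambda>i. 1\<^sub>m (d i)) id" by (rule tens_smult) (auto simp: permutes_id)
  finally show ?thesis by (simp add: tens_one)
qed

lemma tens_trace:
  assumes "\<And>i. i < n \<Longrightarrow> A i \<in> carrier_mat (d i) (d i)"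
  shows "mat_trace (tens n d A id) = (\<Prod>i<n. mat_trace (A i))"
proof -
  have "mat_trace (tens n d A id) = (\<Sum>a<\<Prod>i<n. d i. \<Prod>i<n. A i $$ (tens_index n d a i, tens_index n d a i))"
    by (subst mat_trace_eq[of _ "\<Prod>i<n. d i"]) (auto simp: tens_def)
  also have "\<dots> = (\<Sum>y\<in>(\<Pi>\<^sub>E i\<in>{..<n}. {..<d i}). \<Prod>i<n. A i $$ (y i, y i))"
    by (rule sum.reindex_bij_betw[OF tens_index_bij])
  also have "\<dots> = (\<Prod>i<n. \<Sum>x<d i. A i $$ (x, x))"
    by (rule prod_sum_PiE[symmetric]) auto
  also have "\<dots> = (\<Prod>i<n. mat_trace (A i))" using mat_trace_eq[OF assms] by (intro prod.cong) auto
  finally show ?thesis .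
qed

lemma tens_entries_Qab:
  assumes pi: "\<pi> permutes {..<n}" and A: "\<And>i. i < n \<Longrightarrow> A i \<in> carrier_mat (d i) (d (\<pi> i))"
    and Q: "\<And>i. i < n \<Longrightarrow> mat_Qab (A i)"
    and ab: "a < (\<Prod>i<n. d i)" "b < (\<Prod>i<n. d i)" and i: "i < n"
  shows "A i $$ (tens_index n d a i, tens_index n d b (\<pi> i)) \<in> Qab"
  using Q[OF i] A[OF i] tens_index_less[OF ab(1) i] tens_index_less[OF ab(2) permutes_less[OF pi i]]
  by (auto simp: mat_Qab_def)

lemma mat_Qab_tens:
  assumes "\<pi> permutes {..<n}" "\<And>i. i < n \<Longrightarrow> A i \<in> carrier_mat (d i) (d (\<pi> i))" "\<And>i. i < n \<Longrightarrow> mat_Qab (A i)"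
  shows "mat_Qab (tens n d A \<pi>)"
  unfolding mat_Qab_def
proof (intro allI impI)
  fix a b assume "a < dim_row (tens n d A \<pi>)" "b < dim_col (tens n d A \<pi>)"
  then have ab: "a < (\<Prod>i<n. d i)" "b < (\<Prod>i<n. d i)" by (auto simp: tens_def)
  show "tens n d A \<pi> $$ (a, b) \<in> Qab"
    using tens_entries_Qab[OF assms ab] ab by (auto simp: tens_def intro!: Qab_prod)
qed

lemma map_mat_tens:
  assumes s: "galois_ab \<sigma>" and A: "\<pi> permutes {..<n}" "\<And>i. i < n \<Longrightarrow> A i \<in> carrier_mat (d i) (d (\<pi> i))" "\<And>i. i < n \<Longrightarrow> mat_Qab (A i)"
  shows "map_mat \<sigma> (tens n d A \<pi>) = tens n d (\<lambda>i. map_mat \<sigma> (A i)) \<pi>"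
proof (rule eq_matI, goal_cases)
  case (1 a b)
  then have ab: "a < (\<Prod>i<n. d i)" "b < (\<Prod>i<n. d i)" by (auto simp: tens_def)
  have "\<sigma> (\<Prod>i<n. A i $$ (tens_index n d a i, tens_index n d b (\<pi> i))) =
     (\<Prod>i<n. \<sigma> (A i $$ (tens_index n d a i, tens_index n d b (\<pi> i))))"
    using tens_entries_Qab[OF A ab] by (intro galois_ab_prod[OF s]) auto
  also have "\<dots> = (\<Prod>i<n. map_mat \<sigma> (A i) $$ (tens_index n d a i, tens_index n d b (\<pi> i)))"
  proof (intro prod.cong refl)
    fix i assume "i \<in> {..<n}"
    then have "tens_index n d a i < d i" "tens_index n d b (\<pi> i) < d (\<pi> i)"
      using ab permutes_less[OF A(1)] by (auto simp: tens_index_less)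
    then show "\<sigma> (A i $$ (tens_index n d a i, tens_index n d b (\<pi> i))) = map_mat \<sigma> (A i) $$ (tens_index n d a i, tens_index n d b (\<pi> i))"
      using A(2)[of i] \<open>i \<in> {..<n}\<close> by auto
  qed
  finally show ?case using ab by (simp add: tens_def)
qed (auto simp: tens_def)

section \<open>Direct powers and the factorisation of their irreducible characters\<close>

lemma dpow_carrier [simp]: "carrier (dpow Xc n) = (\<Pi>\<^sub>E i\<in>{..<n}. carrier Xc)"
  by (simp add: dpow_def)

lemma dpow_mult [simp]: "v \<otimes>\<^bsub>dpow Xc n\<^esub> w = (\<lambda>i\<in>{..<n}. v i \<otimes>\<^bsub>Xc\<^esub> w i)"
  by (simp add: dpow_def)

lemma dpow_one [simp]: "\<one>\<^bsub>dpow Xc n\<^esub> = (\<lambda>i\<in>{..<n}. \<one>\<^bsub>Xc\<^esub>)"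
  by (simp add: dpow_def)

lemma dpow_restrict: "(dpow Xc n)\<lparr>carrier := \<Pi>\<^sub>E i\<in>{..<n}. N\<rparr> = dpow (Xc\<lparr>carrier := N\<rparr>) n"
  by (simp add: dpow_def product_group_def)

lemma IrrE:
  assumes "\<chi> \<in> Irr G"
  obtains d \<rho> where "irred_rep G d \<rho>" "\<forall>g. \<chi> g = (if g \<in> carrier G then mat_trace (\<rho> g) else 0)"
  using assms unfolding Irr_def by blast

lemma IrrI:
  assumes "irred_rep G d \<rho>" "\<And>g. \<chi> g = (if g \<in> carrier G then mat_trace (\<rho> g) else 0)"
  shows "\<chi> \<in> Irr G"
  using assms unfolding Irr_def by blast

context group
begin

lemma group_dpow: "group (dpow G n)"
  unfolding dpow_def by (rule product_group) (simp add: is_group)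

lemma dpow_inv [simp]: "v \<in> carrier (dpow G n) \<Longrightarrow> inv\<^bsub>dpow G n\<^esub> v = (\<lambda>i\<in>{..<n}. inv (v i))"
  unfolding dpow_def by (rule inv_product_group) (auto simp: is_group)

lemma finite_dpow: "finite (carrier G) \<Longrightarrow> finite (carrier (dpow G n))"
  by (auto intro!: finite_PiE)

lemma tens_is_rep:
  assumes r: "\<And>i. i < n \<Longrightarrow> is_rep G (d i) (\<rho> i)"
  shows "is_rep (dpow G n) (\<Prod>i<n. d i) (\<lambda>v. tens n d (\<lambda>i. \<rho> i (v i)) id)"
  unfolding is_rep_def
proof (intro conjI ballI)
  fix v w assume vw: "v \<in> carrier (dpow G n)" "w \<in> carrier (dpow G n)"
  then have vwi: "v i \<in> carrier G" "w i \<in> carrier G" if "i < n" for i using that by auto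
  have "tens n d (\<lambda>i. \<rho> i (v i)) id * tens n d (\<lambda>i. \<rho> i (w i)) id = tens n d (\<lambda>i. \<rho> i (v i) * \<rho> (id i) (w (id i))) (id \<circ> id)"
    using vwi rep_mat[OF r] by (intro tens_mult) (auto simp: permutes_id)
  also have "\<dots> = tens n d (\<lambda>i. \<rho> i ((v \<otimes>\<^bsub>dpow G n\<^esub> w) i)) id"
    using vwi by (intro tens_cong) (auto simp: rep_mult[OF r])
  finally show "tens n d (\<lambda>i. \<rho> i ((v \<otimes>\<^bsub>dpow G n\<^esub> w) i)) id = tens n d (\<lambda>i. \<rho> i (v i)) id * tens n d (\<lambda>i. \<rho> i (w i)) id" ..
next
  have "tens n d (\<lambda>i. \<rho> i (\<one>\<^bsub>dpow G n\<^esub> i)) id = tens n d (\<lambda>i. 1\<^sub>m (d i)) id"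
    by (intro tens_cong) (auto simp: rep_one[OF r])
  then show "tens n d (\<lambda>i. \<rho> i (\<one>\<^bsub>dpow G n\<^esub> i)) id = 1\<^sub>m (\<Prod>i<n. d i)" by (simp add: tens_one)
qed auto

lemma sum_dpow_prod:
  fixes f :: "nat \<Rightarrow> 'a \<Rightarrow> complex"
  assumes "finite (carrier G)"
  shows "(\<Sum>v\<in>carrier (dpow G n). \<Prod>i<n. f i (v i)) = (\<Prod>i<n. \<Sum>x\<in>carrier G. f i x)"
  using assms by (simp add: prod_sum_PiE)

text \<open>Orthogonality is multiplicative: the sum over the direct power of a product of
  coefficients is the product of the sums over G.\<close>

lemma tens_irred:
  assumes fin: "finite (carrier G)" and irr: "\<And>i. i < n \<Longrightarrow> irred_rep G (d i) (\<rho> i)"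
  shows "irred_rep (dpow G n) (\<Prod>i<n. d i) (\<lambda>v. tens n d (\<lambda>i. \<rho> i (v i)) id)"
proof (rule group.schur_orth_imp_irred[OF group_dpow])
  have r: "is_rep G (d i) (\<rho> i)" if "i < n" for i using irr[OF that] by (simp add: irred_rep_def)
  show "is_rep (dpow G n) (\<Prod>i<n. d i) (\<lambda>v. tens n d (\<lambda>i. \<rho> i (v i)) id)"
    by (rule tens_is_rep[OF r])
  show "0 < (\<Prod>i<n. d i)" using irr by (auto simp: irred_rep_def intro!: prod_pos)
  show "finite (carrier (dpow G n))" using fin by (rule finite_dpow)
  show "schur_orth (dpow G n) (\<Prod>i<n. d i) (\<lambda>v. tens n d (\<lambda>i. \<rho> i (v i)) id)"
    unfolding schur_orth_def
  proof (intro allI impI)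
    let ?e = "tens_index n d" and ?N = "of_nat (card (carrier G)) :: complex"
    fix s a b t assume ab: "s < (\<Prod>i<n. d i)" "a < (\<Prod>i<n. d i)" "b < (\<Prod>i<n. d i)" "t < (\<Prod>i<n. d i)"
    have "(\<Sum>v\<in>carrier (dpow G n). tens n d (\<lambda>i. \<rho> i (v i)) id $$ (s, a) * tens n d (\<lambda>i. \<rho> i ((inv\<^bsub>dpow G n\<^esub> v) i)) id $$ (b, t))
      = (\<Sum>v\<in>carrier (dpow G n). \<Prod>i<n. \<rho> i (v i) $$ (?e s i, ?e a i) * \<rho> i (inv (v i)) $$ (?e b i, ?e t i))"
      using ab by (intro sum.cong refl, subst dpow_inv) (auto simp: tens_def prod.distrib)
    also have "\<dots> = (\<Prod>i<n. \<Sum>x\<in>carrier G. \<rho> i x $$ (?e s i, ?e a i) * \<rho> i (inv x) $$ (?e b i, ?e t i))"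
      by (rule sum_dpow_prod[OF fin])
    also have "\<dots> = (\<Prod>i<n. if ?e s i = ?e t i \<and> ?e a i = ?e b i then ?N / of_nat (d i) else 0)"
      using ab by (intro prod.cong refl schur_orthD[OF irred_imp_schur_orth[OF irr]]) (auto simp: tens_index_less)
    also have "\<dots> = (if \<forall>i<n. ?e s i = ?e t i \<and> ?e a i = ?e b i then (\<Prod>i<n. ?N / of_nat (d i)) else 0)"
      by auto
    also have "(\<forall>i<n. ?e s i = ?e t i \<and> ?e a i = ?e b i) \<longleftrightarrow> s = t \<and> a = b"
      using tens_index_eq_iff[OF ab(1,4)] tens_index_eq_iff[OF ab(2,3)] by blast
    also have "(\<Prod>i<n. ?N / of_nat (d i)) = of_nat (card (carrier (dpow G n))) / of_nat (\<Prod>i<n. d i)"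
      by (simp add: prod_dividef card_PiE)
    finally show "(\<Sum>v\<in>carrier (dpow G n). tens n d (\<lambda>i. \<rho> i (v i)) id $$ (s, a) * tens n d (\<lambda>i. \<rho> i ((inv\<^bsub>dpow G n\<^esub> v) i)) id $$ (b, t))
      = (if s = t \<and> a = b then of_nat (card (carrier (dpow G n))) / of_nat (\<Prod>i<n. d i) else 0)" .
  qed
qed

lemma prod_char_Irr:
  assumes fin: "finite (carrier G)" and \<theta>: "\<And>i. i < n \<Longrightarrow> \<theta> i \<in> Irr G"
  shows "prod_char (carrier G) n \<theta> \<in> Irr (dpow G n)"
proof -
  have "\<forall>i. \<exists>d \<rho>. i < n \<longrightarrow> irred_rep G d \<rho> \<and> (\<forall>g. \<theta> i g = (if g \<in> carrier G then mat_trace (\<rho> g) else 0))"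
    using \<theta> unfolding Irr_def by blast
  then obtain d \<rho> where irr: "\<And>i. i < n \<Longrightarrow> irred_rep G (d i) (\<rho> i)"
    and tr: "\<And>i g. i < n \<Longrightarrow> \<theta> i g = (if g \<in> carrier G then mat_trace (\<rho> i g) else 0)" by metis
  show ?thesis
  proof (rule IrrI[OF tens_irred[OF fin irr]])
    fix v show "prod_char (carrier G) n \<theta> v = (if v \<in> carrier (dpow G n) then mat_trace (tens n d (\<lambda>i. \<rho> i (v i)) id) else 0)"
    proof (cases "v \<in> carrier (dpow G n)")
      case True
      then have vi: "i < n \<Longrightarrow> v i \<in> carrier G" for i by auto
      have "mat_trace (tens n d (\<lambda>i. \<rho> i (v i)) id) = (\<Prod>i<n. mat_trace (\<rho> i (v i)))"
        using irr vi by (intro tens_trace) (auto simp: irred_rep_def is_rep_def)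
      then show ?thesis using True vi tr by (auto simp: prod_char_def)
    qed (auto simp: prod_char_def)
  qed auto
qed

text \<open>The coordinates are frozen at those of w one after the other. At each stage the sum over
  the tuples with the earlier coordinates prescribed is, as a function of coordinate k, annihilated
  by all irreducible coefficients of G and therefore zero.\<close>

lemma product_irreps_separate:
  fixes f :: "(nat \<Rightarrow> 'a) \<Rightarrow> complex"
  assumes fin: "finite (carrier G)"
    and f: "\<And>d \<rho> a b. (\<And>i. i < n \<Longrightarrow> irred_rep G (d i) (\<rho> i) \<and> a i < d i \<and> b i < d i) \<Longrightarrow>
       (\<Sum>v\<in>carrier (dpow G n). f v * (\<Prod>i<n. \<rho> i (v i) $$ (a i, b i))) = 0"
    and w: "w \<in> carrier (dpow G n)"
  shows "f w = 0"
proof -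
  define S where "S k = {v \<in> carrier (dpow G n). \<forall>j<k. v j = w j}" for k
  have finS: "finite (S k)" for k unfolding S_def using finite_dpow[OF fin, of n] by simp
  have claim: "(\<Sum>v\<in>S k. f v * (\<Prod>i\<in>{k..<n}. \<rho> i (v i) $$ (a i, b i))) = 0"
    if "k \<le> n" "\<And>i. k \<le> i \<Longrightarrow> i < n \<Longrightarrow> irred_rep G (d i) (\<rho> i) \<and> a i < d i \<and> b i < d i" for k d \<rho> a b
    using that
  proof (induction k arbitrary: d \<rho> a b)
    case 0
    then show ?case using f[of d \<rho> a b] by (simp add: S_def atLeast0LessThan)
  next
    case (Suc k)
    define h where "h v = f v * (\<Prod>i\<in>{Suc k..<n}. \<rho> i (v i) $$ (a i, b i))" for v
    define F where "F x = (\<Sum>v\<in>{v\<in>S k. v k = x}. h v)" for x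
    have k: "k < n" using Suc.prems by simp
    have wk: "w k \<in> carrier G" using w k by auto
    have "F (w k) = 0"
    proof (rule irreps_separate[OF fin _ wk])
      fix e \<tau> i j assume e: "irred_rep G e \<tau>" "i < e" "j < e"
      have "(\<Sum>x\<in>carrier G. F x * \<tau> x $$ (i, j)) = (\<Sum>x\<in>carrier G. \<Sum>v\<in>{v\<in>S k. v k = x}. h v * \<tau> (v k) $$ (i, j))"
        by (intro sum.cong refl) (simp add: F_def sum_distrib_right)
      also have "\<dots> = (\<Sum>v\<in>S k. h v * \<tau> (v k) $$ (i, j))"
        using k by (intro sum.group finS fin) (auto simp: S_def)
      also have "\<dots> = (\<Sum>v\<in>S k. f v * (\<Prod>l\<in>{k..<n}. (\<rho>(k := \<tau>)) l (v l) $$ ((a(k := i)) l, (b(k := j)) l)))"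
        using k by (intro sum.cong refl) (simp add: h_def prod.atLeast_Suc_lessThan mult_ac)
      also have "\<dots> = 0"
        by (rule Suc.IH[where d = "d(k := e)"]) (use Suc.prems e in auto)
      finally show "(\<Sum>x\<in>carrier G. F x * \<tau> x $$ (i, j)) = 0" .
    qed
    moreover have "{v\<in>S k. v k = w k} = S (Suc k)" by (auto simp: S_def less_Suc_eq)
    ultimately show ?case by (simp add: F_def h_def)
  qed
  have "S n = {w}" using w by (auto simp: S_def intro!: PiE_ext[of _ "{..<n}" "\<lambda>_. carrier G"])
  then show ?thesis using claim[of n] by simp
qed

text \<open>The function \<open>f\<close>, the character at the inverse element, is nonzero at the
  unit element, so some product of irreducible coefficients pairs nontrivially with it. That product
  is a coefficient of a tensor product representation, which must then have the character
  \<chi>.\<close>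

lemma Irr_dpow:
  assumes fin: "finite (carrier G)" and \<chi>: "\<chi> \<in> Irr (dpow G n)"
  shows "\<exists>\<theta>. (\<forall>i<n. \<theta> i \<in> Irr G) \<and> \<chi> = prod_char (carrier G) n \<theta>"
proof -
  let ?G = "dpow G n"
  interpret D: group ?G by (rule group_dpow)
  obtain e r where r: "irred_rep ?G e r" and \<chi>r: "\<forall>g. \<chi> g = (if g \<in> carrier ?G then mat_trace (r g) else 0)"
    using \<chi> by (rule IrrE) 
  have rr: "is_rep ?G e r" and e: "0 < e" using r by (auto simp: irred_rep_def)
  define f where "f v = mat_trace (r (inv\<^bsub>?G\<^esub> v))" for v
  have "f \<one>\<^bsub>?G\<^esub> \<noteq> 0" using e by (simp add: f_def rep_one[OF rr] del: dpow_one)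
  then obtain d \<rho> a b where irr: "\<And>i. i < n \<Longrightarrow> irred_rep G (d i) (\<rho> i) \<and> a i < d i \<and> b i < d i"
    and nz: "(\<Sum>v\<in>carrier ?G. f v * (\<Prod>i<n. \<rho> i (v i) $$ (a i, b i))) \<noteq> 0"
    using product_irreps_separate[OF fin, of n f "\<one>\<^bsub>?G\<^esub>"] D.one_closed by blast
  define T where "T v = tens n d (\<lambda>i. \<rho> i (v i)) id" for v
  have T: "irred_rep ?G (\<Prod>i<n. d i) T" unfolding T_def using irr by (intro tens_irred[OF fin]) auto
  obtain s where s: "s < (\<Prod>i<n. d i)" "\<And>i. i < n \<Longrightarrow> tens_index n d s i = a i"
    using irr by (auto intro: tens_index_surj[of n a d])
  obtain t where t: "t < (\<Prod>i<n. d i)" "\<And>i. i < n \<Longrightarrow> tens_index n d t i = b i"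
    using irr by (auto intro: tens_index_surj[of n b d])
  have "(\<Sum>j<e. \<Sum>v\<in>carrier ?G. T v $$ (s, t) * r (inv\<^bsub>?G\<^esub> v) $$ (j, j)) = (\<Sum>v\<in>carrier ?G. T v $$ (s, t) * f v)"
    unfolding sum.swap[of _ "carrier ?G"]
    by (intro sum.cong refl) (simp only: f_def mat_trace_eq[OF rep_mat[OF rr D.inv_closed]] sum_distrib_left)
  also have "\<dots> = (\<Sum>v\<in>carrier ?G. f v * (\<Prod>i<n. \<rho> i (v i) $$ (a i, b i)))"
    using s t by (intro sum.cong refl) (simp add: T_def tens_def mult.commute)
  finally have "(\<Sum>j<e. \<Sum>v\<in>carrier ?G. T v $$ (s, t) * r (inv\<^bsub>?G\<^esub> v) $$ (j, j)) \<noteq> 0" using nz by simp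
  then obtain j where j: "j < e" "(\<Sum>v\<in>carrier ?G. T v $$ (s, t) * r (inv\<^bsub>?G\<^esub> v) $$ (j, j)) \<noteq> 0"
    by (meson lessThan_iff sum.neutral)
  have eq: "mat_trace (T g) = mat_trace (r g)" if "g \<in> carrier ?G" for g
    using D.irreps_equal_char[OF r T j(2) s(1) t(1) j(1,1) that] .
  define \<theta> where "\<theta> i g = (if g \<in> carrier G then mat_trace (\<rho> i g) else 0)" for i g
  have "\<forall>i<n. \<theta> i \<in> Irr G" using irr by (auto simp: \<theta>_def intro!: IrrI)
  moreover have "\<chi> v = prod_char (carrier G) n \<theta> v" for v
  proof (cases "v \<in> carrier ?G")
    case True
    then have vi: "i < n \<Longrightarrow> v i \<in> carrier G" for i by auto
    have "\<chi> v = mat_trace (T v)" using True \<chi>r eq by simp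
    also have "\<dots> = (\<Prod>i<n. mat_trace (\<rho> i (v i)))" unfolding T_def
      using irr vi by (intro tens_trace) (auto simp: irred_rep_def is_rep_def)
    finally show ?thesis using True vi by (auto simp: prod_char_def \<theta>_def)
  qed (auto simp: prod_char_def \<chi>r)
  ultimately show ?thesis by blast
qed

lemma Irr_at_one:
  assumes "\<theta> \<in> Irr G" shows "\<exists>d>0. \<theta> \<one> = of_nat d"
  using assms by (elim IrrE) (auto simp: irred_rep_def rep_one)

lemma Irr_norm:
  assumes "\<theta> \<in> Irr G"
  shows "(\<Sum>g\<in>carrier G. \<theta> g * \<theta> (inv g)) = of_nat (card (carrier G))"
proof -
  obtain d \<rho> where irr: "irred_rep G d \<rho>" and tr: "\<forall>g. \<theta> g = (if g \<in> carrier G then mat_trace (\<rho> g) else 0)"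
    using assms by (rule IrrE)
  then show ?thesis using orth_char_sum[OF irred_imp_schur_orth[OF irr]] irr by (simp add: irred_rep_def)
qed

lemma Irr_outside: "\<theta> \<in> Irr G \<Longrightarrow> g \<notin> carrier G \<Longrightarrow> \<theta> g = 0"
  by (elim IrrE) auto

text \<open>Evaluation at tuples with one free coordinate and units elsewhere shows that the i-th
  factors are proportional, the constants being the products A and B of the remaining degrees. Both
  factors have norm one, so A and B have equal squares, and they are positive integers.\<close>

lemma prod_char_inj:
  assumes fin: "finite (carrier G)" and \<theta>: "\<And>i. i < n \<Longrightarrow> \<theta> i \<in> Irr G" "\<And>i. i < n \<Longrightarrow> \<phi> i \<in> Irr G"
    and eq: "prod_char (carrier G) n \<theta> = prod_char (carrier G) n \<phi>" and i: "i < n"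
  shows "\<theta> i = \<phi> i"
proof -
  obtain d where d: "\<And>j. j < n \<Longrightarrow> 0 < d j \<and> \<theta> j \<one> = of_nat (d j)" using Irr_at_one[OF \<theta>(1)] by metis
  obtain e where e: "\<And>j. j < n \<Longrightarrow> 0 < e j \<and> \<phi> j \<one> = of_nat (e j)" using Irr_at_one[OF \<theta>(2)] by metis
  let ?I = "{..<n} - {i}"
  define A where "A = (\<Prod>j\<in>?I. d j)"
  define B where "B = (\<Prod>j\<in>?I. e j)"
  have pos: "0 < A" "0 < B" using d e by (auto simp: A_def B_def intro!: prod_pos)
  have ev: "prod_char (carrier G) n \<psi> (\<lambda>j\<in>{..<n}. if j = i then x else \<one>) = \<psi> i x * (\<Prod>j\<in>?I. \<psi> j \<one>)"
    if "x \<in> carrier G" for \<psi> x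
  proof -
    have "prod_char (carrier G) n \<psi> (\<lambda>j\<in>{..<n}. if j = i then x else \<one>) = (\<Prod>j<n. \<psi> j (if j = i then x else \<one>))"
      using that by (auto simp: prod_char_def)
    also have "\<dots> = \<psi> i x * (\<Prod>j\<in>?I. \<psi> j (if j = i then x else \<one>))" using i by (subst prod.remove[of _ i]) auto
    also have "(\<Prod>j\<in>?I. \<psi> j (if j = i then x else \<one>)) = (\<Prod>j\<in>?I. \<psi> j \<one>)" by (intro prod.cong) auto
    finally show ?thesis .
  qed
  have AA: "(\<Prod>j\<in>?I. \<theta> j \<one>) = of_nat A" using d by (simp add: A_def)
  have BB: "(\<Prod>j\<in>?I. \<phi> j \<one>) = of_nat B" using e by (simp add: B_def)
  have proportional: "\<theta> i x * of_nat A = \<phi> i x * of_nat B" if "x \<in> carrier G" for x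
    using ev[OF that, of \<theta>] ev[OF that, of \<phi>] eq AA BB by simp
  let ?N = "of_nat (card (carrier G)) :: complex"
  have "?N * (of_nat A * of_nat A) = (\<Sum>g\<in>carrier G. (\<theta> i g * of_nat A) * (\<theta> i (inv g) * of_nat A))"
    unfolding Irr_norm[OF \<theta>(1)[OF i], symmetric] by (simp add: sum_distrib_left sum_distrib_right mult_ac)
  also have "\<dots> = (\<Sum>g\<in>carrier G. (\<phi> i g * of_nat B) * (\<phi> i (inv g) * of_nat B))"
    using proportional by (intro sum.cong) auto
  also have "\<dots> = ?N * (of_nat B * of_nat B)"
    unfolding Irr_norm[OF \<theta>(2)[OF i], symmetric] by (simp add: sum_distrib_left sum_distrib_right mult_ac)
  finally have "?N * of_nat (A * A) = ?N * of_nat (B * B)" by simp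
  moreover have "?N \<noteq> 0" using fin one_closed by auto
  ultimately have "A * A = B * B" by (metis mult_cancel_left of_nat_eq_iff)
  then have "A = B" by (metis power2_eq_square power2_eq_iff_nonneg zero_le)
  then have "\<theta> i x = \<phi> i x" for x
    using proportional[of x] pos Irr_outside[OF \<theta>(1)[OF i], of x] Irr_outside[OF \<theta>(2)[OF i], of x] by (cases "x \<in> carrier G") auto
  then show ?thesis by auto
qed

lemma Irr_p'_iff:
  assumes "\<theta> \<in> Irr G" "\<theta> \<one> = of_nat d"
  shows "\<theta> \<in> Irr_p' p G \<longleftrightarrow> \<not> p dvd d"
proof -
  have "(\<exists>k::nat. \<theta> \<one> = of_nat (p * k)) \<longleftrightarrow> p dvd d" unfolding assms(2) by (auto simp: dvd_def simp flip: of_nat_mult)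
  then show ?thesis using assms(1) by (simp only: Irr_p'_def mem_Collect_eq simp_thms)
qed

text \<open>The degree of the product is the product of the degrees, and a prime divides a product
  only if it divides a factor.\<close>

lemma prod_char_Irr_p':
  assumes fin: "finite (carrier G)" and p: "Factorial_Ring.prime p" and \<theta>: "\<And>i. i < n \<Longrightarrow> \<theta> i \<in> Irr G"
  shows "prod_char (carrier G) n \<theta> \<in> Irr_p' p (dpow G n) \<longleftrightarrow> (\<forall>i<n. \<theta> i \<in> Irr_p' p G)"
proof -
  interpret D: group "dpow G n" by (rule group_dpow)
  obtain d where d: "\<And>j. j < n \<Longrightarrow> 0 < d j \<and> \<theta> j \<one> = of_nat (d j)" using Irr_at_one[OF \<theta>] by metis
  have I: "prod_char (carrier G) n \<theta> \<in> Irr (dpow G n)" by (rule prod_char_Irr[OF fin \<theta>])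
  have "prod_char (carrier G) n \<theta> \<one>\<^bsub>dpow G n\<^esub> = of_nat (\<Prod>i<n. d i)" using d by (simp add: prod_char_def)
  then have "prod_char (carrier G) n \<theta> \<in> Irr_p' p (dpow G n) \<longleftrightarrow> \<not> p dvd (\<Prod>i<n. d i)"
    by (rule D.Irr_p'_iff[OF I])
  also have "\<dots> \<longleftrightarrow> (\<forall>i<n. \<not> p dvd d i)" using p by (auto simp: prime_dvd_prod_iff)
  also have "\<dots> \<longleftrightarrow> (\<forall>i<n. \<theta> i \<in> Irr_p' p G)" using d \<theta> by (simp add: Irr_p'_iff)
  finally show ?thesis .
qed

lemma Irr_p'_dpow:
  assumes fin: "finite (carrier G)" and p: "Factorial_Ring.prime p" and \<chi>: "\<chi> \<in> Irr_p' p (dpow G n)"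
  obtains \<theta> where "\<And>i. i < n \<Longrightarrow> \<theta> i \<in> Irr_p' p G" "\<chi> = prod_char (carrier G) n \<theta>"
proof -
  have "\<chi> \<in> Irr (dpow G n)" using \<chi> by (simp add: Irr_p'_def)
  then obtain \<theta> where \<theta>: "\<forall>i<n. \<theta> i \<in> Irr G" "\<chi> = prod_char (carrier G) n \<theta>" using Irr_dpow[OF fin] by blast
  then show thesis using prod_char_Irr_p'[OF fin p, of n \<theta>] \<chi> that by auto
qed

end

lemma prod_char_cong: "(\<And>i. i < n \<Longrightarrow> \<theta> i = \<phi> i) \<Longrightarrow> prod_char K n \<theta> = prod_char K n \<phi>"
  by (auto simp: prod_char_def)

section \<open>Projective representations and their Galois twists\<close>

lemma invertible_mat_obtain:
  fixes A :: "complex mat"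
  assumes "A \<in> carrier_mat d d" "invertible_mat A"
  obtains B where "B \<in> carrier_mat d d" "A * B = 1\<^sub>m d" "B * A = 1\<^sub>m d"
proof -
  obtain B where B: "A * B = 1\<^sub>m (dim_row A)" "B * A = 1\<^sub>m (dim_row B)"
    using assms(2) unfolding invertible_mat_def inverts_mat_def by blast
  have "dim_row B = d" "dim_col B = d"
    using arg_cong[OF B(1), of dim_col] arg_cong[OF B(2), of dim_col] assms(1) by auto
  then show thesis using B assms(1) by (intro that[of B]) auto
qed

lemma invertible_matI:
  fixes A :: "complex mat"
  assumes "A \<in> carrier_mat d d" "B \<in> carrier_mat d d" "A * B = 1\<^sub>m d" "B * A = 1\<^sub>m d"
  shows "invertible_mat A"
  using assms unfolding invertible_mat_def inverts_mat_def by auto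

lemma smult_invertible_cancel:
  fixes A :: "complex mat"
  assumes A: "A \<in> carrier_mat d d" "B \<in> carrier_mat d d" "A * B = 1\<^sub>m d" and d: "0 < d"
    and eq: "c \<cdot>\<^sub>m A = c' \<cdot>\<^sub>m A"
  shows "c = c'"
proof -
  have "c \<cdot>\<^sub>m 1\<^sub>m d = (c \<cdot>\<^sub>m A) * B" using A by (simp add: mult_smult_assoc_mat[of A d d B d])
  also have "\<dots> = c' \<cdot>\<^sub>m 1\<^sub>m d" unfolding eq using A by (simp add: mult_smult_assoc_mat[of A d d B d])
  finally have "(c \<cdot>\<^sub>m 1\<^sub>m d) $$ (0, 0) = (c' \<cdot>\<^sub>m 1\<^sub>m d :: complex mat) $$ (0, 0)" by simp
  then show ?thesis using d by simp
qed

lemma one_smult_mat [simp]: "(1 :: complex) \<cdot>\<^sub>m A = A"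
  by (intro eq_matI) auto

lemma assoc4_mat:
  fixes A :: "complex mat"
  assumes "A \<in> carrier_mat a a'" "B \<in> carrier_mat a' b" "C \<in> carrier_mat b c" "D \<in> carrier_mat c d"
  shows "A * B * (C * D) = A * (B * C) * D"
proof -
  have "A * B * (C * D) = A * (B * (C * D))" using assms by (intro assoc_mult_mat[of _ a a' _ b]) auto
  also have "B * (C * D) = B * C * D" using assms by (intro assoc_mult_mat[symmetric])
  also have "A * (B * C * D) = A * (B * C) * D" using assms by (intro assoc_mult_mat[symmetric]) auto
  finally show ?thesis .
qed

lemma conj_mult:
  fixes A :: "complex mat"
  assumes "A \<in> carrier_mat d d" "B \<in> carrier_mat d d" "M \<in> carrier_mat e d" "M' \<in> carrier_mat d e" "M' * M = 1\<^sub>m d"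
  shows "(M * A * M') * (M * B * M') = M * (A * B) * M'"
proof -
  have "(M * A * M') * (M * B * M') = M * A * (M' * (M * B)) * M'"
    using assms by (subst assoc4_mat[of _ e d _ e, symmetric]) (auto simp: assoc_mult_mat[of _ e d _ d _ e])
  also have "M' * (M * B) = B" using assms by (simp flip: assoc_mult_mat[of M' d e M d B d])
  also have "M * A * B = M * (A * B)" using assms by (intro assoc_mult_mat) auto
  finally show ?thesis .
qed

lemma conj_cancel:
  fixes A :: "complex mat"
  assumes "A \<in> carrier_mat d d" "M \<in> carrier_mat d d" "M' \<in> carrier_mat d d" "M' * M = 1\<^sub>m d"
  shows "M' * (M * A * M') * M = A"
proof -
  have "M' * (M * A * M') * M = (M' * (M * A)) * (M' * M)"
    using assms by (subst assoc4_mat[of _ d d _ d _ d]) (auto simp: assoc_mult_mat[of _ d d _ d _ d])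
  also have "M' * (M * A) = (M' * M) * A" using assms by (intro assoc_mult_mat[symmetric]) auto
  finally show ?thesis using assms by simp
qed

lemma conj_smult:
  fixes A :: "complex mat"
  assumes "A \<in> carrier_mat d d" "M \<in> carrier_mat e d" "M' \<in> carrier_mat d e'"
  shows "M * (c \<cdot>\<^sub>m A) * M' = c \<cdot>\<^sub>m (M * A * M')"
  using assms mult_smult_distrib[of M e d A d c] mult_smult_assoc_mat[of "M * A" e d M' e' c] by simp

lemma entries_Qab_mat: "entries_Qab K d P \<Longrightarrow> x \<in> K \<Longrightarrow> P x \<in> carrier_mat d d \<Longrightarrow> mat_Qab (P x)"
  by (auto simp: entries_Qab_def mat_Qab_def)

text \<open>The factor set is left out: it plays no role for the existence and uniqueness of \<open>\<mu>\<close>.\<close>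
locale assoc_rep = group S for S (structure) +
  fixes L K :: "'a set" and \<theta> :: "'a \<Rightarrow> complex" and d :: nat and P :: "'a \<Rightarrow> complex mat"
  assumes L: "subgroup L S" "finite L" and K: "subgroup K S" "L \<subseteq> K"
    and normal: "\<And>y l. y \<in> K \<Longrightarrow> l \<in> L \<Longrightarrow> inv y \<otimes> l \<otimes> y \<in> L"
    and irr: "\<theta> \<in> Irr (S\<lparr>carrier := L\<rparr>)"
    and carr: "\<And>x. x \<in> K \<Longrightarrow> P x \<in> carrier_mat d d" "\<And>x. x \<in> K \<Longrightarrow> invertible_mat (P x)"
    and assoc: "assoc_with S L \<theta> K P"
begin

lemma P_left: "l \<in> L \<Longrightarrow> y \<in> K \<Longrightarrow> P (l \<otimes> y) = P l * P y"
  and P_right: "l \<in> L \<Longrightarrow> y \<in> K \<Longrightarrow> P (y \<otimes> l) = P y * P l"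
  and P_trace: "l \<in> L \<Longrightarrow> mat_trace (P l) = \<theta> l"
  using assoc by (auto simp: assoc_with_def)

lemma LK: "l \<in> L \<Longrightarrow> l \<in> K" using K by auto

lemma one_L: "\<one> \<in> L" using L(1) by (rule subgroup.one_closed)

lemma group_L: "group (S\<lparr>carrier := L\<rparr>)"
  by (rule subgroup.subgroup_is_group[OF L(1) is_group])

lemma P_one: "P \<one> = 1\<^sub>m d"
proof -
  have c: "P \<one> \<in> carrier_mat d d" "invertible_mat (P \<one>)" using carr one_L LK by auto
  obtain B where B: "B \<in> carrier_mat d d" "P \<one> * B = 1\<^sub>m d" by (rule invertible_mat_obtain[OF c])
  have "P \<one> = P \<one> * P \<one>" using P_left[OF one_L LK[OF one_L]] by simp
  then have "P \<one> * B = P \<one> * (P \<one> * B)" using c B assoc_mult_mat[OF c(1) c(1) B(1)] by simp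
  then show ?thesis using B c by simp
qed

lemma rep: "is_rep (S\<lparr>carrier := L\<rparr>) d P"
  using carr(1) P_left LK P_one by (auto simp: is_rep_def)

lemma irred: "irred_rep (S\<lparr>carrier := L\<rparr>) d P"
proof -
  interpret SL: group "S\<lparr>carrier := L\<rparr>" by (rule group_L)
  obtain e \<rho> where \<rho>: "irred_rep (S\<lparr>carrier := L\<rparr>) e \<rho>" "\<forall>g. \<theta> g = (if g \<in> carrier (S\<lparr>carrier := L\<rparr>) then mat_trace (\<rho> g) else 0)"
    using irr by (rule IrrE)
  show ?thesis
    using conjunct2[OF SL.irred_of_equal_char[OF _ \<rho>(1) rep]] \<rho>(2) P_trace L(2) by simp
qed

lemma d_pos: "0 < d" using irred by (simp add: irred_rep_def)

lemma commuting_scalar_P: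
  assumes "A \<in> carrier_mat d d" "\<And>l. l \<in> L \<Longrightarrow> P l * A = A * P l"
  shows "\<exists>c. A = c \<cdot>\<^sub>m 1\<^sub>m d"
  using schur_commutant[OF irred assms(1)] assms(2) by simp

lemma scalar_unique:
  assumes y: "y \<in> K" and M: "M \<in> carrier_mat d d" "M' \<in> carrier_mat d d" "M * M' = 1\<^sub>m d" "M' * M = 1\<^sub>m d"
    and eq: "c \<cdot>\<^sub>m (M' * P y * M) = c' \<cdot>\<^sub>m (M' * P y * M)"
  shows "c = c'"
proof -
  obtain B where B: "B \<in> carrier_mat d d" "P y * B = 1\<^sub>m d" by (rule invertible_mat_obtain[OF carr[OF y]])
  have "(M' * P y * M) * (M' * B * M) = M' * (P y * B) * M"
    using M B carr(1)[OF y] by (intro conj_mult[of _ d]) auto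
  also have "\<dots> = 1\<^sub>m d" using M B by simp
  finally show ?thesis
    using smult_invertible_cancel[of "M' * P y * M" d "M' * B * M" c c'] d_pos eq M B carr(1)[OF y] by simp
qed

text \<open>On \<open>L\<close> both families afford \<theta>, so a matrix M over \<open>Qab\<close>
  conjugates one into the other there. For y in \<open>K\<close>, the matrix
  \<open>M * Q y * M'\<close> times the inverse of \<open>P y\<close> commutes with all
  \<open>P l\<close>, hence is a scalar by Schur's lemma; this scalar is the multiplier.\<close>

lemma mu_exists:
  assumes Q: "\<And>x. x \<in> K \<Longrightarrow> Q x \<in> carrier_mat d d" "\<And>x. x \<in> K \<Longrightarrow> invertible_mat (Q x)"
    and Qassoc: "assoc_with S L \<theta> K Q"
  obtains M M' \<mu> where "M \<in> carrier_mat d d" "M' \<in> carrier_mat d d" "M * M' = 1\<^sub>m d" "M' * M = 1\<^sub>m d"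
    "\<forall>y\<in>K. Q y = \<mu> y \<cdot>\<^sub>m (M' * P y * M)" "\<forall>y\<in>K. \<mu> y \<noteq> 0" "\<forall>l\<in>L. \<forall>y\<in>K. \<mu> (l \<otimes> y) = \<mu> y" "\<mu> \<one> = 1"
    "(\<forall>x\<in>L. mat_Qab (P x) \<and> mat_Qab (Q x)) \<longrightarrow> mat_Qab M \<and> mat_Qab M'"
proof -
  interpret SL: group "S\<lparr>carrier := L\<rparr>" by (rule group_L)
  interpret Q: assoc_rep S L K \<theta> d Q
    by (intro assoc_rep.intro assoc_rep_axioms.intro is_group) (use L K normal irr Q Qassoc in auto)
  have "mat_trace (Q g) = mat_trace (P g)" if "g \<in> carrier (S\<lparr>carrier := L\<rparr>)" for g
    using that Q.P_trace P_trace by simp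
  note similar = SL.equal_char_similar[OF _ irred Q.rep this, simplified, OF L(2)]
  obtain M M' where M: "M \<in> carrier_mat d d" "M' \<in> carrier_mat d d" "M * M' = 1\<^sub>m d" "M' * M = 1\<^sub>m d"
    and simL: "\<forall>l\<in>L. Q l = M' * P l * M"
    and MQab: "(\<forall>x\<in>L. mat_Qab (P x) \<and> mat_Qab (Q x)) \<longrightarrow> mat_Qab M \<and> mat_Qab M'"
    using similar by blast
  have "\<exists>c. c \<noteq> 0 \<and> Q y = c \<cdot>\<^sub>m (M' * P y * M)" if y: "y \<in> K" for y
  proof -
    define U where "U z = M * Q z * M'" for z
    have U: "U z \<in> carrier_mat d d" if "z \<in> K" for z using that M Q by (auto simp: U_def)
    have UL: "U l = P l" if "l \<in> L" for l
      unfolding U_def bspec[OF simL that] using M carr(1)[OF LK[OF that]] by (intro conj_cancel)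
    have Uleft: "U (l \<otimes> z) = U l * U z" and Uright: "U (z \<otimes> l) = U z * U l" if "l \<in> L" "z \<in> K" for l z
      unfolding U_def using that M Q LK by (simp_all add: Q.P_left Q.P_right conj_mult[of _ d _ M d M'])
    have Py: "P y \<in> carrier_mat d d" using carr y by auto
    obtain B where B: "B \<in> carrier_mat d d" "P y * B = 1\<^sub>m d" "B * P y = 1\<^sub>m d"
      by (rule invertible_mat_obtain[OF carr[OF y]])
    have Uy: "U y \<in> carrier_mat d d" using U y by auto
    have "P l * (U y * B) = (U y * B) * P l" if l: "l \<in> L" for l
    proof -
      \<comment> \<open>\<open>U\<close> and \<open>P\<close> agree on \<open>L\<close> and both
        turn passing l across y into l', so their quotient at y commutes with
        \<open>P l\<close>.\<close>
      define l' where "l' = inv y \<otimes> l \<otimes> y"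
      have l': "l' \<in> L" unfolding l'_def by (rule normal[OF y l])
      have yS: "y \<in> carrier S" "l \<in> carrier S" using y l K L subgroup.subset by blast+
      have ll: "y \<otimes> l' = l \<otimes> y" using yS by (simp add: l'_def m_assoc flip: m_assoc[of y "inv y"])
      have PP: "P l \<in> carrier_mat d d" "P l' \<in> carrier_mat d d" using l l' LK carr by auto
      have "P y * P l' = P l * P y" using P_left[OF l y] P_right[OF l' y] ll by simp
      then have "B * (P y * P l') * B = B * (P l * P y) * B" by simp
      moreover have "B * (P y * P l') * B = P l' * B"
        using B PP Py by (simp flip: assoc_mult_mat[of B d d "P y" d "P l'" d])
      moreover have "B * (P l * P y) * B = B * P l"
      proof -
        have "B * (P l * P y) * B = B * P l * (P y * B)" using B PP Py by (intro assoc4_mat[symmetric])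
        then show ?thesis using B PP by simp
      qed
      ultimately have PB: "P l' * B = B * P l" by simp
      have "P l * (U y * B) = (P l * U y) * B" using PP Uy B by (intro assoc_mult_mat[symmetric])
      also have "P l * U y = U y * P l'" using Uleft[OF l y] Uright[OF l' y] UL l l' ll by simp
      also have "U y * P l' * B = U y * (P l' * B)" using PP Uy B by (intro assoc_mult_mat)
      also have "\<dots> = (U y * B) * P l" unfolding PB using PP Uy B by (intro assoc_mult_mat[symmetric])
      finally show ?thesis .
    qed
    then obtain c where c: "U y * B = c \<cdot>\<^sub>m 1\<^sub>m d" using commuting_scalar_P[of "U y * B"] Uy B by auto
    have "U y = U y * (B * P y)" using B Uy by simp
    also have "\<dots> = (U y * B) * P y" using B Uy Py by (intro assoc_mult_mat[symmetric])
    also have "\<dots> = c \<cdot>\<^sub>m P y" unfolding c using Py by (simp add: mult_smult_assoc_mat[of "1\<^sub>m d" d d "P y" d])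
    finally have Uc: "U y = c \<cdot>\<^sub>m P y" .
    have "Q y = M' * U y * M" unfolding U_def using M Q(1)[OF y] by (intro conj_cancel[symmetric])
    then have Qc: "Q y = c \<cdot>\<^sub>m (M' * P y * M)" unfolding Uc using M Py conj_smult by simp
    have "c \<noteq> 0"
    proof
      assume c0: "c = 0"
      obtain B' where B': "B' \<in> carrier_mat d d" "Q y * B' = 1\<^sub>m d" by (rule invertible_mat_obtain[OF Q[OF y]])
      have "Q y = 0\<^sub>m d d" unfolding Qc c0 using M Py by (intro eq_matI) auto
      then have "(0\<^sub>m d d :: complex mat) = 1\<^sub>m d" using B' by simp
      then have "(0\<^sub>m d d :: complex mat) $$ (0, 0) = 1\<^sub>m d $$ (0, 0)" by simp
      then show False using d_pos by simp
    qed
    then show ?thesis using Qc by blast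
  qed
  then obtain \<mu> where \<mu>: "\<And>y. y \<in> K \<Longrightarrow> \<mu> y \<noteq> 0 \<and> Q y = \<mu> y \<cdot>\<^sub>m (M' * P y * M)" by metis
  have "\<mu> (l \<otimes> y) = \<mu> y" if l: "l \<in> L" and y: "y \<in> K" for l y
  proof -
    have ly: "l \<otimes> y \<in> K" using l y K LK subgroup.m_closed by metis
    note c = carr(1)[OF LK[OF l]] carr(1)[OF y]
    have "Q (l \<otimes> y) = Q l * Q y" by (rule Q.P_left[OF l y])
    also have "\<dots> = (M' * P l * M) * (\<mu> y \<cdot>\<^sub>m (M' * P y * M))" using simL l \<mu>[OF y] by simp
    also have "\<dots> = \<mu> y \<cdot>\<^sub>m ((M' * P l * M) * (M' * P y * M))" using M c by (intro mult_smult_distrib) auto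
    also have "(M' * P l * M) * (M' * P y * M) = M' * (P l * P y) * M" using M c by (intro conj_mult[of _ d])
    finally have "Q (l \<otimes> y) = \<mu> y \<cdot>\<^sub>m (M' * P (l \<otimes> y) * M)" using P_left[OF l y] by simp
    then show ?thesis using scalar_unique[OF ly M, of "\<mu> (l \<otimes> y)" "\<mu> y"] \<mu>[OF ly] by simp
  qed
  moreover have "\<mu> \<one> = 1"
  proof -
    have "Q \<one> = 1 \<cdot>\<^sub>m (M' * P \<one> * M)" using Q.P_one P_one M by (simp add: one_smult_mat)
    then show ?thesis using scalar_unique[OF LK[OF one_L] M, of "\<mu> \<one>" 1] \<mu>[OF LK[OF one_L]] by simp
  qed
  ultimately show thesis using \<mu> by (intro that[OF M, of \<mu>] MQab) auto
qed

text \<open>Multipliers are 1 on \<open>L\<close>, so two base changes for the same twist agree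
  there up to a matrix commuting with \<open>P\<close>. By Schur's lemma \<open>V * Mi\<close> is a
  scalar, and scalars cancel in the conjugation of \<open>P y\<close>.\<close>

lemma mu_unique:
  assumes 1: "sim_scaled K d Q \<mu> P" "\<forall>l\<in>L. \<forall>y\<in>K. \<mu> (l \<otimes> y) = \<mu> y" "\<mu> \<one> = 1"
    and 2: "sim_scaled K d Q \<nu> P" "\<forall>l\<in>L. \<forall>y\<in>K. \<nu> (l \<otimes> y) = \<nu> y" "\<nu> \<one> = 1"
    and y: "y \<in> K"
  shows "\<mu> y = \<nu> y"
proof -
  obtain M Mi where M: "M \<in> carrier_mat d d" "Mi \<in> carrier_mat d d" "M * Mi = 1\<^sub>m d" "Mi * M = 1\<^sub>m d"
    and Qm: "\<forall>y\<in>K. Q y = \<mu> y \<cdot>\<^sub>m (Mi * P y * M)" using 1(1) unfolding sim_scaled_def by blast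
  obtain V Vi where V: "V \<in> carrier_mat d d" "Vi \<in> carrier_mat d d" "V * Vi = 1\<^sub>m d" "Vi * V = 1\<^sub>m d"
    and Qn: "\<forall>y\<in>K. Q y = \<nu> y \<cdot>\<^sub>m (Vi * P y * V)" using 2(1) unfolding sim_scaled_def by blast
  have one: "\<mu> l = 1" "\<nu> l = 1" if "l \<in> L" for l
  proof -
    have "l \<otimes> \<one> = l" using that L(1) subgroup.mem_carrier by (metis r_one)
    then show "\<mu> l = 1" "\<nu> l = 1" using 1 2 that LK[OF one_L] by metis+
  qed
  have comm: "P l * (V * Mi) = (V * Mi) * P l" if l: "l \<in> L" for l
  proof -
    have Pl: "P l \<in> carrier_mat d d" using carr LK l by auto
    have "1 \<cdot>\<^sub>m (Mi * P l * M) = 1 \<cdot>\<^sub>m (Vi * P l * V)" using Qm Qn one[OF l] LK[OF l] by metis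
    then have e: "Mi * P l * M = Vi * P l * V" by (simp add: one_smult_mat)
    have "V * Mi * P l = V * Mi * P l * (M * Mi)" using M V Pl by simp
    also have "\<dots> = V * (Mi * P l * M) * Mi"
      using M V Pl by (simp add: assoc_mult_mat[of _ d d _ d _ d])
    also have "\<dots> = V * (Vi * P l * V) * Mi" unfolding e ..
    also have "V * (Vi * P l * V) = V * (Vi * P l) * V" using V Pl by (intro assoc_mult_mat[symmetric, of _ d d _ d _ d]) auto
    also have "\<dots> = V * Vi * (P l * V)" using V Pl by (intro assoc4_mat[symmetric])
    also have "V * Vi * (P l * V) = P l * V" unfolding V(3) using V Pl by simp
    finally show ?thesis using V M Pl by (simp add: assoc_mult_mat[of _ d d _ d _ d])
  qed
  obtain c where c: "V * Mi = c \<cdot>\<^sub>m 1\<^sub>m d" using commuting_scalar_P[of "V * Mi"] comm M V by auto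
  have Py: "P y \<in> carrier_mat d d" using carr y by auto
  have "V = V * (Mi * M)" using M V by simp
  also have "\<dots> = (V * Mi) * M" using M V by (intro assoc_mult_mat[symmetric])
  also have "\<dots> = c \<cdot>\<^sub>m M" unfolding c using M by (simp add: mult_smult_assoc_mat[of "1\<^sub>m d" d d M d])
  finally have Vc: "V = c \<cdot>\<^sub>m M" .
  have "Mi = (Vi * V) * Mi" using V M by simp
  also have "\<dots> = Vi * (V * Mi)" using V M by (intro assoc_mult_mat)
  also have "\<dots> = c \<cdot>\<^sub>m Vi" unfolding c mult_smult_distrib[OF V(2) one_carrier_mat] using V by simp
  finally have Mc: "Mi = c \<cdot>\<^sub>m Vi" .
  have "Vi * P y * V = c \<cdot>\<^sub>m (Vi * P y * M)" unfolding Vc using V M Py by (intro mult_smult_distrib) auto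
  also have "\<dots> = Mi * P y * M" unfolding Mc using V M Py
    mult_smult_assoc_mat[of Vi d d "P y" d c] mult_smult_assoc_mat[of "Vi * P y" d d M d c] by simp
  finally have "\<mu> y \<cdot>\<^sub>m (Mi * P y * M) = \<nu> y \<cdot>\<^sub>m (Mi * P y * M)" using Qm Qn y by metis
  then show ?thesis by (rule scalar_unique[OF y M])
qed

text \<open>That (x, \<sigma>) fixes \<theta> means that the twisted family still affords \<theta>,
  so the existence of multipliers applies to it.\<close>

lemma twist_assoc:
  assumes x: "x \<in> carrier S" and xK: "\<forall>y\<in>K. x \<otimes> y \<otimes> inv x \<in> K" and xL: "\<forall>l\<in>L. x \<otimes> l \<otimes> inv x \<in> L"
    and s: "galois_ab \<sigma>" and Q: "entries_Qab K d P" and st: "char_act S L \<theta> x \<sigma> = \<theta>"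
  shows "\<And>y. y \<in> K \<Longrightarrow> proj_twist S P x \<sigma> y \<in> carrier_mat d d"
    "\<And>y. y \<in> K \<Longrightarrow> invertible_mat (proj_twist S P x \<sigma> y)"
    "\<And>y. y \<in> K \<Longrightarrow> mat_Qab (proj_twist S P x \<sigma> y)"
    "assoc_with S L \<theta> K (proj_twist S P x \<sigma>)"
proof -
  note xK = xK[rule_format] and xL = xL[rule_format]
  have Pq: "mat_Qab (P y)" if "y \<in> K" for y by (rule entries_Qab_mat[OF Q that carr(1)[OF that]])
  show c: "proj_twist S P x \<sigma> y \<in> carrier_mat d d" if "y \<in> K" for y
    using carr(1)[OF xK[OF that]] by (simp add: proj_twist_def)
  show "mat_Qab (proj_twist S P x \<sigma> y)" if "y \<in> K" for y
    using Pq[OF xK[OF that]] by (simp add: proj_twist_def mat_Qab_map_galois[OF s])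
  show "invertible_mat (proj_twist S P x \<sigma> y)" if y: "y \<in> K" for y
  proof -
    let ?z = "x \<otimes> y \<otimes> inv x"
    obtain B where B: "B \<in> carrier_mat d d" "P ?z * B = 1\<^sub>m d" "B * P ?z = 1\<^sub>m d"
      by (rule invertible_mat_obtain[OF carr[OF xK[OF y]]])
    have BQ: "mat_Qab B" by (rule mat_Qab_inverse[OF carr(1)[OF xK[OF y]] Pq[OF xK[OF y]] B])
    show ?thesis unfolding proj_twist_def
    proof (rule invertible_matI[of _ d "map_mat \<sigma> B"])
      show "map_mat \<sigma> (P ?z) * map_mat \<sigma> B = 1\<^sub>m d"
        using map_mat_galois_mult[OF s carr(1)[OF xK[OF y]] B(1) Pq[OF xK[OF y]] BQ] B map_mat_galois_one[OF s] by simp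
      show "map_mat \<sigma> B * map_mat \<sigma> (P ?z) = 1\<^sub>m d"
        using map_mat_galois_mult[OF s B(1) carr(1)[OF xK[OF y]] BQ Pq[OF xK[OF y]]] B map_mat_galois_one[OF s] by simp
    qed (use B carr(1)[OF xK[OF y]] in auto)
  qed
  have KS: "y \<in> K \<Longrightarrow> y \<in> carrier S" for y using K subgroup.subset by blast
  have conj: "x \<otimes> (y \<otimes> z) \<otimes> inv x = (x \<otimes> y \<otimes> inv x) \<otimes> (x \<otimes> z \<otimes> inv x)" if "y \<in> K" "z \<in> K" for y z
    using KS[OF that(1)] KS[OF that(2)] x by (simp add: m_assoc inv_solve_left flip: m_assoc[of "inv x" x])
  have m: "proj_twist S P x \<sigma> (y \<otimes> z) = proj_twist S P x \<sigma> y * proj_twist S P x \<sigma> z"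
    if "y \<in> K" "z \<in> K" "P ((x \<otimes> y \<otimes> inv x) \<otimes> (x \<otimes> z \<otimes> inv x)) = P (x \<otimes> y \<otimes> inv x) * P (x \<otimes> z \<otimes> inv x)" for y z
    unfolding proj_twist_def conj[OF that(1,2)] that(3)
    by (rule map_mat_galois_mult[OF s carr(1)[OF xK[OF that(1)]] carr(1)[OF xK[OF that(2)]] Pq[OF xK[OF that(1)]] Pq[OF xK[OF that(2)]]])
  show "assoc_with S L \<theta> K (proj_twist S P x \<sigma>)"
    unfolding assoc_with_def
  proof (intro conjI ballI)
    fix l assume l: "l \<in> L"
    show "mat_trace (proj_twist S P x \<sigma> l) = \<theta> l"
    proof -
      have "mat_trace (proj_twist S P x \<sigma> l) = \<sigma> (mat_trace (P (x \<otimes> l \<otimes> inv x)))"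
        unfolding proj_twist_def using Pq[OF LK[OF xL[OF l]]] carr(1)[OF LK[OF xL[OF l]]]
        by (intro mat_trace_map_galois[OF s]) auto
      also have "\<dots> = \<sigma> (\<theta> (x \<otimes> l \<otimes> inv x))" using P_trace[OF xL[OF l]] by simp
      also have "\<dots> = char_act S L \<theta> x \<sigma> l" using l by (simp add: char_act_def)
      finally show ?thesis using st by simp
    qed
  next
    fix l y assume "l \<in> L" "y \<in> K"
    then show "proj_twist S P x \<sigma> (l \<otimes> y) = proj_twist S P x \<sigma> l * proj_twist S P x \<sigma> y"
      "proj_twist S P x \<sigma> (y \<otimes> l) = proj_twist S P x \<sigma> y * proj_twist S P x \<sigma> l"
      using m[of l y] m[of y l] LK[of l] P_left[OF xL xK] P_right[OF xL xK] by simp_all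
  next
    fix l l' assume "l \<in> L" "l' \<in> L"
    then show "proj_twist S P x \<sigma> (l \<otimes> l') = proj_twist S P x \<sigma> l * proj_twist S P x \<sigma> l'"
      using m[of l l'] LK[of l] LK[of l'] P_left[OF xL xK] by simp
  qed
qed

text \<open>Conjugation by l is conjugation by \<open>P l\<close>, which is absorbed in the base
  change. So a multiplier of (x, \<sigma>) serves for the whole coset of x modulo \<open>L\<close>,
  and in a semidirect product it is enough to treat pure automorphisms.\<close>

lemma twist_left:
  assumes x: "x \<in> carrier S" and xK: "\<forall>y\<in>K. x \<otimes> y \<otimes> inv x \<in> K" and l: "l \<in> L"
    and s: "galois_ab \<sigma>" and Q: "entries_Qab K d P"
    and sim: "sim_scaled K d (proj_twist S P x \<sigma>) \<mu> P"
  shows "sim_scaled K d (proj_twist S P (l \<otimes> x) \<sigma>) \<mu> P"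
proof -
  note xK = xK[rule_format]
  have Pq: "mat_Qab (P y)" if "y \<in> K" for y by (rule entries_Qab_mat[OF Q that carr(1)[OF that]])
  have il: "inv l \<in> L" using L(1) l by (rule subgroup.m_inv_closed)
  have lS: "l \<in> carrier S" using L(1) l by (rule subgroup.mem_carrier)
  have KS: "y \<in> K \<Longrightarrow> y \<in> carrier S" for y using K subgroup.subset by blast
  obtain M Mi where M: "M \<in> carrier_mat d d" "Mi \<in> carrier_mat d d" "M * Mi = 1\<^sub>m d" "Mi * M = 1\<^sub>m d"
    and eq: "\<forall>y\<in>K. proj_twist S P x \<sigma> y = \<mu> y \<cdot>\<^sub>m (Mi * P y * M)" using sim unfolding sim_scaled_def by blast
  define U where "U = map_mat \<sigma> (P l)"
  define Ui where "Ui = map_mat \<sigma> (P (inv l))"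
  note PL = carr(1)[OF LK[OF l]] carr(1)[OF LK[OF il]] Pq[OF LK[OF l]] Pq[OF LK[OF il]]
  have U: "U \<in> carrier_mat d d" "Ui \<in> carrier_mat d d" using PL by (auto simp: U_def Ui_def)
  have UU: "U * Ui = 1\<^sub>m d" "Ui * U = 1\<^sub>m d"
    unfolding U_def Ui_def
      map_mat_galois_mult[OF s PL(1,2,3,4), symmetric] map_mat_galois_mult[OF s PL(2,1,4,3), symmetric]
      P_left[OF l LK[OF il], symmetric] P_left[OF il LK[OF l], symmetric]
    using lS by (simp_all add: P_one map_mat_galois_one[OF s])
  have "proj_twist S P (l \<otimes> x) \<sigma> y = \<mu> y \<cdot>\<^sub>m ((U * Mi) * P y * (M * Ui))" if y: "y \<in> K" for y
  proof -
    let ?z = "x \<otimes> y \<otimes> inv x"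
    have z: "?z \<in> K" by (rule xK[OF y])
    have Pz: "P ?z \<in> carrier_mat d d" using carr z by auto
    have Py: "P y \<in> carrier_mat d d" using carr y by auto
    have zl: "?z \<otimes> inv l \<in> K" using subgroup.m_closed[OF K(1) z LK[OF il]] .
    have "l \<otimes> x \<otimes> y \<otimes> inv (l \<otimes> x) = l \<otimes> (?z \<otimes> inv l)"
      using lS x KS[OF y] by (simp add: inv_mult_group m_assoc)
    then have "P (l \<otimes> x \<otimes> y \<otimes> inv (l \<otimes> x)) = P l * (P ?z * P (inv l))"
      using P_left[OF l zl] P_right[OF il z] by simp
    then have "proj_twist S P (l \<otimes> x) \<sigma> y = U * (map_mat \<sigma> (P ?z) * Ui)"
      unfolding proj_twist_def U_def Ui_def
      using map_mat_galois_mult[OF s PL(1) _ PL(3) mat_Qab_mult[OF Pz PL(2) Pq[OF z] PL(4)]]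
        map_mat_galois_mult[OF s Pz PL(2) Pq[OF z] PL(4)] mult_carrier_mat[OF Pz PL(2)] by simp
    also have "map_mat \<sigma> (P ?z) = \<mu> y \<cdot>\<^sub>m (Mi * P y * M)" using eq y by (simp add: proj_twist_def)
    also have "U * ((\<mu> y \<cdot>\<^sub>m (Mi * P y * M)) * Ui) = U * (\<mu> y \<cdot>\<^sub>m (Mi * P y * M)) * Ui"
      using U M Py by (intro assoc_mult_mat[symmetric]) auto
    also have "\<dots> = \<mu> y \<cdot>\<^sub>m (U * (Mi * P y * M) * Ui)" using U M Py by (intro conj_smult) auto
    also have "U * (Mi * P y * M) * Ui = (U * Mi) * P y * (M * Ui)"
      using U M Py by (simp add: assoc_mult_mat[of _ d d _ d _ d])
    finally show ?thesis .
  qed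
  moreover have "(M * Ui) * (U * Mi) = 1\<^sub>m d"
    using U M UU by (subst assoc4_mat[of _ d d _ d _ d]) auto
  moreover have "(U * Mi) * (M * Ui) = 1\<^sub>m d"
    using U M UU by (subst assoc4_mat[of _ d d _ d _ d]) auto
  ultimately show ?thesis unfolding sim_scaled_def
    using U M by (intro exI[of _ "M * Ui"] exI[of _ "U * Mi"]) auto
qed

end

section \<open>Semidirect products\<close>

lemma sdp_carrier [simp]: "carrier (sdp G A) = carrier G \<times> A"
  by (simp add: sdp_def)

lemma sdp_mult [simp]: "(k, a) \<otimes>\<^bsub>sdp G A\<^esub> (k', a') = (k \<otimes>\<^bsub>G\<^esub> a k', a \<circ> a')"
  by (simp add: sdp_def)

lemma sdp_one [simp]: "\<one>\<^bsub>sdp G A\<^esub> = (\<one>\<^bsub>G\<^esub>, id)"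
  by (simp add: sdp_def)

lemma sdp_restrict: "(sdp G A)\<lparr>carrier := N \<times> A\<rparr> = sdp (G\<lparr>carrier := N\<rparr>) A"
  by (simp add: sdp_def)

lemma lift_char_inject [simp]: "lift_char \<theta> = lift_char \<phi> \<longleftrightarrow> \<theta> = \<phi>"
proof
  assume "lift_char \<theta> = lift_char \<phi>"
  then have "lift_char \<theta> (x, id) = lift_char \<phi> (x, id)" for x by simp
  then show "\<theta> = \<phi>" by (auto simp: lift_char_def)
qed simp

lemma lift_char_id [simp]: "lift_char \<theta> (x, id) = \<theta> x"
  by (simp add: lift_char_def)

lemma H_orbit_lift: "H_orbit p (K \<times> {id}) (lift_char \<theta>) = lift_char ` H_orbit p K \<theta>"
proof -
  have "(\<lambda>n. if n \<in> K \<times> {id} then \<sigma> (lift_char \<theta> n) else 0) = lift_char (\<lambda>n. if n \<in> K then \<sigma> (\<theta> n) else 0)" for \<sigma>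
    by (auto simp: lift_char_def fun_eq_iff)
  then show ?thesis unfolding H_orbit_def by auto
qed

lemma H_orbit_aut_twist: "H_orbit p K \<theta> = {aut_twist K \<theta> id \<sigma> | \<sigma>. Hgal p \<sigma>}"
  by (simp add: H_orbit_def aut_twist_def id_def)

lemma aut_twist_twist:
  assumes "\<And>x. x \<in> K \<Longrightarrow> b x \<in> K"
  shows "aut_twist K (aut_twist K \<theta> a \<sigma>) b \<tau> = aut_twist K \<theta> (a \<circ> b) (\<tau> \<circ> \<sigma>)"
  using assms by (auto simp: aut_twist_def fun_eq_iff)

lemma aut_twist_twist_id [simp]:
  "aut_twist K (aut_twist K \<theta> a \<sigma>) id \<tau> = aut_twist K \<theta> a (\<tau> \<circ> \<sigma>)"
  using aut_twist_twist[of K id \<theta> a \<sigma> \<tau>] by simp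

lemma (in group) Irr_class_function:
  assumes "\<theta> \<in> Irr G" "k \<in> carrier G" "x \<in> carrier G"
  shows "\<theta> (k \<otimes> x \<otimes> inv k) = \<theta> x"
proof -
  obtain d \<rho> where irr: "irred_rep G d \<rho>" and tr: "\<forall>g. \<theta> g = (if g \<in> carrier G then mat_trace (\<rho> g) else 0)"
    using assms(1) by (rule IrrE)
  then have r: "is_rep G d \<rho>" by (simp add: irred_rep_def)
  have "\<rho> (k \<otimes> x \<otimes> inv k) = \<rho> k * \<rho> x * \<rho> (inv k)" using assms r by (simp add: rep_mult)
  then have "mat_trace (\<rho> (k \<otimes> x \<otimes> inv k)) = mat_trace (\<rho> x)"
    using mat_trace_conj[of "\<rho> x" d "\<rho> k" "\<rho> (inv k)"] rep_inverse[OF r assms(2)] rep_mat[OF r] assms by simp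
  then show ?thesis using tr assms by simp
qed

text \<open>Automorphisms are total functions that are bijective on the whole type. The group
  operation is then plain composition, the unit is \<open>id\<close> and the inverse is
  \<open>inv_into UNIV\<close>, in accordance with the encoding of semidirect products by
  \<open>sdp\<close>.\<close>

locale aut_group = group G for G (structure) +
  fixes A :: "('a \<Rightarrow> 'a) set"
  assumes finite_G: "finite (carrier G)" and id_A: "id \<in> A"
    and comp_A: "a \<in> A \<Longrightarrow> b \<in> A \<Longrightarrow> a \<circ> b \<in> A"
    and inv_A: "a \<in> A \<Longrightarrow> inv_into UNIV a \<in> A"
    and bij_A: "a \<in> A \<Longrightarrow> bij a"
    and hom_A: "a \<in> A \<Longrightarrow> a \<in> hom G G"
begin

abbreviation ainv :: "('a \<Rightarrow> 'a) \<Rightarrow> 'a \<Rightarrow> 'a" where "ainv \<equiv> inv_into UNIV"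

lemma ainv_simps [simp]:
  assumes "a \<in> A"
  shows "a (ainv a x) = x" "ainv a (a x) = x" "a \<circ> ainv a = id" "ainv a \<circ> a = id"
  using bij_is_inj[OF bij_A[OF assms]] bij_is_surj[OF bij_A[OF assms]]
  by (simp_all add: surj_f_inv_f fun_eq_iff)

lemma ainv_cancel [simp]: "a \<in> A \<Longrightarrow> a \<circ> (ainv a \<circ> c) = c" "a \<in> A \<Longrightarrow> ainv a \<circ> (a \<circ> c) = c"
  by (simp_all flip: comp_assoc)

lemma A_mult: "a \<in> A \<Longrightarrow> x \<in> carrier G \<Longrightarrow> y \<in> carrier G \<Longrightarrow> a (x \<otimes> y) = a x \<otimes> a y"
  using hom_A by (simp add: hom_mult)

lemma A_closed: "a \<in> A \<Longrightarrow> x \<in> carrier G \<Longrightarrow> a x \<in> carrier G"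
  using hom_A[of a] by (auto simp: hom_def)

lemma A_stable: "\<forall>a\<in>A. \<forall>x\<in>carrier G. a x \<in> carrier G"
  using A_closed by blast

lemma A_one: "a \<in> A \<Longrightarrow> a \<one> = \<one>"
  using hom_one[OF hom_A is_group is_group] by simp

lemma group_sdp: "group (sdp G A)"
proof (rule groupI)
  fix x y z assume "x \<in> carrier (sdp G A)" "y \<in> carrier (sdp G A)" "z \<in> carrier (sdp G A)"
  then show "x \<otimes>\<^bsub>sdp G A\<^esub> y \<otimes>\<^bsub>sdp G A\<^esub> z = x \<otimes>\<^bsub>sdp G A\<^esub> (y \<otimes>\<^bsub>sdp G A\<^esub> z)"
    by (cases x; cases y; cases z) (simp add: A_mult A_closed m_assoc comp_assoc)
next
  fix x assume x: "x \<in> carrier (sdp G A)"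
  then obtain k a where ka: "x = (k, a)" "k \<in> carrier G" "a \<in> A" by auto
  show "\<exists>y\<in>carrier (sdp G A). y \<otimes>\<^bsub>sdp G A\<^esub> x = \<one>\<^bsub>sdp G A\<^esub>"
    by (rule bexI[of _ "(ainv a (inv k), ainv a)"])
      (use ka inv_A[OF ka(3)] in \<open>auto simp: A_closed A_one simp flip: A_mult\<close>)
qed (auto simp: A_closed A_one id_A comp_A)

lemma sdp_inv:
  assumes "k \<in> carrier G" "a \<in> A"
  shows "inv\<^bsub>sdp G A\<^esub> (k, a) = (ainv a (inv k), ainv a)"
  by (rule group.inv_equality[OF group_sdp])
    (use assms inv_A[OF assms(2)] in \<open>auto simp: A_closed A_one simp flip: A_mult\<close>)

lemma sdp_conj:
  assumes "k \<in> carrier G" "a \<in> A" "x \<in> carrier G" "b \<in> A"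
  shows "(k, a) \<otimes>\<^bsub>sdp G A\<^esub> (x, b) \<otimes>\<^bsub>sdp G A\<^esub> inv\<^bsub>sdp G A\<^esub> (k, a) =
    (k \<otimes> a x \<otimes> a (b (ainv a (inv k))), a \<circ> b \<circ> ainv a)"
  using assms by (simp add: sdp_inv)

lemma sdp_conj_one:
  assumes "a \<in> A" "x \<in> carrier G" "b \<in> A"
  shows "(\<one>, a) \<otimes>\<^bsub>sdp G A\<^esub> (x, b) \<otimes>\<^bsub>sdp G A\<^esub> inv\<^bsub>sdp G A\<^esub> (\<one>, a) = (a x, a \<circ> b \<circ> ainv a)"
  using assms by (subst sdp_conj) (simp_all add: A_closed A_one inv_A)

lemma sdp_conj_base:
  assumes "k \<in> carrier G" "a \<in> A" "x \<in> carrier G"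
  shows "(k, a) \<otimes>\<^bsub>sdp G A\<^esub> (x, id) \<otimes>\<^bsub>sdp G A\<^esub> inv\<^bsub>sdp G A\<^esub> (k, a) = (k \<otimes> a x \<otimes> inv k, id)"
  using assms by (subst sdp_conj) (simp_all add: id_A)

lemma subgroup_sdp:
  assumes N: "subgroup N G" and B: "B \<subseteq> A" "id \<in> B" "\<And>a b. a \<in> B \<Longrightarrow> b \<in> B \<Longrightarrow> a \<circ> b \<in> B" "\<And>a. a \<in> B \<Longrightarrow> ainv a \<in> B"
    and "\<forall>a\<in>B. \<forall>x\<in>N. a x \<in> N"
  shows "subgroup (N \<times> B) (sdp G A)"
proof (rule group.subgroupI[OF group_sdp])
  have stable: "a x \<in> N" if "a \<in> B" "x \<in> N" for a x using assms(6) that by blast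
  show "N \<times> B \<subseteq> carrier (sdp G A)" using subgroup.subset[OF N] B by auto
  show "N \<times> B \<noteq> {}" using subgroup.one_closed[OF N] B by auto
  fix x assume "x \<in> N \<times> B"
  then obtain k a where "x = (k, a)" "k \<in> N" "a \<in> B" by auto
  then show "inv\<^bsub>sdp G A\<^esub> x \<in> N \<times> B"
    using B stable[OF B(4)] subgroup.m_inv_closed[OF N] subgroup.mem_carrier[OF N] by (auto simp: sdp_inv subsetD)
next
  fix x y assume "x \<in> N \<times> B" "y \<in> N \<times> B"
  then show "x \<otimes>\<^bsub>sdp G A\<^esub> y \<in> N \<times> B"
    using B assms(6) subgroup.m_closed[OF N] by (cases x; cases y) auto
qed

text \<open>The component k acts as an inner automorphism, which class functions do not notice; only
  the automorphism a remains.\<close>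

lemma char_act_lift:
  assumes N: "subgroup N G" and k: "k \<in> N" and a: "a \<in> A" "\<And>x. x \<in> N \<Longrightarrow> a x \<in> N"
    and \<theta>: "\<theta> \<in> Irr (G\<lparr>carrier := N\<rparr>)"
  shows "char_act (sdp G A) (N \<times> {id}) (lift_char \<theta>) (k, a) \<sigma> = lift_char (aut_twist N \<theta> a \<sigma>)"
proof (rule ext)
  fix z :: "'a \<times> ('a \<Rightarrow> 'a)"
  obtain x b where z: "z = (x, b)" by (cases z)
  have kG: "k \<in> carrier G" using N k by (rule subgroup.mem_carrier)
  show "char_act (sdp G A) (N \<times> {id}) (lift_char \<theta>) (k, a) \<sigma> z = lift_char (aut_twist N \<theta> a \<sigma>) z"
  proof (cases "x \<in> N \<and> b = id")
    case True
    then have x: "x \<in> N" "x \<in> carrier G" using N by (auto dest: subgroup.mem_carrier)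
    interpret N: group "G\<lparr>carrier := N\<rparr>" by (rule subgroup.subgroup_is_group[OF N is_group])
    have "\<theta> (k \<otimes> a x \<otimes> inv k) = \<theta> (a x)"
      using N.Irr_class_function[OF \<theta>, of k "a x"] k a(2)[OF x(1)] m_inv_consistent[OF N k] by simp
    then show ?thesis using True x sdp_conj_base[OF kG a(1) x(2)] by (simp add: z char_act_def aut_twist_def)
  next
    case False then show ?thesis by (auto simp: z char_act_def aut_twist_def lift_char_def)
  qed
qed

lemma lift_char_Irr:
  assumes \<theta>: "\<theta> \<in> Irr (G\<lparr>carrier := N\<rparr>)"
  shows "lift_char \<theta> \<in> Irr ((sdp G A)\<lparr>carrier := N \<times> {id}\<rparr>)"
proof -
  obtain d \<rho> where irr: "irred_rep (G\<lparr>carrier := N\<rparr>) d \<rho>"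
    and tr: "\<forall>g. \<theta> g = (if g \<in> carrier (G\<lparr>carrier := N\<rparr>) then mat_trace (\<rho> g) else 0)"
    using \<theta> by (rule IrrE)
  have "is_rep ((sdp G A)\<lparr>carrier := N \<times> {id}\<rparr>) d (\<lambda>x. \<rho> (fst x))"
    using irr by (auto simp: irred_rep_def is_rep_def)
  moreover have "(\<forall>g\<in>carrier ((sdp G A)\<lparr>carrier := N \<times> {id}\<rparr>). Q (\<rho> (fst g))) \<longleftrightarrow> (\<forall>g\<in>N. Q (\<rho> g))" for Q
    by auto
  ultimately have "irred_rep ((sdp G A)\<lparr>carrier := N \<times> {id}\<rparr>) d (\<lambda>x. \<rho> (fst x))"
    using irr unfolding irred_rep_def by simp
  then show ?thesis by (rule IrrI) (use tr in \<open>auto simp: lift_char_def split: if_splits\<close>)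
qed

lemma H_triple_sdp:
  assumes \<theta>: "\<theta> \<in> Irr G" and orb: "\<And>a. a \<in> A \<Longrightarrow> aut_twist (carrier G) \<theta> a id \<in> H_orbit p (carrier G) \<theta>"
  shows "H_triple p (sdp G A) (carrier G \<times> {id}) (lift_char \<theta>)"
  unfolding H_triple_def
proof (intro conjI)
  show "group (sdp G A)" by (rule group_sdp)
  have "subgroup (carrier G \<times> {id}) (sdp G A)"
    using subgroup_self id_A by (intro subgroup_sdp) auto
  moreover have "g \<otimes>\<^bsub>sdp G A\<^esub> h \<otimes>\<^bsub>sdp G A\<^esub> inv\<^bsub>sdp G A\<^esub> g \<in> carrier G \<times> {id}"
    if gh: "g \<in> carrier (sdp G A)" "h \<in> carrier G \<times> {id}" for g h
  proof -
    obtain k a x where kax: "g = (k, a)" "h = (x, id)" "k \<in> carrier G" "a \<in> A" "x \<in> carrier G" using gh by auto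
    show ?thesis unfolding kax(1,2) sdp_conj_base[OF kax(3-5)] using kax A_closed by simp
  qed
  ultimately show "carrier G \<times> {id} \<lhd> sdp G A"
    unfolding group.normal_inv_iff[OF group_sdp] by blast
  show "lift_char \<theta> \<in> Irr ((sdp G A)\<lparr>carrier := carrier G \<times> {id}\<rparr>)"
    by (rule lift_char_Irr) (simp add: \<theta>)
  show "{g \<in> carrier (sdp G A). char_act (sdp G A) (carrier G \<times> {id}) (lift_char \<theta>) g id
        \<in> H_orbit p (carrier G \<times> {id}) (lift_char \<theta>)} = carrier (sdp G A)"
    using orb \<theta> by (auto simp: H_orbit_lift char_act_lift[OF subgroup_self] A_closed)
qed

lemma stab_sdp:
  assumes N: "subgroup N G" and st: "\<forall>a\<in>A. \<forall>x\<in>N. a x \<in> N" and \<theta>: "\<theta> \<in> Irr (G\<lparr>carrier := N\<rparr>)"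
  shows "stab (sdp G A) (N \<times> {id}) (lift_char \<theta>) (N \<times> A) = N \<times> {a \<in> A. aut_twist N \<theta> a id = \<theta>}"
  using char_act_lift[OF N _ _ _ \<theta>] st by (auto simp: stab_def)

lemma stab_sdp_sub:
  assumes N: "subgroup N G" and \<theta>: "\<theta> \<in> Irr G"
  shows "stab (sdp G A) (carrier G \<times> {id}) (lift_char \<theta>) (N \<times> A) = N \<times> {a \<in> A. aut_twist (carrier G) \<theta> a id = \<theta>}"
  using char_act_lift[OF subgroup_self] \<theta> A_closed subgroup.mem_carrier[OF N] by (auto simp: stab_def)

lemma stabilizer_aut_group:
  assumes \<theta>: "\<And>x. x \<notin> K \<Longrightarrow> \<theta> x = 0" and st0: "\<forall>a\<in>A. \<forall>x\<in>K. a x \<in> K"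
  shows "aut_group G {a \<in> A. aut_twist K \<theta> a id = \<theta>}"
proof (intro aut_group.intro aut_group_axioms.intro is_group)
  have st: "a x \<in> K" if "a \<in> A" "x \<in> K" for a x using st0 that by blast
  have tid: "aut_twist K \<theta> id id = \<theta>" using \<theta> by (auto simp: aut_twist_def)
  show "id \<in> {a \<in> A. aut_twist K \<theta> a id = \<theta>}" using id_A tid by simp
  fix a assume "a \<in> {a \<in> A. aut_twist K \<theta> a id = \<theta>}"
  then have a: "a \<in> A" "aut_twist K \<theta> a id = \<theta>" by auto
  show "ainv a \<in> {a \<in> A. aut_twist K \<theta> a id = \<theta>}"
    using aut_twist_twist[of K "ainv a" \<theta> a id id] st[OF inv_A[OF a(1)]] a tid inv_A by simp
  show "bij a" "a \<in> hom G G" using a bij_A hom_A by auto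
  fix b assume "b \<in> {a \<in> A. aut_twist K \<theta> a id = \<theta>}"
  then show "a \<circ> b \<in> {a \<in> A. aut_twist K \<theta> a id = \<theta>}"
    using aut_twist_twist[of K b \<theta> a id id] st a comp_A by auto
qed (rule finite_G)

lemma aut_twist_id_mem_orbit: "Hgal p \<sigma> \<Longrightarrow> aut_twist K \<theta> id \<sigma> \<in> H_orbit p K \<theta>"
  by (auto simp: H_orbit_aut_twist)

text \<open>Galois automorphisms act on values and automorphisms of the group on arguments, so the
  two actions commute. This gives closure under composition and inversion.\<close>

lemma orbit_stabilizer_aut_group:
  assumes \<theta>: "\<And>x. x \<notin> K \<Longrightarrow> \<theta> x = 0" and st0: "\<forall>a\<in>A. \<forall>x\<in>K. a x \<in> K"
  shows "aut_group G (aut_stab_orbit p K A \<theta>)"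
proof (intro aut_group.intro aut_group_axioms.intro is_group)
  have st: "a x \<in> K" if "a \<in> A" "x \<in> K" for a x using st0 that by blast
  have tid: "aut_twist K \<theta> id id = \<theta>" using \<theta> by (auto simp: aut_twist_def)
  show "id \<in> aut_stab_orbit p K A \<theta>"
    using id_A aut_twist_id_mem_orbit[OF Hgal_id] by (simp add: aut_stab_orbit_def)
  fix a assume "a \<in> aut_stab_orbit p K A \<theta>"
  then obtain \<sigma> where a: "a \<in> A" "Hgal p \<sigma>" "aut_twist K \<theta> a id = aut_twist K \<theta> id \<sigma>"
    by (auto simp: aut_stab_orbit_def H_orbit_aut_twist)
  show "bij a" "a \<in> hom G G" using a bij_A hom_A by auto
  obtain \<tau> where \<tau>: "Hgal p \<tau>" "\<tau> \<circ> \<sigma> = id" using Hgal_inverse[OF a(2)] by blast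
  have "\<theta> = aut_twist K (aut_twist K \<theta> a id) (ainv a) id"
    using aut_twist_twist[of K "ainv a" \<theta> a id id] st[OF inv_A[OF a(1)]] a tid by simp
  also have "\<dots> = aut_twist K \<theta> (ainv a) \<sigma>"
    unfolding a(3) using aut_twist_twist[of K "ainv a" \<theta> id \<sigma> id] st[OF inv_A[OF a(1)]] by simp
  finally have "aut_twist K \<theta> id \<tau> = aut_twist K (aut_twist K \<theta> (ainv a) \<sigma>) id \<tau>" by simp
  then have "aut_twist K \<theta> (ainv a) id = aut_twist K \<theta> id \<tau>" using \<tau> by simp
  then show "ainv a \<in> aut_stab_orbit p K A \<theta>"
    using inv_A[OF a(1)] aut_twist_id_mem_orbit[OF \<tau>(1)] by (simp add: aut_stab_orbit_def)
  fix b assume "b \<in> aut_stab_orbit p K A \<theta>"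
  then obtain \<rho> where b: "b \<in> A" "Hgal p \<rho>" "aut_twist K \<theta> b id = aut_twist K \<theta> id \<rho>"
    by (auto simp: aut_stab_orbit_def H_orbit_aut_twist)
  have stb: "x \<in> K \<Longrightarrow> b x \<in> K" for x using st b by blast
  have "aut_twist K \<theta> (a \<circ> b) id = aut_twist K (aut_twist K \<theta> a id) b id"
    using aut_twist_twist[of K b \<theta> a id id, OF stb] by simp
  also have "\<dots> = aut_twist K (aut_twist K \<theta> b id) id \<sigma>"
    unfolding a(3) using aut_twist_twist[of K b \<theta> id \<sigma> id, OF stb] by simp
  also have "\<dots> = aut_twist K \<theta> id (\<sigma> \<circ> \<rho>)" unfolding b(3) by simp
  finally show "a \<circ> b \<in> aut_stab_orbit p K A \<theta>"
    using comp_A[OF a(1) b(1)] aut_twist_id_mem_orbit[OF Hgal_comp[OF a(2) b(2)]] by (simp add: aut_stab_orbit_def)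
qed (rule finite_G)

text \<open>Applying the inverse of \<sigma> exhibits the a-twist of \<theta> as a Galois twist. So
  stabilisers up to Galois action are the same in \<open>A\<close> and in the orbit
  stabiliser.\<close>

lemma fixed_up_to_Galois_mem_orbit:
  assumes "a \<in> A" "Hgal p \<sigma>" "aut_twist K \<theta> a \<sigma> = \<theta>"
  shows "a \<in> aut_stab_orbit p K A \<theta>"
proof -
  obtain \<tau> where \<tau>: "Hgal p \<tau>" "\<tau> \<circ> \<sigma> = id" using Hgal_inverse[OF assms(2)] by blast
  have "aut_twist K \<theta> id \<tau> = aut_twist K (aut_twist K \<theta> a \<sigma>) id \<tau>" using assms(3) by simp
  then have "aut_twist K \<theta> a id = aut_twist K \<theta> id \<tau>" using \<tau> by simp
  then show ?thesis using assms(1) aut_twist_id_mem_orbit[OF \<tau>(1)] by (simp add: aut_stab_orbit_def)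
qed

end

section \<open>Central ordering of triples in semidirect products\<close>

text \<open>The relation that defines the multiplier of (a, \<sigma>), spelled out for a semidirect
  product: \<open>(a x, a \<circ> b \<circ> inv_into UNIV a)\<close> is the conjugate of
  \<open>(x, b)\<close> by a. Multipliers are constant on cosets of the base group, so \<nu> has
  only the automorphism as argument.\<close>

definition galois_compat :: "'a set \<Rightarrow> ('a \<Rightarrow> 'a) set \<Rightarrow> nat \<Rightarrow> ('a \<times> ('a \<Rightarrow> 'a) \<Rightarrow> complex mat) \<Rightarrow> ('a \<Rightarrow> 'a)
    \<Rightarrow> (complex \<Rightarrow> complex) \<Rightarrow> (('a \<Rightarrow> 'a) \<Rightarrow> complex) \<Rightarrow> complex mat \<Rightarrow> complex mat \<Rightarrow> bool" where
  "galois_compat K B d P a \<sigma> \<nu> M M' \<longleftrightarrow>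
     M \<in> carrier_mat d d \<and> M' \<in> carrier_mat d d \<and> M * M' = 1\<^sub>m d \<and> M' * M = 1\<^sub>m d \<and> mat_Qab M \<and> mat_Qab M' \<and>
     (\<forall>x\<in>K. \<forall>b\<in>B. map_mat \<sigma> (P (a x, a \<circ> b \<circ> inv_into UNIV a)) = \<nu> b \<cdot>\<^sub>m (M' * P (x, b) * M))"

text \<open>Conditions (iii) and (iv) of the central order, with the centraliser inclusion of (i).
  Instead of comparing all multipliers of the two representations, one \<nu> common to both is
  required to exist. This form can be transported and multiplied, and existence and uniqueness of
  multipliers translate between it and the original.\<close>

definition central_reps :: "nat \<Rightarrow> ('a, 'c) monoid_scheme \<Rightarrow> ('a \<Rightarrow> 'a) set \<Rightarrow> 'a set \<Rightarrow> ('a \<Rightarrow> complex) \<Rightarrow> ('a \<Rightarrow> complex)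
    \<Rightarrow> nat \<Rightarrow> ('a \<times> ('a \<Rightarrow> 'a) \<Rightarrow> complex mat) \<Rightarrow> ('a \<times> ('a \<Rightarrow> 'a) \<Rightarrow> 'a \<times> ('a \<Rightarrow> 'a) \<Rightarrow> complex)
    \<Rightarrow> nat \<Rightarrow> ('a \<times> ('a \<Rightarrow> 'a) \<Rightarrow> complex mat) \<Rightarrow> ('a \<times> ('a \<Rightarrow> 'a) \<Rightarrow> 'a \<times> ('a \<Rightarrow> 'a) \<Rightarrow> complex) \<Rightarrow> bool" where
  "central_reps p G A N \<theta> \<phi> d P \<alpha> d' P' \<alpha>' \<longleftrightarrow>
     (let K = carrier G; B = {a \<in> A. aut_twist K \<theta> a id = \<theta>} in
        proj_rep (sdp G A) (K \<times> B) d P \<alpha> \<and> assoc_with (sdp G A) (K \<times> {id}) (lift_char \<theta>) (K \<times> B) P \<and>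
        entries_Qab (K \<times> B) d P \<and>
        proj_rep (sdp G A) (N \<times> B) d' P' \<alpha>' \<and> assoc_with (sdp G A) (N \<times> {id}) (lift_char \<phi>) (N \<times> B) P' \<and>
        entries_Qab (N \<times> B) d' P' \<and>
        (\<forall>x \<in> K \<times> B. \<forall>y \<in> K \<times> B. root_of_unity (\<alpha> x y)) \<and>
        (\<forall>x \<in> N \<times> B. \<forall>y \<in> N \<times> B. root_of_unity (\<alpha>' x y)) \<and>
        (\<forall>x \<in> N \<times> B. \<forall>y \<in> N \<times> B. \<alpha> x y = \<alpha>' x y) \<and>
        (\<forall>x\<in>K. \<forall>b\<in>B. (\<forall>y\<in>K. x \<otimes>\<^bsub>G\<^esub> b y = y \<otimes>\<^bsub>G\<^esub> x) \<longrightarrow>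
           x \<in> N \<and> (\<exists>c. P (x, b) = c \<cdot>\<^sub>m 1\<^sub>m d \<and> P' (x, b) = c \<cdot>\<^sub>m 1\<^sub>m d')) \<and>
        (\<forall>a\<in>A. \<forall>\<sigma>. Hgal p \<sigma> \<and> aut_twist K \<theta> a \<sigma> = \<theta> \<longrightarrow>
           (\<exists>\<nu> M M' V V'. (\<forall>b\<in>B. \<nu> b \<noteq> 0) \<and> galois_compat K B d P a \<sigma> \<nu> M M' \<and> galois_compat N B d' P' a \<sigma> \<nu> V V')))"

context aut_group
begin

lemma assoc_rep_sdp:
  assumes K: "subgroup K G" "\<forall>a\<in>A. \<forall>x\<in>K. a x \<in> K"
    and B: "aut_group G B" "B \<subseteq> A" and \<theta>: "\<theta> \<in> Irr (G\<lparr>carrier := K\<rparr>)"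
    and P: "proj_rep (sdp G A) (K \<times> B) d P \<alpha>" "assoc_with (sdp G A) (K \<times> {id}) (lift_char \<theta>) (K \<times> B) P"
  shows "assoc_rep (sdp G A) (K \<times> {id}) (K \<times> B) (lift_char \<theta>) d P"
proof (intro assoc_rep.intro assoc_rep_axioms.intro group_sdp)
  interpret B: aut_group G B by fact
  have stB0: "\<forall>a\<in>B. \<forall>x\<in>K. a x \<in> K" using K(2) B(2) by blast
  have stB: "a \<in> B \<Longrightarrow> x \<in> K \<Longrightarrow> a x \<in> K" for a x using stB0 by blast
  show KB: "subgroup (K \<times> B) (sdp G A)"
    by (rule subgroup_sdp[where N = K and B = B, OF K(1) B(2) B.id_A B.comp_A B.inv_A stB0])
  show "subgroup (K \<times> {id}) (sdp G A)"
    by (rule subgroup_sdp[OF K(1)]) (use id_A in auto)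
  have KG: "K \<subseteq> carrier G" using K(1) by (rule subgroup.subset)
  show "finite (K \<times> {id :: 'a \<Rightarrow> 'a})" using finite_subset[OF KG finite_G] by simp
  show "K \<times> {id} \<subseteq> K \<times> B" using B.id_A by auto
  show "lift_char \<theta> \<in> Irr (sdp G A\<lparr>carrier := K \<times> {id}\<rparr>)" by (rule lift_char_Irr[OF \<theta>])
  show "P x \<in> carrier_mat d d" "invertible_mat (P x)" if "x \<in> K \<times> B" for x
    using P(1) that by (auto simp: proj_rep_def)
  show "assoc_with (sdp G A) (K \<times> {id}) (lift_char \<theta>) (K \<times> B) P" by (rule P(2))
  fix y l assume y: "y \<in> K \<times> B" and l: "l \<in> K \<times> {id :: 'a \<Rightarrow> 'a}"
  interpret S: group "sdp G A" by (rule group_sdp)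
  have "inv\<^bsub>sdp G A\<^esub> y \<in> K \<times> B" using KB y by (rule subgroup.m_inv_closed)
  then obtain k b x where kb: "inv\<^bsub>sdp G A\<^esub> y = (k, b)" "k \<in> K" "b \<in> B" "l = (x, id)" "x \<in> K" using l by auto
  have yc: "y \<in> carrier (sdp G A)" using y KG B by auto
  then have "y = inv\<^bsub>sdp G A\<^esub> (k, b)" using S.inv_inv[of y] kb(1) by simp
  then have "inv\<^bsub>sdp G A\<^esub> y \<otimes>\<^bsub>sdp G A\<^esub> l \<otimes>\<^bsub>sdp G A\<^esub> y = (k, b) \<otimes>\<^bsub>sdp G A\<^esub> (x, id) \<otimes>\<^bsub>sdp G A\<^esub> inv\<^bsub>sdp G A\<^esub> (k, b)"
    using kb by simp
  also have "\<dots> = (k \<otimes> b x \<otimes> inv k, id)" using kb KG B by (intro sdp_conj_base) auto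
  finally show "inv\<^bsub>sdp G A\<^esub> y \<otimes>\<^bsub>sdp G A\<^esub> l \<otimes>\<^bsub>sdp G A\<^esub> y \<in> K \<times> {id}"
    using kb stB K(1) by (simp add: subgroup.m_closed subgroup.m_inv_closed)
qed

end

text \<open>Here \<open>A\<close> plays the part of the orbit stabiliser, so every element moves
  \<theta> inside its Galois orbit, and \<open>stab_eq\<close> records what an equivariant injection
  gives. The locale is instantiated both for the covering group and for its direct power.\<close>

locale stable_pair = aut_group G A for G (structure) and A +
  fixes N :: "'a set" and \<theta> \<phi> :: "'a \<Rightarrow> complex" and p :: nat
  assumes N: "subgroup N G" and stN: "a \<in> A \<Longrightarrow> x \<in> N \<Longrightarrow> a x \<in> N"
    and \<theta>: "\<theta> \<in> Irr G" and \<phi>: "\<phi> \<in> Irr (G\<lparr>carrier := N\<rparr>)"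
    and orb: "a \<in> A \<Longrightarrow> aut_twist (carrier G) \<theta> a id \<in> H_orbit p (carrier G) \<theta>"
    and stab_eq: "a \<in> A \<Longrightarrow> Hgal p \<sigma> \<Longrightarrow> aut_twist (carrier G) \<theta> a \<sigma> = \<theta> \<longleftrightarrow> aut_twist N \<phi> a \<sigma> = \<phi>"
begin

lemma N_stable: "\<forall>a\<in>A. \<forall>x\<in>N. a x \<in> N"
  using stN by blast

abbreviation "S \<equiv> sdp G A"
definition "B = {a \<in> A. aut_twist (carrier G) \<theta> a id = \<theta>}"

lemma B_alt: "B = {a \<in> A. aut_twist N \<phi> a id = \<phi>}"
  using stab_eq[OF _ Hgal_id] by (auto simp: B_def)

lemma \<theta>_outside: "x \<notin> carrier G \<Longrightarrow> \<theta> x = 0"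
  using Irr_outside[OF \<theta>] .

lemma B: "aut_group G B" "B \<subseteq> A"
  unfolding B_def using stabilizer_aut_group[where K = "carrier G" and \<theta> = \<theta>, OF \<theta>_outside A_stable] by auto

lemma stabs:
  "stab S (carrier G \<times> {id}) (lift_char \<theta>) (carrier S) = carrier G \<times> B"
  "stab S (carrier G \<times> {id}) (lift_char \<theta>) (N \<times> A) = N \<times> B"
  "stab S (N \<times> {id}) (lift_char \<phi>) (N \<times> A) = N \<times> B"
  using stab_sdp_sub[OF subgroup_self \<theta>] stab_sdp_sub[OF N \<theta>] stab_sdp[where N = N and \<theta> = \<phi>, OF N N_stable \<phi>] by (simp_all add: B_def B_alt[unfolded B_def])

text \<open>The a-twist of \<theta> is one of its Galois twists and so has the same stabiliser among
  automorphisms; therefore a normalises \<open>B\<close>.\<close>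

lemma B_conj:
  assumes a: "a \<in> A" and s: "Hgal p \<sigma>" "aut_twist (carrier G) \<theta> a \<sigma> = \<theta>" and b: "b \<in> B"
  shows "a \<circ> b \<circ> ainv a \<in> B"
proof -
  obtain \<tau> where \<tau>: "Hgal p \<tau>" "\<tau> \<circ> \<sigma> = id" using Hgal_inverse[OF s(1)] by blast
  let ?t = "aut_twist (carrier G)"
  have bA: "b \<in> A" and b\<theta>: "?t \<theta> b id = \<theta>" using b by (auto simp: B_def)
  have c: "\<And>a x. a \<in> A \<Longrightarrow> x \<in> carrier G \<Longrightarrow> a x \<in> carrier G" by (rule A_closed)
  note tt = aut_twist_twist[of "carrier G"]
  have a\<tau>: "?t \<theta> a id = ?t \<theta> id \<tau>"
  proof -
    have "?t \<theta> id \<tau> = ?t (?t \<theta> a \<sigma>) id \<tau>" using s(2) by simp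
    then show ?thesis using \<tau> by simp
  qed
  have "?t \<theta> (a \<circ> b \<circ> ainv a) id = ?t (?t (?t \<theta> a id) b id) (ainv a) id"
    using tt[of b \<theta> a id id, OF c[OF bA]] tt[of "ainv a" \<theta> "a \<circ> b" id id, OF c[OF inv_A[OF a]]] by simp
  also have "?t (?t \<theta> a id) b id = ?t (?t \<theta> b id) id \<tau>"
    unfolding a\<tau> using tt[of b \<theta> id \<tau> id, OF c[OF bA]] by simp
  also have "\<dots> = ?t \<theta> a id" using b\<theta> a\<tau> by simp
  also have "?t (?t \<theta> a id) (ainv a) id = \<theta>"
    using tt[of "ainv a" \<theta> a id id, OF c[OF inv_A[OF a]]] a \<theta>_outside by (auto simp: aut_twist_def)
  finally have "?t \<theta> (a \<circ> b \<circ> ainv a) id = \<theta>" .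
  then show ?thesis unfolding B_def using comp_A[OF comp_A[OF a bA] inv_A[OF a]] by blast
qed

lemma \<nu>_sim_scaled:
  assumes a: "a \<in> A" and K: "subgroup K G" and
    gc: "galois_compat K B e Q a \<sigma> \<nu> M M'"
  shows "sim_scaled (K \<times> B) e (proj_twist S Q (\<one>, a) \<sigma>) (\<lambda>y. \<nu> (snd y)) Q"
proof -
  have "proj_twist S Q (\<one>, a) \<sigma> y = \<nu> (snd y) \<cdot>\<^sub>m (M' * Q y * M)" if y: "y \<in> K \<times> B" for y
  proof -
    obtain x b where xb: "y = (x, b)" "x \<in> K" "b \<in> B" using y by auto
    have "proj_twist S Q (\<one>, a) \<sigma> (x, b) = map_mat \<sigma> (Q (a x, a \<circ> b \<circ> ainv a))"
      unfolding proj_twist_def using xb a B subgroup.mem_carrier[OF K] by (subst sdp_conj_one) auto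
    then show ?thesis using gc xb by (simp add: galois_compat_def)
  qed
  then show ?thesis unfolding sim_scaled_def using gc unfolding galois_compat_def by blast
qed

lemma galois_compat_exists:
  assumes P: "assoc_rep S (K \<times> {id}) (K \<times> B) (lift_char \<psi>) e Q" and K0: "subgroup K G" "\<forall>a\<in>A. \<forall>x\<in>K. a x \<in> K"
    and \<psi>: "\<psi> \<in> Irr (G\<lparr>carrier := K\<rparr>)"
    and Qab: "entries_Qab (K \<times> B) e Q"
    and a: "a \<in> A" and s: "Hgal p \<sigma>" "aut_twist (carrier G) \<theta> a \<sigma> = \<theta>" "aut_twist K \<psi> a \<sigma> = \<psi>"
  obtains \<mu> M M' where "is_mu S (K \<times> {id}) (K \<times> B) e Q (\<one>, a) \<sigma> \<mu>"
     "galois_compat K B e Q a \<sigma> (\<lambda>b. \<mu> (\<one>, b)) M M'"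
proof -
  interpret S: assoc_rep S "K \<times> {id}" "K \<times> B" "lift_char \<psi>" e Q by (rule P)
  note K = K0(1) K0(2)[rule_format]
  interpret BB: aut_group G B by (rule B)
  have KG: "K \<subseteq> carrier G" using K(1) by (rule subgroup.subset)
  have oneK: "\<one> \<in> K" using K(1) by (rule subgroup.one_closed)
  have x: "(\<one>, a) \<in> carrier S" using a by simp
  have cj: "(\<one>, a) \<otimes>\<^bsub>S\<^esub> (k, b) \<otimes>\<^bsub>S\<^esub> inv\<^bsub>S\<^esub> (\<one>, a) = (a k, a \<circ> b \<circ> ainv a)" if "k \<in> K" "b \<in> B" for k b
    using that KG a B by (intro sdp_conj_one) auto
  have xK: "(\<one>, a) \<otimes>\<^bsub>S\<^esub> y \<otimes>\<^bsub>S\<^esub> inv\<^bsub>S\<^esub> (\<one>, a) \<in> K \<times> B" if "y \<in> K \<times> B" for y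
    using that cj K(2)[OF a] B_conj[OF a s(1,2)] by (cases y) (auto simp del: sdp_mult)
  have xL: "(\<one>, a) \<otimes>\<^bsub>S\<^esub> y \<otimes>\<^bsub>S\<^esub> inv\<^bsub>S\<^esub> (\<one>, a) \<in> K \<times> {id}" if "y \<in> K \<times> {id}" for y
    using that cj[OF _ BB.id_A] K(2)[OF a] a by (cases y) (auto simp del: sdp_mult)
  have st: "char_act S (K \<times> {id}) (lift_char \<psi>) (\<one>, a) \<sigma> = lift_char \<psi>"
    using char_act_lift[OF K(1) oneK a K(2)[OF a] \<psi>] s(3) by simp
  have xK0: "\<forall>y\<in>K \<times> B. (\<one>, a) \<otimes>\<^bsub>S\<^esub> y \<otimes>\<^bsub>S\<^esub> inv\<^bsub>S\<^esub> (\<one>, a) \<in> K \<times> B" by (rule ballI, rule xK)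
  have xL0: "\<forall>y\<in>K \<times> {id}. (\<one>, a) \<otimes>\<^bsub>S\<^esub> y \<otimes>\<^bsub>S\<^esub> inv\<^bsub>S\<^esub> (\<one>, a) \<in> K \<times> {id}" by (rule ballI, rule xL)
  note tw = S.twist_assoc[OF x xK0 xL0 Hgal_galois[OF s(1)] Qab st]
  obtain M M' \<mu> where M: "M \<in> carrier_mat e e" "M' \<in> carrier_mat e e" "M * M' = 1\<^sub>m e" "M' * M = 1\<^sub>m e"
    and \<mu>: "\<forall>y\<in>K \<times> B. proj_twist S Q (\<one>, a) \<sigma> y = \<mu> y \<cdot>\<^sub>m (M' * Q y * M)" "\<forall>y\<in>K \<times> B. \<mu> y \<noteq> 0"
      "\<forall>l\<in>K \<times> {id}. \<forall>y\<in>K \<times> B. \<mu> (l \<otimes>\<^bsub>S\<^esub> y) = \<mu> y" "\<mu> \<one>\<^bsub>S\<^esub> = 1"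
    and MQab: "(\<forall>x\<in>K \<times> {id}. mat_Qab (Q x) \<and> mat_Qab (proj_twist S Q (\<one>, a) \<sigma> x)) \<longrightarrow> mat_Qab M \<and> mat_Qab M'"
    by (rule S.mu_exists[OF tw(1,2,4)])
  have "mat_Qab (Q x) \<and> mat_Qab (proj_twist S Q (\<one>, a) \<sigma> x)" if "x \<in> K \<times> {id}" for x
    using tw(3)[OF S.LK[OF that]] entries_Qab_mat[OF Qab S.LK[OF that] S.carr(1)[OF S.LK[OF that]]] by simp
  then have MQ: "mat_Qab M" "mat_Qab M'" using MQab by auto
  have "is_mu S (K \<times> {id}) (K \<times> B) e Q (\<one>, a) \<sigma> \<mu>"
    unfolding is_mu_def sim_scaled_def using M \<mu> by blast
  moreover have "galois_compat K B e Q a \<sigma> (\<lambda>b. \<mu> (\<one>, b)) M M'"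
    unfolding galois_compat_def
  proof (intro conjI ballI M MQ)
    fix x b assume xb: "x \<in> K" "b \<in> B"
    have "\<mu> (x, b) = \<mu> (\<one>, b)"
      using \<mu>(3)[rule_format, of "(x, id)" "(\<one>, b)"] xb oneK KG by auto
    moreover have "map_mat \<sigma> (Q (a x, a \<circ> b \<circ> ainv a)) = proj_twist S Q (\<one>, a) \<sigma> (x, b)"
      unfolding proj_twist_def cj[OF xb] ..
    ultimately show "map_mat \<sigma> (Q (a x, a \<circ> b \<circ> ainv a)) = \<mu> (\<one>, b) \<cdot>\<^sub>m (M' * Q (x, b) * M)"
      using \<mu>(1) xb by auto
  qed
  ultimately show thesis by (rule that)
qed

text \<open>Left multiplication by \<open>(k, id)\<close> leaves the multiplier relation intact, and
  normalised multipliers are unique.\<close>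

lemma is_mu_eq:
  assumes P: "assoc_rep S (K \<times> {id}) (K \<times> B) (lift_char \<psi>) e Q" and K0: "subgroup K G" "\<forall>a\<in>A. \<forall>x\<in>K. a x \<in> K"
    and Qab: "entries_Qab (K \<times> B) e Q"
    and a: "a \<in> A" "k \<in> K" and s: "Hgal p \<sigma>" "aut_twist (carrier G) \<theta> a \<sigma> = \<theta>"
    and gc: "galois_compat K B e Q a \<sigma> \<nu> M M'"
    and mu: "is_mu S (K \<times> {id}) (K \<times> B) e Q (k, a) \<sigma> \<mu>" and y: "y \<in> K \<times> B"
  shows "\<mu> y = \<nu> (snd y)"
proof -
  interpret S: assoc_rep S "K \<times> {id}" "K \<times> B" "lift_char \<psi>" e Q by (rule P)
  note K = K0(1) K0(2)[rule_format]
  interpret BB: aut_group G B by (rule B)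
  have KG: "K \<subseteq> carrier G" using K(1) by (rule subgroup.subset)
  have oneK: "\<one> \<in> K" using K(1) by (rule subgroup.one_closed)
  have cj: "(\<one>, a) \<otimes>\<^bsub>S\<^esub> (k, b) \<otimes>\<^bsub>S\<^esub> inv\<^bsub>S\<^esub> (\<one>, a) = (a k, a \<circ> b \<circ> ainv a)" if "k \<in> K" "b \<in> B" for k b
    using that KG a B by (intro sdp_conj_one) auto
  have xK: "(\<one>, a) \<otimes>\<^bsub>S\<^esub> y \<otimes>\<^bsub>S\<^esub> inv\<^bsub>S\<^esub> (\<one>, a) \<in> K \<times> B" if "y \<in> K \<times> B" for y
    using that cj K(2)[OF a(1)] B_conj[OF a(1) s(1,2)] by (cases y) (auto simp del: sdp_mult)
  have "sim_scaled (K \<times> B) e (proj_twist S Q ((k, id) \<otimes>\<^bsub>S\<^esub> (\<one>, a)) \<sigma>) (\<lambda>y. \<nu> (snd y)) Q"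
    using a by (intro S.twist_left[OF _ ballI[OF xK] _ Hgal_galois[OF s(1)] Qab \<nu>_sim_scaled[OF a(1) K(1) gc]]) auto
  moreover have "(k, id) \<otimes>\<^bsub>S\<^esub> (\<one>, a) = (k, a)" using a(2) KG by auto
  ultimately have sim: "sim_scaled (K \<times> B) e (proj_twist S Q (k, a) \<sigma>) (\<lambda>y. \<nu> (snd y)) Q" by simp
  \<comment> \<open>The normalisation is not recorded in \<open>galois_compat\<close>; it comes from
    evaluating the relation at the unit element, where \<open>Q\<close> is the identity
    matrix.\<close>
  have n1: "\<nu> id = 1"
  proof -
    have Q1: "Q (\<one>, id) = 1\<^sub>m e" using S.P_one by simp
    have "map_mat \<sigma> (Q (a \<one>, a \<circ> id \<circ> ainv a)) = \<nu> id \<cdot>\<^sub>m (M' * Q (\<one>, id) * M)"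
      using gc oneK BB.id_A unfolding galois_compat_def by blast
    moreover have "a \<circ> id \<circ> ainv a = id" using a by simp
    moreover have "M' * Q (\<one>, id) * M = 1\<^sub>m e" using gc unfolding Q1 by (auto simp: galois_compat_def)
    ultimately have "1 \<cdot>\<^sub>m (1\<^sub>m e) = \<nu> id \<cdot>\<^sub>m (1\<^sub>m e)"
      using Q1 map_mat_galois_one[OF Hgal_galois[OF s(1)]] A_one[OF a(1)] by simp
    then show ?thesis using smult_invertible_cancel[of "1\<^sub>m e" e "1\<^sub>m e" 1 "\<nu> id"] S.d_pos by simp
  qed
  have m: "sim_scaled (K \<times> B) e (proj_twist S Q (k, a) \<sigma>) \<mu> Q"
    "\<forall>l\<in>K \<times> {id}. \<forall>y\<in>K \<times> B. \<mu> (l \<otimes>\<^bsub>S\<^esub> y) = \<mu> y" "\<mu> \<one>\<^bsub>S\<^esub> = 1" using mu by (auto simp: is_mu_def)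
  show ?thesis
    by (rule S.mu_unique[OF m sim _ _ y, simplified]) (use n1 in auto)
qed

text \<open>If the a-twist of \<theta> is its \<sigma>-twist, then a together with the inverse of
  \<sigma> fixes \<theta>. In this form the property is transferred to \<phi> by
  \<open>stab_eq\<close> and then rewritten backwards.\<close>

lemma orb_\<phi>: assumes a: "a \<in> A" shows "aut_twist N \<phi> a id \<in> H_orbit p N \<phi>"
proof -
  obtain \<sigma> where \<sigma>: "Hgal p \<sigma>" "aut_twist (carrier G) \<theta> a id = aut_twist (carrier G) \<theta> id \<sigma>"
    using orb[OF a] by (auto simp: H_orbit_aut_twist)
  obtain \<tau> where \<tau>: "Hgal p \<tau>" "\<tau> \<circ> \<sigma> = id" "\<sigma> \<circ> \<tau> = id" using Hgal_inverse[OF \<sigma>(1)] by blast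
  have "aut_twist (carrier G) \<theta> a \<tau> = aut_twist (carrier G) (aut_twist (carrier G) \<theta> a id) id \<tau>" by simp
  also have "\<dots> = aut_twist (carrier G) \<theta> id id" unfolding \<sigma>(2) aut_twist_twist_id \<tau>(2) ..
  also have "\<dots> = \<theta>" using \<theta>_outside by (auto simp: aut_twist_def)
  finally have "aut_twist N \<phi> a \<tau> = \<phi>" using stab_eq[OF a \<tau>(1)] by simp
  then have "aut_twist N \<phi> id \<sigma> = aut_twist N (aut_twist N \<phi> a \<tau>) id \<sigma>" by simp
  then have "aut_twist N \<phi> a id = aut_twist N \<phi> id \<sigma>" using \<tau> by simp
  then show ?thesis using aut_twist_id_mem_orbit[OF \<sigma>(1)] by simp
qed

lemma reps:
  assumes "central_reps p G A N \<theta> \<phi> d P \<alpha> d' P' \<alpha>'"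
  shows "proj_rep S (carrier G \<times> B) d P \<alpha>" "assoc_with S (carrier G \<times> {id}) (lift_char \<theta>) (carrier G \<times> B) P"
    "entries_Qab (carrier G \<times> B) d P"
    "proj_rep S (N \<times> B) d' P' \<alpha>'" "assoc_with S (N \<times> {id}) (lift_char \<phi>) (N \<times> B) P'" "entries_Qab (N \<times> B) d' P'"
    "x \<in> carrier G \<times> B \<Longrightarrow> y \<in> carrier G \<times> B \<Longrightarrow> root_of_unity (\<alpha> x y)"
    "x \<in> N \<times> B \<Longrightarrow> y \<in> N \<times> B \<Longrightarrow> root_of_unity (\<alpha>' x y)"
    "x \<in> N \<times> B \<Longrightarrow> y \<in> N \<times> B \<Longrightarrow> \<alpha> x y = \<alpha>' x y"
    "k \<in> carrier G \<Longrightarrow> b \<in> B \<Longrightarrow> \<forall>y\<in>carrier G. k \<otimes> b y = y \<otimes> k \<Longrightarrow>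
       k \<in> N \<and> (\<exists>c. P (k, b) = c \<cdot>\<^sub>m 1\<^sub>m d \<and> P' (k, b) = c \<cdot>\<^sub>m 1\<^sub>m d')"
    "a \<in> A \<Longrightarrow> Hgal p \<sigma> \<Longrightarrow> aut_twist (carrier G) \<theta> a \<sigma> = \<theta> \<Longrightarrow>
       \<exists>\<nu> M M' V V'. (\<forall>b\<in>B. \<nu> b \<noteq> 0) \<and> galois_compat (carrier G) B d P a \<sigma> \<nu> M M' \<and> galois_compat N B d' P' a \<sigma> \<nu> V V'"
  using assms unfolding central_reps_def Let_def B_def[symmetric] by blast+

lemma centralizer_iff:
  "(k, b) \<in> centralizer_of S (carrier G \<times> {id}) \<longleftrightarrow> k \<in> carrier G \<and> b \<in> A \<and> (\<forall>y\<in>carrier G. k \<otimes> b y = y \<otimes> k)"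
  by (auto simp: centralizer_of_def)

text \<open>The assumption says that b is conjugation by the inverse of k, and \<theta> is a class
  function.\<close>

lemma centralizing_fixes:
  assumes k: "k \<in> carrier G" "b \<in> A" "\<forall>y\<in>carrier G. k \<otimes> b y = y \<otimes> k"
  shows "b \<in> B"
proof -
  have "\<theta> (b y) = \<theta> y" if y: "y \<in> carrier G" for y
  proof -
    have "k \<otimes> b y \<otimes> inv k = y" using k y A_closed by (simp add: m_assoc)
    then show ?thesis using Irr_class_function[OF \<theta> k(1) A_closed[OF k(2) y]] by simp
  qed
  then show ?thesis using k \<theta>_outside by (auto simp: B_def aut_twist_def)
qed

text \<open>By uniqueness, any two multipliers compared in condition (iv) are both equal to the
  common \<nu>.\<close>

theorem central_geI:
  assumes r: "central_reps p G A N \<theta> \<phi> d P \<alpha> d' P' \<alpha>'"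
  shows "central_ge p S (carrier G \<times> {id}) (lift_char \<theta>) (N \<times> A) (N \<times> {id}) (lift_char \<phi>)"
proof -
  note R = reps[OF r]
  interpret NA: aut_group "G\<lparr>carrier := N\<rparr>" A
  proof (intro aut_group.intro aut_group_axioms.intro subgroup.subgroup_is_group[OF N is_group])
    show "finite (carrier (G\<lparr>carrier := N\<rparr>))" using finite_subset[OF subgroup.subset[OF N] finite_G] by simp
    show "a \<in> hom (G\<lparr>carrier := N\<rparr>) (G\<lparr>carrier := N\<rparr>)" if "a \<in> A" for a
      using that stN A_mult subgroup.mem_carrier[OF N] by (auto simp: hom_def)
  qed (use id_A comp_A inv_A bij_A in auto)
  have NG: "N \<subseteq> carrier G" using N by (rule subgroup.subset)
  have oneN: "\<one> \<in> N" using N by (rule subgroup.one_closed)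
  have big: "assoc_rep S (carrier G \<times> {id}) (carrier G \<times> B) (lift_char \<theta>) d P"
    using \<theta> by (intro assoc_rep_sdp[where K = "carrier G" and \<theta> = \<theta> and B = B, OF subgroup_self A_stable B _ R(1,2)]) auto
  have small: "assoc_rep S (N \<times> {id}) (N \<times> B) (lift_char \<phi>) d' P'"
    using \<phi> by (intro assoc_rep_sdp[where K = N and \<theta> = \<phi> and B = B, OF N N_stable B _ R(4,5)])
  have scal: "(\<exists>c'. P c = c' \<cdot>\<^sub>m 1\<^sub>m d \<and> P' c = c' \<cdot>\<^sub>m 1\<^sub>m d') \<and> c \<in> N \<times> A"
    if "c \<in> centralizer_of S (carrier G \<times> {id})" for c
  proof -
    obtain k b where kb: "c = (k, b)" by (cases c)
    then have *: "k \<in> carrier G" "b \<in> A" "\<forall>y\<in>carrier G. k \<otimes> b y = y \<otimes> k" using that centralizer_iff by auto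
    then show ?thesis using R(10)[OF *(1) centralizing_fixes[OF *] *(3)] kb by auto
  qed
  have mus: "\<mu> h = \<mu>' h"
    if x: "(x, \<sigma>) \<in> stabH p S (carrier G \<times> {id}) (lift_char \<theta>) (N \<times> A)"
      and m: "is_mu S (carrier G \<times> {id}) (carrier G \<times> B) d P x \<sigma> \<mu>" and m': "is_mu S (N \<times> {id}) (N \<times> B) d' P' x \<sigma> \<mu>'"
      and h: "h \<in> N \<times> B" for x \<sigma> \<mu> \<mu>' h
  proof -
    obtain k a where ka: "x = (k, a)" "k \<in> N" "a \<in> A" "Hgal p \<sigma>" 
      and act: "char_act S (carrier G \<times> {id}) (lift_char \<theta>) (k, a) \<sigma> = lift_char \<theta>" using x by (auto simp: stabH_def)
    have kG: "k \<in> carrier G" using ka NG by auto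
    have fix\<theta>: "aut_twist (carrier G) \<theta> a \<sigma> = \<theta>"
      using act char_act_lift[OF subgroup_self kG ka(3) A_closed[OF ka(3)]] \<theta> by simp
    obtain \<nu> M M' V V' where g: "galois_compat (carrier G) B d P a \<sigma> \<nu> M M'" "galois_compat N B d' P' a \<sigma> \<nu> V V'"
      using R(11)[OF ka(3,4) fix\<theta>] by blast
    have hG: "h \<in> carrier G \<times> B" using h NG by auto
    show ?thesis
      using is_mu_eq[where K = "carrier G" and \<psi> = \<theta> and a = a, OF big subgroup_self A_stable R(3) ka(3) kG ka(4) fix\<theta> g(1) m[unfolded ka(1)] hG]
        is_mu_eq[where K = N and \<psi> = \<phi> and a = a, OF small N N_stable R(6) ka(3) ka(2) ka(4) fix\<theta> g(2) m'[unfolded ka(1)] h] by simp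
  qed
  show ?thesis
    unfolding central_ge_def Let_def stabs
  proof (intro conjI)
    show "H_triple p S (carrier G \<times> {id}) (lift_char \<theta>)" by (rule H_triple_sdp[OF \<theta> orb])
    show "subgroup (N \<times> A) S" using id_A comp_A inv_A stN by (intro subgroup_sdp[OF N]) auto
    show "H_triple p (S\<lparr>carrier := N \<times> A\<rparr>) (N \<times> {id}) (lift_char \<phi>)"
      unfolding sdp_restrict using NA.H_triple_sdp[OF \<phi>, of p] orb_\<phi> by simp
    show "carrier S = carrier G \<times> {id} <#>\<^bsub>S\<^esub> N \<times> A"
    proof (intro equalityI subsetI)
      fix z assume "z \<in> carrier S"
      then obtain k a where z: "z = (k, a)" "k \<in> carrier G" "a \<in> A" by auto
      have "z = (k, id) \<otimes>\<^bsub>S\<^esub> (\<one>, a)" using z by simp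
      then show "z \<in> carrier G \<times> {id} <#>\<^bsub>S\<^esub> N \<times> A" unfolding set_mult_def using z oneN by blast
    next
      fix z assume "z \<in> carrier G \<times> {id} <#>\<^bsub>S\<^esub> N \<times> A"
      then show "z \<in> carrier S" using NG by (auto simp: set_mult_def)
    qed
    show "carrier G \<times> {id} \<inter> N \<times> A = N \<times> {id}" using NG id_A by auto
    show "centralizer_of S (carrier G \<times> {id}) \<subseteq> N \<times> A" using scal by blast
    show "stabH p S (carrier G \<times> {id}) (lift_char \<theta>) (N \<times> A) = stabH p S (N \<times> {id}) (lift_char \<phi>) (N \<times> A)"
    proof -
      have "char_act S (carrier G \<times> {id}) (lift_char \<theta>) (k, a) \<sigma> = lift_char \<theta> \<longleftrightarrow>
        char_act S (N \<times> {id}) (lift_char \<phi>) (k, a) \<sigma> = lift_char \<phi>" if "k \<in> N" "a \<in> A" "Hgal p \<sigma>" for k a \<sigma>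
        using char_act_lift[OF subgroup_self _ that(2) A_closed[OF that(2)], of k \<theta> \<sigma>] \<theta> NG that
          char_act_lift[OF N that(1,2) stN[OF that(2)] \<phi>, of \<sigma>] stab_eq[OF that(2,3)] by auto
      then show ?thesis unfolding stabH_def by (auto simp del: lift_char_inject)
    qed
    show "\<exists>d P \<alpha> d' P' \<alpha>'. proj_rep S (carrier G \<times> B) d P \<alpha> \<and>
       assoc_with S (carrier G \<times> {id}) (lift_char \<theta>) (carrier G \<times> B) P \<and> entries_Qab (carrier G \<times> B) d P \<and>
       proj_rep S (N \<times> B) d' P' \<alpha>' \<and> assoc_with S (N \<times> {id}) (lift_char \<phi>) (N \<times> B) P' \<and> entries_Qab (N \<times> B) d' P' \<and>
       (\<forall>x\<in>carrier G \<times> B. \<forall>y\<in>carrier G \<times> B. root_of_unity (\<alpha> x y)) \<and>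
       (\<forall>x\<in>N \<times> B. \<forall>y\<in>N \<times> B. root_of_unity (\<alpha>' x y)) \<and> (\<forall>x\<in>N \<times> B. \<forall>y\<in>N \<times> B. \<alpha> x y = \<alpha>' x y) \<and>
       (\<forall>c\<in>centralizer_of S (carrier G \<times> {id}). \<exists>lam. P c = lam \<cdot>\<^sub>m 1\<^sub>m d \<and> P' c = lam \<cdot>\<^sub>m 1\<^sub>m d') \<and>
       (\<forall>x \<sigma> \<mu> \<mu>'. (x, \<sigma>) \<in> stabH p S (carrier G \<times> {id}) (lift_char \<theta>) (N \<times> A) \<and>
            is_mu S (carrier G \<times> {id}) (carrier G \<times> B) d P x \<sigma> \<mu> \<and> is_mu S (N \<times> {id}) (N \<times> B) d' P' x \<sigma> \<mu>' \<longrightarrow>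
            (\<forall>h\<in>N \<times> B. \<mu> h = \<mu>' h))"
    proof (intro exI conjI)
      show "proj_rep S (carrier G \<times> B) d P \<alpha>" "assoc_with S (carrier G \<times> {id}) (lift_char \<theta>) (carrier G \<times> B) P"
        "entries_Qab (carrier G \<times> B) d P" "proj_rep S (N \<times> B) d' P' \<alpha>'"
        "assoc_with S (N \<times> {id}) (lift_char \<phi>) (N \<times> B) P'" "entries_Qab (N \<times> B) d' P'" by (fact R)+
      show "\<forall>x\<in>carrier G \<times> B. \<forall>y\<in>carrier G \<times> B. root_of_unity (\<alpha> x y)"
        "\<forall>x\<in>N \<times> B. \<forall>y\<in>N \<times> B. root_of_unity (\<alpha>' x y)" "\<forall>x\<in>N \<times> B. \<forall>y\<in>N \<times> B. \<alpha> x y = \<alpha>' x y"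
        by (rule ballI, rule ballI, rule R(7-9), assumption, assumption)+
      show "\<forall>c\<in>centralizer_of S (carrier G \<times> {id}). \<exists>lam. P c = lam \<cdot>\<^sub>m 1\<^sub>m d \<and> P' c = lam \<cdot>\<^sub>m 1\<^sub>m d'"
        by (rule ballI, rule conjunct1[OF scal])
      show "\<forall>x \<sigma> \<mu> \<mu>'. (x, \<sigma>) \<in> stabH p S (carrier G \<times> {id}) (lift_char \<theta>) (N \<times> A) \<and>
            is_mu S (carrier G \<times> {id}) (carrier G \<times> B) d P x \<sigma> \<mu> \<and> is_mu S (N \<times> {id}) (N \<times> B) d' P' x \<sigma> \<mu>' \<longrightarrow>
            (\<forall>h\<in>N \<times> B. \<mu> h = \<mu>' h)"
        by (intro allI impI, elim conjE, rule ballI, rule mus)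
    qed
  qed
qed

text \<open>Condition (iv) speaks about given multipliers, so these have to be produced first. Once
  they exist for \<open>(\<one>, a)\<close> on both sides, the condition identifies them and leaves
  a single \<nu>.\<close>

theorem central_geD:
  assumes "central_ge p S (carrier G \<times> {id}) (lift_char \<theta>) (N \<times> A) (N \<times> {id}) (lift_char \<phi>)"
  obtains d P \<alpha> d' P' \<alpha>' where "central_reps p G A N \<theta> \<phi> d P \<alpha> d' P' \<alpha>'"
proof -
  have NG: "N \<subseteq> carrier G" using N by (rule subgroup.subset)
  have oneN: "\<one> \<in> N" using N by (rule subgroup.one_closed)
  obtain d P \<alpha> d' P' \<alpha>' where R: "proj_rep S (carrier G \<times> B) d P \<alpha>"
       "assoc_with S (carrier G \<times> {id}) (lift_char \<theta>) (carrier G \<times> B) P" "entries_Qab (carrier G \<times> B) d P"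
       "proj_rep S (N \<times> B) d' P' \<alpha>'" "assoc_with S (N \<times> {id}) (lift_char \<phi>) (N \<times> B) P'" "entries_Qab (N \<times> B) d' P'"
       "\<forall>x\<in>carrier G \<times> B. \<forall>y\<in>carrier G \<times> B. root_of_unity (\<alpha> x y)"
       "\<forall>x\<in>N \<times> B. \<forall>y\<in>N \<times> B. root_of_unity (\<alpha>' x y)" "\<forall>x\<in>N \<times> B. \<forall>y\<in>N \<times> B. \<alpha> x y = \<alpha>' x y"
       "\<forall>c\<in>centralizer_of S (carrier G \<times> {id}). \<exists>lam. P c = lam \<cdot>\<^sub>m 1\<^sub>m d \<and> P' c = lam \<cdot>\<^sub>m 1\<^sub>m d'"
       and mus: "\<forall>x \<sigma> \<mu> \<mu>'. (x, \<sigma>) \<in> stabH p S (carrier G \<times> {id}) (lift_char \<theta>) (N \<times> A) \<and>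
            is_mu S (carrier G \<times> {id}) (carrier G \<times> B) d P x \<sigma> \<mu> \<and> is_mu S (N \<times> {id}) (N \<times> B) d' P' x \<sigma> \<mu>' \<longrightarrow>
            (\<forall>h\<in>N \<times> B. \<mu> h = \<mu>' h)"
    using assms unfolding central_ge_def Let_def stabs by - (elim exE conjE, rule that, assumption+)
  have cen: "centralizer_of S (carrier G \<times> {id}) \<subseteq> N \<times> A"
    using assms unfolding central_ge_def by blast
  have big: "assoc_rep S (carrier G \<times> {id}) (carrier G \<times> B) (lift_char \<theta>) d P"
    using \<theta> by (intro assoc_rep_sdp[where K = "carrier G" and \<theta> = \<theta> and B = B, OF subgroup_self A_stable B _ R(1,2)]) auto
  have small: "assoc_rep S (N \<times> {id}) (N \<times> B) (lift_char \<phi>) d' P'"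
    using \<phi> by (intro assoc_rep_sdp[where K = N and \<theta> = \<phi> and B = B, OF N N_stable B _ R(4,5)])
  have gal: "\<exists>\<nu> M M' V V'. (\<forall>b\<in>B. \<nu> b \<noteq> 0) \<and> galois_compat (carrier G) B d P a \<sigma> \<nu> M M' \<and> galois_compat N B d' P' a \<sigma> \<nu> V V'"
    if a: "a \<in> A" and s: "Hgal p \<sigma>" and fix\<theta>: "aut_twist (carrier G) \<theta> a \<sigma> = \<theta>" for a \<sigma>
  proof -
    have fix\<phi>: "aut_twist N \<phi> a \<sigma> = \<phi>" using stab_eq[OF a s] fix\<theta> by simp
    have \<theta>': "\<theta> \<in> Irr (G\<lparr>carrier := carrier G\<rparr>)" using \<theta> by simp
    obtain \<mu> M M' where m: "is_mu S (carrier G \<times> {id}) (carrier G \<times> B) d P (\<one>, a) \<sigma> \<mu>"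
      "galois_compat (carrier G) B d P a \<sigma> (\<lambda>b. \<mu> (\<one>, b)) M M'"
      by (rule galois_compat_exists[where K = "carrier G" and \<psi> = \<theta> and a = a, OF big subgroup_self A_stable \<theta>' R(3) a s fix\<theta> fix\<theta>])
    obtain \<mu>' V V' where m': "is_mu S (N \<times> {id}) (N \<times> B) d' P' (\<one>, a) \<sigma> \<mu>'"
      "galois_compat N B d' P' a \<sigma> (\<lambda>b. \<mu>' (\<one>, b)) V V'"
      by (rule galois_compat_exists[where K = N and \<psi> = \<phi> and a = a, OF small N N_stable \<phi> R(6) a s fix\<theta> fix\<phi>])
    have "((\<one>, a), \<sigma>) \<in> stabH p S (carrier G \<times> {id}) (lift_char \<theta>) (N \<times> A)"
      using a s oneN char_act_lift[OF subgroup_self one_closed a A_closed[OF a] \<theta>'] fix\<theta> by (simp add: stabH_def)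
    then have "\<forall>h\<in>N \<times> B. \<mu> h = \<mu>' h" using mus m(1) m'(1) by blast
    then have "\<forall>b\<in>B. \<mu> (\<one>, b) = \<mu>' (\<one>, b)" using oneN by auto
    then have "galois_compat N B d' P' a \<sigma> (\<lambda>b. \<mu> (\<one>, b)) V V'" using m'(2) by (simp add: galois_compat_def)
    moreover have "\<forall>b\<in>B. \<mu> (\<one>, b) \<noteq> 0" using m(1) by (auto simp: is_mu_def)
    ultimately show ?thesis using m(2)
      by (intro exI[of _ "\<lambda>b. \<mu> (\<one>, b)"] exI[of _ M] exI[of _ M'] exI[of _ V] exI[of _ V'] conjI)
  qed
  have cent: "k \<in> N \<and> (\<exists>c. P (k, b) = c \<cdot>\<^sub>m 1\<^sub>m d \<and> P' (k, b) = c \<cdot>\<^sub>m 1\<^sub>m d')"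
    if "k \<in> carrier G" "b \<in> B" "\<forall>y\<in>carrier G. k \<otimes> b y = y \<otimes> k" for k b
  proof -
    have "(k, b) \<in> centralizer_of S (carrier G \<times> {id})" using that B centralizer_iff by blast
    then show ?thesis using R(10) cen by blast
  qed
  have "central_reps p G A N \<theta> \<phi> d P \<alpha> d' P' \<alpha>'"
    unfolding central_reps_def Let_def B_def[symmetric]
  proof (intro conjI)
    show "\<forall>x\<in>carrier G. \<forall>b\<in>B. (\<forall>y\<in>carrier G. x \<otimes> b y = y \<otimes> x) \<longrightarrow>
        x \<in> N \<and> (\<exists>c. P (x, b) = c \<cdot>\<^sub>m 1\<^sub>m d \<and> P' (x, b) = c \<cdot>\<^sub>m 1\<^sub>m d')"
      by (rule ballI, rule ballI, rule impI, rule cent)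
    show "\<forall>a\<in>A. \<forall>\<sigma>. Hgal p \<sigma> \<and> aut_twist (carrier G) \<theta> a \<sigma> = \<theta> \<longrightarrow>
       (\<exists>\<nu> M M' V V'. (\<forall>b\<in>B. \<nu> b \<noteq> 0) \<and> galois_compat (carrier G) B d P a \<sigma> \<nu> M M' \<and> galois_compat N B d' P' a \<sigma> \<nu> V V')"
      by (rule ballI, rule allI, rule impI, elim conjE, rule gal)
  qed (fact R)+
  then show thesis by (rule that)
qed

end

lemma smult_smult_mat: "a \<cdot>\<^sub>m (b \<cdot>\<^sub>m A) = (a * b) \<cdot>\<^sub>m (A :: complex mat)"
  by (intro eq_matI) (auto simp: mult.assoc)

text \<open>An invertible matrix has a nonzero entry in its first row, so c is a quotient of two
  elements of \<open>Qab\<close>.\<close>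

lemma Qab_of_smult:
  fixes A :: "complex mat"
  assumes A: "A \<in> carrier_mat d d" "C \<in> carrier_mat d d" "A * C = 1\<^sub>m d" and d: "0 < d" and Q: "mat_Qab A" "mat_Qab (c \<cdot>\<^sub>m A)"
  shows "c \<in> Qab"
proof -
  have "\<exists>j<d. A $$ (0, j) \<noteq> 0"
  proof (rule ccontr)
    assume n: "\<not> ?thesis"
    have "(A * C) $$ (0, 0) = (\<Sum>k<d. A $$ (0, k) * C $$ (k, 0))" using A d by (intro mat_mult_entry)
    also have "\<dots> = 0" using n by (intro sum.neutral) auto
    finally show False unfolding A(3) using d by simp
  qed
  then obtain j where j: "j < d" "A $$ (0, j) \<noteq> 0" by blast
  have "c * A $$ (0, j) \<in> Qab" "A $$ (0, j) \<in> Qab" using Q A d j by (auto simp: mat_Qab_def)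
  then have "c * A $$ (0, j) / A $$ (0, j) \<in> Qab" by (rule Qab_divide)
  then show ?thesis using j by simp
qed

lemma root_of_unity_Qab: "root_of_unity z \<Longrightarrow> z \<in> Qab"
  by (rule Qab.root)

section \<open>Multipliers on a coset of the stabiliser\<close>

context stable_pair
begin

text \<open>Unless it is empty, this is a right coset of the stabiliser \<open>B\<close>.\<close>

definition "Fix s = {u \<in> A. aut_twist (carrier G) \<theta> u s = \<theta>}"

text \<open>For every element of \<open>Fix s\<close> the twist of \<theta> by it equals the twist
  by the inverse of s, so any two of them act alike on \<theta>.\<close>

lemma Fix_quotient:
  assumes s: "Hgal p s" and u: "u \<in> Fix s" and w: "w \<in> Fix s"
  shows "u \<circ> ainv w \<in> B"
proof -
  obtain \<tau> where \<tau>: "Hgal p \<tau>" "\<tau> \<circ> s = id" using Hgal_inverse[OF s] by blast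
  let ?t = "aut_twist (carrier G)"
  have uA: "u \<in> A" "w \<in> A" using u w by (auto simp: Fix_def)
  have f: "?t \<theta> v id = ?t \<theta> id \<tau>" if "v \<in> Fix s" for v
  proof -
    have "?t \<theta> id \<tau> = ?t (?t \<theta> v s) id \<tau>" using that by (simp add: Fix_def)
    then show ?thesis using \<tau> by simp
  qed
  have c: "\<And>x. x \<in> carrier G \<Longrightarrow> ainv w x \<in> carrier G" by (rule A_closed[OF inv_A[OF uA(2)]])
  have "?t \<theta> (u \<circ> ainv w) id = ?t (?t \<theta> u id) (ainv w) id"
    using aut_twist_twist[of "carrier G" "ainv w" \<theta> u id id, OF c] by simp
  also have "\<dots> = ?t (?t \<theta> w id) (ainv w) id" using f[OF u] f[OF w] by simp
  also have "\<dots> = ?t \<theta> (w \<circ> ainv w) id"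
    using aut_twist_twist[of "carrier G" "ainv w" \<theta> w id id, OF c] by simp
  also have "\<dots> = \<theta>" using uA \<theta>_outside by (auto simp: aut_twist_def)
  finally show ?thesis using comp_A[OF uA(1) inv_A[OF uA(2)]] by (simp add: B_def)
qed

text \<open>Let k1, k2 be the quotients of u1, u2 by w and c the conjugate of h by w; then
  \<open>u1 \<circ> h \<circ> ainv u2\<close> is the product of k1, c and the inverse of k2. The two
  values in the denominator arise from splitting the matrix of this product into three, the one in
  the numerator from inverting the base change for u1. Only \<alpha> and \<nu> enter, so
  representations that share them share this scalar.\<close>

definition twist_scalar :: "('a \<times> ('a \<Rightarrow> 'a) \<Rightarrow> 'a \<times> ('a \<Rightarrow> 'a) \<Rightarrow> complex) \<Rightarrow> (complex \<Rightarrow> complex) \<Rightarrow> ('a \<Rightarrow> 'a) \<Rightarrow> (('a \<Rightarrow> 'a) \<Rightarrow> complex)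
    \<Rightarrow> ('a \<Rightarrow> 'a) \<Rightarrow> ('a \<Rightarrow> 'a) \<Rightarrow> ('a \<Rightarrow> 'a) \<Rightarrow> complex" where
  "twist_scalar \<alpha> s w \<nu> u1 h u2 =
     \<nu> h * s (\<alpha> (\<one>, ainv (u1 \<circ> ainv w)) (\<one>, u1 \<circ> ainv w)) /
     (s (\<alpha> (\<one>, u1 \<circ> ainv w) (\<one>, w \<circ> h \<circ> ainv w)) * s (\<alpha> (\<one>, (u1 \<circ> ainv w) \<circ> (w \<circ> h \<circ> ainv w)) (\<one>, ainv (u2 \<circ> ainv w))))"

text \<open>An element \<open>u\<close> with \<open>\<theta>\<^sup>u\<^sup>s = \<theta>\<close> differs from a fixed such \<open>w\<close> by an element of the
  stabiliser, so the matrix attached to \<open>u\<close> is that of \<open>w\<close> times a value of the projective representation.\<close>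
lemma twist_groupoid:
  assumes P: "assoc_rep S (K \<times> {id}) (K \<times> B) (lift_char \<psi>) e Q" and pr: "proj_rep S (K \<times> B) e Q \<alpha>"
    and K0: "subgroup K G" "\<forall>a\<in>A. \<forall>x\<in>K. a x \<in> K"
    and Qab: "entries_Qab (K \<times> B) e Q"
    and root: "\<And>b c. b \<in> B \<Longrightarrow> c \<in> B \<Longrightarrow> root_of_unity (\<alpha> (\<one>, b) (\<one>, c))"
    and s: "Hgal p s" and w: "w \<in> Fix s" and gc: "galois_compat K B e Q w s \<nu> M0 M0'"
  obtains M Mi where
    "\<forall>u\<in>Fix s. M u \<in> carrier_mat e e \<and> Mi u \<in> carrier_mat e e \<and> M u * Mi u = 1\<^sub>m e \<and> Mi u * M u = 1\<^sub>m e \<and> mat_Qab (M u) \<and> mat_Qab (Mi u)"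
    "\<forall>u1\<in>Fix s. \<forall>u2\<in>Fix s. \<forall>h\<in>B. \<forall>x\<in>K.
       map_mat s (Q (u1 x, u1 \<circ> h \<circ> ainv u2)) = twist_scalar \<alpha> s w \<nu> u1 h u2 \<cdot>\<^sub>m (Mi u1 * Q (x, h) * M u2)"
    "\<forall>h\<in>B. \<nu> h \<in> Qab"
proof -
  interpret S: assoc_rep S "K \<times> {id}" "K \<times> B" "lift_char \<psi>" e Q by (rule P)
  interpret BB: aut_group G B by (rule B)
  note K = K0(1) K0(2)[rule_format]
  have g: "galois_ab s" by (rule Hgal_galois[OF s])
  have KG: "K \<subseteq> carrier G" using K(1) by (rule subgroup.subset)
  have oneK: "\<one> \<in> K" using K(1) by (rule subgroup.one_closed)
  have FA: "u \<in> A" if "u \<in> Fix s" for u using that by (simp add: Fix_def)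
  have wA: "w \<in> A" by (rule FA[OF w])
  have Qc: "Q y \<in> carrier_mat e e" if "y \<in> K \<times> B" for y using S.carr(1)[OF that] .
  have Qq: "mat_Qab (Q y)" if "y \<in> K \<times> B" for y by (rule entries_Qab_mat[OF Qab that Qc[OF that]])
  define W where "W b = Q (\<one>, b)" for b
  have W: "W b \<in> carrier_mat e e" "mat_Qab (W b)" if "b \<in> B" for b
    using Qc[of "(\<one>, b)"] Qq[of "(\<one>, b)"] that oneK by (auto simp: W_def)
  have W1: "W id = 1\<^sub>m e" using S.P_one by (simp add: W_def)
  have WW: "W b * W c = \<alpha> (\<one>, b) (\<one>, c) \<cdot>\<^sub>m W (b \<circ> c)" if "b \<in> B" "c \<in> B" for b c
  proof -
    have "Q (\<one>, b) * Q (\<one>, c) = \<alpha> (\<one>, b) (\<one>, c) \<cdot>\<^sub>m Q ((\<one>, b) \<otimes>\<^bsub>S\<^esub> (\<one>, c))"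
      using pr that oneK unfolding proj_rep_def by blast
    then show ?thesis using BB.A_one[OF that(1)] by (simp add: W_def)
  qed
  define Z where "Z b = map_mat s (W b)" for b
  have Z: "Z b \<in> carrier_mat e e" "mat_Qab (Z b)" if "b \<in> B" for b
    using W[OF that] by (auto simp: Z_def mat_Qab_map_galois[OF g])
  have ZZ: "Z b * Z c = s (\<alpha> (\<one>, b) (\<one>, c)) \<cdot>\<^sub>m Z (b \<circ> c)" if "b \<in> B" "c \<in> B" for b c
    unfolding Z_def using map_mat_galois_mult[OF g W(1)[OF that(1)] W(1)[OF that(2)] W(2)[OF that(1)] W(2)[OF that(2)]]
      map_mat_galois_smult[OF g root_of_unity_Qab[OF root[OF that]] W(2)[OF BB.comp_A[OF that]]] WW[OF that] by simp
  have Z1: "Z id = 1\<^sub>m e" using map_mat_galois_one[OF g] by (simp add: Z_def W1)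
  have M0: "M0 \<in> carrier_mat e e" "M0' \<in> carrier_mat e e" "M0 * M0' = 1\<^sub>m e" "M0' * M0 = 1\<^sub>m e" "mat_Qab M0" "mat_Qab M0'"
    and gc': "\<And>x b. x \<in> K \<Longrightarrow> b \<in> B \<Longrightarrow> map_mat s (Q (w x, w \<circ> b \<circ> ainv w)) = \<nu> b \<cdot>\<^sub>m (M0' * Q (x, b) * M0)"
    using gc unfolding galois_compat_def by auto
  define k where "k u = u \<circ> ainv w" for u :: "'a \<Rightarrow> 'a"
  have k: "k u \<in> B" "ainv (k u) \<in> B" "k u \<circ> ainv (k u) = id" "ainv (k u) \<circ> k u = id" if "u \<in> Fix s" for u
    using Fix_quotient[OF s that w] BB.inv_A BB.ainv_simps by (auto simp: k_def)
  have s0: "s (\<alpha> (\<one>, b) (\<one>, c)) \<noteq> 0" "s (\<alpha> (\<one>, b) (\<one>, c)) \<in> Qab" if "b \<in> B" "c \<in> B" for b c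
    using root_of_unity_nonzero[OF root[OF that]] galois_ab_eq_0[OF g] galois_abD(1)[OF g root_of_unity_Qab[OF root[OF that]]] by auto
  \<comment> \<open>The scalar by which the twisted matrices at \<open>ainv (k u)\<close> and
    \<open>k u\<close> fail to be inverse to each other.\<close>
  define kap where "kap u = s (\<alpha> (\<one>, ainv (k u)) (\<one>, k u))" for u
  have kap: "kap u \<noteq> 0" "kap u \<in> Qab" if "u \<in> Fix s" for u using s0 k[OF that] by (auto simp: kap_def)
  \<comment> \<open>The base change for w, corrected by the value of the twisted representation at
    the inverse of the quotient of u by w.\<close>
  define M where "M u = M0 * Z (ainv (k u))" for u
  define Mi where "Mi u = inverse (kap u) \<cdot>\<^sub>m (Z (k u) * M0')" for u
  have M: "M u \<in> carrier_mat e e" "Mi u \<in> carrier_mat e e" "mat_Qab (M u)" "mat_Qab (Mi u)" if "u \<in> Fix s" for u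
    using M0 Z[OF k(1)[OF that]] Z[OF k(2)[OF that]] kap[OF that]
    by (auto simp: M_def Mi_def intro!: mat_Qab_mult[of _ e e _ e] mat_Qab_smult Qab.inv)
  have MMi: "M u * Mi u = 1\<^sub>m e" if u: "u \<in> Fix s" for u
  proof -
    note zk = Z(1)[OF k(1)[OF u]] Z(1)[OF k(2)[OF u]]
    have "M u * Mi u = inverse (kap u) \<cdot>\<^sub>m (M u * (Z (k u) * M0'))"
      unfolding Mi_def using M(1)[OF u] zk M0 by (intro mult_smult_distrib[of _ e e _ e]) auto
    also have "M u * (Z (k u) * M0') = M0 * (Z (ainv (k u)) * Z (k u)) * M0'"
      unfolding M_def using zk M0 by (intro assoc4_mat)
    also have "Z (ainv (k u)) * Z (k u) = kap u \<cdot>\<^sub>m 1\<^sub>m e"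
      using ZZ[OF k(2)[OF u] k(1)[OF u]] k[OF u] Z1 by (simp add: kap_def)
    also have "M0 * (kap u \<cdot>\<^sub>m 1\<^sub>m e) * M0' = kap u \<cdot>\<^sub>m (M0 * 1\<^sub>m e * M0')" using M0 by (intro conj_smult) auto
    also have "M0 * 1\<^sub>m e * M0' = 1\<^sub>m e" using M0 by simp
    also have "inverse (kap u) \<cdot>\<^sub>m (kap u \<cdot>\<^sub>m 1\<^sub>m e) = (1\<^sub>m e :: complex mat)" using kap[OF u] by (intro eq_matI) auto
    finally show ?thesis .
  qed
  have "Mi u * M u = 1\<^sub>m e" if "u \<in> Fix s" for u
    by (rule mat_mult_left_right_inverse[OF M(1)[OF that] M(2)[OF that] MMi[OF that]])
  \<comment> \<open>At \<open>(\<one>, h)\<close> the relation for w expresses one matrix over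
    \<open>Qab\<close> as \<open>\<nu> h\<close> times an invertible one over \<open>Qab\<close>.
    Membership is recorded because Galois automorphisms are applied to these scalars in the
    transport.\<close>
  moreover have "\<nu> h \<in> Qab" if h: "h \<in> B" for h
  proof -
    have w1: "w \<one> = \<one>" using A_one[OF wA] .
    have wB: "w \<circ> h \<circ> ainv w \<in> B" using B_conj[OF wA s _ h] w by (simp add: Fix_def)
    have e: "Z (w \<circ> h \<circ> ainv w) = \<nu> h \<cdot>\<^sub>m (M0' * W h * M0)" using gc'[OF oneK h] w1 by (simp add: Z_def W_def)
    have oh: "(\<one>, h) \<in> K \<times> B" using oneK h by simp
    obtain C where C: "C \<in> carrier_mat e e" "W h * C = 1\<^sub>m e"
      using invertible_mat_obtain[OF S.carr[OF oh]] unfolding W_def by blast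
    have "(M0' * W h * M0) * (M0' * C * M0) = M0' * (W h * C) * M0" using M0 W[OF h] C by (intro conj_mult[of _ e])
    then have i: "(M0' * W h * M0) * (M0' * C * M0) = 1\<^sub>m e" using M0 C by simp
    show ?thesis
    proof (rule Qab_of_smult[OF _ _ i S.d_pos])
      show "mat_Qab (M0' * W h * M0)" using M0 W[OF h] by (intro mat_Qab_mult[of _ e e _ e]) auto
      show "mat_Qab (\<nu> h \<cdot>\<^sub>m (M0' * W h * M0))" using Z(2)[OF wB] e by simp
    qed (use M0 W[OF h] C in auto)
  qed
  moreover have "map_mat s (Q (u1 x, u1 \<circ> h \<circ> ainv u2)) = twist_scalar \<alpha> s w \<nu> u1 h u2 \<cdot>\<^sub>m (Mi u1 * Q (x, h) * M u2)"
    if u: "u1 \<in> Fix s" "u2 \<in> Fix s" and h: "h \<in> B" and x: "x \<in> K" for u1 u2 h x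
  proof -
    define c where "c = w \<circ> h \<circ> ainv w"
    have c: "c \<in> B" using B_conj[OF wA s _ h] w by (simp add: Fix_def c_def)
    define k2 where "k2 = ainv (k u2)"
    note k1 = k(1)[OF u(1)]
    have k2: "k2 \<in> B" using k(2)[OF u(2)] by (simp add: k2_def)
    have "k u2 \<circ> (w \<circ> ainv u2) = id" using FA[OF u(2)] wA by (simp add: k_def comp_assoc)
    then have k2': "k2 = w \<circ> ainv u2"
    proof -
      have "k2 = k2 \<circ> (k u2 \<circ> (w \<circ> ainv u2))" using \<open>k u2 \<circ> (w \<circ> ainv u2) = id\<close> by simp
      also have "\<dots> = (k2 \<circ> k u2) \<circ> (w \<circ> ainv u2)" by (simp only: comp_assoc)
      finally show ?thesis using k(4)[OF u(2)] by (simp add: k2_def)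
    qed
    \<comment> \<open>The factorisation through w, which brings the relation known for w alone into
      the middle of the product.\<close>
    have kc: "k u1 \<circ> c \<circ> k2 = u1 \<circ> h \<circ> ainv u2"
      unfolding k2' k_def c_def using wA by (simp add: comp_assoc)
    have kcB: "k u1 \<circ> c \<in> B" "k u1 \<circ> c \<circ> k2 \<in> B" using BB.comp_A k1 c k2 by auto
    have ux: "u1 x \<in> K" "w x \<in> K" using K(2) FA[OF u(1)] wA x by auto
    have uxG: "u1 x \<in> carrier G" "w x \<in> carrier G" using ux KG by auto
    note wc = W(1)[OF k1] W(1)[OF c] W(1)[OF k2]
    have E: "(u1 x, id) \<in> K \<times> {id}" "(w x, id) \<in> K \<times> {id}" using ux by auto
    have Qu: "Q (u1 x, id) \<in> carrier_mat e e" "Q (w x, id) \<in> carrier_mat e e" using Qc E S.LK by auto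
    have left: "Q (y, b) = Q (y, id) * W b" if "y \<in> K" "b \<in> B" for y b
      using S.P_left[of "(y, id)" "(\<one>, b)"] that oneK KG by (auto simp: W_def)
    have kw: "k u1 (w x) = u1 x" using wA by (simp add: k_def)
    \<comment> \<open>The quotient of u1 by w sends w x to u1 x, and this is how a base element
      changes when it passes \<open>W (k u1)\<close>.\<close>
    have move: "W (k u1) * Q (w x, id) = Q (u1 x, id) * W (k u1)"
      using S.P_right[of "(w x, id)" "(\<one>, k u1)"] left[OF ux(1) k1] ux k1 oneK uxG kw by (auto simp: W_def)
    let ?a1 = "\<alpha> (\<one>, k u1) (\<one>, c)" and ?a2 = "\<alpha> (\<one>, k u1 \<circ> c) (\<one>, k2)"
    have "W (k u1) * Q (w x, c) * W k2 = W (k u1) * (Q (w x, id) * W c) * W k2" using left[OF ux(2) c] by simp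
    also have "W (k u1) * (Q (w x, id) * W c) = (W (k u1) * Q (w x, id)) * W c" using wc Qu by (intro assoc_mult_mat[symmetric])
    also have "\<dots> = Q (u1 x, id) * (W (k u1) * W c)" unfolding move using wc Qu by (intro assoc_mult_mat)
    also have "Q (u1 x, id) * (W (k u1) * W c) * W k2 = Q (u1 x, id) * (W (k u1) * W c * W k2)"
      using wc Qu by (intro assoc_mult_mat) auto
    also have "W (k u1) * W c * W k2 = ?a1 \<cdot>\<^sub>m (W (k u1 \<circ> c) * W k2)"
      unfolding WW[OF k1 c] using W(1)[OF kcB(1)] wc by (intro mult_smult_assoc_mat)
    also have "\<dots> = (?a1 * ?a2) \<cdot>\<^sub>m W (k u1 \<circ> c \<circ> k2)"
      unfolding WW[OF kcB(1) k2] using W(1)[OF kcB(2)] by (intro eq_matI) auto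
    also have "Q (u1 x, id) * ((?a1 * ?a2) \<cdot>\<^sub>m W (k u1 \<circ> c \<circ> k2)) = (?a1 * ?a2) \<cdot>\<^sub>m (Q (u1 x, id) * W (k u1 \<circ> c \<circ> k2))"
      using Qu W(1)[OF kcB(2)] by (intro mult_smult_distrib)
    also have "Q (u1 x, id) * W (k u1 \<circ> c \<circ> k2) = Q (u1 x, u1 \<circ> h \<circ> ainv u2)"
      using left[OF ux(1) kcB(2)] kc by simp
    finally have eq: "W (k u1) * Q (w x, c) * W k2 = (?a1 * ?a2) \<cdot>\<^sub>m Q (u1 x, u1 \<circ> h \<circ> ainv u2)" .
    have mem: "(u1 x, u1 \<circ> h \<circ> ainv u2) \<in> K \<times> B" "(w x, c) \<in> K \<times> B" "(x, h) \<in> K \<times> B"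
      using ux kcB kc c x h by auto
    have aQ: "?a1 \<in> Qab" "?a2 \<in> Qab" using root_of_unity_Qab[OF root] k1 c kcB k2 by auto
    have "map_mat s (W (k u1) * Q (w x, c) * W k2) = Z (k u1) * map_mat s (Q (w x, c)) * Z k2"
      unfolding Z_def using map_mat_galois_mult[OF g _ wc(3) mat_Qab_mult[OF wc(1) Qc[OF mem(2)] W(2)[OF k1] Qq[OF mem(2)]] W(2)[OF k2], of e]
        map_mat_galois_mult[OF g wc(1) Qc[OF mem(2)] W(2)[OF k1] Qq[OF mem(2)]] mult_carrier_mat[OF wc(1) Qc[OF mem(2)]] by simp
    also have "map_mat s (Q (w x, c)) = \<nu> h \<cdot>\<^sub>m (M0' * Q (x, h) * M0)" using gc'[OF x h] by (simp add: c_def)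
    also have "Z (k u1) * (\<nu> h \<cdot>\<^sub>m (M0' * Q (x, h) * M0)) * Z k2 = \<nu> h \<cdot>\<^sub>m (Z (k u1) * (M0' * Q (x, h) * M0) * Z k2)"
      using M0 Qc[OF mem(3)] Z(1)[OF k1] Z(1)[OF k2] by (intro conj_smult) auto
    also have "Z (k u1) * (M0' * Q (x, h) * M0) * Z k2 = (Z (k u1) * M0') * Q (x, h) * (M0 * Z k2)"
      using M0 Qc[OF mem(3)] Z(1)[OF k1] Z(1)[OF k2] by (simp add: assoc_mult_mat[of _ e e _ e _ e])
    also have "(Z (k u1) * M0') = kap u1 \<cdot>\<^sub>m Mi u1"
      unfolding Mi_def using kap(1)[OF u(1)] Z(1)[OF k1] M0 by (intro eq_matI) auto
    also have "(kap u1 \<cdot>\<^sub>m Mi u1) * Q (x, h) * (M0 * Z k2) = kap u1 \<cdot>\<^sub>m (Mi u1 * Q (x, h) * M u2)"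
      unfolding M_def k2_def[symmetric]
      using M(2)[OF u(1)] Qc[OF mem(3)] M0 Z(1)[OF k2] mult_smult_assoc_mat[of "Mi u1" e e "Q (x, h)" e "kap u1"]
        mult_smult_assoc_mat[of "Mi u1 * Q (x, h)" e e "M0 * Z k2" e "kap u1"] by simp
    finally have "map_mat s ((?a1 * ?a2) \<cdot>\<^sub>m Q (u1 x, u1 \<circ> h \<circ> ainv u2)) = \<nu> h \<cdot>\<^sub>m (kap u1 \<cdot>\<^sub>m (Mi u1 * Q (x, h) * M u2))"
      unfolding eq .
    then have "(s ?a1 * s ?a2) \<cdot>\<^sub>m map_mat s (Q (u1 x, u1 \<circ> h \<circ> ainv u2)) = (\<nu> h * kap u1) \<cdot>\<^sub>m (Mi u1 * Q (x, h) * M u2)"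
      unfolding map_mat_galois_smult[OF g Qab.mul[OF aQ] Qq[OF mem(1)]] galois_abD(3)[OF g aQ] smult_smult_mat .
    then have "inverse (s ?a1 * s ?a2) \<cdot>\<^sub>m ((s ?a1 * s ?a2) \<cdot>\<^sub>m map_mat s (Q (u1 x, u1 \<circ> h \<circ> ainv u2))) =
       inverse (s ?a1 * s ?a2) \<cdot>\<^sub>m ((\<nu> h * kap u1) \<cdot>\<^sub>m (Mi u1 * Q (x, h) * M u2))" by simp
    moreover have "inverse (s ?a1 * s ?a2) \<cdot>\<^sub>m ((s ?a1 * s ?a2) \<cdot>\<^sub>m map_mat s (Q (u1 x, u1 \<circ> h \<circ> ainv u2))) = map_mat s (Q (u1 x, u1 \<circ> h \<circ> ainv u2))"
      using s0[OF k1 c] s0[OF kcB(1) k2] by (intro eq_matI) (auto simp: field_simps)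
    moreover have "inverse (s ?a1 * s ?a2) \<cdot>\<^sub>m ((\<nu> h * kap u1) \<cdot>\<^sub>m (Mi u1 * Q (x, h) * M u2)) = twist_scalar \<alpha> s w \<nu> u1 h u2 \<cdot>\<^sub>m (Mi u1 * Q (x, h) * M u2)"
      by (intro eq_matI) (auto simp: twist_scalar_def kap_def k_def k2_def c_def divide_inverse mult_ac)
    ultimately show ?thesis by simp
  qed
  ultimately show thesis using M MMi by (intro that[of M Mi]) blast+
qed

text \<open>The same w and \<nu> are used on both sides, and \<open>twist_scalar\<close> evaluates
  the factor sets only at pairs of pure automorphisms, where \<alpha> and \<alpha>' agree. Hence one
  family of scalars serves for G and for \<open>N\<close>.\<close>

lemma common_twist:
  assumes r: "central_reps p G A N \<theta> \<phi> d P \<alpha> d' P' \<alpha>'" and s: "Hgal p s"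
  shows "\<exists>M Mi V Vi \<nu>.
    (\<forall>u\<in>Fix s. M u \<in> carrier_mat d d \<and> Mi u \<in> carrier_mat d d \<and> M u * Mi u = 1\<^sub>m d \<and> Mi u * M u = 1\<^sub>m d \<and> mat_Qab (M u) \<and> mat_Qab (Mi u)) \<and>
    (\<forall>u\<in>Fix s. V u \<in> carrier_mat d' d' \<and> Vi u \<in> carrier_mat d' d' \<and> V u * Vi u = 1\<^sub>m d' \<and> Vi u * V u = 1\<^sub>m d' \<and> mat_Qab (V u) \<and> mat_Qab (Vi u)) \<and>
    (\<forall>u1\<in>Fix s. \<forall>u2\<in>Fix s. \<forall>h\<in>B. \<nu> u1 h u2 \<in> Qab \<and> \<nu> u1 h u2 \<noteq> 0 \<and>
       (\<forall>x\<in>carrier G. map_mat s (P (u1 x, u1 \<circ> h \<circ> ainv u2)) = \<nu> u1 h u2 \<cdot>\<^sub>m (Mi u1 * P (x, h) * M u2)) \<and>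
       (\<forall>x\<in>N. map_mat s (P' (u1 x, u1 \<circ> h \<circ> ainv u2)) = \<nu> u1 h u2 \<cdot>\<^sub>m (Vi u1 * P' (x, h) * V u2)))"
proof (cases "Fix s = {}")
  case False
  then obtain w where w: "w \<in> Fix s" by blast
  interpret BB: aut_group G B by (rule B)
  note R = reps[OF r]
  have g: "galois_ab s" by (rule Hgal_galois[OF s])
  have oneN: "\<one> \<in> N" using N by (rule subgroup.one_closed)
  have big: "assoc_rep S (carrier G \<times> {id}) (carrier G \<times> B) (lift_char \<theta>) d P"
    using \<theta> by (intro assoc_rep_sdp[where K = "carrier G" and \<theta> = \<theta> and B = B, OF subgroup_self A_stable B _ R(1,2)]) auto
  have small: "assoc_rep S (N \<times> {id}) (N \<times> B) (lift_char \<phi>) d' P'"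
    using \<phi> by (intro assoc_rep_sdp[where K = N and \<theta> = \<phi> and B = B, OF N N_stable B _ R(4,5)])
  have \<alpha>\<alpha>': "\<alpha> (\<one>, b) (\<one>, c) = \<alpha>' (\<one>, b) (\<one>, c)" if "b \<in> B" "c \<in> B" for b c
    using R(9)[of "(\<one>, b)" "(\<one>, c)"] that oneN by simp
  have root: "root_of_unity (\<alpha> (\<one>, b) (\<one>, c))" "root_of_unity (\<alpha>' (\<one>, b) (\<one>, c))" if "b \<in> B" "c \<in> B" for b c
    using R(7)[of "(\<one>, b)" "(\<one>, c)"] R(8)[of "(\<one>, b)" "(\<one>, c)"] that oneN by simp_all
  obtain \<nu> M0 M0' V0 V0' where gc: "\<forall>b\<in>B. \<nu> b \<noteq> 0" "galois_compat (carrier G) B d P w s \<nu> M0 M0'" "galois_compat N B d' P' w s \<nu> V0 V0'"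
    using R(11)[of w s] w s by (auto simp: Fix_def)
  obtain M Mi where M: "\<forall>u\<in>Fix s. M u \<in> carrier_mat d d \<and> Mi u \<in> carrier_mat d d \<and> M u * Mi u = 1\<^sub>m d \<and> Mi u * M u = 1\<^sub>m d \<and> mat_Qab (M u) \<and> mat_Qab (Mi u)"
    "\<forall>u1\<in>Fix s. \<forall>u2\<in>Fix s. \<forall>h\<in>B. \<forall>x\<in>carrier G.
       map_mat s (P (u1 x, u1 \<circ> h \<circ> ainv u2)) = twist_scalar \<alpha> s w \<nu> u1 h u2 \<cdot>\<^sub>m (Mi u1 * P (x, h) * M u2)"
    "\<forall>h\<in>B. \<nu> h \<in> Qab"
    by (rule twist_groupoid[OF big R(1) subgroup_self A_stable R(3) root(1) s w gc(2)])
  obtain V Vi where V: "\<forall>u\<in>Fix s. V u \<in> carrier_mat d' d' \<and> Vi u \<in> carrier_mat d' d' \<and> V u * Vi u = 1\<^sub>m d' \<and> Vi u * V u = 1\<^sub>m d' \<and> mat_Qab (V u) \<and> mat_Qab (Vi u)"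
    "\<forall>u1\<in>Fix s. \<forall>u2\<in>Fix s. \<forall>h\<in>B. \<forall>x\<in>N.
       map_mat s (P' (u1 x, u1 \<circ> h \<circ> ainv u2)) = twist_scalar \<alpha>' s w \<nu> u1 h u2 \<cdot>\<^sub>m (Vi u1 * P' (x, h) * V u2)"
    "\<forall>h\<in>B. \<nu> h \<in> Qab"
    by (rule twist_groupoid[OF small R(4) N N_stable R(6) root(2) s w gc(3)])
  have mem: "u \<circ> ainv w \<in> B" "ainv (u \<circ> ainv w) \<in> B" if "u \<in> Fix s" for u
    using Fix_quotient[OF s that w] BB.inv_A by auto
  have wh: "w \<circ> h \<circ> ainv w \<in> B" if "h \<in> B" for h
    using B_conj[OF _ s _ that, of w] w by (simp add: Fix_def)
  have eq: "twist_scalar \<alpha>' s w \<nu> u1 h u2 = twist_scalar \<alpha> s w \<nu> u1 h u2" if "u1 \<in> Fix s" "u2 \<in> Fix s" "h \<in> B" for u1 h u2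
    unfolding twist_scalar_def using \<alpha>\<alpha>' mem[OF that(1)] mem[OF that(2)] wh[OF that(3)] BB.comp_A by simp
  have sr: "s (\<alpha> (\<one>, b) (\<one>, c)) \<noteq> 0" "s (\<alpha> (\<one>, b) (\<one>, c)) \<in> Qab" if "b \<in> B" "c \<in> B" for b c
    using root_of_unity_nonzero[OF root(1)[OF that]] galois_ab_eq_0[OF g] galois_abD(1)[OF g root_of_unity_Qab[OF root(1)[OF that]]] by auto
  have nz: "twist_scalar \<alpha> s w \<nu> u1 h u2 \<in> Qab" "twist_scalar \<alpha> s w \<nu> u1 h u2 \<noteq> 0" if "u1 \<in> Fix s" "u2 \<in> Fix s" "h \<in> B" for u1 h u2
    unfolding twist_scalar_def using M(3) gc(1) that mem[OF that(1)] mem[OF that(2)] wh[OF that(3)] sr BB.comp_A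
    by (auto intro!: Qab_divide Qab.mul)
  show ?thesis
    by (rule exI[of _ M], rule exI[of _ Mi], rule exI[of _ V], rule exI[of _ Vi], rule exI[of _ "twist_scalar \<alpha> s w \<nu>"])
      (use M V nz eq in auto)
qed auto

end

section \<open>Transport along orbits of characters\<close>

context aut_group
begin

text \<open>The right hand side of the orthogonality relations is rational and so survives \<sigma>,
  while a merely permutes the summation over the group.\<close>

lemma twist_irred:
  assumes irr: "irred_rep G d Q" and Q: "\<And>x. x \<in> carrier G \<Longrightarrow> mat_Qab (Q x)" and a: "a \<in> A" and s: "galois_ab \<sigma>"
  shows "irred_rep G d (\<lambda>x. map_mat \<sigma> (Q (a x)))"
proof (rule schur_orth_imp_irred[OF _ _ _ finite_G])
  have r: "is_rep G d Q" and d: "0 < d" using irr by (auto simp: irred_rep_def)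
  show "0 < d" by (rule d)
  have c: "a x \<in> carrier G" if "x \<in> carrier G" for x using A_closed[OF a that] .
  have bij: "bij_betw a (carrier G) (carrier G)"
    by (rule bij_betw_byWitness[where f' = "ainv a"]) (use a A_closed inv_A[OF a] in auto)
  show "is_rep G d (\<lambda>x. map_mat \<sigma> (Q (a x)))"
    unfolding is_rep_def
  proof (intro conjI ballI)
    show "map_mat \<sigma> (Q (a g)) \<in> carrier_mat d d" if "g \<in> carrier G" for g using rep_mat[OF r c[OF that]] by simp
    show "map_mat \<sigma> (Q (a \<one>)) = 1\<^sub>m d" using A_one[OF a] rep_one[OF r] map_mat_galois_one[OF s] by simp
    fix g h assume gh: "g \<in> carrier G" "h \<in> carrier G"
    show "map_mat \<sigma> (Q (a (g \<otimes> h))) = map_mat \<sigma> (Q (a g)) * map_mat \<sigma> (Q (a h))"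
      using map_mat_galois_mult[OF s rep_mat[OF r c[OF gh(1)]] rep_mat[OF r c[OF gh(2)]] Q[OF c[OF gh(1)]] Q[OF c[OF gh(2)]]]
        rep_mult[OF r c[OF gh(1)] c[OF gh(2)]] A_mult[OF a gh] by simp
  qed
  show "schur_orth G d (\<lambda>x. map_mat \<sigma> (Q (a x)))"
    unfolding schur_orth_def
  proof (intro allI impI)
    fix i k l j assume ij: "i < d" "k < d" "l < d" "j < d"
    have e: "Q g $$ (i', j') \<in> Qab" if "g \<in> carrier G" "i' < d" "j' < d" for g i' j'
      using Q[OF that(1)] rep_mat[OF r that(1)] that by (auto simp: mat_Qab_def)
    let ?f = "\<lambda>g. Q g $$ (i, k) * Q (inv g) $$ (l, j)"
    have fQ: "?f g \<in> Qab" if "g \<in> carrier G" for g using that ij e by (auto intro!: Qab.mul)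
    have ai: "a (inv g) = inv (a g)" if "g \<in> carrier G" for g
      using that a A_mult[OF a, of "inv g" g] A_one[OF a] c by (intro inv_equality[symmetric]) auto
    have "(\<Sum>g\<in>carrier G. map_mat \<sigma> (Q (a g)) $$ (i, k) * map_mat \<sigma> (Q (a (inv g))) $$ (l, j)) = (\<Sum>g\<in>carrier G. \<sigma> (?f (a g)))"
    proof (rule sum.cong[OF refl])
      fix g assume gG: "g \<in> carrier G"
      have "Q (a g) \<in> carrier_mat d d" "Q (inv (a g)) \<in> carrier_mat d d" using rep_mat[OF r] c[OF gG] by auto
      then show "map_mat \<sigma> (Q (a g)) $$ (i, k) * map_mat \<sigma> (Q (a (inv g))) $$ (l, j) = \<sigma> (?f (a g))"
        using ij e[OF c[OF gG] ij(1,2)] e[OF inv_closed[OF c[OF gG]] ij(3,4)] ai[OF gG] galois_abD(3)[OF s] by auto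
    qed
    also have "\<dots> = (\<Sum>g\<in>carrier G. \<sigma> (?f g))" by (rule sum.reindex_bij_betw[OF bij])
    also have "\<dots> = \<sigma> (\<Sum>g\<in>carrier G. ?f g)" using galois_ab_sum[OF s, of "carrier G" ?f] fQ by simp
    also have "(\<Sum>g\<in>carrier G. ?f g) = (if i = j \<and> k = l then of_nat (card (carrier G)) / of_nat d else 0)"
      by (rule schur_orthD[OF irred_imp_schur_orth[OF irr] ij])
    also have "\<sigma> \<dots> = \<dots>"
      using galois_ab_0[OF s] galois_abD(3)[OF s, of "of_nat (card (carrier G))" "inverse (of_nat d)"]
        galois_ab_inverse[OF s, of "of_nat d"] galois_ab_of_nat[OF s] Qab.inv[of "of_nat d"] d
      by (auto simp: divide_inverse)
    finally show "(\<Sum>g\<in>carrier G. map_mat \<sigma> (Q (a g)) $$ (i, k) * map_mat \<sigma> (Q (a (inv g))) $$ (l, j)) =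
       (if i = j \<and> k = l then of_nat (card (carrier G)) / of_nat d else 0)" .
  qed
qed

end

locale igm_pair = aut_group G A for G (structure) and A +
  fixes N :: "'a set" and p :: nat and \<Omega> :: "('a \<Rightarrow> complex) \<Rightarrow> 'a \<Rightarrow> complex"
  assumes N: "subgroup N G" and stN: "a \<in> A \<Longrightarrow> x \<in> N \<Longrightarrow> a x \<in> N"
    and bij: "bij_betw \<Omega> (Irr_p' p G) (Irr_p' p (G\<lparr>carrier := N\<rparr>))"
    and eqv: "equivariant_map p (carrier G) N A (Irr_p' p G) \<Omega>"
    and ge: "\<theta> \<in> Irr_p' p G \<Longrightarrow> sdp_central_ge p G A N \<theta> (\<Omega> \<theta>)"
begin

abbreviation "D \<equiv> Irr_p' p G"
abbreviation "tw \<equiv> aut_twist (carrier G)"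
abbreviation "AO \<theta> \<equiv> aut_stab_orbit p (carrier G) A \<theta>"

lemma D_Irr: "\<theta> \<in> D \<Longrightarrow> \<theta> \<in> Irr G"
  by (simp add: Irr_p'_def)

lemma D_outside: "\<theta> \<in> D \<Longrightarrow> x \<notin> carrier G \<Longrightarrow> \<theta> x = 0"
  using Irr_outside[OF D_Irr] .

lemma \<Omega>_Irr: "\<theta> \<in> D \<Longrightarrow> \<Omega> \<theta> \<in> Irr (G\<lparr>carrier := N\<rparr>)"
  using bij_betwE[OF bij] by (auto simp: Irr_p'_def)

lemma AO_group: "\<theta> \<in> D \<Longrightarrow> aut_group G (AO \<theta>)"
  by (rule orbit_stabilizer_aut_group[OF _ A_stable]) (rule D_outside)

lemma AO_sub: "AO \<theta> \<subseteq> A"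
  by (auto simp: aut_stab_orbit_def)

text \<open>The realisation over \<open>Qab\<close> is obtained by restricting to the base group the
  projective representation that the central order supplies.\<close>

lemma D_rep:
  assumes "\<theta> \<in> D"
  obtains d Q where "irred_rep G d Q" "\<forall>x\<in>carrier G. mat_Qab (Q x) \<and> mat_trace (Q x) = \<theta> x"
proof -
  interpret O: aut_group G "AO \<theta>" by (rule AO_group[OF assms])
  define B where "B = {a \<in> AO \<theta>. tw \<theta> a id = \<theta>}"
  have B: "aut_group G B" unfolding B_def
    using O.stabilizer_aut_group[of "carrier G" \<theta>, OF D_outside[OF assms] O.A_stable] .
  then have idB: "id \<in> B" by (simp add: aut_group_def aut_group_axioms_def)
  have st: "stab (sdp G (AO \<theta>)) (carrier G \<times> {id}) (lift_char \<theta>) (carrier (sdp G (AO \<theta>))) = carrier G \<times> B"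
    using O.stab_sdp_sub[OF subgroup_self D_Irr[OF assms]] by (simp add: B_def)
  have "central_ge p (sdp G (AO \<theta>)) (carrier G \<times> {id}) (lift_char \<theta>) (N \<times> AO \<theta>) (N \<times> {id}) (lift_char (\<Omega> \<theta>))"
    using ge[OF assms] by (simp add: sdp_central_ge_def Let_def)
  then obtain d P \<alpha> where P: "proj_rep (sdp G (AO \<theta>)) (carrier G \<times> B) d P \<alpha>"
    "assoc_with (sdp G (AO \<theta>)) (carrier G \<times> {id}) (lift_char \<theta>) (carrier G \<times> B) P" "entries_Qab (carrier G \<times> B) d P"
    unfolding central_ge_def Let_def st by - (elim exE conjE, rule that, assumption+)
  have \<theta>': "\<theta> \<in> Irr (G\<lparr>carrier := carrier G\<rparr>)" using D_Irr[OF assms] by simp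
  interpret R: assoc_rep "sdp G (AO \<theta>)" "carrier G \<times> {id}" "carrier G \<times> B" "lift_char \<theta>" d P
    by (rule O.assoc_rep_sdp[OF subgroup_self O.A_stable B _ \<theta>' P(1,2)]) (auto simp: B_def)
  have r: "is_rep G d (\<lambda>x. P (x, id))"
    unfolding is_rep_def
  proof (intro conjI ballI)
    show "P (g, id) \<in> carrier_mat d d" if "g \<in> carrier G" for g using that idB by (intro R.carr) auto
    show "P (\<one>, id) = 1\<^sub>m d" using R.P_one by simp
    show "P (g \<otimes> h, id) = P (g, id) * P (h, id)" if "g \<in> carrier G" "h \<in> carrier G" for g h
      using R.P_left[of "(g, id)" "(h, id)"] that idB by simp
  qed
  have tr: "mat_trace (P (x, id)) = \<theta> x" if "x \<in> carrier G" for x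
    using R.P_trace[of "(x, id)"] that by simp
  obtain e \<rho> where \<rho>: "irred_rep G e \<rho>" "\<forall>g. \<theta> g = (if g \<in> carrier G then mat_trace (\<rho> g) else 0)"
    using D_Irr[OF assms] by (rule IrrE)
  have "irred_rep G d (\<lambda>x. P (x, id))"
    using conjunct2[OF irred_of_equal_char[OF finite_G \<rho>(1) r]] \<rho>(2) tr by simp
  moreover have "mat_Qab (P (x, id))" if "x \<in> carrier G" for x
    using that idB by (intro entries_Qab_mat[OF P(3)] R.carr) auto
  ultimately show thesis using that tr by blast
qed

lemma D_Qab: "\<theta> \<in> D \<Longrightarrow> \<theta> x \<in> Qab"
proof (cases "x \<in> carrier G")
  case True
  assume "\<theta> \<in> D"
  then obtain d Q where Q: "irred_rep G d Q" "\<forall>x\<in>carrier G. mat_Qab (Q x) \<and> mat_trace (Q x) = \<theta> x" by (rule D_rep)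
  have "Q x \<in> carrier_mat d d" using Q True by (auto simp: irred_rep_def intro: rep_mat)
  then have "mat_trace (Q x) = (\<Sum>i<d. Q x $$ (i, i))" by (rule mat_trace_eq)
  also have "\<dots> \<in> Qab" using Q True \<open>Q x \<in> carrier_mat d d\<close> by (intro Qab_sum) (auto simp: mat_Qab_def)
  finally show ?thesis using Q True by simp
qed (simp add: D_outside)

text \<open>A realisation over \<open>Qab\<close> can be twisted entrywise, which makes the twisted
  function a character; its degree is an integer and does not change.\<close>

lemma D_twist:
  assumes \<theta>: "\<theta> \<in> D" and a: "a \<in> A" and s: "Hgal p \<sigma>"
  shows "tw \<theta> a \<sigma> \<in> D"
proof -
  have g: "galois_ab \<sigma>" using s by (rule Hgal_galois)
  obtain d Q where Q: "irred_rep G d Q" "\<forall>x\<in>carrier G. mat_Qab (Q x) \<and> mat_trace (Q x) = \<theta> x" using \<theta> by (rule D_rep)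
  have r: "is_rep G d Q" using Q by (simp add: irred_rep_def)
  have irr: "irred_rep G d (\<lambda>x. map_mat \<sigma> (Q (a x)))" using Q by (intro twist_irred[OF Q(1) _ a g]) auto
  have tr: "mat_trace (map_mat \<sigma> (Q (a x))) = \<sigma> (\<theta> (a x))" if "x \<in> carrier G" for x
    using Q(2) A_closed[OF a that] rep_mat[OF r A_closed[OF a that]] by (subst mat_trace_map_galois[OF g]) auto
  have I: "tw \<theta> a \<sigma> \<in> Irr G" by (rule IrrI[OF irr]) (auto simp: aut_twist_def tr)
  have "\<theta> \<one> = of_nat d" using Q(2) rep_one[OF r] by (metis mat_trace_one one_closed)
  then have "tw \<theta> a \<sigma> \<one> = \<theta> \<one>" using A_one[OF a] galois_ab_of_nat[OF g] by (simp add: aut_twist_def)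
  then show ?thesis using I \<theta> by (simp add: Irr_p'_def)
qed

lemma tw_tw: "b \<in> A \<Longrightarrow> tw (tw \<theta> a \<sigma>) b \<tau> = tw \<theta> (a \<circ> b) (\<tau> \<circ> \<sigma>)"
  by (rule aut_twist_twist) (rule A_closed)

lemma tw_id: "\<theta> \<in> D \<Longrightarrow> tw \<theta> id id = \<theta>"
  using D_outside by (auto simp: aut_twist_def)

lemma \<Omega>_twist: "\<theta> \<in> D \<Longrightarrow> a \<in> A \<Longrightarrow> Hgal p \<sigma> \<Longrightarrow> \<Omega> (tw \<theta> a \<sigma>) = aut_twist N (\<Omega> \<theta>) a \<sigma>"
  using eqv by (simp add: equivariant_map_def)

text \<open>\<open>stab_eq\<close> combines equivariance with injectivity of \<Omega>. Injectivity
  is available on \<open>D\<close> only, hence the appeal to closure of \<open>D\<close> under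
  twists.\<close>

lemma stable_pair: assumes \<theta>: "\<theta> \<in> D" shows "stable_pair G (AO \<theta>) N \<theta> (\<Omega> \<theta>) p"
proof (intro stable_pair.intro stable_pair_axioms.intro AO_group[OF \<theta>] N D_Irr[OF \<theta>] \<Omega>_Irr[OF \<theta>])
  show "a \<in> AO \<theta> \<Longrightarrow> x \<in> N \<Longrightarrow> a x \<in> N" for a x using AO_sub stN by blast
  show "a \<in> AO \<theta> \<Longrightarrow> tw \<theta> a id \<in> H_orbit p (carrier G) \<theta>" for a by (simp add: aut_stab_orbit_def)
  fix a \<sigma> assume a: "a \<in> AO \<theta>" and s: "Hgal p \<sigma>"
  then have aA: "a \<in> A" using AO_sub by blast
  have "tw \<theta> a \<sigma> = \<theta> \<longleftrightarrow> \<Omega> (tw \<theta> a \<sigma>) = \<Omega> \<theta>"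
    using bij D_twist[OF \<theta> aA s] \<theta> by (auto simp: bij_betw_def inj_on_def)
  then show "tw \<theta> a \<sigma> = \<theta> \<longleftrightarrow> aut_twist N (\<Omega> \<theta>) a \<sigma> = \<Omega> \<theta>" using \<Omega>_twist[OF \<theta> aA s] by simp
qed

text \<open>Stabilisers taken in the full group \<open>A\<close> instead of the orbit stabiliser
  \<open>AO \<psi>\<close>, which varies with \<psi>: transport between different characters needs
  one common group.\<close>

definition "BB \<psi> = {a \<in> A. tw \<psi> a id = \<psi>}"
definition "FF \<psi> s = {a \<in> A. tw \<psi> a s = \<psi>}"

lemma BB_eq: "\<psi> \<in> D \<Longrightarrow> stable_pair.B G (AO \<psi>) \<psi> = BB \<psi>"
  using stable_pair.B_def[OF stable_pair] fixed_up_to_Galois_mem_orbit[OF _ Hgal_id] AO_sub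
  by (fastforce simp: BB_def)

lemma FF_eq: "\<psi> \<in> D \<Longrightarrow> Hgal p s \<Longrightarrow> stable_pair.Fix G (AO \<psi>) \<psi> s = FF \<psi> s"
  using stable_pair.Fix_def[OF stable_pair] fixed_up_to_Galois_mem_orbit AO_sub
  by (fastforce simp: FF_def)

text \<open>One side of the pair, with \<open>K\<close> either the carrier of G or \<open>N\<close>,
  so that every construction is carried out once for both. The factor set is a parameter in order
  that the two sides can be given the same one.\<close>

definition rep_half where
  "rep_half K \<chi> \<psi> d P \<alpha> \<longleftrightarrow>
    (\<forall>x\<in>K. \<forall>b\<in>BB \<psi>. P (x, b) \<in> carrier_mat d d \<and> mat_Qab (P (x, b))) \<and>
    (\<forall>x\<in>K. \<forall>y\<in>K. \<forall>b\<in>BB \<psi>. \<forall>c\<in>BB \<psi>. P (x, b) * P (y, c) = \<alpha> (x, b) (y, c) \<cdot>\<^sub>m P (x \<otimes> b y, b \<circ> c) \<and> root_of_unity (\<alpha> (x, b) (y, c))) \<and>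
    (\<forall>x\<in>K. \<forall>y\<in>K. \<forall>b\<in>BB \<psi>. P (x, id) * P (y, b) = P (x \<otimes> y, b) \<and> P (y, b) * P (x, id) = P (y \<otimes> b x, b)) \<and>
    (\<forall>x\<in>K. mat_trace (P (x, id)) = \<chi> x) \<and> P (\<one>, id) = 1\<^sub>m d"

definition twist_half where
  "twist_half K \<psi> d P s \<nu> M Mi \<longleftrightarrow>
    (\<forall>u\<in>FF \<psi> s. M u \<in> carrier_mat d d \<and> Mi u \<in> carrier_mat d d \<and> M u * Mi u = 1\<^sub>m d \<and> Mi u * M u = 1\<^sub>m d \<and> mat_Qab (M u) \<and> mat_Qab (Mi u)) \<and>
    (\<forall>u1\<in>FF \<psi> s. \<forall>u2\<in>FF \<psi> s. \<forall>h\<in>BB \<psi>. \<nu> u1 h u2 \<in> Qab \<and> \<nu> u1 h u2 \<noteq> 0 \<and>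
       (\<forall>x\<in>K. map_mat s (P (u1 x, u1 \<circ> h \<circ> ainv u2)) = \<nu> u1 h u2 \<cdot>\<^sub>m (Mi u1 * P (x, h) * M u2)))"

definition scalar_on_centralizer where
  "scalar_on_centralizer \<psi> d P d' P' \<longleftrightarrow>
    (\<forall>x\<in>carrier G. \<forall>b\<in>BB \<psi>. (\<forall>y\<in>carrier G. x \<otimes> b y = y \<otimes> x) \<longrightarrow> x \<in> N \<and> (\<exists>c. P (x, b) = c \<cdot>\<^sub>m 1\<^sub>m d \<and> P' (x, b) = c \<cdot>\<^sub>m 1\<^sub>m d'))"

definition "rep_pair \<psi> d P d' P' \<alpha> \<longleftrightarrow> rep_half (carrier G) \<psi> \<psi> d P \<alpha> \<and> rep_half N (\<Omega> \<psi>) \<psi> d' P' \<alpha> \<and> scalar_on_centralizer \<psi> d P d' P' \<and>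
   (\<forall>s. Hgal p s \<longrightarrow> (\<exists>\<nu> M Mi V Vi. twist_half (carrier G) \<psi> d P s \<nu> M Mi \<and> twist_half N \<psi> d' P' s \<nu> V Vi))"

text \<open>The factor sets agree on pairs from \<open>N\<close>, so \<alpha> may replace \<alpha>'
  on that side.\<close>

lemma rep_pair_exists:
  assumes \<psi>: "\<psi> \<in> D"
  shows "\<exists>d P d' P' \<alpha>. rep_pair \<psi> d P d' P' \<alpha>"
proof -
  interpret T: stable_pair G "AO \<psi>" N \<psi> "\<Omega> \<psi>" p by (rule stable_pair[OF \<psi>])
  have "central_ge p (sdp G (AO \<psi>)) (carrier G \<times> {id}) (lift_char \<psi>) (N \<times> AO \<psi>) (N \<times> {id}) (lift_char (\<Omega> \<psi>))"
    using ge[OF \<psi>] by (simp add: sdp_central_ge_def Let_def)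
  then obtain d P \<alpha> d' P' \<alpha>' where r: "central_reps p G (AO \<psi>) N \<psi> (\<Omega> \<psi>) d P \<alpha> d' P' \<alpha>'" by (rule T.central_geD)
  note R = T.reps[OF r, unfolded BB_eq[OF \<psi>]]
  have NG: "x \<in> N \<Longrightarrow> x \<in> carrier G" for x using subgroup.mem_carrier[OF N] .
  interpret b: aut_group G "BB \<psi>" using T.B(1) unfolding BB_eq[OF \<psi>] .
  have one: "P (\<one>, id) = 1\<^sub>m d" "P' (\<one>, id) = 1\<^sub>m d'"
  proof -
    have "\<psi> \<in> Irr (G\<lparr>carrier := carrier G\<rparr>)" using D_Irr[OF \<psi>] by simp
    from assoc_rep.P_one[OF T.assoc_rep_sdp[OF subgroup_self T.A_stable T.B this T.reps(1,2)[OF r]]]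
    show "P (\<one>, id) = 1\<^sub>m d" by simp
    from assoc_rep.P_one[OF T.assoc_rep_sdp[OF N T.N_stable T.B \<Omega>_Irr[OF \<psi>] T.reps(4,5)[OF r]]]
    show "P' (\<one>, id) = 1\<^sub>m d'" by simp
  qed
  have carr: "P (x, b) \<in> carrier_mat d d" "mat_Qab (P (x, b))" if "x \<in> carrier G" "b \<in> BB \<psi>" for x b
    using R(1) that entries_Qab_mat[OF R(3), of "(x, b)"] by (auto simp: proj_rep_def)
  have carr': "P' (x, b) \<in> carrier_mat d' d'" "mat_Qab (P' (x, b))" if "x \<in> N" "b \<in> BB \<psi>" for x b
    using R(4) that entries_Qab_mat[OF R(6), of "(x, b)"] by (auto simp: proj_rep_def)
  have "rep_half (carrier G) \<psi> \<psi> d P \<alpha>"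
    unfolding rep_half_def
  proof (intro conjI ballI)
    fix x y b c assume xy: "x \<in> carrier G" "y \<in> carrier G" "b \<in> BB \<psi>"
    then have m: "(x, b) \<in> carrier G \<times> BB \<psi>" "(x, id) \<in> carrier G \<times> {id}" "(y, b) \<in> carrier G \<times> BB \<psi>" by auto
    have "P ((x, id) \<otimes>\<^bsub>sdp G (AO \<psi>)\<^esub> (y, b)) = P (x, id) * P (y, b) \<and>
      P ((y, b) \<otimes>\<^bsub>sdp G (AO \<psi>)\<^esub> (x, id)) = P (y, b) * P (x, id)"
      using R(2) m unfolding assoc_with_def by blast
    then show "P (x, id) * P (y, b) = P (x \<otimes> y, b)" "P (y, b) * P (x, id) = P (y \<otimes> b x, b)" by simp_all
    assume c: "c \<in> BB \<psi>"
    then have m': "(y, c) \<in> carrier G \<times> BB \<psi>" using xy by auto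
    show "P (x, b) * P (y, c) = \<alpha> (x, b) (y, c) \<cdot>\<^sub>m P (x \<otimes> b y, b \<circ> c)" "root_of_unity (\<alpha> (x, b) (y, c))"
    proof -
      have "P (x, b) * P (y, c) = \<alpha> (x, b) (y, c) \<cdot>\<^sub>m P ((x, b) \<otimes>\<^bsub>sdp G (AO \<psi>)\<^esub> (y, c))"
        using R(1) m m' unfolding proj_rep_def by blast
      then show "P (x, b) * P (y, c) = \<alpha> (x, b) (y, c) \<cdot>\<^sub>m P (x \<otimes> b y, b \<circ> c)" by simp
      show "root_of_unity (\<alpha> (x, b) (y, c))" by (rule R(7)[OF m(1) m'])
    qed
  next
    fix x assume "x \<in> carrier G" then show "mat_trace (P (x, id)) = \<psi> x" using R(2) by (simp add: assoc_with_def)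
  qed (use carr one in auto)
  moreover have "rep_half N (\<Omega> \<psi>) \<psi> d' P' \<alpha>"
    unfolding rep_half_def
  proof (intro conjI ballI)
    fix x y b c assume xy: "x \<in> N" "y \<in> N" "b \<in> BB \<psi>"
    then have m: "(x, b) \<in> N \<times> BB \<psi>" "(x, id) \<in> N \<times> {id}" "(y, b) \<in> N \<times> BB \<psi>" by auto
    have "P' ((x, id) \<otimes>\<^bsub>sdp G (AO \<psi>)\<^esub> (y, b)) = P' (x, id) * P' (y, b) \<and>
      P' ((y, b) \<otimes>\<^bsub>sdp G (AO \<psi>)\<^esub> (x, id)) = P' (y, b) * P' (x, id)"
      using R(5) m unfolding assoc_with_def by blast
    then show "P' (x, id) * P' (y, b) = P' (x \<otimes> y, b)" "P' (y, b) * P' (x, id) = P' (y \<otimes> b x, b)" by simp_all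
    assume c: "c \<in> BB \<psi>"
    then have m': "(y, c) \<in> N \<times> BB \<psi>" using xy by auto
    show "P' (x, b) * P' (y, c) = \<alpha> (x, b) (y, c) \<cdot>\<^sub>m P' (x \<otimes> b y, b \<circ> c)"  "root_of_unity (\<alpha> (x, b) (y, c))"
    proof -
      have "P' (x, b) * P' (y, c) = \<alpha>' (x, b) (y, c) \<cdot>\<^sub>m P' ((x, b) \<otimes>\<^bsub>sdp G (AO \<psi>)\<^esub> (y, c))"
        using R(4) m m' unfolding proj_rep_def by blast
      then show "P' (x, b) * P' (y, c) = \<alpha> (x, b) (y, c) \<cdot>\<^sub>m P' (x \<otimes> b y, b \<circ> c)" using R(9)[OF m(1) m'] by simp
      show "root_of_unity (\<alpha> (x, b) (y, c))" using R(8)[OF m(1) m'] R(9)[OF m(1) m'] by simp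
    qed
  next
    fix x assume "x \<in> N" then show "mat_trace (P' (x, id)) = \<Omega> \<psi> x" using R(5) by (simp add: assoc_with_def)
  qed (use carr' one in auto)
  moreover have "scalar_on_centralizer \<psi> d P d' P'"
    unfolding scalar_on_centralizer_def using R(10) by blast
  moreover have "\<exists>\<nu> M Mi V Vi. twist_half (carrier G) \<psi> d P s \<nu> M Mi \<and> twist_half N \<psi> d' P' s \<nu> V Vi" if s: "Hgal p s" for s
  proof -
    obtain M Mi V Vi \<nu> where 1: "\<forall>u\<in>FF \<psi> s. M u \<in> carrier_mat d d \<and> Mi u \<in> carrier_mat d d \<and> M u * Mi u = 1\<^sub>m d \<and> Mi u * M u = 1\<^sub>m d \<and> mat_Qab (M u) \<and> mat_Qab (Mi u)"
      and 2: "\<forall>u\<in>FF \<psi> s. V u \<in> carrier_mat d' d' \<and> Vi u \<in> carrier_mat d' d' \<and> V u * Vi u = 1\<^sub>m d' \<and> Vi u * V u = 1\<^sub>m d' \<and> mat_Qab (V u) \<and> mat_Qab (Vi u)"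
      and 3: "\<forall>u1\<in>FF \<psi> s. \<forall>u2\<in>FF \<psi> s. \<forall>h\<in>BB \<psi>. \<nu> u1 h u2 \<in> Qab \<and> \<nu> u1 h u2 \<noteq> 0 \<and>
       (\<forall>x\<in>carrier G. map_mat s (P (u1 x, u1 \<circ> h \<circ> ainv u2)) = \<nu> u1 h u2 \<cdot>\<^sub>m (Mi u1 * P (x, h) * M u2)) \<and>
       (\<forall>x\<in>N. map_mat s (P' (u1 x, u1 \<circ> h \<circ> ainv u2)) = \<nu> u1 h u2 \<cdot>\<^sub>m (Vi u1 * P' (x, h) * V u2))"
      using T.common_twist[OF r s] unfolding BB_eq[OF \<psi>] FF_eq[OF \<psi> s] by (elim exE conjE) (rule that)
    have "twist_half (carrier G) \<psi> d P s \<nu> M Mi" unfolding twist_half_def using 1 3 by simp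
    moreover have "twist_half N \<psi> d' P' s \<nu> V Vi" unfolding twist_half_def using 2 3 by simp
    ultimately show ?thesis by blast
  qed
  ultimately have "rep_pair \<psi> d P d' P' \<alpha>" unfolding rep_pair_def by blast
  then show ?thesis by blast
qed

definition "char_orbit \<theta> = {\<psi> \<in> D. \<exists>a\<in>A. \<exists>\<sigma>. Hgal p \<sigma> \<and> \<psi> = tw \<theta> a \<sigma>}"
definition "orep \<theta> = (SOME \<psi>. \<psi> \<in> char_orbit \<theta>)"
text \<open>The Galois part of the path is chosen before the automorphism \<open>arep\<close>, which
  is only quantified existentially here. This makes the choice invariant under twisting \<theta> by
  elements of \<open>A\<close>, which a simultaneous choice of both parts would not
  guarantee.\<close>

definition "grep \<theta> = (SOME \<tau>. Hgal p \<tau> \<and> (\<exists>a\<in>A. tw (orep \<theta>) a \<tau> = \<theta>))"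
definition "arep \<theta> = (SOME a. a \<in> A \<and> tw (orep \<theta>) a (grep \<theta>) = \<theta>)"

lemma tw_inverse:
  assumes "\<theta> \<in> D" "a \<in> A" "Hgal p \<sigma>"
  obtains \<tau> where "Hgal p \<tau>" "\<tau> \<circ> \<sigma> = id" "\<sigma> \<circ> \<tau> = id" "tw (tw \<theta> a \<sigma>) (ainv a) \<tau> = \<theta>"
proof -
  obtain \<tau> where \<tau>: "Hgal p \<tau>" "\<tau> \<circ> \<sigma> = id" "\<sigma> \<circ> \<tau> = id" using Hgal_inverse[OF assms(3)] by blast
  have "tw (tw \<theta> a \<sigma>) (ainv a) \<tau> = \<theta>" using tw_tw[OF inv_A[OF assms(2)]] assms tw_id \<tau> by simp
  then show thesis using \<tau> that by blast
qed

lemma char_orbit_twist: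
  assumes \<theta>: "\<theta> \<in> D" and a: "a \<in> A" and s: "Hgal p \<sigma>"
  shows "char_orbit (tw \<theta> a \<sigma>) = char_orbit \<theta>"
proof -
  have sub: "char_orbit (tw \<theta> a \<sigma>) \<subseteq> char_orbit \<theta>" if "\<theta> \<in> D" "a \<in> A" "Hgal p \<sigma>" for \<theta> a \<sigma>
    using that tw_tw comp_A Hgal_comp unfolding char_orbit_def by (smt (verit) Collect_mono_iff)
  obtain \<tau> where \<tau>: "Hgal p \<tau>" "tw (tw \<theta> a \<sigma>) (ainv a) \<tau> = \<theta>" using assms by (rule tw_inverse)
  have "char_orbit (tw (tw \<theta> a \<sigma>) (ainv a) \<tau>) \<subseteq> char_orbit (tw \<theta> a \<sigma>)"
    by (rule sub[OF D_twist[OF \<theta> a s] inv_A[OF a] \<tau>(1)])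
  then show ?thesis using sub[OF \<theta> a s] \<tau>(2) by simp
qed

lemma orep_twist: "\<theta> \<in> D \<Longrightarrow> a \<in> A \<Longrightarrow> Hgal p \<sigma> \<Longrightarrow> orep (tw \<theta> a \<sigma>) = orep \<theta>"
  by (simp add: orep_def char_orbit_twist)

lemma reps_of:
  assumes \<theta>: "\<theta> \<in> D"
  shows "orep \<theta> \<in> D" "Hgal p (grep \<theta>)" "arep \<theta> \<in> A" "tw (orep \<theta>) (arep \<theta>) (grep \<theta>) = \<theta>"
proof -
  have "\<theta> \<in> char_orbit \<theta>" unfolding char_orbit_def
    using \<theta> tw_id[OF \<theta>] id_A Hgal_id[of p] by (auto intro!: bexI[of _ id] exI[of _ id])
  then have "orep \<theta> \<in> char_orbit \<theta>" unfolding orep_def by (rule someI[of "\<lambda>\<psi>. \<psi> \<in> char_orbit \<theta>"])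
  then obtain a \<sigma> where a: "orep \<theta> \<in> D" "a \<in> A" "Hgal p \<sigma>" "orep \<theta> = tw \<theta> a \<sigma>" by (auto simp: char_orbit_def)
  obtain \<tau> where \<tau>: "Hgal p \<tau>" "tw (tw \<theta> a \<sigma>) (ainv a) \<tau> = \<theta>" using \<theta> a(2,3) by (rule tw_inverse)
  show "orep \<theta> \<in> D" by (rule a)
  have "\<exists>\<tau>. Hgal p \<tau> \<and> (\<exists>a\<in>A. tw (orep \<theta>) a \<tau> = \<theta>)" using \<tau> a inv_A by metis
  then have g: "Hgal p (grep \<theta>) \<and> (\<exists>a\<in>A. tw (orep \<theta>) a (grep \<theta>) = \<theta>)" unfolding grep_def by (rule someI_ex)
  then show "Hgal p (grep \<theta>)" by blast
  have "\<exists>a. a \<in> A \<and> tw (orep \<theta>) a (grep \<theta>) = \<theta>" using g by blast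
  then have "arep \<theta> \<in> A \<and> tw (orep \<theta>) (arep \<theta>) (grep \<theta>) = \<theta>" unfolding arep_def by (rule someI_ex)
  then show "arep \<theta> \<in> A" "tw (orep \<theta>) (arep \<theta>) (grep \<theta>) = \<theta>" by auto
qed

text \<open>Twisting \<theta> by a changes the admissible automorphisms by composition with a, so
  the property selecting the Galois part is literally the same for \<theta> and for its
  twist.\<close>

lemma grep_twist:
  assumes \<theta>: "\<theta> \<in> D" and a: "a \<in> A"
  shows "grep (tw \<theta> a id) = grep \<theta>"
proof -
  have 1: "\<exists>b\<in>A. tw \<psi> b \<tau> = tw \<theta> a id" if "b \<in> A" "tw \<psi> b \<tau> = \<theta>" "a \<in> A" for \<psi> b \<tau> \<theta> a
    using tw_tw[OF that(3), of \<psi> b \<tau> id] that comp_A by (intro bexI[of _ "b \<circ> a"]) auto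
  have undo: "tw (tw \<theta> a id) (ainv a) id = \<theta>" using tw_tw[OF inv_A[OF a]] tw_id[OF \<theta>] a by simp
  have "(\<exists>b\<in>A. tw \<psi> b \<tau> = tw \<theta> a id) \<longleftrightarrow> (\<exists>b\<in>A. tw \<psi> b \<tau> = \<theta>)" for \<psi> \<tau>
    using 1[of _ \<psi> \<tau> \<theta> a] 1[of _ \<psi> \<tau> "tw \<theta> a id" "ainv a"] a inv_A[OF a] undo by metis
  then show ?thesis unfolding grep_def orep_twist[OF \<theta> a Hgal_id] by simp
qed

text \<open>Conjugating by the chosen elements carries \<open>(a, \<sigma>)\<close> from \<open>\<theta>\<close> to the representative of its orbit.\<close>
definition "hat \<theta> a \<sigma> = arep \<theta> \<circ> a \<circ> ainv (arep (tw \<theta> a \<sigma>))"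

text \<open>The path from the representative to \<theta>, followed by (a, \<sigma>) and by the way
  back along the path of the twisted character, is a loop at the representative.\<close>

lemma hat_FF:
  assumes \<theta>: "\<theta> \<in> D" and a: "a \<in> A" and s: "Hgal p \<sigma>" and g: "g \<circ> grep (tw \<theta> a \<sigma>) = id"
  shows "hat \<theta> a \<sigma> \<in> FF (orep \<theta>) (g \<circ> \<sigma> \<circ> grep \<theta>)"
proof -
  let ?\<theta>' = "tw \<theta> a \<sigma>" and ?\<psi> = "orep \<theta>"
  have \<theta>': "?\<theta>' \<in> D" by (rule D_twist[OF assms(1-3)])
  note r = reps_of[OF \<theta>] and r' = reps_of[OF \<theta>', unfolded orep_twist[OF \<theta> a s]]
  have hA: "hat \<theta> a \<sigma> \<in> A" unfolding hat_def using comp_A[OF comp_A[OF r(3) a] inv_A[OF r'(3)]] .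
  have "tw ?\<psi> (hat \<theta> a \<sigma>) (g \<circ> \<sigma> \<circ> grep \<theta>) = tw (tw (tw ?\<psi> (arep \<theta>) (grep \<theta>)) a \<sigma>) (ainv (arep ?\<theta>')) g"
    using tw_tw[OF a] tw_tw[OF inv_A[OF r'(3)]] by (simp add: hat_def comp_assoc)
  also have "\<dots> = tw (tw ?\<psi> (arep ?\<theta>') (grep ?\<theta>')) (ainv (arep ?\<theta>')) g" using r(4) r'(4) by simp
  also have "\<dots> = tw ?\<psi> id id" using tw_tw[OF inv_A[OF r'(3)]] r'(3) g by simp
  also have "\<dots> = ?\<psi>" by (rule tw_id[OF r(1)])
  finally show ?thesis using hA by (simp add: FF_def)
qed

text \<open>For \<sigma> = id both ends have the same Galois part, which cancels. The loop is then
  an element of the stabiliser, where the projective representation is defined.\<close>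

lemma hat_BB:
  assumes \<theta>: "\<theta> \<in> D" and a: "a \<in> A"
  shows "hat \<theta> a id \<in> BB (orep \<theta>)"
proof -
  obtain g where g: "g \<circ> grep \<theta> = id" using Hgal_inverse[OF reps_of(2)[OF \<theta>]] by blast
  have "hat \<theta> a id \<in> FF (orep \<theta>) (g \<circ> id \<circ> grep \<theta>)"
    using g grep_twist[OF \<theta> a] by (intro hat_FF[OF \<theta> a Hgal_id]) simp
  then show ?thesis using g by (simp add: FF_def BB_def)
qed

end

section \<open>Transported matrices and their Galois twists\<close>

context igm_pair
begin

lemma ainv_comp: "a \<in> A \<Longrightarrow> b \<in> A \<Longrightarrow> ainv (a \<circ> b) = ainv b \<circ> ainv a"
  by (rule o_inv_distrib[OF bij_A bij_A])

lemma ainv_ainv: "a \<in> A \<Longrightarrow> ainv (ainv a) = a"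
  by (rule inv_inv_eq[OF bij_A])

lemma hat_id:
  assumes "\<theta> \<in> D" shows "hat \<theta> id id = id"
  using reps_of(3)[OF assms] by (simp add: hat_def tw_id[OF assms])

text \<open>The automorphism chosen for the intermediate character cancels, so \<open>hat\<close> is
  multiplicative along composable arrows.\<close>

lemma hat_comp:
  assumes \<theta>: "\<theta> \<in> D" and ab: "a \<in> A" "b \<in> A"
  shows "hat \<theta> a id \<circ> hat (tw \<theta> a id) b id = hat \<theta> (a \<circ> b) id"
proof -
  have "arep (tw \<theta> a id) \<in> A" by (rule reps_of(3)[OF D_twist[OF \<theta> ab(1) Hgal_id]])
  then show ?thesis using tw_tw[OF ab(2), of \<theta> a id id] by (simp add: hat_def comp_assoc)
qed

text \<open>The matrix of the orbit representative at the loop belonging to a, carried to \<theta>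
  by the Galois part of its path. Products along composable arrows make sense because \<theta> and
  its twist by a share that Galois part.\<close>

definition "build P = (\<lambda>\<theta> (x, a). map_mat (grep \<theta>) (P (orep \<theta>) (arep \<theta> x, hat \<theta> a id)))"
definition "build_fac \<alpha> = (\<lambda>\<theta> (x, a) (y, b).
  grep \<theta> (\<alpha> (orep \<theta>) (arep \<theta> x, hat \<theta> a id) (arep (tw \<theta> a id) y, hat (tw \<theta> a id) b id)) :: complex)"

text \<open>Here \<open>a\<close> need not fix \<open>\<theta>\<close>: the matrices \<open>Q \<theta> (x, a)\<close> form a projective representation of the
  action groupoid, in which \<open>a\<close> leads from \<open>\<theta>\<close> to its twist by \<open>a\<close>.\<close>
definition bundle_half where
  "bundle_half K \<chi> e Q fac \<longleftrightarrow>
    (\<forall>\<theta>\<in>D. \<forall>a\<in>A. \<forall>\<sigma>. Hgal p \<sigma> \<longrightarrow> e (tw \<theta> a \<sigma>) = e \<theta>) \<and>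
    (\<forall>\<theta>\<in>D. \<forall>x\<in>K. \<forall>a\<in>A. Q \<theta> (x, a) \<in> carrier_mat (e \<theta>) (e \<theta>) \<and> mat_Qab (Q \<theta> (x, a))) \<and>
    (\<forall>\<theta>\<in>D. \<forall>x\<in>K. \<forall>y\<in>K. \<forall>a\<in>A. \<forall>b\<in>A. Q \<theta> (x, a) * Q (tw \<theta> a id) (y, b) = fac \<theta> (x, a) (y, b) \<cdot>\<^sub>m Q \<theta> (x \<otimes> a y, a \<circ> b) \<and>
       root_of_unity (fac \<theta> (x, a) (y, b))) \<and>
    (\<forall>\<theta>\<in>D. \<forall>x\<in>K. \<forall>y\<in>K. \<forall>a\<in>A. Q \<theta> (x, id) * Q \<theta> (y, a) = Q \<theta> (x \<otimes> y, a) \<and>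
       Q \<theta> (y, a) * Q (tw \<theta> a id) (x, id) = Q \<theta> (y \<otimes> a x, a)) \<and>
    (\<forall>\<theta>\<in>D. (\<forall>x\<in>K. mat_trace (Q \<theta> (x, id)) = \<chi> \<theta> x) \<and> Q \<theta> (\<one>, id) = 1\<^sub>m (e \<theta>))"

lemma bundle_halfD:
  assumes "bundle_half K \<chi> e Q fac" "\<theta> \<in> D"
  shows "a \<in> A \<Longrightarrow> Hgal p \<sigma> \<Longrightarrow> e (tw \<theta> a \<sigma>) = e \<theta>"
    "x \<in> K \<Longrightarrow> a \<in> A \<Longrightarrow> Q \<theta> (x, a) \<in> carrier_mat (e \<theta>) (e \<theta>)" "x \<in> K \<Longrightarrow> a \<in> A \<Longrightarrow> mat_Qab (Q \<theta> (x, a))"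
    "x \<in> K \<Longrightarrow> y \<in> K \<Longrightarrow> a \<in> A \<Longrightarrow> b \<in> A \<Longrightarrow>
       Q \<theta> (x, a) * Q (tw \<theta> a id) (y, b) = fac \<theta> (x, a) (y, b) \<cdot>\<^sub>m Q \<theta> (x \<otimes> a y, a \<circ> b)"
    "x \<in> K \<Longrightarrow> y \<in> K \<Longrightarrow> a \<in> A \<Longrightarrow> b \<in> A \<Longrightarrow> root_of_unity (fac \<theta> (x, a) (y, b))"
    "x \<in> K \<Longrightarrow> y \<in> K \<Longrightarrow> a \<in> A \<Longrightarrow> Q \<theta> (x, id) * Q \<theta> (y, a) = Q \<theta> (x \<otimes> y, a)"
    "x \<in> K \<Longrightarrow> y \<in> K \<Longrightarrow> a \<in> A \<Longrightarrow> Q \<theta> (y, a) * Q (tw \<theta> a id) (x, id) = Q \<theta> (y \<otimes> a x, a)"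
    "x \<in> K \<Longrightarrow> mat_trace (Q \<theta> (x, id)) = \<chi> \<theta> x" "Q \<theta> (\<one>, id) = 1\<^sub>m (e \<theta>)"
  using assms unfolding bundle_half_def by blast+

lemma build_half:
  assumes h: "\<forall>\<psi>\<in>D. rep_half K (\<chi> \<psi>) \<psi> (d \<psi>) (P \<psi>) (\<alpha> \<psi>)" and K: "K \<subseteq> carrier G" "\<forall>a\<in>A. \<forall>x\<in>K. a x \<in> K"
    and \<chi>: "\<forall>\<psi>\<in>D. \<forall>a\<in>A. \<forall>\<sigma>. Hgal p \<sigma> \<longrightarrow> (\<forall>x\<in>K. \<chi> (tw \<psi> a \<sigma>) x = \<sigma> (\<chi> \<psi> (a x)))"
  shows "bundle_half K \<chi> (\<lambda>\<theta>. d (orep \<theta>)) (build P) (build_fac \<alpha>)"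
proof -
  have main: "build P \<theta> (x, a) \<in> carrier_mat (d (orep \<theta>)) (d (orep \<theta>))" "mat_Qab (build P \<theta> (x, a))"
     "build P \<theta> (x, a) * build P (tw \<theta> a id) (y, b) = build_fac \<alpha> \<theta> (x, a) (y, b) \<cdot>\<^sub>m build P \<theta> (x \<otimes> a y, a \<circ> b)"
     "root_of_unity (build_fac \<alpha> \<theta> (x, a) (y, b))"
     "build P \<theta> (x, id) * build P \<theta> (y, a) = build P \<theta> (x \<otimes> y, a)"
     "build P \<theta> (y, a) * build P (tw \<theta> a id) (x, id) = build P \<theta> (y \<otimes> a x, a)"
     "mat_trace (build P \<theta> (x, id)) = \<chi> \<theta> x"
    if \<theta>: "\<theta> \<in> D" and xy: "x \<in> K" "y \<in> K" and ab: "a \<in> A" "b \<in> A" for \<theta> x y a b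
  proof -
    define \<psi> where "\<psi> = orep \<theta>"
    define \<tau> where "\<tau> = grep \<theta>"
    define \<theta>' where "\<theta>' = tw \<theta> a id"
    have \<theta>': "\<theta>' \<in> D" unfolding \<theta>'_def by (rule D_twist[OF \<theta> ab(1) Hgal_id])
    note r = reps_of[OF \<theta>] and r' = reps_of[OF \<theta>']
    have e: "orep \<theta>' = \<psi>" "grep \<theta>' = \<tau>"
      unfolding \<theta>'_def \<psi>_def \<tau>_def by (rule orep_twist[OF \<theta> ab(1) Hgal_id], rule grep_twist[OF \<theta> ab(1)])
    have g: "galois_ab \<tau>" unfolding \<tau>_def by (rule Hgal_galois[OF r(2)])
    have \<psi>: "\<psi> \<in> D" unfolding \<psi>_def by (rule r)
    have H: "rep_half K (\<chi> \<psi>) \<psi> (d \<psi>) (P \<psi>) (\<alpha> \<psi>)" using h \<psi> by blast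
    have c: "P \<psi> (z, c) \<in> carrier_mat (d \<psi>) (d \<psi>)" "mat_Qab (P \<psi> (z, c))" if "z \<in> K" "c \<in> BB \<psi>" for z c
      using H that unfolding rep_half_def by blast+
    have m: "P \<psi> (z, b) * P \<psi> (z', c) = \<alpha> \<psi> (z, b) (z', c) \<cdot>\<^sub>m P \<psi> (z \<otimes> b z', b \<circ> c)" "root_of_unity (\<alpha> \<psi> (z, b) (z', c))"
      if "z \<in> K" "z' \<in> K" "b \<in> BB \<psi>" "c \<in> BB \<psi>" for z z' b c
      using H that unfolding rep_half_def by blast+
    have l: "P \<psi> (z, id) * P \<psi> (z', b) = P \<psi> (z \<otimes> z', b)" "P \<psi> (z', b) * P \<psi> (z, id) = P \<psi> (z' \<otimes> b z, b)"
      if "z \<in> K" "z' \<in> K" "b \<in> BB \<psi>" for z z' b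
      using H that unfolding rep_half_def by blast+
    have t: "mat_trace (P \<psi> (z, id)) = \<chi> \<psi> z" if "z \<in> K" for z using H that unfolding rep_half_def by blast
    have ha: "hat \<theta> a id \<in> BB \<psi>" "hat \<theta>' b id \<in> BB \<psi>"
      using hat_BB[OF \<theta> ab(1)] hat_BB[OF \<theta>' ab(2)] e by (simp_all add: \<psi>_def)
    have hab: "hat \<theta> (a \<circ> b) id \<in> BB \<psi>" unfolding \<psi>_def by (rule hat_BB[OF \<theta> comp_A[OF ab]])
    have idB: "id \<in> BB \<psi>" using id_A tw_id[OF \<psi>] by (simp add: BB_def)
    have S: "arep \<theta> z \<in> K" "arep \<theta>' z \<in> K" if "z \<in> K" for z using K(2) r(3) r'(3) that by auto
    \<comment> \<open>\<open>hat\<close> undoes the automorphism chosen for the target of a and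
      applies the one chosen for \<theta>, so base elements on either side end up in the coordinates
      of \<theta>.\<close>
    have mv: "hat \<theta> a id (arep \<theta>' z) = arep \<theta> (a z)" for z using r'(3) by (simp add: hat_def flip: \<theta>'_def)
    have KG: "z \<in> K \<Longrightarrow> z \<in> carrier G" for z using K(1) by blast
    have ay: "a y \<in> K" "a x \<in> K" using K(2) ab xy by auto
    have ar: "arep \<theta> z \<otimes> arep \<theta> z' = arep \<theta> (z \<otimes> z')" if "z \<in> K" "z' \<in> K" for z z'
      using A_mult[OF r(3) KG[OF that(1)] KG[OF that(2)]] by simp
    have b1: "build P \<theta> (z, c) = map_mat \<tau> (P \<psi> (arep \<theta> z, hat \<theta> c id))" for z c by (simp add: build_def \<psi>_def \<tau>_def)
    have b2: "build P \<theta>' (z, c) = map_mat \<tau> (P \<psi> (arep \<theta>' z, hat \<theta>' c id))" for z c by (simp add: build_def e)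
    show "build P \<theta> (x, a) \<in> carrier_mat (d (orep \<theta>)) (d (orep \<theta>))" "mat_Qab (build P \<theta> (x, a))"
      unfolding b1 using c[OF S(1)[OF xy(1)] ha(1)] mat_Qab_map_galois[OF g] by (simp_all add: \<psi>_def)
    note c1 = c[OF S(1)[OF xy(1)] ha(1)] and c2 = c[OF S(2)[OF xy(2)] ha(2)]
    have f: "build_fac \<alpha> \<theta> (x, a) (y, b) = \<tau> (\<alpha> \<psi> (arep \<theta> x, hat \<theta> a id) (arep \<theta>' y, hat \<theta>' b id))"
      by (simp add: build_fac_def \<psi>_def \<tau>_def \<theta>'_def)
    note mm = m[OF S(1)[OF xy(1)] S(2)[OF xy(2)] ha]
    have hc: "hat \<theta> a id \<circ> hat \<theta>' b id = hat \<theta> (a \<circ> b) id" unfolding \<theta>'_def by (rule hat_comp[OF \<theta> ab])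
    have xay: "x \<otimes> a y \<in> carrier G" using KG xy ay by simp
    \<comment> \<open>\<open>K\<close> is just a stable subset here, so the product of two of its
      elements is not known to lie in \<open>K\<close>; dimension and entries are taken from the
      multiplication rule instead.\<close>
    have Pxy: "P \<psi> (arep \<theta> (x \<otimes> a y), hat \<theta> (a \<circ> b) id) \<in> carrier_mat (d \<psi>) (d \<psi>)" "mat_Qab (P \<psi> (arep \<theta> (x \<otimes> a y), hat \<theta> (a \<circ> b) id))"
    proof -
      have "P \<psi> (arep \<theta> x, id) * P \<psi> (arep \<theta> (a y), hat \<theta> (a \<circ> b) id) = P \<psi> (arep \<theta> (x \<otimes> a y), hat \<theta> (a \<circ> b) id)"
        using l(1)[OF S(1)[OF xy(1)] S(1)[OF ay(1)] hab] ar[OF xy(1) ay(1)] by simp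
      then show "P \<psi> (arep \<theta> (x \<otimes> a y), hat \<theta> (a \<circ> b) id) \<in> carrier_mat (d \<psi>) (d \<psi>)" "mat_Qab (P \<psi> (arep \<theta> (x \<otimes> a y), hat \<theta> (a \<circ> b) id))"
        using mult_carrier_mat[OF c(1)[OF S(1)[OF xy(1)] idB] c(1)[OF S(1)[OF ay(1)] hab]]
          mat_Qab_mult[OF c(1)[OF S(1)[OF xy(1)] idB] c(1)[OF S(1)[OF ay(1)] hab] c(2)[OF S(1)[OF xy(1)] idB] c(2)[OF S(1)[OF ay(1)] hab]] by simp_all
    qed
    have "build P \<theta> (x, a) * build P \<theta>' (y, b) = build_fac \<alpha> \<theta> (x, a) (y, b) \<cdot>\<^sub>m build P \<theta> (x \<otimes> a y, a \<circ> b)"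
      unfolding b1 b2 f map_mat_galois_mult[OF g c1(1) c2(1) c1(2) c2(2), symmetric] mm(1) mv hc ar[OF xy(1) ay(1)]
      by (rule map_mat_galois_smult[OF g root_of_unity_Qab[OF mm(2)] Pxy(2)])
    then show "build P \<theta> (x, a) * build P (tw \<theta> a id) (y, b) = build_fac \<alpha> \<theta> (x, a) (y, b) \<cdot>\<^sub>m build P \<theta> (x \<otimes> a y, a \<circ> b)"
      by (simp add: \<theta>'_def)
    show "root_of_unity (build_fac \<alpha> \<theta> (x, a) (y, b))" unfolding f by (rule galois_ab_root_of_unity[OF g mm(2)])
    note ci = c[OF S(1)[OF xy(1)] idB] and ca = c[OF S(1)[OF xy(2)] ha(1)] and ci' = c[OF S(2)[OF xy(1)] idB]
    show "build P \<theta> (x, id) * build P \<theta> (y, a) = build P \<theta> (x \<otimes> y, a)"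
      unfolding b1 hat_id[OF \<theta>] map_mat_galois_mult[OF g ci(1) ca(1) ci(2) ca(2), symmetric]
        l(1)[OF S(1)[OF xy(1)] S(1)[OF xy(2)] ha(1)] ar[OF xy] ..
    have "build P \<theta> (y, a) * build P \<theta>' (x, id) = build P \<theta> (y \<otimes> a x, a)"
      unfolding b1 b2 hat_id[OF \<theta>'] map_mat_galois_mult[OF g ca(1) ci'(1) ca(2) ci'(2), symmetric]
        l(2)[OF S(2)[OF xy(1)] S(1)[OF xy(2)] ha(1)] mv ar[OF xy(2) ay(2)] ..
    then show "build P \<theta> (y, a) * build P (tw \<theta> a id) (x, id) = build P \<theta> (y \<otimes> a x, a)" by (simp add: \<theta>'_def)
    have "mat_trace (build P \<theta> (x, id)) = \<tau> (\<chi> \<psi> (arep \<theta> x))"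
      unfolding b1 hat_id[OF \<theta>] using mat_trace_map_galois[OF g ci(2)] ci(1) t[OF S(1)[OF xy(1)]] by simp
    also have "\<dots> = \<chi> (tw \<psi> (arep \<theta>) \<tau>) x" using \<chi> \<psi> r xy unfolding \<tau>_def by simp
    finally show "mat_trace (build P \<theta> (x, id)) = \<chi> \<theta> x" using r(4) by (simp add: \<psi>_def \<tau>_def)
  qed
  show ?thesis
    unfolding bundle_half_def
  proof (intro conjI ballI allI impI)
    show "d (orep (tw \<theta> a \<sigma>)) = d (orep \<theta>)" if "\<theta> \<in> D" "a \<in> A" "Hgal p \<sigma>" for \<theta> a \<sigma>
      using orep_twist[OF that] by simp
  next
    fix \<theta> x a assume "\<theta> \<in> D" "x \<in> K" "a \<in> A"
    then show "build P \<theta> (x, a) \<in> carrier_mat (d (orep \<theta>)) (d (orep \<theta>))" "mat_Qab (build P \<theta> (x, a))"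
      using main(1,2)[of \<theta> x x a a] by simp_all
  next
    fix \<theta> x y a b assume "\<theta> \<in> D" "x \<in> K" "y \<in> K" "a \<in> A" "b \<in> A"
    then show "build P \<theta> (x, a) * build P (tw \<theta> a id) (y, b) = build_fac \<alpha> \<theta> (x, a) (y, b) \<cdot>\<^sub>m build P \<theta> (x \<otimes> a y, a \<circ> b)"
     "root_of_unity (build_fac \<alpha> \<theta> (x, a) (y, b))"
      by (rule main(3,4))+
  next
    fix \<theta> x y a assume "\<theta> \<in> D" "x \<in> K" "y \<in> K" "a \<in> A"
    then show "build P \<theta> (x, id) * build P \<theta> (y, a) = build P \<theta> (x \<otimes> y, a)"
     "build P \<theta> (y, a) * build P (tw \<theta> a id) (x, id) = build P \<theta> (y \<otimes> a x, a)"
      using main(5,6)[of \<theta> x y a a] by simp_all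
  next
    fix \<theta> x assume "\<theta> \<in> D" "x \<in> K"
    then show "mat_trace (build P \<theta> (x, id)) = \<chi> \<theta> x" using main(7)[of \<theta> x x id id] id_A by simp
  next
    fix \<theta> assume \<theta>: "\<theta> \<in> D"
    note r = reps_of[OF \<theta>]
    have "P (orep \<theta>) (\<one>, id) = 1\<^sub>m (d (orep \<theta>))" using h r(1) unfolding rep_half_def by blast
    then show "build P \<theta> (\<one>, id) = 1\<^sub>m (d (orep \<theta>))"
      using A_one[OF r(3)] hat_id[OF \<theta>] map_mat_galois_one[OF Hgal_galois[OF r(2)]] by (simp add: build_def)
  qed
qed

definition "ginv \<tau> = (SOME g. Hgal p g \<and> g \<circ> \<tau> = id \<and> \<tau> \<circ> g = id)"

lemma ginv: assumes "Hgal p \<tau>" shows "Hgal p (ginv \<tau>)" "ginv \<tau> \<circ> \<tau> = id" "\<tau> \<circ> ginv \<tau> = id"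
  using someI_ex[OF Hgal_inverse[OF assms]] unfolding ginv_def by auto

text \<open>The automorphism \<sigma> as seen from the orbit representative, corrected by the Galois
  parts of the paths to \<theta> and to its twist; together with it,
  \<open>hat \<theta> g \<sigma>\<close> fixes the representative.\<close>

definition "sb \<sigma> \<theta> g = ginv (grep (tw \<theta> g \<sigma>)) \<circ> \<sigma> \<circ> grep \<theta>"
text \<open>Base changes act on the side of the twisted character, hence its Galois part is the one
  that is applied.\<close>

definition "build_M M \<sigma> = (\<lambda>\<theta> g. map_mat (grep (tw \<theta> g \<sigma>)) (M (orep \<theta>) (sb \<sigma> \<theta> g) (hat \<theta> g \<sigma>)))"
definition "build_nu \<nu> \<sigma> = (\<lambda>\<theta>1 g1 b \<theta>2 g2. grep (tw \<theta>1 g1 \<sigma>)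
  (\<nu> (orep \<theta>1) (sb \<sigma> \<theta>1 g1) (hat \<theta>1 g1 \<sigma>) (hat (tw \<theta>1 g1 \<sigma>) b id) (hat \<theta>2 g2 \<sigma>)) :: complex)"

text \<open>The side condition says that b is an arrow from the twist of \<theta>1 to the twist of
  \<theta>2; then \<open>g1 \<circ> b \<circ> ainv g2\<close> is an arrow from \<theta>1 to
  \<theta>2. With \<theta>1 = \<theta>2 fixed by (g1, \<sigma>) and g1 = g2 this is the usual
  multiplier relation. The general form is needed because tensor slots that are permuted have
  different sources and targets.\<close>

definition bundle_twist where
  "bundle_twist K e Q \<sigma> \<nu> M Mi \<longleftrightarrow>
    (\<forall>\<theta>\<in>D. \<forall>g\<in>A. M \<theta> g \<in> carrier_mat (e \<theta>) (e \<theta>) \<and> Mi \<theta> g \<in> carrier_mat (e \<theta>) (e \<theta>) \<and>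
       M \<theta> g * Mi \<theta> g = 1\<^sub>m (e \<theta>) \<and> Mi \<theta> g * M \<theta> g = 1\<^sub>m (e \<theta>) \<and> mat_Qab (M \<theta> g) \<and> mat_Qab (Mi \<theta> g)) \<and>
    (\<forall>\<theta>1\<in>D. \<forall>\<theta>2\<in>D. \<forall>g1\<in>A. \<forall>g2\<in>A. \<forall>b\<in>A. tw (tw \<theta>1 g1 \<sigma>) b id = tw \<theta>2 g2 \<sigma> \<longrightarrow> \<nu> \<theta>1 g1 b \<theta>2 g2 \<noteq> 0 \<and>
       (\<forall>x\<in>K. map_mat \<sigma> (Q \<theta>1 (g1 x, g1 \<circ> b \<circ> ainv g2)) = \<nu> \<theta>1 g1 b \<theta>2 g2 \<cdot>\<^sub>m (Mi \<theta>1 g1 * Q (tw \<theta>1 g1 \<sigma>) (x, b) * M \<theta>2 g2)))"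

lemma bundle_twistD:
  assumes "bundle_twist K e Q \<sigma> \<nu> M Mi"
  shows "\<theta> \<in> D \<Longrightarrow> g \<in> A \<Longrightarrow> M \<theta> g \<in> carrier_mat (e \<theta>) (e \<theta>)" "\<theta> \<in> D \<Longrightarrow> g \<in> A \<Longrightarrow> Mi \<theta> g \<in> carrier_mat (e \<theta>) (e \<theta>)"
    "\<theta> \<in> D \<Longrightarrow> g \<in> A \<Longrightarrow> M \<theta> g * Mi \<theta> g = 1\<^sub>m (e \<theta>)" "\<theta> \<in> D \<Longrightarrow> g \<in> A \<Longrightarrow> Mi \<theta> g * M \<theta> g = 1\<^sub>m (e \<theta>)"
    "\<theta> \<in> D \<Longrightarrow> g \<in> A \<Longrightarrow> mat_Qab (M \<theta> g)" "\<theta> \<in> D \<Longrightarrow> g \<in> A \<Longrightarrow> mat_Qab (Mi \<theta> g)"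
    "\<theta>1 \<in> D \<Longrightarrow> \<theta>2 \<in> D \<Longrightarrow> g1 \<in> A \<Longrightarrow> g2 \<in> A \<Longrightarrow> b \<in> A \<Longrightarrow> tw (tw \<theta>1 g1 \<sigma>) b id = tw \<theta>2 g2 \<sigma> \<Longrightarrow> \<nu> \<theta>1 g1 b \<theta>2 g2 \<noteq> 0"
    "\<theta>1 \<in> D \<Longrightarrow> \<theta>2 \<in> D \<Longrightarrow> g1 \<in> A \<Longrightarrow> g2 \<in> A \<Longrightarrow> b \<in> A \<Longrightarrow> tw (tw \<theta>1 g1 \<sigma>) b id = tw \<theta>2 g2 \<sigma> \<Longrightarrow> x \<in> K \<Longrightarrow>
       map_mat \<sigma> (Q \<theta>1 (g1 x, g1 \<circ> b \<circ> ainv g2)) = \<nu> \<theta>1 g1 b \<theta>2 g2 \<cdot>\<^sub>m (Mi \<theta>1 g1 * Q (tw \<theta>1 g1 \<sigma>) (x, b) * M \<theta>2 g2)"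
  using assms unfolding bundle_twist_def by blast+

text \<open>All elements involved correspond to loops at the common representative \<psi>. There the
  relation for \<psi> applies with s' in place of \<sigma>, and \<tau>3 carries it to the twisted
  characters.\<close>

lemma build_twist:
  assumes h: "\<forall>\<psi>\<in>D. rep_half K (\<chi> \<psi>) \<psi> (d \<psi>) (P \<psi>) (\<alpha> \<psi>)" and K: "K \<subseteq> carrier G" "\<forall>a\<in>A. \<forall>x\<in>K. a x \<in> K"
    and tw: "\<forall>\<psi>\<in>D. \<forall>s. Hgal p s \<longrightarrow> twist_half K \<psi> (d \<psi>) (P \<psi>) s (\<nu> \<psi> s) (M \<psi> s) (Mi \<psi> s)"
    and s: "Hgal p \<sigma>"
  shows "bundle_twist K (\<lambda>\<theta>. d (orep \<theta>)) (build P) \<sigma> (build_nu \<nu> \<sigma>) (build_M M \<sigma>) (build_M Mi \<sigma>)"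
proof -
  have base: "Hgal p (sb \<sigma> \<theta> g) \<and> hat \<theta> g \<sigma> \<in> FF (orep \<theta>) (sb \<sigma> \<theta> g) \<and> galois_ab (grep (tw \<theta> g \<sigma>))"
    if "\<theta> \<in> D" "g \<in> A" for \<theta> g
  proof -
    have t: "tw \<theta> g \<sigma> \<in> D" by (rule D_twist[OF that s])
    note gi = ginv[OF reps_of(2)[OF t]]
    show ?thesis unfolding sb_def
      using Hgal_comp[OF Hgal_comp[OF gi(1) s] reps_of(2)[OF that(1)]] hat_FF[OF that s gi(2)] Hgal_galois[OF reps_of(2)[OF t]] by simp
  qed
  have 1: "build_M M \<sigma> \<theta> g \<in> carrier_mat (d (orep \<theta>)) (d (orep \<theta>)) \<and> build_M Mi \<sigma> \<theta> g \<in> carrier_mat (d (orep \<theta>)) (d (orep \<theta>)) \<and>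
       build_M M \<sigma> \<theta> g * build_M Mi \<sigma> \<theta> g = 1\<^sub>m (d (orep \<theta>)) \<and> build_M Mi \<sigma> \<theta> g * build_M M \<sigma> \<theta> g = 1\<^sub>m (d (orep \<theta>)) \<and>
       mat_Qab (build_M M \<sigma> \<theta> g) \<and> mat_Qab (build_M Mi \<sigma> \<theta> g)" if \<theta>: "\<theta> \<in> D" and g: "g \<in> A" for \<theta> g
  proof -
    note b = base[OF \<theta> g]
    define M0 where "M0 = M (orep \<theta>) (sb \<sigma> \<theta> g) (hat \<theta> g \<sigma>)"
    define M1 where "M1 = Mi (orep \<theta>) (sb \<sigma> \<theta> g) (hat \<theta> g \<sigma>)"
    have "twist_half K (orep \<theta>) (d (orep \<theta>)) (P (orep \<theta>)) (sb \<sigma> \<theta> g) (\<nu> (orep \<theta>) (sb \<sigma> \<theta> g)) (M (orep \<theta>) (sb \<sigma> \<theta> g)) (Mi (orep \<theta>) (sb \<sigma> \<theta> g))"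
      using tw reps_of(1)[OF \<theta>] b by blast
    then have M: "M0 \<in> carrier_mat (d (orep \<theta>)) (d (orep \<theta>))" "M1 \<in> carrier_mat (d (orep \<theta>)) (d (orep \<theta>))"
      "M0 * M1 = 1\<^sub>m (d (orep \<theta>))" "M1 * M0 = 1\<^sub>m (d (orep \<theta>))" "mat_Qab M0" "mat_Qab M1"
      using b unfolding twist_half_def M0_def M1_def by blast+
    have g: "galois_ab (grep (tw \<theta> g \<sigma>))" using b by blast
    have e: "build_M M \<sigma> \<theta> g = map_mat (grep (tw \<theta> g \<sigma>)) M0" "build_M Mi \<sigma> \<theta> g = map_mat (grep (tw \<theta> g \<sigma>)) M1"
      by (simp_all add: build_M_def M0_def M1_def)
    show ?thesis unfolding e map_mat_galois_mult[OF g M(1,2,5,6), symmetric] map_mat_galois_mult[OF g M(2,1,6,5), symmetric] M(3,4)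
      using M mat_Qab_map_galois[OF g] map_mat_galois_one[OF g] by simp
  qed
  have 2: "build_nu \<nu> \<sigma> \<theta>1 g1 b \<theta>2 g2 \<noteq> 0 \<and> (\<forall>x\<in>K. map_mat \<sigma> (build P \<theta>1 (g1 x, g1 \<circ> b \<circ> ainv g2)) =
       build_nu \<nu> \<sigma> \<theta>1 g1 b \<theta>2 g2 \<cdot>\<^sub>m (build_M Mi \<sigma> \<theta>1 g1 * build P (tw \<theta>1 g1 \<sigma>) (x, b) * build_M M \<sigma> \<theta>2 g2))"
    if \<theta>: "\<theta>1 \<in> D" "\<theta>2 \<in> D" and g: "g1 \<in> A" "g2 \<in> A" and b: "b \<in> A" and eq: "tw (tw \<theta>1 g1 \<sigma>) b id = tw \<theta>2 g2 \<sigma>" for \<theta>1 \<theta>2 g1 g2 b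
  proof -
    define \<theta>3 where "\<theta>3 = tw \<theta>1 g1 \<sigma>"
    define \<theta>4 where "\<theta>4 = tw \<theta>2 g2 \<sigma>"
    define c where "c = g1 \<circ> b \<circ> ainv g2"
    have c: "c \<in> A" using g b comp_A inv_A by (simp add: c_def)
    have \<theta>3: "\<theta>3 \<in> D" and \<theta>4: "\<theta>4 \<in> D" using D_twist[OF \<theta>(1) g(1) s] D_twist[OF \<theta>(2) g(2) s] by (simp_all add: \<theta>3_def \<theta>4_def)
    have 34: "tw \<theta>3 b id = \<theta>4" using eq by (simp add: \<theta>3_def \<theta>4_def)
    \<comment> \<open>Undoing (g2, \<sigma>) on both sides of the assumed equality shows that c
      leads from \<theta>1 to \<theta>2; so these share representative and Galois part.\<close>
    have 12: "tw \<theta>1 c id = \<theta>2"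
    proof -
      obtain t where t: "t \<circ> \<sigma> = id" "tw (tw \<theta>2 g2 \<sigma>) (ainv g2) t = \<theta>2" by (rule tw_inverse[OF \<theta>(2) g(2) s])
      have "tw (tw (tw \<theta>1 g1 \<sigma>) b id) (ainv g2) t = tw \<theta>1 c (t \<circ> \<sigma>)"
        using tw_tw[OF b] tw_tw[OF inv_A[OF g(2)]] by (simp add: c_def)
      then show ?thesis using t eq by simp
    qed
    define \<psi> where "\<psi> = orep \<theta>1"
    define \<tau>1 where "\<tau>1 = grep \<theta>1"
    define \<tau>3 where "\<tau>3 = grep \<theta>3"
    have o: "orep \<theta>2 = \<psi>" "orep \<theta>3 = \<psi>" using orep_twist[OF \<theta>(1) c Hgal_id] 12 orep_twist[OF \<theta>(1) g(1) s] by (simp_all add: \<psi>_def \<theta>3_def)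
    have gr: "grep \<theta>2 = \<tau>1" "grep \<theta>4 = \<tau>3" using grep_twist[OF \<theta>(1) c] 12 grep_twist[OF \<theta>3 b] 34 by (simp_all add: \<tau>1_def \<tau>3_def)
    define s' where "s' = sb \<sigma> \<theta>1 g1"
    have s'2: "sb \<sigma> \<theta>2 g2 = s'" by (simp add: s'_def sb_def gr flip: \<theta>3_def \<theta>4_def \<tau>1_def \<tau>3_def)
    define u1 where "u1 = hat \<theta>1 g1 \<sigma>"
    define u2 where "u2 = hat \<theta>2 g2 \<sigma>"
    define h' where "h' = hat \<theta>3 b id"
    have u: "u1 \<in> FF \<psi> s'" "u2 \<in> FF \<psi> s'" and Hs': "Hgal p s'" and g3: "galois_ab \<tau>3"
      using base[OF \<theta>(1) g(1)] base[OF \<theta>(2) g(2)] o by (simp_all add: u1_def u2_def \<psi>_def s'_def s'2[unfolded s'_def] \<tau>3_def \<theta>3_def)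
    have h': "h' \<in> BB \<psi>" using hat_BB[OF \<theta>3 b] o by (simp add: h'_def)
    have \<psi>: "\<psi> \<in> D" unfolding \<psi>_def by (rule reps_of[OF \<theta>(1)])
    have th: "twist_half K \<psi> (d \<psi>) (P \<psi>) s' (\<nu> \<psi> s') (M \<psi> s') (Mi \<psi> s')" using tw \<psi> Hs' by blast
    have n: "\<nu> \<psi> s' u1 h' u2 \<in> Qab" "\<nu> \<psi> s' u1 h' u2 \<noteq> 0" using th u h' unfolding twist_half_def by blast+
    have tw': "map_mat s' (P \<psi> (u1 x, u1 \<circ> h' \<circ> ainv u2)) = \<nu> \<psi> s' u1 h' u2 \<cdot>\<^sub>m (Mi \<psi> s' u1 * P \<psi> (x, h') * M \<psi> s' u2)" if "x \<in> K" for x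
      using th u h' that unfolding twist_half_def by blast
    have Mc: "M \<psi> s' u2 \<in> carrier_mat (d \<psi>) (d \<psi>)" "mat_Qab (M \<psi> s' u2)" "Mi \<psi> s' u1 \<in> carrier_mat (d \<psi>) (d \<psi>)" "mat_Qab (Mi \<psi> s' u1)"
      using th u unfolding twist_half_def by blast+
    have nu: "build_nu \<nu> \<sigma> \<theta>1 g1 b \<theta>2 g2 = \<tau>3 (\<nu> \<psi> s' u1 h' u2)"
      by (simp add: build_nu_def \<psi>_def s'_def u1_def u2_def h'_def \<tau>3_def \<theta>3_def)
    note r1 = reps_of[OF \<theta>(1)] and r2 = reps_of[OF \<theta>(2)] and r3 = reps_of[OF \<theta>3] and r4 = reps_of[OF \<theta>4]
    \<comment> \<open>Applying \<sigma> at \<theta>1 amounts to applying s' at the representative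
      and then passing to the twisted character.\<close>
    have ts: "\<tau>3 \<circ> s' = \<sigma> \<circ> \<tau>1"
    proof -
      have "\<tau>3 \<circ> s' = (\<tau>3 \<circ> ginv \<tau>3) \<circ> (\<sigma> \<circ> \<tau>1)" by (simp add: s'_def sb_def \<tau>1_def \<tau>3_def \<theta>3_def comp_assoc)
      then show ?thesis using ginv(3)[OF r3(2)] by (simp add: \<tau>3_def)
    qed
    have u1e: "u1 = arep \<theta>1 \<circ> g1 \<circ> ainv (arep \<theta>3)" by (simp add: u1_def hat_def \<theta>3_def)
    have u2e: "ainv u2 = arep \<theta>4 \<circ> ainv g2 \<circ> ainv (arep \<theta>2)"
      using ainv_comp[OF comp_A[OF r2(3) g(2)] inv_A[OF r4(3)]] ainv_comp[OF r2(3) g(2)] ainv_ainv[OF r4(3)]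
      by (simp add: u2_def hat_def comp_assoc flip: \<theta>4_def)
    have he: "h' = arep \<theta>3 \<circ> b \<circ> ainv (arep \<theta>4)" by (simp add: h'_def hat_def 34)
    \<comment> \<open>The automorphisms chosen for the twisted characters \<theta>3 and \<theta>4
      cancel in the middle.\<close>
    have hc: "u1 \<circ> h' \<circ> ainv u2 = hat \<theta>1 c id"
    proof -
      have "hat \<theta>1 c id = arep \<theta>1 \<circ> c \<circ> ainv (arep \<theta>2)" by (simp only: hat_def 12)
      then show ?thesis unfolding u1e u2e he c_def using r3(3) r4(3) by (simp add: comp_assoc)
    qed
    have main: "map_mat \<sigma> (build P \<theta>1 (g1 x, c)) = build_nu \<nu> \<sigma> \<theta>1 g1 b \<theta>2 g2 \<cdot>\<^sub>m
       (build_M Mi \<sigma> \<theta>1 g1 * build P \<theta>3 (x, b) * build_M M \<sigma> \<theta>2 g2)" if x: "x \<in> K" for x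
    proof -
      have x3: "arep \<theta>3 x \<in> K" using K(2) r3(3) x by blast
      have ux: "u1 (arep \<theta>3 x) = arep \<theta>1 (g1 x)" using r3(3) by (simp add: u1e)
      have Pc: "P \<psi> (arep \<theta>3 x, h') \<in> carrier_mat (d \<psi>) (d \<psi>)" "mat_Qab (P \<psi> (arep \<theta>3 x, h'))"
        using h \<psi> x3 h' unfolding rep_half_def by blast+
      have "map_mat \<sigma> (build P \<theta>1 (g1 x, c)) = map_mat (\<sigma> \<circ> \<tau>1) (P \<psi> (arep \<theta>1 (g1 x), hat \<theta>1 c id))"
        by (simp add: build_def map_mat_comp \<psi>_def \<tau>1_def)
      also have "\<dots> = map_mat \<tau>3 (map_mat s' (P \<psi> (u1 (arep \<theta>3 x), u1 \<circ> h' \<circ> ainv u2)))"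
        by (simp only: map_mat_comp ts ux hc)
      also have "\<dots> = map_mat \<tau>3 (\<nu> \<psi> s' u1 h' u2 \<cdot>\<^sub>m (Mi \<psi> s' u1 * P \<psi> (arep \<theta>3 x, h') * M \<psi> s' u2))"
        by (simp only: tw'[OF x3])
      also have "\<dots> = \<tau>3 (\<nu> \<psi> s' u1 h' u2) \<cdot>\<^sub>m map_mat \<tau>3 (Mi \<psi> s' u1 * P \<psi> (arep \<theta>3 x, h') * M \<psi> s' u2)"
        using Mc Pc by (intro map_mat_galois_smult[OF g3 n(1)] mat_Qab_mult[of _ "d \<psi>" "d \<psi>" _ "d \<psi>"]) auto
      also have "map_mat \<tau>3 (Mi \<psi> s' u1 * P \<psi> (arep \<theta>3 x, h') * M \<psi> s' u2) =
          map_mat \<tau>3 (Mi \<psi> s' u1) * map_mat \<tau>3 (P \<psi> (arep \<theta>3 x, h')) * map_mat \<tau>3 (M \<psi> s' u2)"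
        using map_mat_galois_mult[OF g3 mult_carrier_mat[OF Mc(3) Pc(1)] Mc(1) mat_Qab_mult[OF Mc(3) Pc(1) Mc(4) Pc(2)] Mc(2)]
          map_mat_galois_mult[OF g3 Mc(3) Pc(1) Mc(4) Pc(2)] by simp
      also have "map_mat \<tau>3 (Mi \<psi> s' u1) = build_M Mi \<sigma> \<theta>1 g1" by (simp add: build_M_def \<tau>3_def \<theta>3_def \<psi>_def s'_def u1_def)
      also have "map_mat \<tau>3 (M \<psi> s' u2) = build_M M \<sigma> \<theta>2 g2" by (simp add: build_M_def o s'2 u2_def gr flip: \<theta>4_def)
      also have "map_mat \<tau>3 (P \<psi> (arep \<theta>3 x, h')) = build P \<theta>3 (x, b)" by (simp add: build_def o \<tau>3_def h'_def)
      finally show ?thesis by (simp only: nu)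
    qed
    have "build_nu \<nu> \<sigma> \<theta>1 g1 b \<theta>2 g2 \<noteq> 0" unfolding nu using galois_ab_eq_0[OF g3] n(2) by simp
    then show ?thesis using main by (simp add: c_def \<theta>3_def)
  qed
  show ?thesis unfolding bundle_twist_def using 1 2 by blast
qed

lemma fixed_by_centralizing:
  assumes \<theta>: "\<theta> \<in> D" and x: "x \<in> carrier G" and a: "a \<in> A" and c: "\<forall>y\<in>carrier G. x \<otimes> a y = y \<otimes> x"
  shows "tw \<theta> a id = \<theta>"
proof -
  have "\<theta> (a y) = \<theta> y" if y: "y \<in> carrier G" for y
  proof -
    have "x \<otimes> a y \<otimes> inv x = y" using c y x A_closed[OF a y] by (simp add: m_assoc)
    then show ?thesis using Irr_class_function[OF D_Irr[OF \<theta>] x A_closed[OF a y]] by simp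
  qed
  then show ?thesis using D_outside[OF \<theta>] by (auto simp: aut_twist_def)
qed

definition "central_scalars e Q e' Q' \<longleftrightarrow> (\<forall>\<theta>\<in>D. \<forall>x\<in>carrier G. \<forall>a\<in>A. (\<forall>y\<in>carrier G. x \<otimes> a y = y \<otimes> x) \<longrightarrow>
   x \<in> N \<and> (\<exists>c. Q \<theta> (x, a) = c \<cdot>\<^sub>m 1\<^sub>m (e \<theta>) \<and> Q' \<theta> (x, a) = c \<cdot>\<^sub>m 1\<^sub>m (e' \<theta>)))"

text \<open>What a direct power requires from a single factor, stated for all characters at once
  rather than for one stabiliser. The factor set and, for each \<sigma>, the multiplier are one
  function for both groups; only degrees, matrices and base changes differ.\<close>

theorem bundle_exists:
  "\<exists>e Q e' Q' fac. bundle_half (carrier G) (\<lambda>\<theta>. \<theta>) e Q fac \<and> bundle_half N \<Omega> e' Q' fac \<and> central_scalars e Q e' Q' \<and>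
     (\<forall>\<sigma>. Hgal p \<sigma> \<longrightarrow> (\<exists>\<nu> M Mi V Vi. bundle_twist (carrier G) e Q \<sigma> \<nu> M Mi \<and> bundle_twist N e' Q' \<sigma> \<nu> V Vi))"
proof -
  obtain d P d' P' \<alpha> where rp: "\<forall>\<psi>\<in>D. rep_pair \<psi> (d \<psi>) (P \<psi>) (d' \<psi>) (P' \<psi>) (\<alpha> \<psi>)"
    using rep_pair_exists by metis
  have NG: "N \<subseteq> carrier G" using N by (rule subgroup.subset)
  have Nst: "\<forall>a\<in>A. \<forall>x\<in>N. a x \<in> N" using stN by blast
  have h: "\<forall>\<psi>\<in>D. rep_half (carrier G) \<psi> \<psi> (d \<psi>) (P \<psi>) (\<alpha> \<psi>)" "\<forall>\<psi>\<in>D. rep_half N (\<Omega> \<psi>) \<psi> (d' \<psi>) (P' \<psi>) (\<alpha> \<psi>)"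
    "\<forall>\<psi>\<in>D. scalar_on_centralizer \<psi> (d \<psi>) (P \<psi>) (d' \<psi>) (P' \<psi>)"
    using rp unfolding rep_pair_def by blast+
  have "\<forall>\<psi> s. \<exists>\<nu> M Mi V Vi. \<psi> \<in> D \<and> Hgal p s \<longrightarrow> twist_half (carrier G) \<psi> (d \<psi>) (P \<psi>) s \<nu> M Mi \<and> twist_half N \<psi> (d' \<psi>) (P' \<psi>) s \<nu> V Vi"
    using rp unfolding rep_pair_def by blast
  then obtain \<nu> M Mi V Vi where t: "\<forall>\<psi> s. \<psi> \<in> D \<and> Hgal p s \<longrightarrow>
      twist_half (carrier G) \<psi> (d \<psi>) (P \<psi>) s (\<nu> \<psi> s) (M \<psi> s) (Mi \<psi> s) \<and> twist_half N \<psi> (d' \<psi>) (P' \<psi>) s (\<nu> \<psi> s) (V \<psi> s) (Vi \<psi> s)"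
    by metis
  then have t1: "\<forall>\<psi>\<in>D. \<forall>s. Hgal p s \<longrightarrow> twist_half (carrier G) \<psi> (d \<psi>) (P \<psi>) s (\<nu> \<psi> s) (M \<psi> s) (Mi \<psi> s)"
    and t2: "\<forall>\<psi>\<in>D. \<forall>s. Hgal p s \<longrightarrow> twist_half N \<psi> (d' \<psi>) (P' \<psi>) s (\<nu> \<psi> s) (V \<psi> s) (Vi \<psi> s)" by blast+
  have b1: "bundle_half (carrier G) (\<lambda>\<theta>. \<theta>) (\<lambda>\<theta>. d (orep \<theta>)) (build P) (build_fac \<alpha>)"
    by (rule build_half[OF h(1) subset_refl A_stable]) (auto simp: aut_twist_def)
  have b2: "bundle_half N \<Omega> (\<lambda>\<theta>. d' (orep \<theta>)) (build P') (build_fac \<alpha>)"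
    by (rule build_half[OF h(2) NG Nst]) (intro ballI allI impI, simp only: \<Omega>_twist, simp add: aut_twist_def)
  have "central_scalars (\<lambda>\<theta>. d (orep \<theta>)) (build P) (\<lambda>\<theta>. d' (orep \<theta>)) (build P')"
    unfolding central_scalars_def
  proof (intro ballI impI)
    fix \<theta> x a assume \<theta>: "\<theta> \<in> D" and x: "x \<in> carrier G" and a: "a \<in> A" and c: "\<forall>y\<in>carrier G. x \<otimes> a y = y \<otimes> x"
    note r = reps_of[OF \<theta>]
    have f: "tw \<theta> a id = \<theta>" by (rule fixed_by_centralizing[OF \<theta> x a c])
    have ha: "hat \<theta> a id = arep \<theta> \<circ> a \<circ> ainv (arep \<theta>)" by (simp add: hat_def f)
    \<comment> \<open>The centralising condition is transported to the representative by the
      automorphism \<open>arep \<theta>\<close>.\<close>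
    have "arep \<theta> x \<otimes> hat \<theta> a id y = y \<otimes> arep \<theta> x" if y: "y \<in> carrier G" for y
    proof -
      define z where "z = ainv (arep \<theta>) y"
      have z: "z \<in> carrier G" "y = arep \<theta> z" using A_closed[OF inv_A[OF r(3)] y] r(3) by (simp_all add: z_def)
      have "arep \<theta> x \<otimes> hat \<theta> a id y = arep \<theta> (x \<otimes> a z)"
        using A_mult[OF r(3) x A_closed[OF a z(1)]] r(3) by (simp add: ha z(2))
      also have "\<dots> = arep \<theta> z \<otimes> arep \<theta> x" using c z(1) A_mult[OF r(3) z(1) x] by simp
      finally show ?thesis by (simp add: z(2))
    qed
    then obtain k where k: "arep \<theta> x \<in> N" "P (orep \<theta>) (arep \<theta> x, hat \<theta> a id) = k \<cdot>\<^sub>m 1\<^sub>m (d (orep \<theta>))"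
      "P' (orep \<theta>) (arep \<theta> x, hat \<theta> a id) = k \<cdot>\<^sub>m 1\<^sub>m (d' (orep \<theta>))"
      using h(3) r(1) A_closed[OF r(3) x] hat_BB[OF \<theta> a] unfolding scalar_on_centralizer_def by meson
    have "ainv (arep \<theta>) (arep \<theta> x) \<in> N" using stN[OF inv_A[OF r(3)] k(1)] .
    then have "x \<in> N" using r(3) by simp
    moreover have "map_mat (grep \<theta>) (k \<cdot>\<^sub>m 1\<^sub>m n) = grep \<theta> k \<cdot>\<^sub>m 1\<^sub>m n" for n
      using galois_ab_0[OF Hgal_galois[OF r(2)]] by (intro eq_matI) auto
    ultimately show "x \<in> N \<and> (\<exists>c. build P \<theta> (x, a) = c \<cdot>\<^sub>m 1\<^sub>m (d (orep \<theta>)) \<and> build P' \<theta> (x, a) = c \<cdot>\<^sub>m 1\<^sub>m (d' (orep \<theta>)))"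
      using k by (auto simp: build_def)
  qed
  moreover have "\<exists>\<nu> M Mi V Vi. bundle_twist (carrier G) (\<lambda>\<theta>. d (orep \<theta>)) (build P) \<sigma> \<nu> M Mi \<and> bundle_twist N (\<lambda>\<theta>. d' (orep \<theta>)) (build P') \<sigma> \<nu> V Vi"
    if s: "Hgal p \<sigma>" for \<sigma>
    using build_twist[OF h(1) subset_refl A_stable t1 s] build_twist[OF h(2) NG Nst t2 s] by blast
  ultimately show ?thesis using b1 b2 by blast
qed

end

section \<open>Wreath products\<close>

definition wreath_map :: "'a set \<Rightarrow> nat \<Rightarrow> (nat \<Rightarrow> 'a \<Rightarrow> 'a) \<Rightarrow> (nat \<Rightarrow> nat) \<Rightarrow> (nat \<Rightarrow> 'a) \<Rightarrow> nat \<Rightarrow> 'a" where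
  "wreath_map C n \<gamma> \<pi> = (\<lambda>v. if v \<in> (\<Pi>\<^sub>E i\<in>{..<n}. C) then (\<lambda>i. if i < n then \<gamma> i (v (\<pi> i)) else undefined) else v)"

lemma wreath_aut_eq: "wreath_aut G A n = {wreath_map (carrier G) n \<gamma> \<pi> | \<gamma> \<pi>. (\<forall>i<n. \<gamma> i \<in> A) \<and> \<pi> permutes {..<n}}"
  by (simp add: wreath_aut_def wreath_map_def)

text \<open>Elements of the wreath product are encoded as functions on tuples. The two assumptions
  make such a function determine its components: over a trivial group, every permutation would
  induce the identity.\<close>

locale wreath = aut_group G A for G (structure) and A +
  fixes n :: nat
  assumes outside: "a \<in> A \<Longrightarrow> x \<notin> carrier G \<Longrightarrow> a x = x" and nontrivial: "\<exists>x\<in>carrier G. x \<noteq> \<one>"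
begin

abbreviation "W \<equiv> wreath_map (carrier G) n"
abbreviation "Gn \<equiv> dpow G n"
abbreviation "An \<equiv> wreath_aut G A n"

lemma W_apply: "v \<in> carrier Gn \<Longrightarrow> i < n \<Longrightarrow> W \<gamma> \<pi> v i = \<gamma> i (v (\<pi> i))"
  by (simp add: wreath_map_def)

lemma W_PiE:
  assumes "\<forall>a\<in>A. \<forall>x\<in>K. a x \<in> K" "K \<subseteq> carrier G" "\<forall>i<n. \<gamma> i \<in> A" "\<pi> permutes {..<n}" and v: "v \<in> (\<Pi>\<^sub>E i\<in>{..<n}. K)"
  shows "W \<gamma> \<pi> v \<in> (\<Pi>\<^sub>E i\<in>{..<n}. K)"
proof -
  have "v \<in> (\<Pi>\<^sub>E i\<in>{..<n}. carrier G)" using v assms(2) by (auto simp: PiE_def Pi_def)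
  moreover have "v (\<pi> i) \<in> K" if "i < n" for i using v permutes_less[OF assms(4) that] by auto
  ultimately show ?thesis using assms(1,3) by (auto simp: wreath_map_def)
qed

lemma W_closed: "\<forall>i<n. \<gamma> i \<in> A \<Longrightarrow> \<pi> permutes {..<n} \<Longrightarrow> v \<in> carrier Gn \<Longrightarrow> W \<gamma> \<pi> v \<in> carrier Gn"
  using W_PiE[OF A_stable subset_refl] by simp

lemma W_cong: "(\<And>i. i < n \<Longrightarrow> \<gamma> i = \<gamma>' i) \<Longrightarrow> W \<gamma> \<pi> = W \<gamma>' \<pi>"
  by (auto simp: wreath_map_def fun_eq_iff)

text \<open>Coordinate i reads from \<pi> i, and there from \<pi>' (\<pi> i). So permutations
  compose in reverse order, just as they do in \<open>tens_mult\<close>.\<close>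

lemma W_comp:
  assumes "\<forall>i<n. \<gamma>' i \<in> A" "\<pi> permutes {..<n}" "\<pi>' permutes {..<n}"
  shows "W \<gamma> \<pi> \<circ> W \<gamma>' \<pi>' = W (\<lambda>i. \<gamma> i \<circ> \<gamma>' (\<pi> i)) (\<pi>' \<circ> \<pi>)"
proof (rule ext)
  fix v
  show "(W \<gamma> \<pi> \<circ> W \<gamma>' \<pi>') v = W (\<lambda>i. \<gamma> i \<circ> \<gamma>' (\<pi> i)) (\<pi>' \<circ> \<pi>) v"
  proof (cases "v \<in> carrier Gn")
    case True
    then have c: "W \<gamma>' \<pi>' v \<in> carrier Gn" using W_closed assms by blast
    have "W \<gamma> \<pi> (W \<gamma>' \<pi>' v) i = W (\<lambda>i. \<gamma> i \<circ> \<gamma>' (\<pi> i)) (\<pi>' \<circ> \<pi>) v i" for i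
    proof (cases "i < n")
      case i: True
      then show ?thesis using W_apply[OF c i] W_apply[OF True i] W_apply[OF True permutes_less[OF assms(2) i]] by simp
    next
      case False
      then show ?thesis using True c by (simp add: wreath_map_def)
    qed
    then show ?thesis by (simp add: fun_eq_iff)
  next
    case False then show ?thesis by (auto simp: wreath_map_def)
  qed
qed

lemma W_id: "W (\<lambda>_. id) id = id"
  by (auto simp: wreath_map_def fun_eq_iff PiE_def extensional_def)

lemma W_inject:
  assumes g: "\<forall>i<n. \<gamma> i \<in> A" "\<forall>i<n. \<gamma>' i \<in> A" and p: "\<pi> permutes {..<n}" "\<pi>' permutes {..<n}"
    and eq: "W \<gamma> \<pi> = W \<gamma>' \<pi>'"
  shows "\<pi> = \<pi>'" "i < n \<Longrightarrow> \<gamma> i = \<gamma>' i"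
proof -
  obtain x where x: "x \<in> carrier G" "x \<noteq> \<one>" using nontrivial by blast
  have p': "\<pi> i = \<pi>' i" if i: "i < n" for i
  proof (rule ccontr)
    assume ne: "\<pi> i \<noteq> \<pi>' i"
    \<comment> \<open>A tuple whose only nontrivial entry sits in slot \<pi> i tells the two slots
      apart.\<close>
    define v where "v = (\<lambda>j\<in>{..<n}. if j = \<pi> i then x else \<one>)"
    have v: "v \<in> carrier Gn" using x by (auto simp: v_def)
    have pi: "\<pi> i < n" "\<pi>' i < n" using permutes_less p i by blast+
    have "\<gamma> i (v (\<pi> i)) = \<gamma>' i (v (\<pi>' i))" using W_apply[OF v i, of \<gamma> \<pi>] W_apply[OF v i, of \<gamma>' \<pi>'] eq by simp
    then have "\<gamma> i x = \<gamma>' i \<one>" using pi ne by (simp add: v_def)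
    also have "\<dots> = \<gamma> i \<one>" using A_one g i by metis
    finally have "x = \<one>" using g i bij_A by (metis bij_is_inj injD)
    then show False using x by simp
  qed
  have "\<pi> i = \<pi>' i" for i
    using p' p by (cases "i < n") (auto simp: permutes_def)
  then show pp: "\<pi> = \<pi>'" by auto
  show "\<gamma> i = \<gamma>' i" if i: "i < n"
  proof (rule ext)
    fix y
    show "\<gamma> i y = \<gamma>' i y"
    proof (cases "y \<in> carrier G")
      case True
      define v where "v = (\<lambda>j\<in>{..<n}. y)"
      have v: "v \<in> carrier Gn" using True by (auto simp: v_def)
      have "\<gamma> i (v (\<pi> i)) = \<gamma>' i (v (\<pi>' i))" using W_apply[OF v i, of \<gamma> \<pi>] W_apply[OF v i, of \<gamma>' \<pi>'] eq by simp
      then show ?thesis using permutes_less[OF p(1) i] pp by (simp add: v_def)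
    next
      case False then show ?thesis using outside g i by metis
    qed
  qed
qed

text \<open>The permutation is determined by a, the automorphisms \<open>gam a i\<close> only for i
  < n.\<close>

definition "wdec a = (SOME z. (\<forall>i<n. fst z i \<in> A) \<and> snd z permutes {..<n} \<and> a = W (fst z) (snd z))"
definition "gam a = fst (wdec a)"
definition "per a = snd (wdec a)"

lemma wdec:
  assumes "a \<in> An"
  shows "i < n \<Longrightarrow> gam a i \<in> A" "per a permutes {..<n}" "a = W (gam a) (per a)"
proof -
  obtain \<gamma> \<pi> where "(\<forall>i<n. \<gamma> i \<in> A) \<and> \<pi> permutes {..<n} \<and> a = W \<gamma> \<pi>" using assms by (auto simp: wreath_aut_eq)
  then have "\<exists>z. (\<forall>i<n. fst z i \<in> A) \<and> snd z permutes {..<n} \<and> a = W (fst z) (snd z)"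
    by (intro exI[of _ "(\<gamma>, \<pi>)"]) simp
  then have "(\<forall>i<n. gam a i \<in> A) \<and> per a permutes {..<n} \<and> a = W (gam a) (per a)"
    unfolding gam_def per_def wdec_def by (rule someI_ex)
  then show "i < n \<Longrightarrow> gam a i \<in> A" "per a permutes {..<n}" "a = W (gam a) (per a)" by blast+
qed

lemma W_An: "\<forall>i<n. \<gamma> i \<in> A \<Longrightarrow> \<pi> permutes {..<n} \<Longrightarrow> W \<gamma> \<pi> \<in> An"
  by (auto simp: wreath_aut_eq)

lemma wdec_W:
  assumes "\<forall>i<n. \<gamma> i \<in> A" "\<pi> permutes {..<n}"
  shows "per (W \<gamma> \<pi>) = \<pi>" "i < n \<Longrightarrow> gam (W \<gamma> \<pi>) i = \<gamma> i"
proof -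
  note w = wdec[OF W_An[OF assms]]
  have g: "\<forall>i<n. gam (W \<gamma> \<pi>) i \<in> A" using w(1) by blast
  show "per (W \<gamma> \<pi>) = \<pi>" "i < n \<Longrightarrow> gam (W \<gamma> \<pi>) i = \<gamma> i"
    using W_inject[OF g assms(1) w(2) assms(2) w(3)[symmetric]] by blast+
qed

lemma An_apply: "a \<in> An \<Longrightarrow> v \<in> carrier Gn \<Longrightarrow> i < n \<Longrightarrow> a v i = gam a i (v (per a i))"
  using wdec(3)[of a] W_apply by metis

lemma An_id: "id \<in> An" "per id = id" "i < n \<Longrightarrow> gam id i = id"
  using W_An[of "\<lambda>_. id" id] wdec_W[of "\<lambda>_. id" id] id_A permutes_id by (auto simp: W_id)

lemma An_comp:
  assumes a: "a \<in> An" and b: "b \<in> An"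
  shows "a \<circ> b \<in> An" "per (a \<circ> b) = per b \<circ> per a" "i < n \<Longrightarrow> gam (a \<circ> b) i = gam a i \<circ> gam b (per a i)"
proof -
  note A = wdec[OF a] and B = wdec[OF b]
  have gb: "\<forall>i<n. gam b i \<in> A" using B by blast
  have c: "a \<circ> b = W (\<lambda>i. gam a i \<circ> gam b (per a i)) (per b \<circ> per a)"
    using W_comp[OF gb A(2) B(2), of "gam a"] A(3) B(3) by simp
  have g: "\<forall>i<n. gam a i \<circ> gam b (per a i) \<in> A" using A(1) B(1) permutes_less[OF A(2)] comp_A by blast
  have p: "per b \<circ> per a permutes {..<n}" using permutes_compose[OF A(2) B(2)] .
  show "a \<circ> b \<in> An" "per (a \<circ> b) = per b \<circ> per a" "i < n \<Longrightarrow> gam (a \<circ> b) i = gam a i \<circ> gam b (per a i)"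
    unfolding c using W_An[OF g p] wdec_W[OF g p] by auto
qed

lemma An_inv:
  assumes a: "a \<in> An"
  shows "inv_into UNIV a \<in> An" "per (inv_into UNIV a) = inv_into UNIV (per a)"
    "i < n \<Longrightarrow> gam (inv_into UNIV a) i = ainv (gam a (inv_into UNIV (per a) i))" "bij a"
proof -
  note A = wdec[OF a]
  let ?p = "inv_into UNIV (per a)" and ?g = "\<lambda>i. ainv (gam a (inv_into UNIV (per a) i))"
  have p: "?p permutes {..<n}" by (rule permutes_inv[OF A(2)])
  have g: "\<forall>i<n. ?g i \<in> A" using A(1) permutes_less[OF p] inv_A by blast
  have ga: "\<forall>i<n. gam a i \<in> A" using A by blast
  note pinv = permutes_inverses[OF A(2)]
  have "W (gam a) (per a) \<circ> W ?g ?p = W (\<lambda>i. gam a i \<circ> ?g (per a i)) (?p \<circ> per a)" by (rule W_comp[OF g A(2) p])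
  also have "?p \<circ> per a = id" using pinv by auto
  also have "W (\<lambda>i. gam a i \<circ> ?g (per a i)) id = W (\<lambda>_. id) id" using ga pinv by (intro W_cong) simp
  finally have 1: "a \<circ> W ?g ?p = id" unfolding W_id A(3)[symmetric] .
  have "W ?g ?p \<circ> W (gam a) (per a) = W (\<lambda>i. ?g i \<circ> gam a (?p i)) (per a \<circ> ?p)" by (rule W_comp[OF ga p A(2)])
  also have "per a \<circ> ?p = id" using pinv by auto
  also have "W (\<lambda>i. ?g i \<circ> gam a (?p i)) id = W (\<lambda>_. id) id" using ga permutes_less[OF p] by (intro W_cong) simp
  finally have 2: "W ?g ?p \<circ> a = id" unfolding W_id A(3)[symmetric] .
  have i: "inv_into UNIV a = W ?g ?p" by (rule inv_unique_comp[OF 1 2])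
  show "inv_into UNIV a \<in> An" "per (inv_into UNIV a) = ?p" "i < n \<Longrightarrow> gam (inv_into UNIV a) i = ?g i"
    unfolding i using W_An[OF g p] wdec_W[OF g p] by auto
  show "bij a" using 1 2 by (rule o_bij[rotated])
qed

lemma An_stable:
  assumes K: "\<forall>a\<in>A. \<forall>x\<in>K. a x \<in> K" "K \<subseteq> carrier G"
  shows "\<forall>a\<in>An. \<forall>v\<in>(\<Pi>\<^sub>E i\<in>{..<n}. K). a v \<in> (\<Pi>\<^sub>E i\<in>{..<n}. K)"
  using W_PiE[OF K] by (auto simp: wreath_aut_eq simp del: PiE_iff)

lemma An_group: "aut_group Gn An"
proof (intro aut_group.intro aut_group_axioms.intro group_dpow finite_dpow[OF finite_G] An_id(1))
  fix a assume a: "a \<in> An"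
  show "inv_into UNIV a \<in> An" "bij a" using An_inv[OF a] by auto
  have st: "v \<in> carrier Gn \<Longrightarrow> a v \<in> carrier Gn" for v using An_stable[OF A_stable subset_refl] a by auto
  show "a \<in> hom Gn Gn"
  proof (rule homI)
    fix v w assume vw: "v \<in> carrier Gn" "w \<in> carrier Gn"
    interpret D: group Gn by (rule group_dpow)
    have m: "v \<otimes>\<^bsub>Gn\<^esub> w \<in> carrier Gn" using vw by (rule D.m_closed)
    show "a (v \<otimes>\<^bsub>Gn\<^esub> w) = a v \<otimes>\<^bsub>Gn\<^esub> a w"
    proof (rule PiE_ext)
      show "a (v \<otimes>\<^bsub>Gn\<^esub> w) \<in> (\<Pi>\<^sub>E i\<in>{..<n}. carrier G)" using st[OF m] by simp
      show "a v \<otimes>\<^bsub>Gn\<^esub> a w \<in> (\<Pi>\<^sub>E i\<in>{..<n}. carrier G)" using D.m_closed[OF st[OF vw(1)] st[OF vw(2)]] by simp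
      fix i assume "i \<in> {..<n}"
      then have i: "i < n" by simp
      then have pi: "per a i < n" using permutes_less[OF wdec(2)[OF a]] by blast
      have "v (per a i) \<in> carrier G" "w (per a i) \<in> carrier G" using vw pi by auto
      then show "a (v \<otimes>\<^bsub>Gn\<^esub> w) i = (a v \<otimes>\<^bsub>Gn\<^esub> a w) i"
        using An_apply[OF a m i] An_apply[OF a vw(1) i] An_apply[OF a vw(2) i] i pi A_mult[OF wdec(1)[OF a i]] by simp
    qed
  qed (rule st)
  fix b assume "b \<in> An"
  then show "a \<circ> b \<in> An" using An_comp[OF a] by blast
qed

text \<open>The factor \<open>\<chi> i\<close> is evaluated at coordinate \<open>per a i\<close>.
  Seen from coordinate j, it is the factor at the preimage of j that appears, twisted by the
  automorphism sitting there. Values in \<open>Qab\<close> let \<sigma> pass through the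
  product.\<close>

lemma twist_prod_char:
  assumes K: "\<forall>a\<in>A. \<forall>x\<in>K. a x \<in> K" "K \<subseteq> carrier G" and \<chi>: "\<forall>i<n. \<forall>x\<in>K. \<chi> i x \<in> Qab" and s: "galois_ab \<sigma>" and a: "a \<in> An"
  shows "aut_twist (\<Pi>\<^sub>E i\<in>{..<n}. K) (prod_char K n \<chi>) a \<sigma> =
     prod_char K n (\<lambda>j. aut_twist K (\<chi> (inv_into UNIV (per a) j)) (gam a (inv_into UNIV (per a) j)) \<sigma>)"
proof (rule ext)
  fix v
  let ?p = "inv_into UNIV (per a)"
  note A = wdec[OF a]
  have p: "?p permutes {..<n}" by (rule permutes_inv[OF A(2)])
  show "aut_twist (\<Pi>\<^sub>E i\<in>{..<n}. K) (prod_char K n \<chi>) a \<sigma> v =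
     prod_char K n (\<lambda>j. aut_twist K (\<chi> (?p j)) (gam a (?p j)) \<sigma>) v"
  proof (cases "v \<in> (\<Pi>\<^sub>E i\<in>{..<n}. K)")
    case True
    then have vG: "v \<in> carrier Gn" using K(2) by (auto simp: PiE_def Pi_def)
    have av: "a v \<in> (\<Pi>\<^sub>E i\<in>{..<n}. K)" using An_stable[OF K] a True by blast
    have vi: "v i \<in> K" if "i < n" for i using True that by auto
    have q: "\<chi> i (gam a i (v (per a i))) \<in> Qab" if "i < n" for i
      using \<chi> that K(1) A(1)[OF that] vi[OF permutes_less[OF A(2) that]] by blast
    have "aut_twist (\<Pi>\<^sub>E i\<in>{..<n}. K) (prod_char K n \<chi>) a \<sigma> v = \<sigma> (\<Prod>i<n. \<chi> i (gam a i (v (per a i))))"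
      using True av An_apply[OF a vG] by (simp add: aut_twist_def prod_char_def del: PiE_iff)
    also have "\<dots> = (\<Prod>i<n. \<sigma> (\<chi> i (gam a i (v (per a i)))))" using q by (intro galois_ab_prod[OF s]) auto
    also have "\<dots> = (\<Prod>j<n. \<sigma> (\<chi> (?p j) (gam a (?p j) (v j))))"
      by (subst prod.permute[OF p]) (simp add: comp_def permutes_inverses[OF A(2)])
    also have "\<dots> = prod_char K n (\<lambda>j. aut_twist K (\<chi> (?p j)) (gam a (?p j)) \<sigma>) v"
      using True vi by (simp add: prod_char_def aut_twist_def del: PiE_iff)
    finally show ?thesis .
  qed (simp add: aut_twist_def prod_char_def)
qed

end

section \<open>The map on characters of direct powers\<close>

locale igm_wreath = igm_pair G A N p \<Omega> + wreath G A n
  for G (structure) and A N p \<Omega> n +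
  assumes prime_p: "Factorial_Ring.prime p"
begin

lemma NG: "N \<subseteq> carrier G" using N by (rule subgroup.subset)

lemma Nst: "\<forall>a\<in>A. \<forall>x\<in>N. a x \<in> N" using stN by blast

abbreviation "Nn \<equiv> \<Pi>\<^sub>E i\<in>{..<n}. N"
abbreviation "Dn \<equiv> Irr_p' p Gn"

lemma group_N: "group (G\<lparr>carrier := N\<rparr>)"
  by (rule subgroup.subgroup_is_group[OF N is_group])

lemma finite_N: "finite (carrier (G\<lparr>carrier := N\<rparr>))"
  using finite_subset[OF NG finite_G] by simp

lemma \<Omega>_mem: "\<theta> \<in> D \<Longrightarrow> \<Omega> \<theta> \<in> Irr_p' p (G\<lparr>carrier := N\<rparr>)"
  using bij_betwE[OF bij] by blast

lemma \<Omega>_Qab: assumes \<theta>: "\<theta> \<in> D" and x: "x \<in> N" shows "\<Omega> \<theta> x \<in> Qab"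
proof -
  obtain e Q e' Q' fac where "bundle_half N \<Omega> e' Q' fac" using bundle_exists by blast
  note b = bundle_halfD[OF this \<theta>]
  have Q: "Q' \<theta> (x, id) \<in> carrier_mat (e' \<theta>) (e' \<theta>)" "mat_Qab (Q' \<theta> (x, id))" using b(2,3) x id_A by auto
  have "\<Omega> \<theta> x = mat_trace (Q' \<theta> (x, id))" using b(8)[OF x] by simp
  also have "\<dots> = (\<Sum>i<e' \<theta>. Q' \<theta> (x, id) $$ (i, i))" by (rule mat_trace_eq[OF Q(1)])
  also have "\<dots> \<in> Qab" using Q by (intro Qab_sum) (auto simp: mat_Qab_def)
  finally show ?thesis .
qed

lemma Dn_cases:
  assumes "\<chi> \<in> Dn"
  obtains \<theta> where "\<forall>i<n. \<theta> i \<in> D" "\<chi> = prod_char (carrier G) n \<theta>"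
  using Irr_p'_dpow[OF finite_G prime_p assms] by blast

lemma prod_char_Dn: "\<forall>i<n. \<theta> i \<in> D \<Longrightarrow> prod_char (carrier G) n \<theta> \<in> Dn"
  using prod_char_Irr_p'[OF finite_G prime_p, of n \<theta>] D_Irr by blast

lemma prod_char_D_inj:
  assumes "\<forall>i<n. \<theta> i \<in> D" "\<forall>i<n. \<phi> i \<in> D" "prod_char (carrier G) n \<theta> = prod_char (carrier G) n \<phi>" "i < n"
  shows "\<theta> i = \<phi> i"
  using prod_char_inj[OF finite_G _ _ assms(3,4)] assms(1,2) D_Irr by blast

definition "char_factors \<chi> = (SOME \<theta>. (\<forall>i<n. \<theta> i \<in> D) \<and> \<chi> = prod_char (carrier G) n \<theta>)"
definition "\<Omega>n \<chi> = prod_char N n (\<lambda>i. \<Omega> (char_factors \<chi> i))"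

text \<open>Uniqueness of the factorisation identifies the chosen factors with the given
  ones.\<close>

lemma \<Omega>n_prod:
  assumes \<theta>: "\<forall>i<n. \<theta> i \<in> D"
  shows "\<Omega>n (prod_char (carrier G) n \<theta>) = prod_char N n (\<lambda>i. \<Omega> (\<theta> i))"
proof -
  let ?\<phi> = "char_factors (prod_char (carrier G) n \<theta>)"
  have f: "(\<forall>i<n. ?\<phi> i \<in> D) \<and> prod_char (carrier G) n \<theta> = prod_char (carrier G) n ?\<phi>"
    unfolding char_factors_def by (rule someI[of _ \<theta>]) (simp add: \<theta>)
  have "?\<phi> i = \<theta> i" if "i < n" for i using prod_char_D_inj[of \<theta> ?\<phi> i] f \<theta> that by simp
  then show ?thesis unfolding \<Omega>n_def by (intro prod_char_cong) simp
qed

text \<open>On either side the characters of p'-degree are exactly the products of such characters,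
  with unique factors, so bijectivity can be checked factor by factor.\<close>

lemma \<Omega>n_bij: "bij_betw \<Omega>n Dn (Irr_p' p (Gn\<lparr>carrier := Nn\<rparr>))"
  unfolding dpow_restrict bij_betw_def
proof (intro conjI)
  interpret GN: group "G\<lparr>carrier := N\<rparr>" by (rule group_N)
  have I: "\<Omega> \<theta> \<in> Irr (G\<lparr>carrier := N\<rparr>)" if "\<theta> \<in> D" for \<theta> using \<Omega>_Irr[OF that] .
  have inj: "inj_on \<Omega> D" using bij by (simp add: bij_betw_def)
  show "inj_on \<Omega>n Dn"
  proof (rule inj_onI)
    fix \<chi> \<chi>' assume c: "\<chi> \<in> Dn" "\<chi>' \<in> Dn" and eq: "\<Omega>n \<chi> = \<Omega>n \<chi>'"
    obtain \<theta> where t: "\<forall>i<n. \<theta> i \<in> D" "\<chi> = prod_char (carrier G) n \<theta>" using c(1) by (rule Dn_cases)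
    obtain \<phi> where f: "\<forall>i<n. \<phi> i \<in> D" "\<chi>' = prod_char (carrier G) n \<phi>" using c(2) by (rule Dn_cases)
    have e: "prod_char (carrier (G\<lparr>carrier := N\<rparr>)) n (\<lambda>i. \<Omega> (\<theta> i)) = prod_char (carrier (G\<lparr>carrier := N\<rparr>)) n (\<lambda>i. \<Omega> (\<phi> i))"
      using eq \<Omega>n_prod t f by simp
    have "\<Omega> (\<theta> i) = \<Omega> (\<phi> i)" if "i < n" for i
      using GN.prod_char_inj[OF finite_N _ _ e that] I t f by blast
    then have "\<theta> i = \<phi> i" if "i < n" for i using inj t f that by (auto simp: inj_on_def)
    then show "\<chi> = \<chi>'" unfolding t(2) f(2) by (rule prod_char_cong)
  qed
  show "\<Omega>n ` Dn = Irr_p' p (dpow (G\<lparr>carrier := N\<rparr>) n)"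
  proof (intro equalityI subsetI)
    fix \<psi> assume "\<psi> \<in> \<Omega>n ` Dn"
    then obtain \<chi> where c: "\<chi> \<in> Dn" "\<psi> = \<Omega>n \<chi>" by blast
    obtain \<theta> where t0: "\<forall>i<n. \<theta> i \<in> D" "\<chi> = prod_char (carrier G) n \<theta>" using c(1) by (rule Dn_cases)
    then have t: "\<forall>i<n. \<theta> i \<in> D" "\<psi> = \<Omega>n (prod_char (carrier G) n \<theta>)" using c by simp_all
    have "\<psi> = prod_char (carrier (G\<lparr>carrier := N\<rparr>)) n (\<lambda>i. \<Omega> (\<theta> i))" using \<Omega>n_prod t by simp
    then show "\<psi> \<in> Irr_p' p (dpow (G\<lparr>carrier := N\<rparr>) n)"
      using GN.prod_char_Irr_p'[OF finite_N prime_p, of n "\<lambda>i. \<Omega> (\<theta> i)"] \<Omega>_mem \<Omega>_Irr t(1) by simp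
  next
    fix \<psi> assume psi: "\<psi> \<in> Irr_p' p (dpow (G\<lparr>carrier := N\<rparr>) n)"
    obtain \<phi> where f0: "\<forall>i<n. \<phi> i \<in> Irr_p' p (G\<lparr>carrier := N\<rparr>)" "\<psi> = prod_char (carrier (G\<lparr>carrier := N\<rparr>)) n \<phi>"
      using GN.Irr_p'_dpow[OF finite_N prime_p psi] by blast
    then have f: "\<forall>i<n. \<phi> i \<in> Irr_p' p (G\<lparr>carrier := N\<rparr>)" "\<psi> = prod_char N n \<phi>" by simp_all
    have "\<forall>i. \<exists>\<theta>. i < n \<longrightarrow> \<theta> \<in> D \<and> \<phi> i = \<Omega> \<theta>" using f(1) bij unfolding bij_betw_def by blast
    then obtain \<theta> where t: "\<forall>i<n. \<theta> i \<in> D \<and> \<phi> i = \<Omega> (\<theta> i)" by metis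
    have "\<psi> = prod_char N n (\<lambda>i. \<Omega> (\<theta> i))" unfolding f(2) using t by (intro prod_char_cong) simp
    also have "\<dots> = \<Omega>n (prod_char (carrier G) n \<theta>)" using \<Omega>n_prod t by simp
    finally show "\<psi> \<in> \<Omega>n ` Dn" using prod_char_Dn t by blast
  qed
qed

lemma twist_Dn:
  assumes \<theta>: "\<forall>i<n. \<theta> i \<in> D" and a: "a \<in> An" and s: "Hgal p \<sigma>"
  defines "\<phi> \<equiv> \<lambda>j. tw (\<theta> (inv_into UNIV (per a) j)) (gam a (inv_into UNIV (per a) j)) \<sigma>"
  shows "aut_twist (carrier Gn) (prod_char (carrier G) n \<theta>) a \<sigma> = prod_char (carrier G) n \<phi>" "\<forall>i<n. \<phi> i \<in> D"
    "aut_twist Nn (prod_char N n (\<lambda>i. \<Omega> (\<theta> i))) a \<sigma> = prod_char N n (\<lambda>i. \<Omega> (\<phi> i))"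
proof -
  have g: "galois_ab \<sigma>" using s by (rule Hgal_galois)
  have p: "inv_into UNIV (per a) permutes {..<n}" by (rule permutes_inv[OF wdec(2)[OF a]])
  have q: "\<forall>i<n. \<forall>x\<in>carrier G. \<theta> i x \<in> Qab" "\<forall>i<n. \<forall>x\<in>N. \<Omega> (\<theta> i) x \<in> Qab" using \<theta> D_Qab \<Omega>_Qab by blast+
  show "aut_twist (carrier Gn) (prod_char (carrier G) n \<theta>) a \<sigma> = prod_char (carrier G) n \<phi>"
    unfolding \<phi>_def dpow_carrier by (rule twist_prod_char[OF A_stable subset_refl q(1) g a])
  show "\<forall>i<n. \<phi> i \<in> D" unfolding \<phi>_def using D_twist \<theta> wdec(1)[OF a] permutes_less[OF p] s by blast
  have "aut_twist Nn (prod_char N n (\<lambda>i. \<Omega> (\<theta> i))) a \<sigma> =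
    prod_char N n (\<lambda>j. aut_twist N (\<Omega> (\<theta> (inv_into UNIV (per a) j))) (gam a (inv_into UNIV (per a) j)) \<sigma>)"
    by (rule twist_prod_char[OF Nst NG q(2) g a])
  also have "\<dots> = prod_char N n (\<lambda>i. \<Omega> (\<phi> i))"
    unfolding \<phi>_def using \<theta> permutes_less[OF p] wdec(1)[OF a] s by (intro prod_char_cong \<Omega>_twist[symmetric]) auto
  finally show "aut_twist Nn (prod_char N n (\<lambda>i. \<Omega> (\<theta> i))) a \<sigma> = prod_char N n (\<lambda>i. \<Omega> (\<phi> i))" .
qed

lemma twist_Dn_mem: "\<chi> \<in> Dn \<Longrightarrow> a \<in> An \<Longrightarrow> Hgal p \<sigma> \<Longrightarrow> aut_twist (carrier Gn) \<chi> a \<sigma> \<in> Dn"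
proof -
  assume a: "\<chi> \<in> Dn" "a \<in> An" "Hgal p \<sigma>"
  obtain \<theta> where t: "\<forall>i<n. \<theta> i \<in> D" "\<chi> = prod_char (carrier G) n \<theta>" using a(1) by (rule Dn_cases)
  show "aut_twist (carrier Gn) \<chi> a \<sigma> \<in> Dn"
    unfolding t(2) twist_Dn(1)[OF t(1) a(2,3)] by (rule prod_char_Dn[OF twist_Dn(2)[OF t(1) a(2,3)]])
qed

lemma \<Omega>n_twist: assumes "\<chi> \<in> Dn" "a \<in> An" "Hgal p \<sigma>" shows "\<Omega>n (aut_twist (carrier Gn) \<chi> a \<sigma>) = aut_twist Nn (\<Omega>n \<chi>) a \<sigma>"
proof -
  obtain \<theta> where t: "\<forall>i<n. \<theta> i \<in> D" "\<chi> = prod_char (carrier G) n \<theta>" using assms(1) by (rule Dn_cases)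
  show ?thesis unfolding t(2) twist_Dn(1)[OF t(1) assms(2,3)] \<Omega>n_prod[OF t(1)] twist_Dn(3)[OF t(1) assms(2,3)]
    by (rule \<Omega>n_prod[OF twist_Dn(2)[OF t(1) assms(2,3)]])
qed

text \<open>Both sides of \<open>fixed\<close> are products, and comparing their unique factors in
  slot \<open>per a i\<close> gives the claim. Thus \<open>gam a i\<close> together with \<sigma>
  leads from the character in slot i to the one in slot \<open>per a i\<close>, which matches the
  way \<open>tens\<close> connects its slots.\<close>

lemma fixed_components:
  assumes \<theta>: "\<forall>i<n. \<theta> i \<in> D" and a: "a \<in> An" and s: "Hgal p \<sigma>"
    and fixed: "aut_twist (carrier Gn) (prod_char (carrier G) n \<theta>) a \<sigma> = prod_char (carrier G) n \<theta>" and i: "i < n"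
  shows "\<theta> (per a i) = tw (\<theta> i) (gam a i) \<sigma>"
proof -
  have pi: "per a i < n" by (rule permutes_less[OF wdec(2)[OF a] i])
  show ?thesis
    using prod_char_D_inj[OF \<theta> twist_Dn(2)[OF \<theta> a s] _ pi] fixed twist_Dn(1)[OF \<theta> a s] permutes_inverses[OF wdec(2)[OF a]] by simp
qed

abbreviation "AOn \<chi> \<equiv> aut_stab_orbit p (carrier Gn) An \<chi>"

lemma Gn_N: "subgroup Nn Gn"
  unfolding dpow_def using PiE_subgroup_product_group[of "{..<n}" "\<lambda>_. G" "\<lambda>_. N"] N is_group by simp

lemma stable_pair_n:
  assumes \<chi>: "\<chi> \<in> Dn" shows "stable_pair Gn (AOn \<chi>) Nn \<chi> (\<Omega>n \<chi>) p"
proof -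
  interpret W: aut_group Gn An by (rule An_group)
  have sub: "AOn \<chi> \<subseteq> An" by (auto simp: aut_stab_orbit_def)
  have I: "\<chi> \<in> Irr Gn" using \<chi> by (simp add: Irr_p'_def)
  have O: "\<Omega>n \<chi> \<in> Irr (Gn\<lparr>carrier := Nn\<rparr>)" using bij_betwE[OF \<Omega>n_bij] \<chi> by (auto simp: Irr_p'_def)
  have out: "x \<notin> carrier Gn \<Longrightarrow> \<chi> x = 0" for x by (rule W.Irr_outside[OF I])
  show ?thesis
  proof (intro stable_pair.intro stable_pair_axioms.intro Gn_N I O)
    show "aut_group Gn (AOn \<chi>)" by (rule W.orbit_stabilizer_aut_group[OF out W.A_stable])
    show "a \<in> AOn \<chi> \<Longrightarrow> x \<in> Nn \<Longrightarrow> a x \<in> Nn" for a x using An_stable[OF Nst NG] sub by blast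
    show "a \<in> AOn \<chi> \<Longrightarrow> aut_twist (carrier Gn) \<chi> a id \<in> H_orbit p (carrier Gn) \<chi>" for a by (simp only: aut_stab_orbit_def mem_Collect_eq)
    fix a \<sigma> assume a: "a \<in> AOn \<chi>" and s: "Hgal p \<sigma>"
    then have aA: "a \<in> An" using sub by blast
    have "aut_twist (carrier Gn) \<chi> a \<sigma> = \<chi> \<longleftrightarrow> \<Omega>n (aut_twist (carrier Gn) \<chi> a \<sigma>) = \<Omega>n \<chi>"
      using inj_on_eq_iff[OF bij_betw_imp_inj_on[OF \<Omega>n_bij] twist_Dn_mem[OF \<chi> aA s] \<chi>] by simp
    then show "aut_twist (carrier Gn) \<chi> a \<sigma> = \<chi> \<longleftrightarrow> aut_twist Nn (\<Omega>n \<chi>) a \<sigma> = \<Omega>n \<chi>" using \<Omega>n_twist[OF \<chi> aA s] by simp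
  qed
qed

text \<open>Slot i contributes the matrix of the arrow \<open>gam a i\<close>, which starts at
  \<open>\<theta> i\<close> and, for a in the stabiliser, ends at
  \<open>\<theta> (per a i)\<close>.\<close>

definition "tens_rep \<theta> e Q = (\<lambda>(v, a). tens n (\<lambda>i. e (\<theta> i)) (\<lambda>i. Q (\<theta> i) (v i, gam a i)) (per a))"
definition "tens_fac \<theta> fac = (\<lambda>(v, a) (w, b). (\<Prod>i<n. fac (\<theta> i) (v i, gam a i) (w (per a i), gam b (per a i))) :: complex)"

end

section \<open>Tensor products of projective representations\<close>

context igm_wreath
begin

text \<open>By \<open>fixed_components\<close> the arrows met in successive slots are composable, so
  the relations of the groupoid hold slotwise and \<open>tens_mult\<close> puts them together. Since
  \<chi> and \<open>K\<close> are parameters, the lemma serves for the powers of G and of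
  \<open>N\<close> with the same factor set.\<close>

lemma tens_half:
  assumes \<theta>: "\<forall>i<n. \<theta> i \<in> D" and h: "bundle_half K \<chi> e Q fac" and K: "subgroup K G" "\<forall>a\<in>A. \<forall>x\<in>K. a x \<in> K"
  defines "Kn \<equiv> \<Pi>\<^sub>E i\<in>{..<n}. K" and "\<Theta> \<equiv> prod_char (carrier G) n \<theta>"
  defines "B \<equiv> {a \<in> AOn \<Theta>. aut_twist (carrier Gn) \<Theta> a id = \<Theta>}" and "d \<equiv> \<Prod>i<n. e (\<theta> i)"
  shows "proj_rep (sdp Gn (AOn \<Theta>)) (Kn \<times> B) d (tens_rep \<theta> e Q) (tens_fac \<theta> fac)"
    "assoc_with (sdp Gn (AOn \<Theta>)) (Kn \<times> {id}) (lift_char (prod_char K n (\<lambda>i. \<chi> (\<theta> i)))) (Kn \<times> B) (tens_rep \<theta> e Q)"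
    "entries_Qab (Kn \<times> B) d (tens_rep \<theta> e Q)"
    "x \<in> Kn \<times> B \<Longrightarrow> y \<in> Kn \<times> B \<Longrightarrow> root_of_unity (tens_fac \<theta> fac x y)"
proof -
  interpret S: stable_pair Gn "AOn \<Theta>" Nn \<Theta> "\<Omega>n \<Theta>" p
    unfolding \<Theta>_def by (rule stable_pair_n[OF prod_char_Dn[OF \<theta>]])
  have SB: "S.B = B" unfolding S.B_def B_def ..
  interpret B: aut_group Gn B using S.B(1) unfolding SB .
  have BA: "b \<in> An" and Bfix: "aut_twist (carrier Gn) \<Theta> b id = \<Theta>" and BO: "b \<in> AOn \<Theta>" if "b \<in> B" for b
    using that by (auto simp: B_def aut_stab_orbit_def)
  have comp: "\<theta> (per b i) = tw (\<theta> i) (gam b i) id" if "b \<in> B" "i < n" for b i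
    using fixed_components[OF \<theta> BA[OF that(1)] Hgal_id Bfix[OF that(1), unfolded \<Theta>_def] that(2)] .
  have KG: "K \<subseteq> carrier G" using K(1) by (rule subgroup.subset)
  have Kn: "Kn \<subseteq> carrier Gn" using KG by (auto simp: Kn_def PiE_def Pi_def)
  have ev: "v i \<in> K" if "v \<in> Kn" "i < n" for v i using that by (auto simp: Kn_def)
  have pl: "per b permutes {..<n}" "i < n \<Longrightarrow> per b i < n" "i < n \<Longrightarrow> gam b i \<in> A" if "b \<in> B" for b i
    using wdec[OF BA[OF that]] permutes_less by auto
  note bh = bundle_halfD[OF h]
  \<comment> \<open>Degrees are constant on orbits, so slots connected by the permutation have equal
    dimension.\<close>
  have ee: "e (\<theta> (per b i)) = e (\<theta> i)" if "b \<in> B" "i < n" for b i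
    unfolding comp[OF that] using bh(1) \<theta> that pl Hgal_id by blast
  have Qc: "Q (\<theta> i) (x, gam b i) \<in> carrier_mat (e (\<theta> i)) (e (\<theta> (per b i)))" "mat_Qab (Q (\<theta> i) (x, gam b i))"
    if "b \<in> B" "i < n" "x \<in> K" for b i x
    unfolding ee[OF that(1,2)] using bh(2,3)[of "\<theta> i" x "gam b i"] \<theta> that pl by blast+
  have tr: "tens_rep \<theta> e Q (v, b) = tens n (\<lambda>i. e (\<theta> i)) (\<lambda>i. Q (\<theta> i) (v i, gam b i)) (per b)" for v b
    by (simp add: tens_rep_def)
  have car: "tens_rep \<theta> e Q x \<in> carrier_mat d d" for x by (cases x) (simp add: tr d_def)
  have entr: "mat_Qab (tens_rep \<theta> e Q (v, b))" if "v \<in> Kn" "b \<in> B" for v b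
    unfolding tr using pl(1) Qc ev that by (intro mat_Qab_tens) auto
  have fr: "root_of_unity (fac (\<theta> i) (v i, gam a i) (w (per a i), gam b (per a i)))"
    if "v \<in> Kn" "w \<in> Kn" "a \<in> B" "b \<in> B" "i < n" for v w a b i
    by (rule bh(5)[OF \<theta>[rule_format, OF that(5)] ev[OF that(1,5)] ev[OF that(2) pl(2)[OF that(3,5)]] pl(3)[OF that(3,5)] pl(3)[OF that(4) pl(2)[OF that(3,5)]]])
  have root: "root_of_unity (tens_fac \<theta> fac (v, a) (w, b))" if "v \<in> Kn" "w \<in> Kn" "a \<in> B" "b \<in> B" for v w a b
    using fr[OF that] by (auto simp: tens_fac_def intro: root_of_unity_prod)
  then show "x \<in> Kn \<times> B \<Longrightarrow> y \<in> Kn \<times> B \<Longrightarrow> root_of_unity (tens_fac \<theta> fac x y)" by (cases x; cases y) auto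
  have prodt: "tens_rep \<theta> e Q (v, a) * tens_rep \<theta> e Q (w, b) =
     tens n (\<lambda>i. e (\<theta> i)) (\<lambda>i. Q (\<theta> i) (v i, gam a i) * Q (\<theta> (per a i)) (w (per a i), gam b (per a i))) (per b \<circ> per a)"
    if "v \<in> Kn" "w \<in> Kn" "a \<in> B" "b \<in> B" for v w a b
    unfolding tr using pl(1) Qc(1) ev that by (intro tens_mult) auto
  have awi: "(v \<otimes>\<^bsub>Gn\<^esub> a w) i = v i \<otimes> gam a i (w (per a i))" if "w \<in> Kn" "a \<in> B" "i < n" for v w a i
    using An_apply[OF BA[OF that(2)] subsetD[OF Kn that(1)] that(3)] that by simp
  have mult: "tens_rep \<theta> e Q (v, a) * tens_rep \<theta> e Q (w, b) =
     tens_fac \<theta> fac (v, a) (w, b) \<cdot>\<^sub>m tens_rep \<theta> e Q (v \<otimes>\<^bsub>Gn\<^esub> a w, a \<circ> b)"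
    if vw: "v \<in> Kn" "w \<in> Kn" and ab: "a \<in> B" "b \<in> B" for v w a b
  proof -
    note ac = An_comp[OF BA[OF ab(1)] BA[OF ab(2)]]
    have abB: "a \<circ> b \<in> B" using ab by (rule B.comp_A)
    let ?c = "\<lambda>i. fac (\<theta> i) (v i, gam a i) (w (per a i), gam b (per a i))"
    let ?R = "\<lambda>i. Q (\<theta> i) ((v \<otimes>\<^bsub>Gn\<^esub> a w) i, gam (a \<circ> b) i)"
    have m: "Q (\<theta> i) (v i, gam a i) * Q (\<theta> (per a i)) (w (per a i), gam b (per a i)) = ?c i \<cdot>\<^sub>m ?R i" if i: "i < n" for i
      unfolding comp[OF ab(1) i] awi[OF vw(2) ab(1) i] ac(3)[OF i]
      by (rule bh(4)[OF \<theta>[rule_format, OF i] ev[OF vw(1) i] ev[OF vw(2) pl(2)[OF ab(1) i]] pl(3)[OF ab(1) i] pl(3)[OF ab(2) pl(2)[OF ab(1) i]]])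
    have Rc: "?R i \<in> carrier_mat (e (\<theta> i)) (e (\<theta> ((per b \<circ> per a) i)))" if i: "i < n" for i
    proof -
      have "(v \<otimes>\<^bsub>Gn\<^esub> a w) i \<in> K" unfolding awi[OF vw(2) ab(1) i]
        using ev[OF vw(1) i] ev[OF vw(2) pl(2)[OF ab(1) i]] K(2) pl(3)[OF ab(1) i] subgroup.m_closed[OF K(1)] by blast
      from Qc(1)[OF abB i this] show ?thesis unfolding ac(2) .
    qed
    have "tens_rep \<theta> e Q (v, a) * tens_rep \<theta> e Q (w, b) = tens n (\<lambda>i. e (\<theta> i)) (\<lambda>i. ?c i \<cdot>\<^sub>m ?R i) (per b \<circ> per a)"
      unfolding prodt[OF vw ab] using m by (intro tens_cong) auto
    also have "\<dots> = (\<Prod>i<n. ?c i) \<cdot>\<^sub>m tens n (\<lambda>i. e (\<theta> i)) ?R (per b \<circ> per a)"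
      using Rc by (intro tens_smult permutes_compose pl ab) simp
    finally show ?thesis unfolding tr ac(2) by (simp add: tens_fac_def)
  qed
  have one: "tens_rep \<theta> e Q (\<one>\<^bsub>Gn\<^esub>, id) = 1\<^sub>m d"
  proof -
    have "tens_rep \<theta> e Q (\<one>\<^bsub>Gn\<^esub>, id) = tens n (\<lambda>i. e (\<theta> i)) (\<lambda>i. 1\<^sub>m (e (\<theta> i))) id"
      unfolding tr using An_id bh(9) \<theta> by (intro tens_cong) auto
    then show ?thesis by (simp only: tens_one d_def)
  qed
  have sK: "subgroup (Kn \<times> B) (sdp Gn (AOn \<Theta>))"
  proof (rule S.subgroup_sdp)
    show "subgroup Kn Gn" unfolding Kn_def dpow_def using PiE_subgroup_product_group[of "{..<n}" "\<lambda>_. G" "\<lambda>_. K"] K(1) is_group by simp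
    show "\<forall>a\<in>B. \<forall>x\<in>Kn. a x \<in> Kn" using An_stable[OF K(2) KG] BA unfolding Kn_def by blast
  qed (use BO B.id_A B.comp_A B.inv_A in auto)
  \<comment> \<open>Multiplying by the value at the inverse element gives a nonzero scalar
    matrix.\<close>
  have inv: "invertible_mat (tens_rep \<theta> e Q x)" if x: "x \<in> Kn \<times> B" for x
  proof -
    interpret SS: group "sdp Gn (AOn \<Theta>)" by (rule S.group_sdp)
    define y where "y = inv\<^bsub>sdp Gn (AOn \<Theta>)\<^esub> x"
    have y: "y \<in> Kn \<times> B" unfolding y_def by (rule subgroup.m_inv_closed[OF sK x])
    have xc: "x \<in> carrier (sdp Gn (AOn \<Theta>))" by (rule subgroup.mem_carrier[OF sK x])
    let ?c = "tens_fac \<theta> fac x y"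
    have c: "?c \<noteq> 0" using root x y root_of_unity_nonzero by (cases x; cases y) auto
    have xy: "x \<otimes>\<^bsub>sdp Gn (AOn \<Theta>)\<^esub> y = (\<one>\<^bsub>Gn\<^esub>, id)" unfolding y_def using SS.r_inv[OF xc] by (simp only: sdp_one)
    have "tens_rep \<theta> e Q x * tens_rep \<theta> e Q y = ?c \<cdot>\<^sub>m tens_rep \<theta> e Q (x \<otimes>\<^bsub>sdp Gn (AOn \<Theta>)\<^esub> y)"
      using mult x y by (cases x; cases y) (auto simp del: dpow_mult)
    then have m: "tens_rep \<theta> e Q x * tens_rep \<theta> e Q y = ?c \<cdot>\<^sub>m 1\<^sub>m d" unfolding xy one .
    have "tens_rep \<theta> e Q x * (inverse ?c \<cdot>\<^sub>m tens_rep \<theta> e Q y) = inverse ?c \<cdot>\<^sub>m (?c \<cdot>\<^sub>m 1\<^sub>m d)"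
      using mult_smult_distrib[OF car[of x] car[of y], of "inverse ?c"] m by simp
    also have "\<dots> = 1\<^sub>m d" using c by (intro eq_matI) auto
    finally have 1: "tens_rep \<theta> e Q x * (inverse ?c \<cdot>\<^sub>m tens_rep \<theta> e Q y) = 1\<^sub>m d" .
    have c2: "inverse ?c \<cdot>\<^sub>m tens_rep \<theta> e Q y \<in> carrier_mat d d" using car by simp
    show ?thesis by (rule invertible_matI[OF car c2 1 mat_mult_left_right_inverse[OF car c2 1]])
  qed
  show "proj_rep (sdp Gn (AOn \<Theta>)) (Kn \<times> B) d (tens_rep \<theta> e Q) (tens_fac \<theta> fac)"
    unfolding proj_rep_def
  proof (intro conjI ballI)
    fix x y assume "x \<in> Kn \<times> B" "y \<in> Kn \<times> B"
    then show "tens_rep \<theta> e Q x * tens_rep \<theta> e Q y = tens_fac \<theta> fac x y \<cdot>\<^sub>m tens_rep \<theta> e Q (x \<otimes>\<^bsub>sdp Gn (AOn \<Theta>)\<^esub> y)"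
      using mult by (cases x; cases y) (auto simp del: dpow_mult)
  qed (use car inv in auto)
  show "entries_Qab (Kn \<times> B) d (tens_rep \<theta> e Q)"
    unfolding entries_Qab_def
  proof (intro ballI allI impI)
    fix x i j assume x: "x \<in> Kn \<times> B" and ij: "i < d" "j < d"
    then have "mat_Qab (tens_rep \<theta> e Q x)" using entr by (cases x) auto
    then show "tens_rep \<theta> e Q x $$ (i, j) \<in> Qab" using ij carrier_matD[OF car[of x]] by (simp add: mat_Qab_def)
  qed
  have left: "tens_rep \<theta> e Q (v \<otimes>\<^bsub>Gn\<^esub> w, b) = tens_rep \<theta> e Q (v, id) * tens_rep \<theta> e Q (w, b)"
    and right: "tens_rep \<theta> e Q (w \<otimes>\<^bsub>Gn\<^esub> b v, b) = tens_rep \<theta> e Q (w, b) * tens_rep \<theta> e Q (v, id)"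
    if vw: "v \<in> Kn" "w \<in> Kn" and b: "b \<in> B" for v w b
  proof -
    have "tens_rep \<theta> e Q (v, id) * tens_rep \<theta> e Q (w, b) = tens n (\<lambda>i. e (\<theta> i)) (\<lambda>i. Q (\<theta> i) ((v \<otimes>\<^bsub>Gn\<^esub> w) i, gam b i)) (per b)"
      unfolding prodt[OF vw B.id_A b]
    proof (intro tens_cong)
      fix i assume i: "i < n"
      show "Q (\<theta> i) (v i, gam id i) * Q (\<theta> (per id i)) (w (per id i), gam b (per id i)) = Q (\<theta> i) ((v \<otimes>\<^bsub>Gn\<^esub> w) i, gam b i)"
        using bh(6)[of "\<theta> i" "v i" "w i" "gam b i"] \<theta> i ev[OF vw(1) i] ev[OF vw(2) i] pl(3)[OF b i] An_id by simp
    qed (simp add: An_id)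
    then show "tens_rep \<theta> e Q (v \<otimes>\<^bsub>Gn\<^esub> w, b) = tens_rep \<theta> e Q (v, id) * tens_rep \<theta> e Q (w, b)" unfolding tr by simp
    have "tens_rep \<theta> e Q (w, b) * tens_rep \<theta> e Q (v, id) = tens n (\<lambda>i. e (\<theta> i)) (\<lambda>i. Q (\<theta> i) ((w \<otimes>\<^bsub>Gn\<^esub> b v) i, gam b i)) (per b)"
      unfolding prodt[OF vw(2,1) b B.id_A]
    proof (intro tens_cong)
      fix i assume i: "i < n"
      show "Q (\<theta> i) (w i, gam b i) * Q (\<theta> (per b i)) (v (per b i), gam id (per b i)) = Q (\<theta> i) ((w \<otimes>\<^bsub>Gn\<^esub> b v) i, gam b i)"
        unfolding comp[OF b i] awi[OF vw(1) b i]
        using bh(7)[of "\<theta> i" "v (per b i)" "w i" "gam b i"] \<theta> i ev[OF vw(2) i] ev[OF vw(1) pl(2)[OF b i]] pl(2,3)[OF b i] An_id(3)[OF pl(2)[OF b i]] by simp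
    qed (simp add: An_id)
    then show "tens_rep \<theta> e Q (w \<otimes>\<^bsub>Gn\<^esub> b v, b) = tens_rep \<theta> e Q (w, b) * tens_rep \<theta> e Q (v, id)" unfolding tr by simp
  qed
  show "assoc_with (sdp Gn (AOn \<Theta>)) (Kn \<times> {id}) (lift_char (prod_char K n (\<lambda>i. \<chi> (\<theta> i)))) (Kn \<times> B) (tens_rep \<theta> e Q)"
    unfolding assoc_with_def
  proof (intro conjI ballI)
    fix x :: "(nat \<Rightarrow> 'a) \<times> ((nat \<Rightarrow> 'a) \<Rightarrow> nat \<Rightarrow> 'a)" assume "x \<in> Kn \<times> {id}"
    then obtain v where v: "x = (v, id)" "v \<in> Kn" by auto
    have "mat_trace (tens_rep \<theta> e Q x) = (\<Prod>i<n. mat_trace (Q (\<theta> i) (v i, id)))"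
    proof -
      have "tens_rep \<theta> e Q x = tens n (\<lambda>i. e (\<theta> i)) (\<lambda>i. Q (\<theta> i) (v i, id)) id"
        unfolding v(1) tr using An_id by (intro tens_cong) auto
      then show ?thesis using bh(2) \<theta> ev[OF v(2)] id_A by (simp only:) (intro tens_trace, auto)
    qed
    also have "\<dots> = (\<Prod>i<n. \<chi> (\<theta> i) (v i))" using bh(8) \<theta> ev[OF v(2)] by (intro prod.cong) auto
    also have "\<dots> = lift_char (prod_char K n (\<lambda>i. \<chi> (\<theta> i))) x" using v by (simp add: prod_char_def Kn_def del: PiE_iff)
    finally show "mat_trace (tens_rep \<theta> e Q x) = lift_char (prod_char K n (\<lambda>i. \<chi> (\<theta> i))) x" .
  next
    fix x y :: "(nat \<Rightarrow> 'a) \<times> ((nat \<Rightarrow> 'a) \<Rightarrow> nat \<Rightarrow> 'a)" assume "x \<in> Kn \<times> {id}" "y \<in> Kn \<times> {id}"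
    then show "tens_rep \<theta> e Q (x \<otimes>\<^bsub>sdp Gn (AOn \<Theta>)\<^esub> y) = tens_rep \<theta> e Q x * tens_rep \<theta> e Q y"
      using left B.id_A by (auto simp del: dpow_mult)
  next
    fix x y :: "(nat \<Rightarrow> 'a) \<times> ((nat \<Rightarrow> 'a) \<Rightarrow> nat \<Rightarrow> 'a)" assume "x \<in> Kn \<times> {id}" "y \<in> Kn \<times> B"
    then show "tens_rep \<theta> e Q (x \<otimes>\<^bsub>sdp Gn (AOn \<Theta>)\<^esub> y) = tens_rep \<theta> e Q x * tens_rep \<theta> e Q y"
      "tens_rep \<theta> e Q (y \<otimes>\<^bsub>sdp Gn (AOn \<Theta>)\<^esub> x) = tens_rep \<theta> e Q y * tens_rep \<theta> e Q x"
      using left right by (auto simp del: dpow_mult)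
  qed
qed

end

section \<open>Galois twists of tensor products and the centraliser\<close>

context igm_wreath
begin

text \<open>The image of i under the permutation of
  \<open>a \<circ> b \<circ> inv_into UNIV a\<close>; equivalently the slot that a sends to where b
  leads from \<open>per a i\<close>.\<close>

definition "back_index a b i = inv_into UNIV (per a) (per b (per a i))"
definition "tens_nu \<theta> \<nu> a b =
  (\<Prod>i<n. \<nu> (\<theta> i) (gam a i) (gam b (per a i)) (\<theta> (back_index a b i)) (gam a (back_index a b i)) :: complex)"

text \<open>In slot i, the conjugate of b by a consists of the arrow of a at i, the arrow of b, and
  the inverse of the arrow of a at \<open>back_index a b i\<close>. This is the shape described by
  \<open>bundle_twist\<close>, whose scalars multiply to \<open>tens_nu\<close>. As no matrices
  enter there, the result is the same for both groups.\<close>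

lemma tens_twist:
  assumes \<theta>: "\<forall>i<n. \<theta> i \<in> D" and h: "bundle_half K \<chi> e Q fac" and t: "bundle_twist K e Q \<sigma> \<nu> M Mi"
    and K: "subgroup K G" "\<forall>a\<in>A. \<forall>x\<in>K. a x \<in> K"
  defines "Kn \<equiv> \<Pi>\<^sub>E i\<in>{..<n}. K" and "\<Theta> \<equiv> prod_char (carrier G) n \<theta>"
  defines "B \<equiv> {a \<in> AOn \<Theta>. aut_twist (carrier Gn) \<Theta> a id = \<Theta>}" and "d \<equiv> \<Prod>i<n. e (\<theta> i)"
  assumes aO: "a \<in> AOn \<Theta>" and s: "Hgal p \<sigma>" and fixed: "aut_twist (carrier Gn) \<Theta> a \<sigma> = \<Theta>"
  defines "q \<equiv> inv_into UNIV (per a)"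
  shows "b \<in> B \<Longrightarrow> tens_nu \<theta> \<nu> a b \<noteq> 0"
    "galois_compat Kn B d (tens_rep \<theta> e Q) a \<sigma> (tens_nu \<theta> \<nu> a)
       (tens n (\<lambda>i. e (\<theta> i)) (\<lambda>k. M (\<theta> (q k)) (gam a (q k))) q)
       (tens n (\<lambda>i. e (\<theta> i)) (\<lambda>i. Mi (\<theta> i) (gam a i)) (per a))"
proof -
  interpret S: stable_pair Gn "AOn \<Theta>" Nn \<Theta> "\<Omega>n \<Theta>" p
    unfolding \<Theta>_def by (rule stable_pair_n[OF prod_char_Dn[OF \<theta>]])
  have SB: "S.B = B" unfolding S.B_def B_def ..
  let ?E = "\<lambda>i. e (\<theta> i)" and ?g = "gam a" and ?p = "per a"
  have sub: "AOn \<Theta> \<subseteq> An" by (auto simp: aut_stab_orbit_def)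
  have aA: "a \<in> An" using aO sub by blast
  have BA: "b \<in> An" and Bfix: "aut_twist (carrier Gn) \<Theta> b id = \<Theta>" if "b \<in> B" for b
    using that sub by (auto simp: B_def)
  have KG: "K \<subseteq> carrier G" using K(1) by (rule subgroup.subset)
  have Kn: "Kn \<subseteq> carrier Gn" using KG by (auto simp: Kn_def PiE_def Pi_def)
  have ev: "v i \<in> K" if "v \<in> Kn" "i < n" for v i using that by (auto simp: Kn_def)
  have \<theta>i: "\<theta> i \<in> D" if "i < n" for i using \<theta> that by blast
  note pp = wdec(2)[OF aA]
  have qp: "q permutes {..<n}" unfolding q_def by (rule permutes_inv[OF pp])
  have pq: "?p (q i) = i" "q (?p i) = i" for i unfolding q_def using permutes_inverses[OF pp] by auto
  have gA: "?g i \<in> A" if "i < n" for i by (rule wdec(1)[OF aA that])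
  have pl: "i < n \<Longrightarrow> ?p i < n" "i < n \<Longrightarrow> q i < n" for i using permutes_less[OF pp] permutes_less[OF qp] by auto
  have compa: "\<theta> (?p i) = tw (\<theta> i) (?g i) \<sigma>" if "i < n" for i
    by (rule fixed_components[OF \<theta> aA s fixed[unfolded \<Theta>_def] that])
  have compb: "\<theta> (per b i) = tw (\<theta> i) (gam b i) id" if "b \<in> B" "i < n" for b i
    by (rule fixed_components[OF \<theta> BA[OF that(1)] Hgal_id Bfix[OF that(1), unfolded \<Theta>_def] that(2)])
  have ea: "e (\<theta> (?p i)) = e (\<theta> i)" if "i < n" for i
    unfolding compa[OF that] by (rule bundle_halfD(1)[OF h \<theta>i gA s]) (rule that)+
  have eq: "e (\<theta> (q i)) = e (\<theta> i)" if "i < n" for i using ea[OF pl(2)[OF that]] pq by simp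
  have eb: "e (\<theta> (per b i)) = e (\<theta> i)" if "b \<in> B" "i < n" for b i
    unfolding compb[OF that] by (rule bundle_halfD(1)[OF h \<theta>i wdec(1)[OF BA] Hgal_id]) (rule that)+
  have Qc: "Q (\<theta> i) (x, gam b i) \<in> carrier_mat (e (\<theta> i)) (e (\<theta> (per b i)))" "mat_Qab (Q (\<theta> i) (x, gam b i))"
    if "b \<in> B" "i < n" "x \<in> K" for b i x
    unfolding eb[OF that(1,2)] by (rule bundle_halfD(2,3)[OF h \<theta>i _ wdec(1)[OF BA]], rule that, rule that, rule that, rule that)+
  note bt = bundle_twistD[OF t]
  \<comment> \<open>The base change of slot q k is placed in slot k and combined with q, since it
    has to invert the matrix leading from slot q k to slot k.\<close>
  define Mt where "Mt = (\<lambda>k. M (\<theta> (q k)) (?g (q k)))"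
  define Mit where "Mit = (\<lambda>i. Mi (\<theta> i) (?g i))"
  have Mc: "Mt k \<in> carrier_mat (?E k) (?E (q k))" "mat_Qab (Mt k)" if "k < n" for k
    using bt(1,5)[OF \<theta>i gA, OF pl(2) pl(2), OF that that] by (simp_all add: Mt_def eq[OF that])
  have Mic: "Mit k \<in> carrier_mat (?E k) (?E (?p k))" "mat_Qab (Mit k)" if "k < n" for k
    using bt(2,6)[OF \<theta>i gA, OF that that] by (simp_all add: Mit_def ea[OF that])
  have MMi: "Mt k * Mit (q k) = 1\<^sub>m (?E k)" if "k < n" for k
    using bt(3)[OF \<theta>i gA, OF pl(2) pl(2), OF that that] eq[OF that] by (simp add: Mt_def Mit_def)
  have MiM: "Mit k * Mt (?p k) = 1\<^sub>m (?E k)" if "k < n" for k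
    using bt(4)[OF \<theta>i gA, OF that that] by (simp add: Mt_def Mit_def pq)
  let ?TM = "tens n ?E Mt q" and ?TMi = "tens n ?E Mit ?p"
  have cond: "tw (tw (\<theta> i) (?g i) \<sigma>) (gam b (?p i)) id = tw (\<theta> (back_index a b i)) (?g (back_index a b i)) \<sigma>"
    and jl: "back_index a b i < n" if b: "b \<in> B" and i: "i < n" for b i
  proof -
    have r: "per b (?p i) < n" by (rule permutes_less[OF wdec(2)[OF BA[OF b]] pl(1)[OF i]])
    show j: "back_index a b i < n" unfolding back_index_def q_def[symmetric] by (rule pl(2)[OF r])
    have "?p (back_index a b i) = per b (?p i)" unfolding back_index_def q_def[symmetric] by (rule pq)
    then show "tw (tw (\<theta> i) (?g i) \<sigma>) (gam b (?p i)) id = tw (\<theta> (back_index a b i)) (?g (back_index a b i)) \<sigma>"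
      using compa[OF i] compa[OF j] compb[OF b pl(1)[OF i]] by simp
  qed
  have gbA: "gam b (?p i) \<in> A" if "b \<in> B" "i < n" for b i by (rule wdec(1)[OF BA[OF that(1)] pl(1)[OF that(2)]])
  have nz: "\<nu> (\<theta> i) (?g i) (gam b (?p i)) (\<theta> (back_index a b i)) (?g (back_index a b i)) \<noteq> 0" if "b \<in> B" "i < n" for b i
    by (rule bt(7)[OF \<theta>i[OF that(2)] \<theta>i[OF jl[OF that]] gA[OF that(2)] gA[OF jl[OF that]] gbA[OF that] cond[OF that]])
  then show "b \<in> B \<Longrightarrow> tens_nu \<theta> \<nu> a b \<noteq> 0" unfolding tens_nu_def by simp
  have main: "map_mat \<sigma> (tens_rep \<theta> e Q (a v, a \<circ> b \<circ> inv_into UNIV a)) = tens_nu \<theta> \<nu> a b \<cdot>\<^sub>m (?TMi * tens_rep \<theta> e Q (v, b) * ?TM)"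
    if v: "v \<in> Kn" and b: "b \<in> B" for v b
  proof -
    define c where "c = a \<circ> b \<circ> inv_into UNIV a"
    have c: "c \<in> B" unfolding c_def using S.B_conj[OF aO s fixed, of b] b unfolding SB by blast
    note ab = An_comp[OF aA BA[OF b]]
    note cc = An_comp[OF ab(1) An_inv(1)[OF aA], folded c_def]
    have pc: "per c = q \<circ> (per b \<circ> ?p)" unfolding cc(2) ab(2) An_inv(2)[OF aA] q_def ..
    have av: "a v \<in> Kn" using An_stable[OF K(2) KG] aA v unfolding Kn_def by blast
    have avi: "a v i = ?g i (v (?p i))" if "i < n" for i by (rule An_apply[OF aA subsetD[OF Kn v] that])
    have gc: "gam c i = ?g i \<circ> gam b (?p i) \<circ> ainv (?g (back_index a b i))" if i: "i < n" for i
    proof -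
      have "per (a \<circ> b) i < n" unfolding ab(2) using permutes_less[OF wdec(2)[OF BA[OF b]] pl(1)[OF i]] by simp
      from An_inv(3)[OF aA this] have "gam (inv_into UNIV a) (per (a \<circ> b) i) = ainv (?g (back_index a b i))"
        unfolding back_index_def ab(2) by simp
      then show ?thesis using cc(3)[OF i] ab(3)[OF i] by simp
    qed
    let ?\<nu> = "\<lambda>i. \<nu> (\<theta> i) (?g i) (gam b (?p i)) (\<theta> (back_index a b i)) (?g (back_index a b i))"
    let ?R = "\<lambda>i. Mit i * Q (\<theta> (?p i)) (v (?p i), gam b (?p i)) * Mt ((per b \<circ> ?p) i)"
    have vp: "v (?p i) \<in> K" if "i < n" for i by (rule ev[OF v pl(1)[OF that]])
    have "map_mat \<sigma> (tens_rep \<theta> e Q (a v, c)) = map_mat \<sigma> (tens n ?E (\<lambda>i. Q (\<theta> i) (a v i, gam c i)) (per c))"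
      by (simp add: tens_rep_def)
    also have "\<dots> = tens n ?E (\<lambda>i. map_mat \<sigma> (Q (\<theta> i) (a v i, gam c i))) (per c)"
      using Qc[OF c] ev[OF av] by (intro map_mat_tens Hgal_galois[OF s] wdec(2)[OF BA[OF c]]) auto
    also have "\<dots> = tens n ?E (\<lambda>i. ?\<nu> i \<cdot>\<^sub>m ?R i) (per c)"
    proof (intro tens_cong refl)
      fix i assume i: "i < n"
      have "map_mat \<sigma> (Q (\<theta> i) (?g i (v (?p i)), ?g i \<circ> gam b (?p i) \<circ> ainv (?g (back_index a b i)))) =
        ?\<nu> i \<cdot>\<^sub>m (Mi (\<theta> i) (?g i) * Q (tw (\<theta> i) (?g i) \<sigma>) (v (?p i), gam b (?p i)) * M (\<theta> (back_index a b i)) (?g (back_index a b i)))"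
        by (rule bt(8)[OF \<theta>i[OF i] \<theta>i[OF jl[OF b i]] gA[OF i] gA[OF jl[OF b i]] gbA[OF b i] cond[OF b i] vp[OF i]])
      then show "map_mat \<sigma> (Q (\<theta> i) (a v i, gam c i)) = ?\<nu> i \<cdot>\<^sub>m ?R i"
        unfolding avi[OF i] gc[OF i] compa[OF i] Mit_def Mt_def by (simp add: back_index_def q_def)
    qed
    also have "\<dots> = tens_nu \<theta> \<nu> a b \<cdot>\<^sub>m tens n ?E ?R (per c)"
      unfolding tens_nu_def
    proof (rule tens_smult[OF wdec(2)[OF BA[OF c]]])
      fix i assume i: "i < n"
      have "(per b \<circ> ?p) i < n" using permutes_less[OF wdec(2)[OF BA[OF b]] pl(1)[OF i]] by simp
      from Mc(1)[OF this] show "?R i \<in> carrier_mat (?E i) (?E (per c i))"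
        using Mic(1)[OF i] Qc(1)[OF b pl(1)[OF i] vp[OF i]] unfolding pc by auto
    qed
    also have "tens n ?E ?R (per c) = ?TMi * tens_rep \<theta> e Q (v, b) * ?TM"
    proof -
      have 1: "?TMi * tens_rep \<theta> e Q (v, b) = tens n ?E (\<lambda>i. Mit i * Q (\<theta> (?p i)) (v (?p i), gam b (?p i))) (per b \<circ> ?p)"
        unfolding tens_rep_def prod.case
        using pp wdec(2)[OF BA[OF b]] Mic(1) Qc(1)[OF b] ev[OF v] by (intro tens_mult) auto
      have "?TMi * tens_rep \<theta> e Q (v, b) * ?TM = tens n ?E ?R (q \<circ> (per b \<circ> ?p))"
        unfolding 1
      proof (intro tens_mult permutes_compose[OF pp wdec(2)[OF BA[OF b]]] qp)
        fix i assume i: "i < n"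
        show "Mt i \<in> carrier_mat (?E i) (?E (q i))" by (rule Mc(1)[OF i])
        show "Mit i * Q (\<theta> (?p i)) (v (?p i), gam b (?p i)) \<in> carrier_mat (?E i) (?E ((per b \<circ> ?p) i))"
          using Mic(1)[OF i] Qc(1)[OF b pl(1)[OF i] vp[OF i]] by auto
      qed
      then show ?thesis unfolding pc ..
    qed
    finally show ?thesis unfolding c_def .
  qed
  have inv1: "?TM * ?TMi = 1\<^sub>m d"
  proof -
    have "?TM * ?TMi = tens n ?E (\<lambda>k. Mt k * Mit (q k)) (?p \<circ> q)" using qp pp Mc(1) Mic(1) by (intro tens_mult) auto
    also have "\<dots> = tens n ?E (\<lambda>i. 1\<^sub>m (?E i)) id" using MMi pq by (intro tens_cong) auto
    finally show ?thesis unfolding tens_one d_def .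
  qed
  have inv2: "?TMi * ?TM = 1\<^sub>m d"
  proof -
    have "?TMi * ?TM = tens n ?E (\<lambda>k. Mit k * Mt (?p k)) (q \<circ> ?p)" using qp pp Mc(1) Mic(1) by (intro tens_mult) auto
    also have "\<dots> = tens n ?E (\<lambda>i. 1\<^sub>m (?E i)) id" using MiM pq by (intro tens_cong) auto
    finally show ?thesis unfolding tens_one d_def .
  qed
  have "galois_compat Kn B d (tens_rep \<theta> e Q) a \<sigma> (tens_nu \<theta> \<nu> a) ?TM ?TMi"
    unfolding galois_compat_def
  proof (intro conjI ballI inv1 inv2)
    show "?TM \<in> carrier_mat d d" "?TMi \<in> carrier_mat d d" unfolding d_def by (rule tens_carrier)+
    show "mat_Qab ?TM" using qp Mc by (intro mat_Qab_tens) auto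
    show "mat_Qab ?TMi" using pp Mic by (intro mat_Qab_tens) auto
  qed (rule main)
  then show "galois_compat Kn B d (tens_rep \<theta> e Q) a \<sigma> (tens_nu \<theta> \<nu> a)
       (tens n ?E (\<lambda>k. M (\<theta> (q k)) (gam a (q k))) q) (tens n ?E (\<lambda>i. Mi (\<theta> i) (gam a i)) (per a))"
    unfolding Mt_def Mit_def .
qed

text \<open>The assumption makes b an inner automorphism of the direct power. Such an automorphism
  cannot permute the coordinates of a nontrivial group, and what is left is the centralising
  condition in every slot.\<close>

lemma wreath_centralizer:
  assumes v: "v \<in> carrier Gn" and b: "b \<in> An" and c: "\<forall>w\<in>carrier Gn. v \<otimes>\<^bsub>Gn\<^esub> b w = w \<otimes>\<^bsub>Gn\<^esub> v"
  shows "per b = id" "i < n \<Longrightarrow> \<forall>y\<in>carrier G. v i \<otimes> gam b i y = y \<otimes> v i"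
proof -
  have vG: "v i \<in> carrier G" if "i < n" for i using v that by auto
  have eq: "v i \<otimes> gam b i (w (per b i)) = w i \<otimes> v i" if "w \<in> carrier Gn" "i < n" for w i
  proof -
    have "(v \<otimes>\<^bsub>Gn\<^esub> b w) i = (w \<otimes>\<^bsub>Gn\<^esub> v) i" using c that(1) by metis
    then show ?thesis using An_apply[OF b that] that(2) by simp
  qed
  have fp: "per b i = i" if i: "i < n" for i
  proof (rule ccontr)
    assume ne: "per b i \<noteq> i"
    obtain x where x: "x \<in> carrier G" "x \<noteq> \<one>" using nontrivial by blast
    \<comment> \<open>If slot i were moved, b would read the unit element at i from a tuple that is
      nontrivial there.\<close>
    define w where "w = (\<lambda>j\<in>{..<n}. if j = i then x else \<one>)"
    have w: "w \<in> carrier Gn" using x by (auto simp: w_def)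
    have "v i \<otimes> gam b i \<one> = x \<otimes> v i"
      using eq[OF w i] permutes_less[OF wdec(2)[OF b] i] ne i by (simp add: w_def)
    then have "\<one> \<otimes> v i = x \<otimes> v i" using A_one[OF wdec(1)[OF b i]] vG[OF i] by simp
    from r_cancel[OF this one_closed x(1) vG[OF i]] show False using x by simp
  qed
  have "per b i = i" for i using fp wdec(2)[OF b] by (cases "i < n") (auto simp: permutes_def)
  then show "per b = id" by auto
  show "\<forall>y\<in>carrier G. v i \<otimes> gam b i y = y \<otimes> v i" if i: "i < n"
  proof
    fix y assume y: "y \<in> carrier G"
    have "(\<lambda>j\<in>{..<n}. y) \<in> carrier Gn" using y by auto
    from eq[OF this i] show "v i \<otimes> gam b i y = y \<otimes> v i" using fp[OF i] i by simp
  qed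
qed

theorem sdp_central_ge_n:
  assumes \<chi>: "\<chi> \<in> Dn"
  shows "sdp_central_ge p Gn An Nn \<chi> (\<Omega>n \<chi>)"
proof -
  obtain \<theta> where \<theta>: "\<forall>i<n. \<theta> i \<in> D" and \<chi>_eq: "\<chi> = prod_char (carrier G) n \<theta>" using \<chi> by (rule Dn_cases)
  interpret S: stable_pair Gn "AOn \<chi>" Nn \<chi> "\<Omega>n \<chi>" p by (rule stable_pair_n[OF \<chi>])
  have \<Omega>\<chi>: "\<Omega>n \<chi> = prod_char N n (\<lambda>i. \<Omega> (\<theta> i))" unfolding \<chi>_eq by (rule \<Omega>n_prod[OF \<theta>])
  have ex: "\<exists>e Q e' Q' fac. bundle_half (carrier G) (\<lambda>\<theta>. \<theta>) e Q fac \<and> bundle_half N \<Omega> e' Q' fac \<and> central_scalars e Q e' Q' \<and>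
     (\<forall>\<sigma>. Hgal p \<sigma> \<longrightarrow> (\<exists>\<nu> M Mi V Vi. bundle_twist (carrier G) e Q \<sigma> \<nu> M Mi \<and> bundle_twist N e' Q' \<sigma> \<nu> V Vi))"
    by (rule bundle_exists)
  obtain e Q e' Q' fac where h: "bundle_half (carrier G) (\<lambda>\<theta>. \<theta>) e Q fac" and h': "bundle_half N \<Omega> e' Q' fac"
    and cs: "central_scalars e Q e' Q'"
    and t: "\<forall>\<sigma>. Hgal p \<sigma> \<longrightarrow> (\<exists>\<nu> M Mi V Vi. bundle_twist (carrier G) e Q \<sigma> \<nu> M Mi \<and> bundle_twist N e' Q' \<sigma> \<nu> V Vi)"
    using ex by (elim exE conjE) (rule that)
  define B where "B = {a \<in> AOn \<chi>. aut_twist (carrier Gn) \<chi> a id = \<chi>}"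
  have sub: "AOn \<chi> \<subseteq> An" by (auto simp: aut_stab_orbit_def)
  define d where "d = (\<Prod>i<n. e (\<theta> i))"
  define d' where "d' = (\<Prod>i<n. e' (\<theta> i))"
  note big = tens_half[OF \<theta> h subgroup_self A_stable, folded \<chi>_eq, folded B_def d_def dpow_carrier]
  note small = tens_half[OF \<theta> h' N Nst, folded \<chi>_eq, folded B_def d'_def, folded \<Omega>\<chi>]
  have NGn: "Nn \<subseteq> carrier Gn" using Gn_N by (rule subgroup.subset)
  \<comment> \<open>On the centraliser no slots are permuted, so the tensor product is scalar in
    every slot, with scalars that \<open>central_scalars\<close> makes equal for the two
    groups.\<close>
  have cent: "v \<in> Nn \<and> (\<exists>c. tens_rep \<theta> e Q (v, b) = c \<cdot>\<^sub>m 1\<^sub>m d \<and> tens_rep \<theta> e' Q' (v, b) = c \<cdot>\<^sub>m 1\<^sub>m d')"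
    if v: "v \<in> carrier Gn" and b: "b \<in> B" and vb: "\<forall>w\<in>carrier Gn. v \<otimes>\<^bsub>Gn\<^esub> b w = w \<otimes>\<^bsub>Gn\<^esub> v" for v b
  proof -
    have bA: "b \<in> An" using b sub by (auto simp: B_def)
    note wc = wreath_centralizer[OF v bA vb]
    have vG: "v i \<in> carrier G" if "i < n" for i using v that by auto
    have "\<exists>c. i < n \<longrightarrow> v i \<in> N \<and> Q (\<theta> i) (v i, gam b i) = c \<cdot>\<^sub>m 1\<^sub>m (e (\<theta> i)) \<and> Q' (\<theta> i) (v i, gam b i) = c \<cdot>\<^sub>m 1\<^sub>m (e' (\<theta> i))" for i
    proof (cases "i < n")
      case True
      have "\<theta> i \<in> D" using \<theta> True by blast
      with cs vG[OF True] wdec(1)[OF bA True] wc(2)[OF True] show ?thesis unfolding central_scalars_def by blast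
    qed simp
    then obtain c where c: "\<forall>i. i < n \<longrightarrow> v i \<in> N \<and> Q (\<theta> i) (v i, gam b i) = c i \<cdot>\<^sub>m 1\<^sub>m (e (\<theta> i)) \<and> Q' (\<theta> i) (v i, gam b i) = c i \<cdot>\<^sub>m 1\<^sub>m (e' (\<theta> i))"
      by metis
    have "v \<in> Nn" using c v by (auto simp: PiE_def Pi_def)
    moreover have "tens_rep \<theta> e Q (v, b) = (\<Prod>i<n. c i) \<cdot>\<^sub>m 1\<^sub>m d" "tens_rep \<theta> e' Q' (v, b) = (\<Prod>i<n. c i) \<cdot>\<^sub>m 1\<^sub>m d'"
      unfolding tens_rep_def prod.case wc(1) d_def d'_def using c by (intro tens_scalar, simp)+
    ultimately show ?thesis by blast
  qed
  have gal: "\<exists>\<nu> M M' V V'. (\<forall>b\<in>B. \<nu> b \<noteq> 0) \<and> galois_compat (carrier Gn) B d (tens_rep \<theta> e Q) a \<sigma> \<nu> M M' \<and> galois_compat Nn B d' (tens_rep \<theta> e' Q') a \<sigma> \<nu> V V'"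
    if a: "a \<in> AOn \<chi>" and s: "Hgal p \<sigma>" and fixed: "aut_twist (carrier Gn) \<chi> a \<sigma> = \<chi>" for a \<sigma>
  proof -
    obtain \<nu> M Mi V Vi where tt: "bundle_twist (carrier G) e Q \<sigma> \<nu> M Mi" "bundle_twist N e' Q' \<sigma> \<nu> V Vi" using t s by blast
    note T = tens_twist[OF \<theta> h tt(1) subgroup_self A_stable, folded \<chi>_eq, folded B_def d_def dpow_carrier, OF a s fixed]
    note T' = tens_twist[OF \<theta> h' tt(2) N Nst, folded \<chi>_eq, folded B_def d'_def dpow_carrier, OF a s fixed]
    show ?thesis
      apply (intro exI conjI ballI)
        apply (erule T(1))
       apply (rule T(2))
      apply (rule T'(2))
      done
  qed
  have "central_reps p Gn (AOn \<chi>) Nn \<chi> (\<Omega>n \<chi>) d (tens_rep \<theta> e Q) (tens_fac \<theta> fac) d' (tens_rep \<theta> e' Q') (tens_fac \<theta> fac)"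
    unfolding central_reps_def Let_def B_def[symmetric]
  proof (intro conjI)
    show "\<forall>x\<in>carrier Gn \<times> B. \<forall>y\<in>carrier Gn \<times> B. root_of_unity (tens_fac \<theta> fac x y)"
      by (rule ballI, rule ballI, rule big(4))
    show "\<forall>x\<in>Nn \<times> B. \<forall>y\<in>Nn \<times> B. root_of_unity (tens_fac \<theta> fac x y)"
      by (rule ballI, rule ballI, rule small(4))
    show "\<forall>x\<in>carrier Gn. \<forall>b\<in>B. (\<forall>y\<in>carrier Gn. x \<otimes>\<^bsub>Gn\<^esub> b y = y \<otimes>\<^bsub>Gn\<^esub> x) \<longrightarrow>
        x \<in> Nn \<and> (\<exists>c. tens_rep \<theta> e Q (x, b) = c \<cdot>\<^sub>m 1\<^sub>m d \<and> tens_rep \<theta> e' Q' (x, b) = c \<cdot>\<^sub>m 1\<^sub>m d')"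
      by (rule ballI, rule ballI, rule impI, rule cent)
    show "\<forall>a\<in>AOn \<chi>. \<forall>\<sigma>. Hgal p \<sigma> \<and> aut_twist (carrier Gn) \<chi> a \<sigma> = \<chi> \<longrightarrow>
       (\<exists>\<nu> M M' V V'. (\<forall>b\<in>B. \<nu> b \<noteq> 0) \<and> galois_compat (carrier Gn) B d (tens_rep \<theta> e Q) a \<sigma> \<nu> M M' \<and> galois_compat Nn B d' (tens_rep \<theta> e' Q') a \<sigma> \<nu> V V')"
      by (rule ballI, rule allI, rule impI, elim conjE, rule gal)
  qed (rule big(1-3) small(1-3) ballI refl)+
  from S.central_geI[OF this] show ?thesis unfolding sdp_central_ge_def Let_def .
qed

end

text \<open>Elements of \<open>Aut_stab\<close> are the identity outside the carrier, so they are
  bijections of the whole type and their inverses are again of this form.\<close>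

lemma aut_stab_group:
  assumes "group Xc" "finite (carrier Xc)"
  shows "aut_group Xc (Aut_stab Xc R)"
proof (intro aut_group.intro aut_group_axioms.intro assms)
  interpret group Xc by fact
  show "id \<in> Aut_stab Xc R" by (auto simp: Aut_stab_def iso_def hom_def)
  fix a assume a: "a \<in> Aut_stab Xc R"
  then have ah: "a \<in> hom Xc Xc" and ab: "bij_betw a (carrier Xc) (carrier Xc)" and aR: "a ` R = R"
    and ao: "\<forall>x. x \<notin> carrier Xc \<longrightarrow> a x = x" by (auto simp: Aut_stab_def iso_def)
  show "a \<in> hom Xc Xc" by (rule ah)
  have "bij_betw a (- carrier Xc) (- carrier Xc)"
    using ao by (intro bij_betw_cong[THEN iffD2, OF _ bij_betw_id]) auto
  from bij_betw_combine[OF ab this] show bij: "bij a" by (simp add: Compl_partition)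
  have r: "inv_into UNIV a (a x) = x" "a (inv_into UNIV a x) = x" for x
    using bij by (simp_all add: bij_is_inj bij_is_surj surj_f_inv_f)
  have ic: "inv_into UNIV a x \<in> carrier Xc" if "x \<in> carrier Xc" for x
    using ab that r ao by (metis bij_betwE)
  have io: "inv_into UNIV a x = x" if "x \<notin> carrier Xc" for x using r ao that by metis
  have "inv_into UNIV a \<in> hom Xc Xc"
  proof (rule homI)
    fix x y assume xy: "x \<in> carrier Xc" "y \<in> carrier Xc"
    have "a (inv_into UNIV a x \<otimes>\<^bsub>Xc\<^esub> inv_into UNIV a y) = x \<otimes>\<^bsub>Xc\<^esub> y" using hom_mult[OF ah ic ic] xy r by simp
    then show "inv_into UNIV a (x \<otimes>\<^bsub>Xc\<^esub> y) = inv_into UNIV a x \<otimes>\<^bsub>Xc\<^esub> inv_into UNIV a y" using r by metis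
  qed (rule ic)
  moreover have "bij_betw (inv_into UNIV a) (carrier Xc) (carrier Xc)"
    using ic ab r by (intro bij_betw_byWitness[where f' = a]) (auto dest: bij_betwE)
  moreover have "inv_into UNIV a ` R = R"
  proof -
    have "inv_into UNIV a ` R = inv_into UNIV a ` a ` R" unfolding aR ..
    then show ?thesis by (simp add: image_image r)
  qed
  ultimately show "inv_into UNIV a \<in> Aut_stab Xc R" using io by (auto simp: Aut_stab_def iso_def)
  fix b assume "b \<in> Aut_stab Xc R"
  then have bh: "b \<in> hom Xc Xc" and bb: "bij_betw b (carrier Xc) (carrier Xc)" and bR: "b ` R = R"
    and bo: "\<forall>x. x \<notin> carrier Xc \<longrightarrow> b x = x" by (auto simp: Aut_stab_def iso_def)
  have "a \<circ> b \<in> hom Xc Xc" using ah bh by (auto simp: hom_def)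
  moreover have "bij_betw (a \<circ> b) (carrier Xc) (carrier Xc)" by (rule bij_betw_trans[OF bb ab])
  moreover have "(a \<circ> b) ` R = R" unfolding image_comp[symmetric] bR aR ..
  ultimately show "a \<circ> b \<in> Aut_stab Xc R" using ao bo by (simp add: Aut_stab_def iso_def)
qed

text \<open>Otherwise \<open>order\<close> below would be the multiplicity of a root of a polynomial.\<close>
hide_const (open) Polynomial.order

theorem theorem3p2:
  fixes p n :: nat and S :: "('s, 'd) monoid_scheme" and Xc :: "('a, 'c) monoid_scheme"
    and R N :: "'a set" and \<Omega> :: "('a \<Rightarrow> complex) \<Rightarrow> ('a \<Rightarrow> complex)"
  assumes "Factorial_Ring.prime p"
    and "simple_group S" and "\<not> comm_group S" and "finite (carrier S)" and "p dvd order S"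
    and "universal_cover Xc S" and "finite (carrier Xc)"
    and "sylow_p p Xc R"
    and "igm_data p Xc R N \<Omega>"
    and "0 < n"
  shows "\<exists>\<Omega>t. (\<forall>\<theta>s. (\<forall>i<n. \<theta>s i \<in> Irr_p' p Xc) \<longrightarrow>
                 \<Omega>t (prod_char (carrier Xc) n \<theta>s) = prod_char N n (\<lambda>i. \<Omega> (\<theta>s i)))
        \<and> bij_betw \<Omega>t (Irr_p' p (dpow Xc n)) (Irr_p' p ((dpow Xc n)\<lparr>carrier := \<Pi>\<^sub>E i\<in>{..<n}. N\<rparr>))
        \<and> equivariant_map p (carrier (dpow Xc n)) (\<Pi>\<^sub>E i\<in>{..<n}. N)
             (wreath_aut Xc (Aut_stab Xc R) n) (Irr_p' p (dpow Xc n)) \<Omega>t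
        \<and> (\<forall>\<theta>t \<in> Irr_p' p (dpow Xc n).
             sdp_central_ge p (dpow Xc n) (wreath_aut Xc (Aut_stab Xc R) n) (\<Pi>\<^sub>E i\<in>{..<n}. N) \<theta>t (\<Omega>t \<theta>t))"
proof -
  have "group Xc" using assms(6) by (auto simp: universal_cover_def central_ext_def)
  then have ag: "aut_group Xc (Aut_stab Xc R)" using assms(7) by (rule aut_stab_group)
  have d: "subgroup N Xc" "N \<subset> carrier Xc" "\<forall>\<gamma>\<in>Aut_stab Xc R. \<gamma> ` N = N"
    "bij_betw \<Omega> (Irr_p' p Xc) (Irr_p' p (Xc\<lparr>carrier := N\<rparr>))"
    "equivariant_map p (carrier Xc) N (Aut_stab Xc R) (Irr_p' p Xc) \<Omega>"
    "\<forall>\<theta>\<in>Irr_p' p Xc. sdp_central_ge p Xc (Aut_stab Xc R) N \<theta> (\<Omega> \<theta>)"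
    using assms(9) unfolding igm_data_def Let_def by blast+
  interpret igm_wreath Xc "Aut_stab Xc R" N p \<Omega> n
  proof (intro igm_wreath.intro igm_pair.intro igm_pair_axioms.intro wreath.intro wreath_axioms.intro igm_wreath_axioms.intro ag d(1,4,5) assms(1))
    show "a \<in> Aut_stab Xc R \<Longrightarrow> x \<in> N \<Longrightarrow> a x \<in> N" for a x using d(3) by blast
    show "\<theta> \<in> Irr_p' p Xc \<Longrightarrow> sdp_central_ge p Xc (Aut_stab Xc R) N \<theta> (\<Omega> \<theta>)" for \<theta> using d(6) by blast
    show "a \<in> Aut_stab Xc R \<Longrightarrow> x \<notin> carrier Xc \<Longrightarrow> a x = x" for a x by (simp add: Aut_stab_def)
    \<comment> \<open>Any element outside the proper subgroup \<open>N\<close> is different from the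
      unit element.\<close>
    show "\<exists>x\<in>carrier Xc. x \<noteq> \<one>\<^bsub>Xc\<^esub>" using psubset_imp_ex_mem[OF d(2)] subgroup.one_closed[OF d(1)] by force
  qed
  show ?thesis
  proof (intro exI[of _ \<Omega>n] conjI allI impI ballI)
    show "equivariant_map p (carrier Gn) Nn An Dn \<Omega>n"
      unfolding equivariant_map_def by (intro ballI allI impI \<Omega>n_twist)
  qed (use \<Omega>n_prod \<Omega>n_bij sdp_central_ge_n in auto)
qed

end
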